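(* Suppose that conditions (A1)–(A5) of the context hold. Let $\theta^l$ be the solution of the problem $(P_l)$ on $(0,T)\times\mathcal O_l$ and let $\theta^l_{p,q}$ ($p\in\{1,\dots,I\}$, $q\ge1$) be the solutions of the Schwarz waveform relaxation subproblems $(S_{p,q})$, both described in the context. Then $$\lim_{q\to\infty}\ \sup_{p\in\{1,\dots,I\}}\ \|\theta^l_{p,q}-\theta^l\|_{(L^\infty((0,T)\times(-l,l)^{n-1}\times(a_p,b_p)))^m}=0.$$
   Context: Coefficients: $T>0$, $b:[0,T]\times\mathbb{R}^n\times\mathbb{R}^m\to\mathbb{R}^n$, $\hat b:[0,T]\times\mathbb{R}^n\times\mathbb{R}^m\to\mathbb{R}^m$, $\sigma:[0,T]\times\mathbb{R}^n\times\mathbb{R}^m\to\mathbb{R}^{n\times d}$, $\hat\sigma:[0,T]\times\mathbb{R}^n\times\mathbb{R}^m\times\mathbb{R}^{m\times d}\to\mathbb{R}^{m\times d}$, $g:\mathbb{R}^n\to\mathbb{R}^m$. Set $(a_{i,j}(t,x,y))=\frac12\sigma(t,x,y)\sigma^T(t,x,y)$; $\langle\nabla\theta,b\rangle$ is the vector with $k$-th component $\sum_i b^i\,\partial\theta^k/\partial x_i$. Conditions: (A1) $b,\hat b,\sigma,\hat\sigma,g$ are $C^1$-functions with bounded partial derivatives, and $g$ is bounded in $C^{2+\delta}(\mathbb{R}^n)$ for some $\delta\in(0,1)$. (A2) There are a positive continuous function $\nu$ and a positive constant $C$ with $|\sigma(t,x,y)|\le C$ and $\sigma(t,x,y)\sigma^T(t,x,y)\ge\nu(|y|)I$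 for all $(t,x,y)\in[0,T]\times\mathbb{R}^n\times\mathbb{R}^m$. (A3) There exists a positive continuous function $\kappa$ with $\sup\{|z|:\hat\sigma(t,x,y,z)=0\}\le\kappa(|y|)$ for all $(t,x,y)\in[0,T]\times\mathbb{R}^n\times\mathbb{R}^m$. For fixed $(t,x,y)$ the map $z\mapsto\hat\sigma(t,x,y,z)$ is bijective, with inverse $\hat\sigma^{-1}(t,x,y)(\cdot)$; $\hat\sigma^{-1}(t,x,y)(\zeta)$ is continuous with respect to $t,x,y,\zeta$; and there exist a continuous function $\lambda:\mathbb{R}\to\mathbb{R}_+$ and a constant $\alpha\in[1,2)$ with $|\hat\sigma^{-1}(t,x,y)(\zeta)-\hat\sigma^{-1}(t,x,y)(\zeta')|\le\lambda(|y|)|\zeta-\zeta'|^{\alpha}$ for all $\zeta,\zeta'\in\mathbb{R}^{m\times d}$. (A4) There exist a positive function $\eta$ and a positive constant $C$ such that $|b(t,x,y)|\le\eta(|y|)$ and $|\hat b(t,x,0)|\le C$ for all $(t,x,y)\in[0,T]\times\mathbb{R}^n\times\mathbb{R}^m$. (A5) For all $k\in\{1,\dots,m\}$ and all $(t,x,y_1,\dots,y_{k-1},y_{k+1},\dots,y_m)\in[0,T]\times\mathbb{R}^n\times\mathbb{R}^{m-1}$, $\hat b^k(t,x,y_1,\dots,y_{k-1},0,y_{k+1},\dots,y_m)=0$, and $\hat b^k(t,x,y_1,\dots,y_m)$ is decreasing in $y_k$. Problem $(P_l)$: $l>0$ is a large enough constant, $\mathcal O_l=(-l,l)^n$, and $\theta^l$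 is the unique classical solution (with $\theta^l,\frac{\partial}{\partial t}\theta^l,\nabla\theta^l,\Delta\theta^l$ bounded) of $$\begin{cases}\dfrac{\partial\theta^l}{\partial t}+\displaystyle\sum_{i,j=1}^n a_{i,j}(t,x,\theta^l)\dfrac{\partial^2\theta^l}{\partial x_i\partial x_j}+\langle\nabla\theta^l,b(t,x,\theta^l)\rangle+\hat b(t,x,\theta^l)=0 & \text{in }(0,T)\times\mathcal O_l,\\ \theta^l(t,x)=g(x) & \text{on }(0,T)\times\partial\mathcal O_l,\\ \theta^l(T,x)=g(x) & \text{on }\mathcal O_l.\end{cases}$$ Domain decomposition: $\mathcal O_l=\bigcup_{p=1}^I\Omega_p$, $\Omega_p=(-l,l)^{n-1}\times(a_p,b_p)$, where $-l=a_1<a_2<b_1<a_3<b_2<\dots<a_I<b_{I-1}<b_I=l$. Points are written $x=(X,x_n)$ with $X\in(-l,l)^{n-1}$. Iteration: choose a bounded initial guess $\theta^l_0\in C^\infty(\mathbb{R}^n)$ ($\mathbb{R}^m$-valued), and set $\theta^l_{p,0}=\theta^l_0$ on $\Omega_p$ for each $p$. For $q\ge1$ and $p\in\{1,\dots,I\}$, $\theta^l_{p,q}$ is the unique classical solution (with $\theta^l_{p,q},\frac{\partial}{\partial t}\theta^l_{p,q},\nabla\theta^l_{p,q},\Delta\theta^l_{p,q}$ bounded) of the subproblem $(S_{p,q})$: $$\begin{cases}\dfrac{\partial\theta^l_{p,q}}{\partial t}+\displaystyle\sum_{i,j=1}^n a_{i,j}(t,x,\theta^l_{p,q})\dfrac{\partial^2\theta^l_{p,q}}{\partial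 x_i\partial x_j}+\langle\nabla\theta^l_{p,q},b(t,x,\theta^l_{p,q})\rangle+\hat b(t,x,\theta^l_{p,q})=0 & \text{in }(0,T)\times\Omega_p,\\ \theta^l_{p,q}(\cdot,\cdot,a_p)=\theta^l_{p-1,q-1}(\cdot,\cdot,a_p) & \text{on }(0,T)\times(-l,l)^{n-1},\\ \theta^l_{p,q}(\cdot,\cdot,b_p)=\theta^l_{p+1,q-1}(\cdot,\cdot,b_p) & \text{on }(0,T)\times(-l,l)^{n-1},\\ \theta^l_{p,q}(t,x)=g(x) & \text{on }(0,T)\times\big(\partial\Omega_p\setminus((-l,l)^{n-1}\times\{a_p,b_p\})\big),\\ \theta^l_{p,q}(T,x)=g(x) & \text{on }(-l,l)^{n-1}\times(a_p,b_p),\end{cases}$$ where for $p=1$ the condition at $x_n=a_1$ is replaced by $\theta^l_{1,q}=g$ there, and for $p=I$ the condition at $x_n=b_I$ is replaced by $\theta^l_{I,q}=g$ there. *)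

theory Defs
  imports "HOL-Analysis.Analysis" "HOL-Probability.Essential_Supremum"
begin

section \<open>Regularity\<close>

text \<open>
  \<open>C\<^sup>1\<close> with bounded partial derivatives on a set \<open>S\<close>. The derivative is taken within \<open>S\<close>, so that
  the closed time interval \<open>[0,T]\<close> can be a factor of \<open>S\<close>; \<open>f' z v\<close> for \<open>v \<in> Basis\<close> are the
  partial derivatives.
\<close>
definition C1_bdd_partials :: "'a::euclidean_space set \<Rightarrow> ('a \<Rightarrow> 'b::euclidean_space) \<Rightarrow> bool" where
  "C1_bdd_partials S f \<longleftrightarrow>
     (\<exists>f'. (\<forall>z\<in>S. (f has_derivative f' z) (at z within S)) \<and>
           (\<forall>v\<in>Basis. continuous_on S (\<lambda>z. f' z v) \<and> bounded ((\<lambda>z. f' z v) ` S)))"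

definition has_partial :: "'n \<Rightarrow> (real^'n \<Rightarrow> 'b::real_normed_vector) \<Rightarrow> real^'n \<Rightarrow> bool" where
  "has_partial i f x \<longleftrightarrow> (\<lambda>h. f (x + h *\<^sub>R axis i 1)) differentiable (at 0)"

definition partial :: "'n \<Rightarrow> (real^'n \<Rightarrow> 'b::real_normed_vector) \<Rightarrow> real^'n \<Rightarrow> 'b" where
  "partial i f x = vector_derivative (\<lambda>h. f (x + h *\<^sub>R axis i 1)) (at 0)"

primrec Ck :: "nat \<Rightarrow> (real^'n \<Rightarrow> 'b::real_normed_vector) \<Rightarrow> bool" where
  "Ck 0 f \<longleftrightarrow> continuous_on UNIV f"
| "Ck (Suc k) f \<longleftrightarrow> continuous_on UNIV f \<and> (\<forall>i. (\<forall>x. has_partial i f x) \<and> Ck k (partial i f))"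

definition C_infinity :: "(real^'n \<Rightarrow> 'b::real_normed_vector) \<Rightarrow> bool" where
  "C_infinity f \<longleftrightarrow> (\<forall>k. Ck k f)"

text \<open>Finiteness of the Hoelder norm of \<open>C\<^bsup>2+\<delta>\<^esup>(\<real>\<^sup>n)\<close>.\<close>
definition bdd_C2_Holder :: "real \<Rightarrow> (real^'n \<Rightarrow> 'b::real_normed_vector) \<Rightarrow> bool" where
  "bdd_C2_Holder \<delta> f \<longleftrightarrow>
     Ck 2 f \<and> bounded (range f) \<and> (\<forall>i. bounded (range (partial i f))) \<and>
     (\<forall>i j. bounded (range (partial i (partial j f))) \<and>
        (\<exists>C. \<forall>x x'. norm (partial i (partial j f) x - partial i (partial j f) x')
                      \<le> C * norm (x - x') powr \<delta>))"


section \<open>Conditions on the coefficients\<close>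

text \<open>Matrices carry the Frobenius norm. The arguments \<open>|y|\<close> of \<open>\<nu>\<close>, \<open>\<kappa>\<close>, \<open>\<eta>\<close> range over \<open>[0,\<infinity>)\<close>.
  In \<open>cond_A3\<close> the function called \<open>\<lambda>\<close> in the mathematical text is \<open>L\<close>.\<close>

definition positive_continuous :: "(real \<Rightarrow> real) \<Rightarrow> bool" where
  "positive_continuous f \<longleftrightarrow> continuous_on {0..} f \<and> (\<forall>r\<ge>0. 0 < f r)"

definition loewner_le :: "real^'n^'n \<Rightarrow> real^'n^'n \<Rightarrow> bool" where
  "loewner_le A B \<longleftrightarrow> (\<forall>v. v \<bullet> (A *v v) \<le> v \<bullet> (B *v v))"

definition cond_A1 ::
  "real \<Rightarrow> (real \<Rightarrow> real^'n \<Rightarrow> real^'m \<Rightarrow> real^'n) \<Rightarrow> (real \<Rightarrow> real^'n \<Rightarrow> real^'m \<Rightarrow> real^'m) \<Rightarrow>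
   (real \<Rightarrow> real^'n \<Rightarrow> real^'m \<Rightarrow> real^'d^'n) \<Rightarrow>
   (real \<Rightarrow> real^'n \<Rightarrow> real^'m \<Rightarrow> real^'d^'m \<Rightarrow> real^'d^'m) \<Rightarrow> (real^'n \<Rightarrow> real^'m) \<Rightarrow> bool" where
  "cond_A1 T b bh \<sigma> \<sigma>h g \<longleftrightarrow>
     C1_bdd_partials ({0..T} \<times> UNIV) (\<lambda>(t, x, y). b t x y) \<and>
     C1_bdd_partials ({0..T} \<times> UNIV) (\<lambda>(t, x, y). bh t x y) \<and>
     C1_bdd_partials ({0..T} \<times> UNIV) (\<lambda>(t, x, y). \<sigma> t x y) \<and>
     C1_bdd_partials ({0..T} \<times> UNIV) (\<lambda>(t, x, y, z). \<sigma>h t x y z) \<and>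
     C1_bdd_partials UNIV g \<and>
     (\<exists>\<delta>. 0 < \<delta> \<and> \<delta> < 1 \<and> bdd_C2_Holder \<delta> g)"

definition cond_A2 :: "real \<Rightarrow> (real \<Rightarrow> real^'n \<Rightarrow> real^'m \<Rightarrow> real^'d^'n) \<Rightarrow> bool" where
  "cond_A2 T \<sigma> \<longleftrightarrow>
     (\<exists>\<nu> C. positive_continuous \<nu> \<and> 0 < C \<and>
        (\<forall>t\<in>{0..T}. \<forall>x y. norm (\<sigma> t x y) \<le> C \<and>
           loewner_le (\<nu> (norm y) *\<^sub>R mat 1) (\<sigma> t x y ** transpose (\<sigma> t x y))))"

definition cond_A3 ::
  "real \<Rightarrow> (real \<Rightarrow> real^'n \<Rightarrow> real^'m \<Rightarrow> real^'d^'m \<Rightarrow> real^'d^'m) \<Rightarrow> bool" where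
  "cond_A3 T \<sigma>h \<longleftrightarrow>
     (\<exists>\<kappa>. positive_continuous \<kappa> \<and>
        (\<forall>t\<in>{0..T}. \<forall>x y. (SUP z\<in>{z. \<sigma>h t x y z = 0}. ereal (norm z)) \<le> ereal (\<kappa> (norm y)))) \<and>
     (\<forall>t\<in>{0..T}. \<forall>x y. bij (\<sigma>h t x y)) \<and>
     continuous_on ({0..T} \<times> UNIV) (\<lambda>(t, x, y, \<zeta>). inv (\<sigma>h t x y) \<zeta>) \<and>
     (\<exists>L \<alpha>. continuous_on UNIV L \<and> (\<forall>r::real. 0 \<le> L r) \<and> 1 \<le> \<alpha> \<and> \<alpha> < 2 \<and>
        (\<forall>t\<in>{0..T}. \<forall>x y \<zeta> \<zeta>'.
           norm (inv (\<sigma>h t x y) \<zeta> - inv (\<sigma>h t x y) \<zeta>') \<le> L (norm y) * norm (\<zeta> - \<zeta>') powr \<alpha>))"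

definition cond_A4 ::
  "real \<Rightarrow> (real \<Rightarrow> real^'n \<Rightarrow> real^'m \<Rightarrow> real^'n) \<Rightarrow> (real \<Rightarrow> real^'n \<Rightarrow> real^'m \<Rightarrow> real^'m) \<Rightarrow> bool" where
  "cond_A4 T b bh \<longleftrightarrow>
     (\<exists>\<eta> C. (\<forall>r\<ge>0. 0 < \<eta> r) \<and> 0 < C \<and>
        (\<forall>t\<in>{0..T}. \<forall>x y. norm (b t x y) \<le> \<eta> (norm y) \<and> norm (bh t x 0) \<le> C))"

definition replace_coord :: "'m \<Rightarrow> real \<Rightarrow> real^'m \<Rightarrow> real^'m" where
  "replace_coord k s y = (\<chi> j. if j = k then s else y $ j)"

text \<open>``Decreasing'' is read in the weak sense.\<close>
definition cond_A5 :: "real \<Rightarrow> (real \<Rightarrow> real^'n \<Rightarrow> real^'m \<Rightarrow> real^'m) \<Rightarrow> bool" where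
  "cond_A5 T bh \<longleftrightarrow>
     (\<forall>k. \<forall>t\<in>{0..T}. \<forall>x y. bh t x (replace_coord k 0 y) $ k = 0 \<and>
                           antimono (\<lambda>s. bh t x (replace_coord k s y) $ k))"


section \<open>The parabolic system and its classical solutions\<close>

definition diffusion :: "(real \<Rightarrow> real^'n \<Rightarrow> real^'m \<Rightarrow> real^'d^'n) \<Rightarrow> real \<Rightarrow> real^'n \<Rightarrow> real^'m \<Rightarrow> real^'n^'n" where
  "diffusion \<sigma> t x y = (1/2) *\<^sub>R (\<sigma> t x y ** transpose (\<sigma> t x y))"

text \<open>Functions of time and space are curried, \<open>u t x\<close>.\<close>

definition time_deriv :: "(real \<Rightarrow> real^'n \<Rightarrow> real^'m) \<Rightarrow> real \<Rightarrow> real^'n \<Rightarrow> real^'m" where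
  "time_deriv u t x = vector_derivative (\<lambda>s. u s x) (at t)"

definition Laplacian :: "(real^'n \<Rightarrow> real^'m) \<Rightarrow> real^'n \<Rightarrow> real^'m" where
  "Laplacian f x = (\<Sum>i\<in>UNIV. partial i (partial i f) x)"

definition grad_inner :: "(real^'n \<Rightarrow> real^'m) \<Rightarrow> real^'n \<Rightarrow> real^'n \<Rightarrow> real^'m" where
  "grad_inner f x v = (\<Sum>i\<in>UNIV. v $ i *\<^sub>R partial i f x)"

definition C12 :: "real \<Rightarrow> (real^'n) set \<Rightarrow> (real \<Rightarrow> real^'n \<Rightarrow> real^'m) \<Rightarrow> bool" where
  "C12 T D u \<longleftrightarrow>
     (\<forall>t\<in>{0<..<T}. \<forall>x\<in>D.
        (\<lambda>s. u s x) differentiable (at t) \<and>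
        (\<forall>i. has_partial i (u t) x) \<and>
        (\<forall>i j. has_partial i (partial j (u t)) x)) \<and>
     continuous_on ({0<..<T} \<times> D) (\<lambda>(t, x). u t x) \<and>
     continuous_on ({0<..<T} \<times> D) (\<lambda>(t, x). time_deriv u t x) \<and>
     (\<forall>i. continuous_on ({0<..<T} \<times> D) (\<lambda>(t, x). partial i (u t) x)) \<and>
     (\<forall>i j. continuous_on ({0<..<T} \<times> D) (\<lambda>(t, x). partial i (partial j (u t)) x))"

text \<open>
  A classical solution is \<open>C\<^bsup>1,2\<^esup>\<close> inside and continuous up to the part of the boundary
  on which data are prescribed: the lateral boundary \<open>(0,T) \<times> \<partial>D\<close> and the terminal slice \<open>{T} \<times> D\<close>.
\<close>
definition classical_solution ::
  "real \<Rightarrow> (real \<Rightarrow> real^'n \<Rightarrow> real^'m \<Rightarrow> real^'n) \<Rightarrow> (real \<Rightarrow> real^'n \<Rightarrow> real^'m \<Rightarrow> real^'m) \<Rightarrow>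
   (real \<Rightarrow> real^'n \<Rightarrow> real^'m \<Rightarrow> real^'d^'n) \<Rightarrow> (real^'n) set \<Rightarrow> (real \<Rightarrow> real^'n \<Rightarrow> real^'m) \<Rightarrow> bool" where
  "classical_solution T b bh \<sigma> D u \<longleftrightarrow>
     C12 T D u \<and>
     continuous_on ({0<..<T} \<times> closure D \<union> {T} \<times> D) (\<lambda>(t, x). u t x) \<and>
     bounded ((\<lambda>(t, x). u t x) ` ({0<..<T} \<times> D)) \<and>
     bounded ((\<lambda>(t, x). time_deriv u t x) ` ({0<..<T} \<times> D)) \<and>
     (\<forall>i. bounded ((\<lambda>(t, x). partial i (u t) x) ` ({0<..<T} \<times> D))) \<and>
     bounded ((\<lambda>(t, x). Laplacian (u t) x) ` ({0<..<T} \<times> D)) \<and>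
     (\<forall>t\<in>{0<..<T}. \<forall>x\<in>D.
        time_deriv u t x
        + (\<Sum>i\<in>UNIV. \<Sum>j\<in>UNIV. diffusion \<sigma> t x (u t x) $ i $ j *\<^sub>R partial i (partial j (u t)) x)
        + grad_inner (u t) x (b t x (u t x))
        + bh t x (u t x) = 0)"


section \<open>The problem on the cube and the Schwarz iteration\<close>

definition cube :: "real \<Rightarrow> (real^'n) set" where
  "cube l = {x. \<forall>i. -l < x $ i \<and> x $ i < l}"

definition solves_P ::
  "real \<Rightarrow> (real \<Rightarrow> real^'n \<Rightarrow> real^'m \<Rightarrow> real^'n) \<Rightarrow> (real \<Rightarrow> real^'n \<Rightarrow> real^'m \<Rightarrow> real^'m) \<Rightarrow>
   (real \<Rightarrow> real^'n \<Rightarrow> real^'m \<Rightarrow> real^'d^'n) \<Rightarrow> (real^'n \<Rightarrow> real^'m) \<Rightarrow> real \<Rightarrow>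
   (real \<Rightarrow> real^'n \<Rightarrow> real^'m) \<Rightarrow> bool" where
  "solves_P T b bh \<sigma> g l u \<longleftrightarrow>
     classical_solution T b bh \<sigma> (cube l) u \<and>
     (\<forall>t\<in>{0<..<T}. \<forall>x\<in>frontier (cube l). u t x = g x) \<and>
     (\<forall>x\<in>cube l. u T x = g x)"

text \<open>
  The index \<open>e\<close> singles out the coordinate called \<open>x\<^sub>n\<close>, along which the cube is decomposed.
  \<open>slab e l c d\<close> is \<open>(-l,l)\<^bsup>n-1\<^esup> \<times> (c,d)\<close> and \<open>face e l c\<close> is \<open>(-l,l)\<^bsup>n-1\<^esup> \<times> {c}\<close>.
\<close>
definition slab :: "'n \<Rightarrow> real \<Rightarrow> real \<Rightarrow> real \<Rightarrow> (real^'n) set" where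
  "slab e l c d = {x. (\<forall>i. i \<noteq> e \<longrightarrow> -l < x $ i \<and> x $ i < l) \<and> c < x $ e \<and> x $ e < d}"

definition face :: "'n \<Rightarrow> real \<Rightarrow> real \<Rightarrow> (real^'n) set" where
  "face e l c = {x. (\<forall>i. i \<noteq> e \<longrightarrow> -l < x $ i \<and> x $ i < l) \<and> x $ e = c}"

text \<open>The chain \<open>-l = a\<^sub>1 < a\<^sub>2 < b\<^sub>1 < a\<^sub>3 < b\<^sub>2 < \<dots> < a\<^sub>N < b\<^bsub>N-1\<^esub> < b\<^sub>N = l\<close>.\<close>
definition overlapping_chain :: "real \<Rightarrow> nat \<Rightarrow> (nat \<Rightarrow> real) \<Rightarrow> (nat \<Rightarrow> real) \<Rightarrow> bool" where
  "overlapping_chain l N a b \<longleftrightarrow>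
     1 \<le> N \<and> a 1 = -l \<and> b N = l \<and>
     (\<forall>p\<in>{1..<N}. a p < a (p + 1) \<and> a (p + 1) < b p \<and> b p < b (p + 1)) \<and>
     (\<forall>p\<ge>1. p + 2 \<le> N \<longrightarrow> b p < a (p + 2))"

lemma overlapping_chain_bounds:
  assumes "overlapping_chain l N a b" and "p \<in> {1..N}"
  shows "-l \<le> a p" and "b p \<le> l"
proof -
  have a1: "a 1 = -l" and bN: "b N = l"
    and st: "\<And>p. p \<in> {1..<N} \<Longrightarrow> a p < a (p + 1) \<and> b p < b (p + 1)"
    using assms(1) unfolding overlapping_chain_def by blast+
  have "1 \<le> p" "p \<le> N" using assms(2) by auto
  show "-l \<le> a p" using \<open>1 \<le> p\<close> \<open>p \<le> N\<close>
  proof (induction p rule: dec_induct)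
    case base then show ?case using a1 by simp
  next
    case (step n) then show ?case using st[of n] by simp
  qed
  show "b p \<le> l" using \<open>p \<le> N\<close> \<open>1 \<le> p\<close>
  proof (induction p rule: inc_induct)
    case base then show ?case using bN by simp
  next
    case (step n) then show ?case using st[of n] by simp
  qed
qed

lemma slabs_cover_cube:
  fixes e :: "'n::finite"
  assumes ch: "overlapping_chain l N a b"
  shows "(\<Union>p\<in>{1..N}. slab e l (a p) (b p)) = cube l"
proof (intro equalityI subsetI)
  fix x :: "real^'n" assume "x \<in> (\<Union>p\<in>{1..N}. slab e l (a p) (b p))"
  then obtain p where p: "p \<in> {1..N}" "x \<in> slab e l (a p) (b p)" by blast
  note B = overlapping_chain_bounds[OF ch p(1)]
  have "-l < x $ i \<and> x $ i < l" for i
    using p(2) B by (cases "i = e") (auto simp: slab_def)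
  then show "x \<in> cube l" by (simp add: cube_def)
next
  fix x :: "real^'n" assume x: "x \<in> cube l"
  have N: "1 \<le> N" "a 1 = -l" "b N = l" using ch by (auto simp: overlapping_chain_def)
  define S where "S = {p\<in>{1..N}. a p < x $ e}"
  have fin: "finite S" and mem1: "1 \<in> S" using N x by (auto simp: S_def cube_def)
  define p where "p = Max S"
  have pS: "p \<in> S" unfolding p_def using fin mem1 by (intro Max_in) auto
  have "x $ e < b p"
  proof (cases "p = N")
    case True then show ?thesis using N x by (simp add: cube_def)
  next
    case False
    then have pN: "p \<in> {1..<N}" using pS by (auto simp: S_def)
    have "p + 1 \<notin> S" using Max_ge[OF fin, of "p + 1"] by (auto simp: p_def)
    then have "x $ e \<le> a (p + 1)" using pN by (auto simp: S_def)
    also have "\<dots> < b p" using ch pN by (simp add: overlapping_chain_def)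
    finally show ?thesis .
  qed
  then have "x \<in> slab e l (a p) (b p)" using x pS by (auto simp: slab_def cube_def S_def)
  then show "x \<in> (\<Union>p\<in>{1..N}. slab e l (a p) (b p))" using pS by (auto simp: S_def)
qed

text \<open>
  \<open>\<theta>pq p q\<close> is the \<open>q\<close>-th iterate on the \<open>p\<close>-th subdomain. The constraint \<open>q \<ge> 1\<close> is imposed
  where this predicate is used.
\<close>
definition solves_S ::
  "real \<Rightarrow> (real \<Rightarrow> real^'n \<Rightarrow> real^'m \<Rightarrow> real^'n) \<Rightarrow> (real \<Rightarrow> real^'n \<Rightarrow> real^'m \<Rightarrow> real^'m) \<Rightarrow>
   (real \<Rightarrow> real^'n \<Rightarrow> real^'m \<Rightarrow> real^'d^'n) \<Rightarrow> (real^'n \<Rightarrow> real^'m) \<Rightarrow> 'n \<Rightarrow> real \<Rightarrow>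
   nat \<Rightarrow> (nat \<Rightarrow> real) \<Rightarrow> (nat \<Rightarrow> real) \<Rightarrow>
   (nat \<Rightarrow> nat \<Rightarrow> real \<Rightarrow> real^'n \<Rightarrow> real^'m) \<Rightarrow> nat \<Rightarrow> nat \<Rightarrow> bool" where
  "solves_S T b bh \<sigma> g e l N lo hi \<theta>pq p q \<longleftrightarrow>
     classical_solution T b bh \<sigma> (slab e l (lo p) (hi p)) (\<theta>pq p q) \<and>
     (\<forall>t\<in>{0<..<T}. \<forall>x\<in>face e l (lo p).
        \<theta>pq p q t x = (if p = 1 then g x else \<theta>pq (p - 1) (q - 1) t x)) \<and>
     (\<forall>t\<in>{0<..<T}. \<forall>x\<in>face e l (hi p).
        \<theta>pq p q t x = (if p = N then g x else \<theta>pq (p + 1) (q - 1) t x)) \<and>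
     (\<forall>t\<in>{0<..<T}. \<forall>x\<in>frontier (slab e l (lo p) (hi p)) - (face e l (lo p) \<union> face e l (hi p)).
        \<theta>pq p q t x = g x) \<and>
     (\<forall>x\<in>slab e l (lo p) (hi p). \<theta>pq p q T x = g x)"


section \<open>The norm of the error\<close>

definition Linfty_norm :: "'a::euclidean_space set \<Rightarrow> ('a \<Rightarrow> real) \<Rightarrow> ereal" where
  "Linfty_norm D f = esssup (restrict_space lborel D) (\<lambda>z. ereal \<bar>f z\<bar>)"

text \<open>The norm of the product space \<open>(L\<^sup>\<infinity>(D))\<^sup>m\<close>, taken as the maximum of the component norms.\<close>
definition Linfty_vec_norm :: "'a::euclidean_space set \<Rightarrow> ('a \<Rightarrow> real^'m) \<Rightarrow> ereal" where
  "Linfty_vec_norm D f = (SUP k. Linfty_norm D (\<lambda>z. f z $ k))"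

end

theory Submission
  imports Defs
begin

text \<open>
  An iterate and the limit \<open>\<theta>\<close> solve the same equation with the same terminal data and the same data on the
  boundary of the cube; they differ only because an iterate takes its values on the interior interfaces
  from the previous iterates of its neighbours. The error \<open>w\<close> satisfies a linear parabolic system with the
  coefficients of the iterate. Its right-hand side is at most a multiple of \<open>(1 + \<bar>D\<^sup>2\<theta>\<bar>) \<bar>w\<bar>\<close>, the Hessian being
  multiplied by the difference of the two diffusion matrices. If the Hessian were bounded, \<open>w\<close> could be
  compared with \<open>exp (k (T - t))\<close> times a sum of two exponentials that decay away from the two interfaces of
  the slab. An interface of one slab lies at a positive distance from the interfaces of the
  neighbour that supplies its values, so with fast enough decay the weighted error is halved in each
  iteration. The maximum principle behind this (\<open>ratio_comparison\<close>) works with the largest component of \<open>w\<close>,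
  since at a maximum only one component is differentiated.

  The difficulty is that a classical solution has a bounded gradient and a bounded Laplacian, but nothing
  bounds its Hessian. This is repaired by replacing \<open>\<theta>\<close> with its mollification at scale \<open>\<epsilon>\<close>, whose Hessian
  is at most a constant times \<open>1/d + ln (l/\<epsilon>)\<close> at distance \<open>d\<close> from the boundary of the cube
  (\<open>hessian_bound\<close>). The mollified function solves the equation up to a residual of this size times \<open>\<epsilon>\<close>
  (\<open>residual\<close>), which rests on the oscillation of the gradient (\<open>gradient_osc\<close>, \<open>commutator_bound\<close>). The singular
  part \<open>1/d\<close> of the potential is absorbed by the weight \<open>exp (\<Sum>\<^sub>i \<surd>(l - x\<^sub>i) + \<surd>(l + x\<^sub>i))\<close>, which is bounded above and below
  and concave like \<open>- d\<^bsup>-3/2\<^esup>\<close> across the faces (\<open>barrier_operator\<close>). The logarithm only enlarges \<open>k\<close>: over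
  a time \<open>T - t\<close> it costs the factor \<open>(l/\<epsilon>)\<^bsup>C (T - t)\<^esup>\<close> (\<open>contraction\<close>). For short times
  this factor is at most a multiple of \<open>\<surd>(l/\<epsilon>)\<close>, and \<open>\<surd>(l/\<epsilon>) \<epsilon>\<close> tends to zero, which gives convergence on a time interval whose
  length is fixed by the coefficients and the limit (\<open>time_step\<close>). Finitely many such intervals, taken backwards
  from \<open>T\<close>, cover \<open>(0,T)\<close> (\<open>uniform_convergence\<close>).

  Two estimates have to be uniform over all iterates. The sign condition on the source term keeps them in
  one ball (\<open>uniform_bound\<close>), on which the equation is uniformly elliptic. Closer than \<open>8 \<epsilon>\<close> to the boundary
  of the cube, where \<open>\<theta>\<close> is not mollified, \<open>\<theta>\<^sub>p\<^sub>q\<close> and \<open>\<theta>\<close> differ from \<open>g\<close> by \<open>O(\<epsilon>)\<close>. For the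
  iterates this cannot be read off from their gradients, whose bounds may grow with \<open>q\<close>; instead the bound for the first
  iterates is carried along by comparison with a function of the distance to one face (\<open>iterates_lateral\<close>).
\<close>

section \<open>Derivatives and coordinate partials\<close>

text \<open>
  The partial derivatives are carried along as explicit families instead of being recovered by \<open>partial\<close>, so
  that sums, products, mollifications and explicit barriers obtain theirs by rule application. In \<open>jet2\<close> the
  index order is \<open>f2 i j = \<partial>\<^sub>i \<partial>\<^sub>j f\<close>.
\<close>
definition jet1 :: "(real^'n) set \<Rightarrow> (real^'n \<Rightarrow> 'b::real_normed_vector) \<Rightarrow> ('n \<Rightarrow> real^'n \<Rightarrow> 'b) \<Rightarrow> bool" where
  "jet1 D f f1 \<longleftrightarrow>
     (\<forall>x\<in>D. (f has_derivative (\<lambda>v. \<Sum>i\<in>UNIV. v $ i *\<^sub>R f1 i x)) (at x)) \<and> (\<forall>i. continuous_on D (f1 i))"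

definition jet2 :: "(real^'n) set \<Rightarrow> (real^'n \<Rightarrow> 'b::real_normed_vector) \<Rightarrow> ('n \<Rightarrow> real^'n \<Rightarrow> 'b)
    \<Rightarrow> ('n \<Rightarrow> 'n \<Rightarrow> real^'n \<Rightarrow> 'b) \<Rightarrow> bool" where
  "jet2 D f f1 f2 \<longleftrightarrow> jet1 D f f1 \<and> (\<forall>j. jet1 D (f1 j) (\<lambda>i. f2 i j))"

lemma norm_bound_of_vector_derivative:
  fixes \<phi> :: "real \<Rightarrow> 'b::real_normed_vector"
  assumes "convex S" "\<And>h. h \<in> S \<Longrightarrow> (\<phi> has_vector_derivative \<phi>' h) (at h within S)"
    and "\<And>h. h \<in> S \<Longrightarrow> norm (\<phi>' h) \<le> B" and "a \<in> S" "c \<in> S"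
  shows "norm (\<phi> a - \<phi> c) \<le> B * \<bar>a - c\<bar>"
proof -
  have "norm (\<phi> a - \<phi> c) \<le> B * norm (a - c)"
  proof (rule differentiable_bound[OF assms(1) _ _ assms(4,5)])
    fix h assume h: "h \<in> S"
    show "(\<phi> has_derivative (\<lambda>t. t *\<^sub>R \<phi>' h)) (at h within S)"
      using assms(2)[OF h] by (simp add: has_vector_derivative_def)
    show "onorm (\<lambda>t. t *\<^sub>R \<phi>' h) \<le> B"
      using assms(3)[OF h] by (intro onorm_le) (simp, metis abs_ge_zero mult.commute mult_left_mono)
  qed
  then show ?thesis by simp
qed

lemma shift_vector_derivative:
  assumes "(\<phi> has_vector_derivative d) (at 0)"
  shows "((\<lambda>s. \<phi> (s - h)) has_vector_derivative d) (at h)"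
proof -
  have 1: "((\<lambda>s. s - h) has_derivative (\<lambda>s. s)) (at h)" by (auto intro!: derivative_eq_intros)
  show ?thesis
    using has_derivative_compose[OF 1, of \<phi>] assms unfolding has_vector_derivative_def by simp
qed

text \<open>
  The increment of \<open>f\<close> is telescoped by switching on one coordinate of the displacement after the other. Each
  summand is a one-dimensional increment, to which the mean value inequality applies.
\<close>
lemma has_derivative_of_continuous_partials:
  fixes f :: "real^'n \<Rightarrow> 'b::real_normed_vector"
  assumes D: "open D" "x \<in> D"
    and d: "\<And>y i. y \<in> D \<Longrightarrow> ((\<lambda>h. f (y + h *\<^sub>R axis i 1)) has_vector_derivative f1 i y) (at 0)"
    and c: "\<And>i. continuous_on D (f1 i)"
  shows "(f has_derivative (\<lambda>v. \<Sum>i\<in>UNIV. v $ i *\<^sub>R f1 i x)) (at x)"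
  unfolding has_derivative_at_alt
proof (intro conjI allI impI)
  show "bounded_linear (\<lambda>v::real^'n. \<Sum>i\<in>UNIV. v $ i *\<^sub>R f1 i x)"
    by (intro bounded_linear_sum bounded_linear_scaleR_left[THEN bounded_linear_compose] bounded_linear_vec_nth)
next
  fix e :: real assume e: "0 < e"
  define e' where "e' = e / CARD('n)"
  have e': "e' > 0" using e by (simp add: e'_def)
  obtain r0 where r0: "r0 > 0" "ball x r0 \<subseteq> D" using D by (auto simp: open_contains_ball)
  have "\<exists>r>0. \<forall>y. dist y x < r \<longrightarrow> dist (f1 i y) (f1 i x) < e'" for i
  proof -
    have "isCont (f1 i) x" using c[of i] D by (simp add: continuous_on_eq_continuous_at)
    then show ?thesis using e' by (auto simp: continuous_at_eps_delta)
  qed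
  then obtain r where r: "\<And>i. r i > 0" "\<And>i y. dist y x < r i \<Longrightarrow> dist (f1 i y) (f1 i x) < e'"
    by metis
  define \<delta> where "\<delta> = min r0 (Min (range r))"
  have \<delta>: "\<delta> > 0" "\<delta> \<le> r0" "\<And>i. \<delta> \<le> r i" using r0 r(1) by (auto simp: \<delta>_def min.coboundedI2)
  have main: "norm (f (x + v) - f x - (\<Sum>i\<in>UNIV. v $ i *\<^sub>R f1 i x)) \<le> e * norm v" if v: "norm v < \<delta>" for v
  proof -
    define pr where "pr = (\<lambda>S. (\<chi> i. if i \<in> S then v $ i else 0) :: real^'n)"
    have "norm (f (x + pr S) - f x - (\<Sum>i\<in>S. v $ i *\<^sub>R f1 i x)) \<le> card S * e' * norm v" for S
      using finite[of S]
    proof (induction S rule: finite_induct)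
      case empty
      have "pr {} = 0" by (simp add: pr_def vec_eq_iff)
      then show ?case by simp
    next
      case (insert j S)
      define \<phi> where "\<phi> = (\<lambda>h. f (x + pr S + h *\<^sub>R axis j 1) - h *\<^sub>R f1 j x)"
      define C where "C = closed_segment 0 (v $ j)"
      have inb: "dist (x + pr S + h *\<^sub>R axis j 1) x < \<delta>" if "h \<in> C" for h
      proof -
        have hv: "\<bar>h\<bar> \<le> \<bar>v $ j\<bar>" using that by (auto simp: C_def closed_segment_eq_real_ivl split: if_splits)
        have "norm (pr S + h *\<^sub>R axis j 1) \<le> norm v"
          by (rule norm_le_componentwise_cart) (use hv insert(2) in \<open>auto simp: pr_def axis_def\<close>)
        then show ?thesis using v by (simp add: dist_norm add.assoc)
      qed
      have "norm (\<phi> (v $ j) - \<phi> 0) \<le> e' * \<bar>v $ j - 0\<bar>"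
      proof (rule norm_bound_of_vector_derivative)
        show "convex C" "v $ j \<in> C" "0 \<in> C" by (auto simp: C_def)
        fix h assume h: "h \<in> C"
        let ?y = "x + pr S + h *\<^sub>R axis j 1"
        have yD: "?y \<in> D" using inb[OF h] \<delta>(2) r0(2) by (auto simp: dist_commute subset_iff)
        have "((\<lambda>s. f (?y + (s - h) *\<^sub>R axis j 1)) has_vector_derivative f1 j ?y) (at h)"
          by (rule shift_vector_derivative[OF d[OF yD]])
        then have "((\<lambda>s. f (x + pr S + s *\<^sub>R axis j 1)) has_vector_derivative f1 j ?y) (at h)"
          by (simp add: algebra_simps)
        then have "(\<phi> has_vector_derivative f1 j ?y - f1 j x) (at h)"
          unfolding \<phi>_def by (auto intro!: derivative_eq_intros)
        then show "(\<phi> has_vector_derivative f1 j ?y - f1 j x) (at h within C)"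
          by (rule has_vector_derivative_at_within)
        show "norm (f1 j ?y - f1 j x) \<le> e'"
          using r(2)[of ?y j] inb[OF h] \<delta>(3)[of j] by (simp add: dist_norm)
      qed
      moreover have "pr (insert j S) = pr S + (v $ j) *\<^sub>R axis j 1"
        using insert(2) by (auto simp: pr_def vec_eq_iff axis_def)
      moreover have "e' * \<bar>v $ j\<bar> \<le> e' * norm v" using e' by (simp add: component_le_norm_cart)
      ultimately have A: "norm (f (x + pr (insert j S)) - f (x + pr S) - v $ j *\<^sub>R f1 j x) \<le> e' * norm v"
        by (simp add: \<phi>_def algebra_simps)
      have "norm (f (x + pr (insert j S)) - f x - (\<Sum>i\<in>insert j S. v $ i *\<^sub>R f1 i x))
          = norm ((f (x + pr (insert j S)) - f (x + pr S) - v $ j *\<^sub>R f1 j x) + (f (x + pr S) - f x - (\<Sum>i\<in>S. v $ i *\<^sub>R f1 i x)))"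
        using insert(1,2) by (simp add: algebra_simps)
      also have "\<dots> \<le> e' * norm v + card S * e' * norm v"
        using A insert(3) norm_triangle_le by (meson add_mono order_trans norm_triangle_ineq)
      finally show ?case using insert(1,2) by (simp add: algebra_simps)
    qed
    moreover have "pr UNIV = v" by (simp add: pr_def vec_eq_iff)
    moreover have "real (card (UNIV :: 'n set)) * e' = e" by (simp add: e'_def)
    ultimately show ?thesis by metis
  qed
  show "\<exists>d>0. \<forall>y. norm (y - x) < d \<longrightarrow> norm (f y - f x - (\<Sum>i\<in>UNIV. (y - x) $ i *\<^sub>R f1 i x)) \<le> e * norm (y - x)"
  proof (intro exI[of _ \<delta>] conjI allI impI)
    fix y assume "norm (y - x) < \<delta>"
    from main[OF this] show "norm (f y - f x - (\<Sum>i\<in>UNIV. (y - x) $ i *\<^sub>R f1 i x)) \<le> e * norm (y - x)" by simp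
  qed (rule \<delta>(1))
qed

lemma has_partial_vector_derivative:
  assumes "has_partial i f x"
  shows "((\<lambda>h. f (x + h *\<^sub>R axis i 1)) has_vector_derivative partial i f x) (at 0)"
  using assms unfolding has_partial_def partial_def by (simp add: vector_derivative_works)

lemma jet1_of_partials:
  assumes "open D" "\<And>x i. x \<in> D \<Longrightarrow> has_partial i f x" "\<And>i. continuous_on D (partial i f)"
  shows "jet1 D f (\<lambda>i. partial i f)"
  unfolding jet1_def
  using has_derivative_of_continuous_partials[OF assms(1) _ has_partial_vector_derivative[OF assms(2)] assms(3)] assms(3)
  by blast

lemma jet1_line:
  assumes "jet1 D f f1" "x + h *\<^sub>R v \<in> D"
  shows "((\<lambda>s. f (x + s *\<^sub>R v)) has_vector_derivative (\<Sum>i\<in>UNIV. v $ i *\<^sub>R f1 i (x + h *\<^sub>R v))) (at h within S)"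
proof -
  have 1: "((\<lambda>s. x + s *\<^sub>R v) has_derivative (\<lambda>s. s *\<^sub>R v)) (at h within S)"
    by (auto intro!: derivative_eq_intros)
  have 2: "(f has_derivative (\<lambda>w. \<Sum>i\<in>UNIV. w $ i *\<^sub>R f1 i (x + h *\<^sub>R v))) (at (x + h *\<^sub>R v))"
    using assms by (auto simp: jet1_def)
  show ?thesis
    using has_derivative_compose[OF 1 2] by (simp add: has_vector_derivative_def scaleR_sum_right flip: scaleR_scaleR)
qed

lemma sum_axis_scaleR:
  fixes f :: "'n::finite \<Rightarrow> 'b::real_vector"
  shows "(\<Sum>i\<in>UNIV. (axis j 1 :: real^'n) $ i *\<^sub>R f i) = f j"
proof -
  have "(\<Sum>i\<in>UNIV. (axis j 1 :: real^'n) $ i *\<^sub>R f i) = (\<Sum>i\<in>UNIV. if i = j then f j else 0)"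
    by (intro sum.cong) (auto simp: axis_def)
  then show ?thesis by simp
qed

lemma jet1_axis:
  assumes "jet1 D f f1" "x + h *\<^sub>R axis j 1 \<in> D"
  shows "((\<lambda>s. f (x + s *\<^sub>R axis j 1)) has_vector_derivative f1 j (x + h *\<^sub>R axis j 1)) (at h within S)"
  using jet1_line[OF assms] unfolding sum_axis_scaleR .

lemma jet1_continuous: "jet1 D f f1 \<Longrightarrow> continuous_on D f"
  unfolding jet1_def by (intro continuous_at_imp_continuous_on ballI) (blast intro: has_derivative_continuous)

lemma jet1_continuous_partial: "jet1 D f f1 \<Longrightarrow> continuous_on D (f1 i)"
  unfolding jet1_def by blast

lemma jet1_subset: "jet1 D f f1 \<Longrightarrow> E \<subseteq> D \<Longrightarrow> jet1 E f f1"
  unfolding jet1_def by (meson continuous_on_subset subsetD)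

lemma jet2_subset: "jet2 D f f1 f2 \<Longrightarrow> E \<subseteq> D \<Longrightarrow> jet2 E f f1 f2"
  unfolding jet2_def by (meson jet1_subset)

lemma jet1_const: "jet1 D (\<lambda>x. c) (\<lambda>i x. 0)"
  unfolding jet1_def by simp

lemma jet1_add:
  assumes "jet1 D f f1" "jet1 D g g1"
  shows "jet1 D (\<lambda>x. f x + g x) (\<lambda>i x. f1 i x + g1 i x)"
  using assms unfolding jet1_def
  by (auto simp: scaleR_add_right sum.distrib intro!: continuous_intros has_derivative_add)

lemma jet1_linear:
  assumes "bounded_linear L" "jet1 D f f1"
  shows "jet1 D (\<lambda>x. L (f x)) (\<lambda>i x. L (f1 i x))"
proof -
  interpret L: bounded_linear L by fact
  show ?thesis using assms(2) unfolding jet1_def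
    by (auto simp: L.sum L.scaleR intro!: continuous_intros L.continuous_on dest!: L.has_derivative)
qed

lemma jet1_diff:
  assumes "jet1 D f f1" "jet1 D g g1"
  shows "jet1 D (\<lambda>x. f x - g x) (\<lambda>i x. f1 i x - g1 i x)"
  using jet1_add[OF assms(1) jet1_linear[OF bounded_linear_minus[OF bounded_linear_ident] assms(2)]] by simp

lemma jet1_scaleR:
  assumes "jet1 D f f1" "jet1 D g g1"
  shows "jet1 D (\<lambda>x. f x *\<^sub>R g x) (\<lambda>i x. f x *\<^sub>R g1 i x + f1 i x *\<^sub>R g x)"
proof -
  note cf = jet1_continuous[OF assms(1)] jet1_continuous[OF assms(2)]
  have "((\<lambda>x. f x *\<^sub>R g x) has_derivative (\<lambda>v. \<Sum>i\<in>UNIV. v $ i *\<^sub>R (f x *\<^sub>R g1 i x + f1 i x *\<^sub>R g x))) (at x)" if "x \<in> D" for x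
  proof -
    have "((\<lambda>x. f x *\<^sub>R g x) has_derivative (\<lambda>v. f x *\<^sub>R (\<Sum>i\<in>UNIV. v $ i *\<^sub>R g1 i x) + (\<Sum>i\<in>UNIV. v $ i *\<^sub>R f1 i x) *\<^sub>R g x)) (at x)"
      using assms that unfolding jet1_def by (intro has_derivative_scaleR) auto
    then show ?thesis
      by (simp add: scaleR_sum_right scaleR_sum_left scaleR_add_right sum.distrib mult.commute[of "f x"])
  qed
  then show ?thesis using assms cf unfolding jet1_def by (auto intro!: continuous_intros)
qed

lemma jet1_mult:
  fixes f g :: "real^'n \<Rightarrow> real"
  assumes "jet1 D f f1" "jet1 D g g1"
  shows "jet1 D (\<lambda>x. f x * g x) (\<lambda>i x. f x * g1 i x + f1 i x * g x)"
  using jet1_scaleR[OF assms] by simp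

lemma jet1_sum:
  assumes "finite I" "\<And>k. k \<in> I \<Longrightarrow> jet1 D (f k) (f1 k)"
  shows "jet1 D (\<lambda>x. \<Sum>k\<in>I. f k x) (\<lambda>i x. \<Sum>k\<in>I. f1 k i x)"
  using assms by (induction I) (auto intro: jet1_const jet1_add)

lemma jet1_chain:
  fixes f :: "real^'n \<Rightarrow> real"
  assumes "jet1 D f f1" "\<And>x. x \<in> D \<Longrightarrow> (\<phi> has_real_derivative \<phi>' (f x)) (at (f x))"
    and "continuous_on (f ` D) \<phi>'"
  shows "jet1 D (\<lambda>x. \<phi> (f x)) (\<lambda>i x. \<phi>' (f x) * f1 i x)"
proof -
  have "((\<lambda>x. \<phi> (f x)) has_derivative (\<lambda>v. \<Sum>i\<in>UNIV. v $ i *\<^sub>R (\<phi>' (f x) * f1 i x))) (at x)" if "x \<in> D" for x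
  proof -
    have "((\<lambda>x. \<phi> (f x)) has_derivative (\<lambda>v. \<phi>' (f x) * (\<Sum>i\<in>UNIV. v $ i *\<^sub>R f1 i x))) (at x)"
      using assms(1,2) that unfolding jet1_def has_field_derivative_def
      by (intro has_derivative_compose[of f _ x UNIV \<phi>]) auto
    then show ?thesis by (simp add: sum_distrib_left algebra_simps)
  qed
  moreover have "continuous_on D (\<lambda>x. \<phi>' (f x))"
    using continuous_on_compose2[OF assms(3) jet1_continuous[OF assms(1)]] by auto
  ultimately show ?thesis using assms unfolding jet1_def by (auto intro!: continuous_intros)
qed

lemma jet1_coord: "jet1 D (\<lambda>x::real^'n. x $ j) (\<lambda>i x. if i = j then 1 else 0)"
  unfolding jet1_def
  by (auto simp: if_distrib[of "\<lambda>a. _ * a"] sum.delta bounded_linear_imp_has_derivative bounded_linear_vec_nth cong: if_cong)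

lemma jet1_coord_fun:
  assumes "\<And>x. x \<in> D \<Longrightarrow> (\<phi> has_real_derivative \<phi>' (x $ j)) (at (x $ j))"
    and "continuous_on ((\<lambda>x. x $ j) ` D) \<phi>'"
  shows "jet1 D (\<lambda>x::real^'n. \<phi> (x $ j)) (\<lambda>i x. \<phi>' (x $ j) * (if i = j then 1 else 0))"
  by (rule jet1_chain[OF jet1_coord assms])

lemma jet1_cong: "jet1 D f f1 \<Longrightarrow> (\<And>x. f x = g x) \<Longrightarrow> (\<And>i x. f1 i x = g1 i x) \<Longrightarrow> jet1 D g g1"
proof -
  assume a: "jet1 D f f1" and b: "\<And>x. f x = g x" "\<And>i x. f1 i x = g1 i x"
  have "f = g" "f1 = g1" using b by (auto simp: fun_eq_iff)
  then show ?thesis using a by simp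
qed

lemma jet2_diff: "jet2 D f f1 f2 \<Longrightarrow> jet2 D g g1 g2 \<Longrightarrow>
    jet2 D (\<lambda>x. f x - g x) (\<lambda>i x. f1 i x - g1 i x) (\<lambda>i j x. f2 i j x - g2 i j x)"
  unfolding jet2_def using jet1_diff by blast

lemma jet2_linear: "bounded_linear L \<Longrightarrow> jet2 D f f1 f2 \<Longrightarrow>
    jet2 D (\<lambda>x. L (f x)) (\<lambda>i x. L (f1 i x)) (\<lambda>i j x. L (f2 i j x))"
  unfolding jet2_def using jet1_linear by blast

lemma jet1_Lipschitz:
  fixes f :: "real^'n \<Rightarrow> 'b::real_normed_vector" and B :: real
  assumes "jet1 D f f1" "convex S" "S \<subseteq> D" "\<And>x i. x \<in> S \<Longrightarrow> norm (f1 i x) \<le> B" "x \<in> S" "y \<in> S"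
  shows "norm (f x - f y) \<le> CARD('n) * B * norm (x - y)"
proof (rule differentiable_bound[OF assms(2) _ _ assms(5,6)])
  fix z assume z: "z \<in> S"
  show "(f has_derivative (\<lambda>v. \<Sum>i\<in>UNIV. v $ i *\<^sub>R f1 i z)) (at z within S)"
    using assms(1,3) z by (auto simp: jet1_def intro: has_derivative_at_withinI)
  show "onorm (\<lambda>v::real^'n. \<Sum>i\<in>UNIV. v $ i *\<^sub>R f1 i z) \<le> CARD('n) * B"
  proof (rule onorm_le)
    fix v :: "real^'n"
    have "norm (\<Sum>i\<in>UNIV. v $ i *\<^sub>R f1 i z) \<le> (\<Sum>i\<in>(UNIV::'n set). norm v * B)"
      by (intro sum_norm_le) (auto intro!: mult_mono component_le_norm_cart assms(4) z)
    then show "norm (\<Sum>i\<in>UNIV. v $ i *\<^sub>R f1 i z) \<le> CARD('n) * B * norm v" by (simp add: algebra_simps)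
  qed
qed

section \<open>Mollification\<close>

text \<open>
  The kernels used for mollification live on the unit ball. They are integrated over a larger box: translations
  by less than one keep the support inside, and on a compact box continuous integrands can be differentiated
  under the integral. The convolution is an average over the unscaled variable, so that it also makes sense
  at scale \<open>s = 0\<close> and can be differentiated with respect to \<open>s\<close>.
\<close>
definition box2 :: "(real^'n) set" where
  "box2 = cbox (\<chi> i. -2) (\<chi> i. 2)"

definition conv :: "real \<Rightarrow> (real^'n \<Rightarrow> real) \<Rightarrow> (real^'n \<Rightarrow> 'b::euclidean_space) \<Rightarrow> real^'n \<Rightarrow> 'b" where
  "conv s \<kappa> F x = integral box2 (\<lambda>y. \<kappa> y *\<^sub>R F (x - s *\<^sub>R y))"

definition mass :: "(real^'n \<Rightarrow> real) \<Rightarrow> real" where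
  "mass \<kappa> = integral box2 (\<lambda>y. \<bar>\<kappa> y\<bar>)"

lemma mem_box2: "y \<in> box2 \<longleftrightarrow> (\<forall>i. \<bar>y $ i\<bar> \<le> 2)"
  by (auto simp: box2_def mem_box_cart abs_le_iff) (metis minus_le_iff)+

lemma ball_subset_box2: "ball 0 2 \<subseteq> (box2 :: (real^'n) set)"
proof
  fix y :: "real^'n" assume "y \<in> ball 0 2"
  then have "\<bar>y $ i\<bar> \<le> 2" for i using component_le_norm_cart[of y i] by simp
  then show "y \<in> box2" by (simp add: mem_box2)
qed

lemma conv_continuous_integrand:
  fixes F :: "real^'n \<Rightarrow> 'b::euclidean_space"
  assumes "continuous_on D F" "\<And>y. y \<in> box2 \<Longrightarrow> x - s *\<^sub>R y \<in> D" "continuous_on UNIV \<kappa>"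
  shows "continuous_on box2 (\<lambda>y. \<kappa> y *\<^sub>R F (x - s *\<^sub>R y))"
proof -
  have "continuous_on box2 (\<lambda>y. F (x - s *\<^sub>R y))"
    by (rule continuous_on_compose2[OF assms(1)]) (auto intro!: continuous_intros assms(2))
  from continuous_on_scaleR[OF continuous_on_subset[OF assms(3)] this] show ?thesis by simp
qed

lemma integrable_box2: "continuous_on box2 f \<Longrightarrow> f integrable_on (box2 :: (real^'n) set)"
  for f :: "real^'n \<Rightarrow> 'b::euclidean_space"
  unfolding box2_def by (rule integrable_continuous)

lemmas conv_integrable = integrable_box2[OF conv_continuous_integrand]

lemma mass_nonneg: "continuous_on UNIV \<kappa> \<Longrightarrow> 0 \<le> mass \<kappa>"
  unfolding mass_def
  by (intro integral_nonneg integrable_box2 continuous_on_rabs) (auto elim: continuous_on_subset)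

lemma norm_conv_le:
  fixes F :: "real^'n \<Rightarrow> 'b::euclidean_space"
  assumes "continuous_on D F" "\<And>y. y \<in> box2 \<Longrightarrow> x - s *\<^sub>R y \<in> D" "continuous_on UNIV \<kappa>"
    and "\<And>y. y \<in> box2 \<Longrightarrow> norm (F (x - s *\<^sub>R y)) \<le> B"
  shows "norm (conv s \<kappa> F x) \<le> mass \<kappa> * B"
proof -
  have i: "(\<lambda>y. \<bar>\<kappa> y\<bar>) integrable_on box2"
    by (intro integrable_box2) (auto intro!: continuous_intros continuous_on_subset[OF assms(3)])
  have "norm (conv s \<kappa> F x) \<le> integral box2 (\<lambda>y. \<bar>\<kappa> y\<bar> * B)"
    unfolding conv_def
    by (rule integral_norm_bound_integral[OF conv_integrable[OF assms(1-3)]])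
      (use i in \<open>auto intro!: integrable_on_mult_left mult_left_mono assms(4)\<close>)
  then show ?thesis by (simp add: mass_def)
qed

lemma conv_add:
  fixes F :: "real^'n \<Rightarrow> 'b::euclidean_space"
  assumes "continuous_on D F" "continuous_on D H" "\<And>y. y \<in> box2 \<Longrightarrow> x - s *\<^sub>R y \<in> D" "continuous_on UNIV \<kappa>"
  shows "conv s \<kappa> (\<lambda>z. F z + H z) x = conv s \<kappa> F x + conv s \<kappa> H x"
  unfolding conv_def scaleR_add_right
  by (rule integral_add[OF conv_integrable[OF assms(1,3,4)] conv_integrable[OF assms(2,3,4)]])

lemma conv_linear:
  fixes F :: "real^'n \<Rightarrow> 'b::euclidean_space" and L :: "'b \<Rightarrow> 'c::euclidean_space"
  assumes "bounded_linear L" "continuous_on D F" "\<And>y. y \<in> box2 \<Longrightarrow> x - s *\<^sub>R y \<in> D" "continuous_on UNIV \<kappa>"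
  shows "conv s \<kappa> (\<lambda>z. L (F z)) x = L (conv s \<kappa> F x)"
proof -
  interpret L: bounded_linear L by fact
  show ?thesis
    using integral_linear[OF conv_integrable[OF assms(2-4)] assms(1)]
    by (simp add: conv_def o_def L.scaleR)
qed

lemma conv_sum:
  fixes F :: "'k \<Rightarrow> real^'n \<Rightarrow> 'b::euclidean_space"
  assumes "finite I" "\<And>k. k \<in> I \<Longrightarrow> continuous_on D (F k)" "\<And>y. y \<in> box2 \<Longrightarrow> x - s *\<^sub>R y \<in> D"
    "continuous_on UNIV \<kappa>"
  shows "conv s \<kappa> (\<lambda>z. \<Sum>k\<in>I. F k z) x = (\<Sum>k\<in>I. conv s \<kappa> (F k) x)"
  unfolding conv_def scaleR_sum_right
  by (rule integral_sum[OF assms(1)]) (rule conv_integrable[OF assms(2-4)])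

lemma conv_kernel_add:
  fixes F :: "real^'n \<Rightarrow> 'b::euclidean_space"
  assumes "continuous_on D F" "\<And>y. y \<in> box2 \<Longrightarrow> x - s *\<^sub>R y \<in> D" "continuous_on UNIV \<kappa>" "continuous_on UNIV \<kappa>'"
  shows "conv s (\<lambda>y. \<kappa> y + \<kappa>' y) F x = conv s \<kappa> F x + conv s \<kappa>' F x"
  unfolding conv_def scaleR_add_left
  by (rule integral_add[OF conv_integrable[OF assms(1-3)] conv_integrable[OF assms(1,2,4)]])

lemma conv_kernel_mult:
  fixes F :: "real^'n \<Rightarrow> 'b::euclidean_space"
  assumes "continuous_on D F" "\<And>y. y \<in> box2 \<Longrightarrow> x - s *\<^sub>R y \<in> D" "continuous_on UNIV \<kappa>"
  shows "conv s (\<lambda>y. c * \<kappa> y) F x = c *\<^sub>R conv s \<kappa> F x"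
  unfolding conv_def scaleR_scaleR[symmetric] by (rule integral_cmul)

lemma integral_derivative_param:
  fixes G :: "real \<Rightarrow> real^'n \<Rightarrow> 'b::euclidean_space"
  assumes h0: "h0 \<in> {a<..<c}"
    and der: "\<And>h y. h \<in> {a<..<c} \<Longrightarrow> y \<in> box2 \<Longrightarrow> ((\<lambda>h. G h y) has_vector_derivative G' h y) (at h)"
    and G: "\<And>h. h \<in> {a<..<c} \<Longrightarrow> continuous_on box2 (G h)"
    and G': "continuous_on ({a<..<c} \<times> box2) (\<lambda>(h, y). G' h y)"
  shows "((\<lambda>h. integral box2 (G h)) has_vector_derivative integral box2 (G' h0)) (at h0)"
proof -
  have "((\<lambda>h. integral box2 (G h)) has_vector_derivative integral box2 (G' h0)) (at h0 within {a<..<c})"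
    unfolding box2_def
  proof (rule leibniz_rule_vector_derivative)
    fix h y assume "h \<in> {a<..<c}" "y \<in> cbox (\<chi> i. -2) ((\<chi> i. 2) :: real^'n)"
    then show "((\<lambda>h. G h y) has_vector_derivative G' h y) (at h within {a<..<c})"
      using der unfolding box2_def by (blast intro: has_vector_derivative_at_within)
  next
    fix h assume "h \<in> {a<..<c}"
    then show "G h integrable_on cbox (\<chi> i. -2) (\<chi> i. 2)"
      using integrable_box2[OF G] by (simp add: box2_def)
  next
    show "continuous_on ({a<..<c} \<times> cbox (\<chi> i. -2) (\<chi> i. 2)) (\<lambda>(h, y). G' h y)"
      using G' by (simp add: box2_def)
  qed (use h0 in auto)
  then show ?thesis using h0 by (metis at_within_open open_greaterThanLessThan)
qed

text \<open>
  The integral does not change when \<open>f\<close> is translated by less than one. Differentiating this constant function of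
  the translation under the integral gives the claim.
\<close>
lemma integral_partial_zero:
  fixes f :: "real^'n \<Rightarrow> 'b::euclidean_space"
  assumes der: "\<And>y. ((\<lambda>h. f (y + h *\<^sub>R axis l 1)) has_vector_derivative f' y) (at 0)"
    and f: "continuous_on UNIV f" and f': "continuous_on UNIV f'"
    and supp: "\<And>y. norm y \<ge> 1 \<Longrightarrow> f y = 0"
  shows "integral box2 f' = 0"
proof -
  let ?e = "axis l 1 :: real^'n"
  have der': "((\<lambda>h. f (y + h *\<^sub>R ?e)) has_vector_derivative f' (y + h *\<^sub>R ?e)) (at h)" for y h
    using shift_vector_derivative[OF der[of "y + h *\<^sub>R ?e"], of h] by (simp add: algebra_simps)
  have shift: "integral box2 (\<lambda>y. f (y + h *\<^sub>R ?e)) = integral box2 f" if h: "\<bar>h\<bar> < 1" for h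
  proof -
    let ?c = "h *\<^sub>R ?e"
    have "(f has_integral integral box2 f) box2"
      by (intro integrable_integral integrable_box2 continuous_on_subset[OF f]) auto
    then have "((\<lambda>y. f (1 *\<^sub>R y + ?c)) has_integral integral box2 f) (cbox ((\<chi> i. -2) - ?c) ((\<chi> i. 2) - ?c))"
      unfolding box2_def using has_integral_affinity'[of f _ _ _ 1 ?c] by fastforce
    note B = this
    have A: "((\<lambda>y. f (y + ?c)) has_integral integral box2 f) UNIV"
    proof (rule has_integral_on_superset)
      show "((\<lambda>y. f (y + ?c)) has_integral integral box2 f) (cbox ((\<chi> i. -2) - ?c) ((\<chi> i. 2) - ?c))"
        using B by simp
    next
      fix y assume y: "y \<notin> cbox ((\<chi> i. -2) - ?c) ((\<chi> i. 2) - ?c)"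
      have "y + ?c \<notin> box2"
        using y by (auto simp: box2_def mem_box_cart algebra_simps)
      then have "norm (y + ?c) \<ge> 2" using ball_subset_box2 by (metis dist_0_norm mem_ball not_less subsetD)
      then show "f (y + ?c) = 0" using supp by simp
    qed simp
    have "f (y + ?c) = 0" if "y \<notin> box2" for y
    proof -
      have "norm y \<ge> 2" using that ball_subset_box2 by (metis dist_0_norm mem_ball not_less subsetD)
      moreover have "norm ?c < 1" using h by simp
      ultimately have "norm (y + ?c) \<ge> 1" using norm_diff_ineq[of y ?c] by linarith
      then show ?thesis using supp by simp
    qed
    then have "(\<lambda>y. if y \<in> box2 then f (y + ?c) else 0) = (\<lambda>y. f (y + ?c))" by auto
    then have "((\<lambda>y. f (y + ?c)) has_integral integral box2 f) box2"
      using A has_integral_restrict_UNIV[of box2 "\<lambda>y. f (y + ?c)"] by simp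
    then show ?thesis by (rule integral_unique)
  qed
  have "((\<lambda>h. integral box2 (\<lambda>y. f (y + h *\<^sub>R ?e))) has_vector_derivative integral box2 (\<lambda>y. f' (y + 0 *\<^sub>R ?e))) (at 0)"
    by (rule integral_derivative_param[of 0 "-1" 1])
      (auto intro!: der' continuous_on_compose2[OF f] continuous_on_compose2[OF f'] continuous_intros simp: case_prod_unfold)
  moreover have "((\<lambda>h. integral box2 (\<lambda>y. f (y + h *\<^sub>R ?e))) has_vector_derivative 0) (at 0)"
    by (rule has_vector_derivative_transform_within_open[of "\<lambda>h. integral box2 f" 0 0 "{-1<..<1}"])
      (auto simp: shift)
  ultimately show ?thesis using vector_derivative_unique_at by fastforce
qed

text \<open>
  The integral of the \<open>l\<close>-th derivative of \<open>\<kappa> y *\<^sub>R F (x - s *\<^sub>R y)\<close> vanishes; the factor \<open>s\<close> comes from the chain rule.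
\<close>
lemma conv_by_parts:
  fixes F :: "real^'n \<Rightarrow> 'b::euclidean_space"
  assumes F: "jet1 D F F1" and D: "\<And>y. y \<in> box2 \<Longrightarrow> x - s *\<^sub>R y \<in> D"
    and \<kappa>: "jet1 UNIV \<kappa> \<kappa>1" and supp: "\<And>y. norm y \<ge> 1 \<Longrightarrow> \<kappa> y = 0" "\<And>y i. norm y \<ge> 1 \<Longrightarrow> \<kappa>1 i y = 0"
  shows "s *\<^sub>R conv s \<kappa> (F1 l) x = conv s (\<kappa>1 l) F x"
proof -
  define f where "f = (\<lambda>y. \<kappa> y *\<^sub>R F (x - s *\<^sub>R y))"
  define f' where "f' = (\<lambda>y. \<kappa>1 l y *\<^sub>R F (x - s *\<^sub>R y) - s *\<^sub>R \<kappa> y *\<^sub>R F1 l (x - s *\<^sub>R y))"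
  note cF = jet1_continuous[OF F] jet1_continuous_partial[OF F]
  note ck = jet1_continuous[OF \<kappa>] jet1_continuous_partial[OF \<kappa>]
  have z: "f y = 0" "f' y = 0" if "norm y \<ge> 1" for y using supp that by (auto simp: f_def f'_def)
  \<comment> \<open>\<open>F\<close> is arbitrary outside \<open>D\<close>; continuity on the whole space is due to the vanishing off the unit ball.\<close>
  have cont: "continuous_on UNIV \<phi>" if "continuous_on box2 \<phi>" "\<And>y. norm y \<ge> 1 \<Longrightarrow> \<phi> y = 0" for \<phi> :: "real^'n \<Rightarrow> 'b"
  proof -
    have "continuous_on (ball 0 2) \<phi>" using that(1) ball_subset_box2 continuous_on_subset by blast
    moreover have "continuous_on (- cball 0 1) \<phi>"
      by (rule continuous_on_eq[of _ "\<lambda>_. 0"]) (auto simp: that(2))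
    ultimately have "continuous_on (ball 0 2 \<union> - cball 0 1) \<phi>"
      by (intro continuous_on_open_Un) auto
    moreover have "ball 0 2 \<union> - cball 0 1 = (UNIV :: (real^'n) set)" by auto
    ultimately show ?thesis by simp
  qed
  have cbf: "continuous_on box2 f" unfolding f_def by (rule conv_continuous_integrand[OF cF(1) D ck(1)])
  have ints: "(\<lambda>y. \<kappa>1 l y *\<^sub>R F (x - s *\<^sub>R y)) integrable_on box2" "(\<lambda>y. \<kappa> y *\<^sub>R F1 l (x - s *\<^sub>R y)) integrable_on box2"
    by (rule conv_integrable[OF cF(1) D ck(2)], simp, rule conv_integrable[OF cF(2) D ck(1)], simp)
  have cbf': "continuous_on box2 f'" unfolding f'_def
    by (intro continuous_intros conv_continuous_integrand[OF cF(1) D ck(2)] conv_continuous_integrand[OF cF(2) D ck(1)])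
  \<comment> \<open>In the ball of radius 2 the argument of \<open>F\<close> stays in \<open>D\<close>; outside it \<open>f\<close> is zero near \<open>y\<close>.\<close>
  have der: "((\<lambda>h. f (y + h *\<^sub>R axis l 1)) has_vector_derivative f' y) (at 0)" for y
  proof (cases "norm y < 2")
    case True
    then have yD: "x - s *\<^sub>R y \<in> D" using D ball_subset_box2 by (metis dist_0_norm mem_ball subsetD)
    have 1: "((\<lambda>h. \<kappa> (y + h *\<^sub>R axis l 1)) has_vector_derivative \<kappa>1 l y) (at 0)"
      using jet1_axis[OF \<kappa>, of y 0 l UNIV] by simp
    have 2: "((\<lambda>h. F (x - s *\<^sub>R (y + h *\<^sub>R axis l 1))) has_vector_derivative - s *\<^sub>R F1 l (x - s *\<^sub>R y)) (at 0)"
    proof -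
      have "(\<Sum>i\<in>UNIV. (- s *\<^sub>R axis l 1 :: real^'n) $ i *\<^sub>R F1 i (x - s *\<^sub>R y)) = - s *\<^sub>R F1 l (x - s *\<^sub>R y)"
        by (simp only: vector_scaleR_component real_scaleR_def scaleR_scaleR[symmetric] scaleR_sum_right[symmetric] sum_axis_scaleR)
      moreover have Q: "x - s *\<^sub>R (y + h *\<^sub>R axis l 1) = (x - s *\<^sub>R y) + h *\<^sub>R (- s *\<^sub>R axis l 1)" for h
        by (simp add: algebra_simps)
      moreover have "(x - s *\<^sub>R y) + 0 *\<^sub>R (- s *\<^sub>R axis l 1) \<in> D" using yD by simp
      ultimately show ?thesis
        unfolding Q using jet1_line[OF F, of "x - s *\<^sub>R y" 0 "- s *\<^sub>R axis l 1" UNIV]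
        by (simp only: scaleR_zero_left add_0_right)
    qed
    have "((\<lambda>h. \<kappa> (y + h *\<^sub>R axis l 1) *\<^sub>R F (x - s *\<^sub>R (y + h *\<^sub>R axis l 1))) has_vector_derivative
        (\<kappa> (y + 0 *\<^sub>R axis l 1) *\<^sub>R (- s *\<^sub>R F1 l (x - s *\<^sub>R y)) + \<kappa>1 l y *\<^sub>R F (x - s *\<^sub>R (y + 0 *\<^sub>R axis l 1)))) (at 0)"
      by (rule has_vector_derivative_scaleR[OF _ 2]) (use 1 in \<open>simp add: has_real_derivative_iff_has_vector_derivative\<close>)
    then show ?thesis by (simp add: f_def f'_def algebra_simps)
  next
    case False
    have fz: "f (y + h *\<^sub>R axis l 1) = 0" if "h \<in> {-1<..<1}" for h
    proof (rule z)
      show "1 \<le> norm (y + h *\<^sub>R axis l 1)" using False that norm_diff_ineq[of y "h *\<^sub>R axis l 1"] by auto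
    qed
    have "((\<lambda>h. f (y + h *\<^sub>R axis l 1)) has_vector_derivative 0) (at 0)"
      by (rule has_vector_derivative_transform_within_open[of "\<lambda>h. 0" 0 0 "{-1<..<1}"]) (simp_all add: fz)
    then show ?thesis using z(2)[of y] False by simp
  qed
  have "integral box2 f' = 0"
    by (rule integral_partial_zero[OF der cont cont]) (use z cbf cbf' in auto)
  moreover have "integral box2 f' = conv s (\<kappa>1 l) F x - s *\<^sub>R conv s \<kappa> (F1 l) x"
    unfolding f'_def conv_def
    by (simp only: integral_diff[OF ints(1) integrable_cmul[OF ints(2), of s]] integral_cmul)
  ultimately show ?thesis by simp
qed

lemma conv_deriv_scale:
  fixes F :: "real^'n \<Rightarrow> 'b::euclidean_space"
  assumes F: "jet1 D F F1" and s: "s \<in> {a<..<c}" and D: "\<And>s y. s \<in> {a<..<c} \<Longrightarrow> y \<in> box2 \<Longrightarrow> x - s *\<^sub>R y \<in> D"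
    and \<kappa>: "continuous_on UNIV \<kappa>"
  shows "((\<lambda>s. conv s \<kappa> F x) has_vector_derivative - (\<Sum>l\<in>UNIV. conv s (\<lambda>y. y $ l * \<kappa> y) (F1 l) x)) (at s)"
proof -
  define G' where "G' = (\<lambda>s y. \<kappa> y *\<^sub>R (\<Sum>l\<in>UNIV. (- y) $ l *\<^sub>R F1 l (x - s *\<^sub>R y)))"
  have "((\<lambda>s. integral box2 (\<lambda>y. \<kappa> y *\<^sub>R F (x - s *\<^sub>R y))) has_vector_derivative integral box2 (G' s)) (at s)"
  proof (rule integral_derivative_param[OF s])
    fix h y assume hy: "h \<in> {a<..<c}" "y \<in> (box2 :: (real^'n) set)"
    have "((\<lambda>s. F (x + s *\<^sub>R (- y))) has_vector_derivative (\<Sum>l\<in>UNIV. (- y) $ l *\<^sub>R F1 l (x + h *\<^sub>R (- y)))) (at h)"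
      by (rule jet1_line[OF F]) (use D[OF hy] in simp)
    then show "((\<lambda>s. \<kappa> y *\<^sub>R F (x - s *\<^sub>R y)) has_vector_derivative G' h y) (at h)"
      unfolding G'_def by (auto intro!: derivative_eq_intros)
  next
    fix h assume "h \<in> {a<..<c}"
    then show "continuous_on box2 (\<lambda>y. \<kappa> y *\<^sub>R F (x - h *\<^sub>R y))"
      by (intro conv_continuous_integrand[OF jet1_continuous[OF F] D \<kappa>])
  next
    have "continuous_on ({a<..<c} \<times> box2) (\<lambda>p. F1 l (x - fst p *\<^sub>R snd p))" for l
      by (rule continuous_on_compose2[OF jet1_continuous_partial[OF F]]) (use D in \<open>auto intro!: continuous_intros\<close>)
    moreover have "continuous_on ({a<..<c} \<times> box2) (\<lambda>p. \<kappa> (snd p))"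
      by (rule continuous_on_compose2[OF \<kappa>]) (auto intro!: continuous_intros)
    ultimately show "continuous_on ({a<..<c} \<times> box2) (\<lambda>(h, y). G' h y)"
      unfolding G'_def case_prod_unfold by (auto intro!: continuous_intros)
  qed
  moreover have "integral box2 (G' s) = - (\<Sum>l\<in>UNIV. conv s (\<lambda>y. y $ l * \<kappa> y) (F1 l) x)"
  proof -
    have i: "(\<lambda>y. (y $ l * \<kappa> y) *\<^sub>R F1 l (x - s *\<^sub>R y)) integrable_on box2" for l
      by (rule conv_integrable[OF jet1_continuous_partial[OF F] D[OF s]]) (use \<kappa> in \<open>auto intro!: continuous_intros\<close>)
    have "integral box2 (G' s) = integral box2 (\<lambda>y. - (\<Sum>l\<in>UNIV. (y $ l * \<kappa> y) *\<^sub>R F1 l (x - s *\<^sub>R y)))"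
      by (simp add: G'_def scaleR_sum_right sum_negf mult.commute)
    then show ?thesis unfolding conv_def by (simp add: integral_sum[OF _ i])
  qed
  ultimately show ?thesis unfolding conv_def by simp
qed

lemma conv_jet1:
  fixes F :: "real^'n \<Rightarrow> 'b::euclidean_space"
  assumes F: "jet1 D F F1" and E: "open E" and D: "\<And>x y. x \<in> E \<Longrightarrow> y \<in> box2 \<Longrightarrow> x - s *\<^sub>R y \<in> D"
    and \<kappa>: "continuous_on UNIV \<kappa>"
  shows "jet1 E (conv s \<kappa> F) (\<lambda>i. conv s \<kappa> (F1 i))"
proof -
  have cont: "continuous_on E (conv s \<kappa> H)" if "continuous_on D H" for H :: "real^'n \<Rightarrow> 'b"
  proof -
    have "continuous_on (E \<times> box2) (\<lambda>p. H (fst p - s *\<^sub>R snd p))"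
      by (rule continuous_on_compose2[OF that]) (use D in \<open>auto intro!: continuous_intros\<close>)
    moreover have "continuous_on (E \<times> box2) (\<lambda>p. \<kappa> (snd p))"
      by (rule continuous_on_compose2[OF \<kappa>]) (auto intro!: continuous_intros)
    ultimately have "continuous_on (E \<times> box2) (\<lambda>(x, y). \<kappa> y *\<^sub>R H (x - s *\<^sub>R y))"
      by (auto simp: case_prod_unfold intro!: continuous_intros)
    then have "continuous_on E (\<lambda>x. conv s \<kappa> H x)"
      unfolding conv_def box2_def by (rule integral_continuous_on_param)
    then show ?thesis by simp
  qed
  have der: "((\<lambda>h. conv s \<kappa> F (x + h *\<^sub>R axis i 1)) has_vector_derivative conv s \<kappa> (F1 i) x) (at 0)" if x: "x \<in> E" for x i
  proof -
    obtain r where r: "r > 0" "ball x r \<subseteq> E" using E x by (auto simp: open_contains_ball)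
    have xE: "x + h *\<^sub>R axis i 1 \<in> E" if "h \<in> {-r<..<r}" for h
      using that r(2) by (auto simp: subset_iff dist_norm)
    have "((\<lambda>h. integral box2 (\<lambda>y. \<kappa> y *\<^sub>R F (x + h *\<^sub>R axis i 1 - s *\<^sub>R y))) has_vector_derivative
        integral box2 (\<lambda>y. \<kappa> y *\<^sub>R F1 i (x + 0 *\<^sub>R axis i 1 - s *\<^sub>R y))) (at 0)"
    proof (rule integral_derivative_param)
      show "0 \<in> {-r<..<r}" using r by simp
      fix h y assume hy: "h \<in> {-r<..<r}" "y \<in> (box2 :: (real^'n) set)"
      have "((\<lambda>h. F ((x - s *\<^sub>R y) + h *\<^sub>R axis i 1)) has_vector_derivative F1 i ((x - s *\<^sub>R y) + h *\<^sub>R axis i 1)) (at h)"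
        by (rule jet1_axis[OF F]) (use D[OF xE[OF hy(1)] hy(2)] in \<open>simp add: algebra_simps\<close>)
      then show "((\<lambda>h. \<kappa> y *\<^sub>R F (x + h *\<^sub>R axis i 1 - s *\<^sub>R y)) has_vector_derivative \<kappa> y *\<^sub>R F1 i (x + h *\<^sub>R axis i 1 - s *\<^sub>R y)) (at h)"
        by (auto simp: algebra_simps intro!: derivative_eq_intros)
    next
      fix h assume "h \<in> {-r<..<r}"
      then show "continuous_on box2 (\<lambda>y. \<kappa> y *\<^sub>R F (x + h *\<^sub>R axis i 1 - s *\<^sub>R y))"
        by (intro conv_continuous_integrand[OF jet1_continuous[OF F] D[OF xE] \<kappa>])
    next
      have "continuous_on ({-r<..<r} \<times> box2) (\<lambda>p. F1 i (x + fst p *\<^sub>R axis i 1 - s *\<^sub>R snd p))"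
        by (rule continuous_on_compose2[OF jet1_continuous_partial[OF F]]) (use D xE in \<open>auto intro!: continuous_intros\<close>)
      moreover have "continuous_on ({-r<..<r} \<times> box2) (\<lambda>p. \<kappa> (snd p))"
        by (rule continuous_on_compose2[OF \<kappa>]) (auto intro!: continuous_intros)
      ultimately show "continuous_on ({-r<..<r} \<times> box2) (\<lambda>(h, y). \<kappa> y *\<^sub>R F1 i (x + h *\<^sub>R axis i 1 - s *\<^sub>R y))"
        by (auto simp: case_prod_unfold intro!: continuous_intros)
    qed
    then show ?thesis by (simp add: conv_def)
  qed
  show ?thesis unfolding jet1_def
    using has_derivative_of_continuous_partials[OF E _ der cont[OF jet1_continuous_partial[OF F]]]
      cont[OF jet1_continuous_partial[OF F]] by blast
qed

lemma conv_time_deriv: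
  fixes u :: "real \<Rightarrow> real^'n \<Rightarrow> 'b::euclidean_space"
  assumes t: "t \<in> {0<..<T}" and der: "\<And>t z. t \<in> {0<..<T} \<Longrightarrow> z \<in> D \<Longrightarrow> ((\<lambda>t. u t z) has_vector_derivative u' t z) (at t)"
    and c: "\<And>t. t \<in> {0<..<T} \<Longrightarrow> continuous_on D (u t)"
    and c': "continuous_on ({0<..<T} \<times> D) (\<lambda>(t, z). u' t z)"
    and D: "\<And>y. y \<in> box2 \<Longrightarrow> x - s *\<^sub>R y \<in> D" and \<kappa>: "continuous_on UNIV \<kappa>"
  shows "((\<lambda>t. conv s \<kappa> (u t) x) has_vector_derivative conv s \<kappa> (u' t) x) (at t)"
  unfolding conv_def
proof (rule integral_derivative_param[OF t])
  fix h y assume hy: "h \<in> {0<..<T}" "y \<in> (box2 :: (real^'n) set)"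
  show "((\<lambda>h. \<kappa> y *\<^sub>R u h (x - s *\<^sub>R y)) has_vector_derivative \<kappa> y *\<^sub>R u' h (x - s *\<^sub>R y)) (at h)"
    using der[OF hy(1) D[OF hy(2)]] by (auto intro!: derivative_eq_intros)
next
  fix h assume "h \<in> {0<..<T}"
  then show "continuous_on box2 (\<lambda>y. \<kappa> y *\<^sub>R u h (x - s *\<^sub>R y))"
    by (intro conv_continuous_integrand[OF c D \<kappa>])
next
  have "continuous_on ({0<..<T} \<times> box2) (\<lambda>p. (\<lambda>(t, z). u' t z) (fst p, x - s *\<^sub>R snd p))"
    by (rule continuous_on_compose2[OF c']) (use D in \<open>auto intro!: continuous_intros\<close>)
  moreover have "continuous_on ({0<..<T} \<times> box2) (\<lambda>p. \<kappa> (snd p))"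
    by (rule continuous_on_compose2[OF \<kappa>]) (auto intro!: continuous_intros)
  ultimately show "continuous_on ({0<..<T} \<times> box2) (\<lambda>(h, y). \<kappa> y *\<^sub>R u' h (x - s *\<^sub>R y))"
    by (auto simp: case_prod_unfold intro!: continuous_intros)
qed

section \<open>The kernel\<close>

definition bump :: "nat \<Rightarrow> real^'n \<Rightarrow> real" where
  "bump m y = (max 0 (1 - y \<bullet> y)) ^ m"

lemma bump_zero: "norm y \<ge> 1 \<Longrightarrow> m > 0 \<Longrightarrow> bump m y = 0"
proof -
  assume "norm y \<ge> 1" "m > 0"
  then have "1 \<le> y \<bullet> y" by (simp add: norm_ge_square[of 1 y])
  then show ?thesis using \<open>m > 0\<close> by (simp add: bump_def)
qed

lemma bump_continuous: "continuous_on UNIV (bump m)"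
  unfolding bump_def by (intro continuous_intros)

lemma positive_part_power_deriv:
  assumes "m \<ge> 1"
  shows "((\<lambda>r::real. (max 0 r) ^ Suc m) has_real_derivative real (Suc m) * (max 0 r) ^ m) (at r)"
proof -
  consider "r < 0" | "r > 0" | "r = 0" by linarith
  then show ?thesis
  proof cases
    case 1
    have "((\<lambda>r::real. 0) has_real_derivative 0) (at r)" by simp
    then have "((\<lambda>r::real. (max 0 r) ^ Suc m) has_real_derivative 0) (at r)"
      by (rule has_field_derivative_transform_within_open[of _ _ _ "{..<0}"]) (use 1 in auto)
    moreover have z: "real (Suc m) * (max 0 r) ^ m = 0" using 1 assms by (simp add: power_0_left)
    ultimately show ?thesis unfolding z by blast
  next
    case 2
    have "((\<lambda>r::real. r ^ Suc m) has_real_derivative real (Suc m) * r ^ m) (at r)"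
      by (rule DERIV_cong[OF DERIV_pow]) simp
    then have "((\<lambda>r::real. (max 0 r) ^ Suc m) has_real_derivative real (Suc m) * r ^ m) (at r)"
      by (rule has_field_derivative_transform_within_open[of _ _ _ "{0<..}"]) (use 2 in auto)
    then show ?thesis using 2 by simp
  next
    case 3
    have z: "(0::real) ^ m = 0" using assms by simp
    have "((\<lambda>h::real. (max 0 h) ^ m) \<longlongrightarrow> (max 0 0) ^ m) (at 0)" by (intro tendsto_intros)
    then have "((\<lambda>h::real. (max 0 h) ^ m) \<longlongrightarrow> 0) (at 0)" unfolding max.idem z .
    then have "((\<lambda>h::real. (max 0 h) ^ Suc m / h) \<longlongrightarrow> 0) (at 0)"
      by (rule Lim_null_comparison[rotated]) (auto simp: eventually_at_filter max_def)
    then show ?thesis using 3 by (simp add: DERIV_def z)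
  qed
qed

lemma bump_jet1:
  assumes "m \<ge> 1"
  shows "jet1 UNIV (bump (Suc m)) (\<lambda>i y::real^'n. - 2 * real (Suc m) * y $ i * bump m y)"
proof -
  have "((\<lambda>y::real^'n. 1 - y \<bullet> y) has_derivative (\<lambda>v. \<Sum>i\<in>UNIV. v $ i *\<^sub>R (- 2 * y $ i))) (at y)" for y
  proof -
    have "((\<lambda>y::real^'n. 1 - y \<bullet> y) has_derivative (\<lambda>v. - 2 * (v \<bullet> y))) (at y)"
      by (auto intro!: derivative_eq_intros simp: inner_commute)
    moreover have "(\<lambda>v. - 2 * (v \<bullet> y)) = (\<lambda>v. \<Sum>i\<in>UNIV. v $ i *\<^sub>R (- 2 * y $ i))"
      by (rule ext) (simp add: inner_vec_def sum_distrib_left sum_negf algebra_simps)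
    ultimately show ?thesis by simp
  qed
  then have q: "jet1 UNIV (\<lambda>y::real^'n. 1 - y \<bullet> y) (\<lambda>i y. - 2 * y $ i)"
    unfolding jet1_def by (auto intro!: continuous_intros)
  have "jet1 UNIV (\<lambda>y::real^'n. (max 0 (1 - y \<bullet> y)) ^ Suc m)
      (\<lambda>i y. real (Suc m) * (max 0 (1 - y \<bullet> y)) ^ m * (- 2 * y $ i))"
    by (rule jet1_chain[OF q positive_part_power_deriv[OF assms]]) (auto intro!: continuous_intros)
  then show ?thesis by (rule jet1_cong) (auto simp: bump_def algebra_simps)
qed

text \<open>
  The kernel is \<open>c (1 - \<bar>y\<bar>\<^sup>2)\<^sub>+\<^sup>4\<close>; the exponent leaves it two continuous derivatives of compact support, \<open>kern1\<close> and
  \<open>kern2\<close>. The functions \<open>pot1\<close>, \<open>pot2\<close>, \<open>pot3\<close> are the derivatives of first to third order of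
  \<open>\<eta> = c/10 (1 - \<bar>y\<bar>\<^sup>2)\<^sub>+\<^sup>5\<close>, the potential with \<open>\<nabla>\<eta> = - y kern(y)\<close>. A change of scale in a mollification moves
  the point \<open>x - s y\<close> along \<open>- y\<close>, so that \<open>d/ds (kern\<^sub>s * u) = s (\<eta>\<^sub>s * \<Delta>u)\<close>: this identity lets the
  Laplacian alone control how mollifications depend on the scale.
\<close>
definition kernel_const :: "'n::finite itself \<Rightarrow> real" where
  "kernel_const _ = 1 / integral box2 (bump 4 :: real^'n \<Rightarrow> real)"

definition kern :: "real^'n \<Rightarrow> real" where
  "kern y = kernel_const TYPE('n) * bump 4 y"

definition kern1 :: "'n \<Rightarrow> real^'n \<Rightarrow> real" where
  "kern1 i y = kernel_const TYPE('n) * (- 8 * y $ i * bump 3 y)"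

definition kern2 :: "'n \<Rightarrow> 'n \<Rightarrow> real^'n \<Rightarrow> real" where
  "kern2 i j y = kernel_const TYPE('n) * ((if i = j then - 8 else 0) * bump 3 y + 48 * y $ i * y $ j * bump 2 y)"

definition pot1 :: "'n \<Rightarrow> real^'n \<Rightarrow> real" where
  "pot1 i y = - (y $ i * kern y)"

definition pot2 :: "'n \<Rightarrow> 'n \<Rightarrow> real^'n \<Rightarrow> real" where
  "pot2 i j y = - ((if i = j then kern y else 0) + y $ j * kern1 i y)"

definition pot3 :: "'n \<Rightarrow> 'n \<Rightarrow> 'n \<Rightarrow> real^'n \<Rightarrow> real" where
  "pot3 l i j y = - ((if i = j then kern1 l y else 0) + (if l = j then kern1 i y else 0) + y $ j * kern2 l i y)"

lemma bump4_integral_pos: "0 < integral box2 (bump 4 :: real^'n \<Rightarrow> real)"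
proof -
  let ?f = "bump 4 :: real^'n \<Rightarrow> real"
  have i: "?f integrable_on box2" by (intro integrable_box2 continuous_on_subset[OF bump_continuous]) simp
  have nn: "0 \<le> ?f y" for y by (simp add: bump_def)
  have "0 \<le> integral box2 ?f" using integral_nonneg[OF i] nn by simp
  moreover have "integral box2 ?f \<noteq> 0"
  proof
    assume "integral box2 ?f = 0"
    then have "(?f has_integral 0) box2" using i by (metis integrable_integral)
    then have "?f 0 = 0"
      unfolding box2_def
      by (rule has_integral_0_cbox_imp_0[rotated 2])
        (auto simp: mem_box_cart nn interval_ne_empty_cart intro: continuous_on_subset[OF bump_continuous])
    then show False by (simp add: bump_def)
  qed
  ultimately show ?thesis by linarith
qed

lemma integral_kern: "integral box2 (kern :: real^'n \<Rightarrow> real) = 1"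
  using bump4_integral_pos[where 'n='n] by (simp add: kern_def[abs_def] kernel_const_def)

lemma kern_nonneg: "0 \<le> kern y"
  using bump4_integral_pos[where 'n='a] by (simp add: kern_def kernel_const_def bump_def)

lemma jet1_cmult: "jet1 D f f1 \<Longrightarrow> jet1 D (\<lambda>x. c * f x) (\<lambda>i x. c * f1 i x)" for c :: real
  by (rule jet1_linear[OF bounded_linear_mult_right])

lemma kern_jet1: "jet1 UNIV (kern :: real^'n \<Rightarrow> real) kern1"
  by (rule jet1_cong[OF jet1_cmult[OF bump_jet1[of 3], of "kernel_const TYPE('n)"]])
    (auto simp: kern_def kern1_def numeral_eq_Suc)

lemma kern1_jet1: "jet1 UNIV (kern1 j :: real^'n \<Rightarrow> real) (\<lambda>i. kern2 i j)"
  by (rule jet1_cong[OF jet1_cmult[OF jet1_mult[OF jet1_coord[of _ j] bump_jet1[of 2]], of "-8 * kernel_const TYPE('n)"]])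
    (auto simp: kern1_def kern2_def numeral_eq_Suc algebra_simps)

lemma pot1_jet1: "jet1 UNIV (pot1 j :: real^'n \<Rightarrow> real) (\<lambda>i. pot2 i j)"
  by (rule jet1_cong[OF jet1_cmult[OF jet1_mult[OF jet1_coord[of _ j] kern_jet1], of "-1"]])
    (auto simp: pot1_def pot2_def algebra_simps)

lemma pot2_jet1: "jet1 UNIV (pot2 i j :: real^'n \<Rightarrow> real) (\<lambda>l. pot3 l i j)"
proof (cases "i = j")
  case True
  show ?thesis
    by (rule jet1_cong[OF jet1_cmult[OF jet1_add[OF kern_jet1 jet1_mult[OF jet1_coord[of _ j] kern1_jet1[of i]]], of "-1"]])
      (auto simp: pot2_def pot3_def True algebra_simps)
next
  case False
  show ?thesis
    by (rule jet1_cong[OF jet1_cmult[OF jet1_mult[OF jet1_coord[of _ j] kern1_jet1[of i]], of "-1"]])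
      (auto simp: pot2_def pot3_def False algebra_simps)
qed

lemma kernel_zero:
  assumes "norm y \<ge> 1"
  shows "kern y = 0" "kern1 i y = 0" "kern2 i j y = 0" "pot1 i y = 0" "pot2 i j y = 0" "pot3 l i j y = 0"
  using bump_zero[OF assms] by (simp_all add: kern_def kern1_def kern2_def pot1_def pot2_def pot3_def)

lemma kern2_sym: "kern2 i j y = kern2 j i y"
  by (simp add: kern2_def)

text \<open>
  The field \<open>y kern(y)\<close> is a gradient, hence free of curl. The next lemma is the same symmetry for the third
  derivatives of the potential.
\<close>
lemma kern1_swap: "y $ j * kern1 i y = y $ i * kern1 j y"
  by (simp add: kern1_def)

lemma kern2_swap: "y $ j * kern2 l i y + (if i = j then kern1 l y else 0)
   = y $ l * kern2 i j y + (if l = i then kern1 j y else 0)"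
  by (auto simp: kern2_def kern1_def algebra_simps)

lemmas kern_cont = jet1_continuous[OF kern_jet1]
lemmas kern1_cont = jet1_continuous[OF kern1_jet1]
lemmas kern2_cont = jet1_continuous_partial[OF kern1_jet1]
lemmas pot1_cont = jet1_continuous[OF pot1_jet1]
lemmas pot2_cont = jet1_continuous[OF pot2_jet1]

lemma mass_kern: "mass (kern :: real^'n \<Rightarrow> real) = 1"
  by (simp add: mass_def kern_nonneg integral_kern)

lemma conv_const_kern: "conv s (kern :: real^'n \<Rightarrow> real) (\<lambda>_. c) x = c"
proof -
  have "integral box2 (\<lambda>y. kern (y :: real^'n) *\<^sub>R c) = integral box2 (kern :: real^'n \<Rightarrow> real) *\<^sub>R c"
    using integral_linear[OF integrable_box2[OF continuous_on_subset[OF kern_cont subset_UNIV]] bounded_linear_scaleR_left]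
    unfolding o_def .
  then show ?thesis by (simp add: conv_def integral_kern)
qed

section \<open>Functions with bounded Laplacian\<close>

definition kernel_bound :: "'n::finite itself \<Rightarrow> real" where
  "kernel_bound _ = 1 + (\<Sum>i\<in>UNIV. mass (kern1 i :: real^'n \<Rightarrow> real)) + (\<Sum>i\<in>UNIV. mass (pot1 i :: real^'n \<Rightarrow> real))
     + (\<Sum>i\<in>UNIV. \<Sum>j\<in>UNIV. mass (pot2 i j :: real^'n \<Rightarrow> real))"

lemma kernel_bound:
  "mass (kern1 i :: real^'n \<Rightarrow> real) \<le> kernel_bound TYPE('n)"
  "mass (pot1 i :: real^'n \<Rightarrow> real) \<le> kernel_bound TYPE('n)"
  "mass (pot2 i j :: real^'n \<Rightarrow> real) \<le> kernel_bound TYPE('n)"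
  "0 \<le> kernel_bound TYPE('n)"
proof -
  have nn: "0 \<le> mass (kern1 i :: real^'n \<Rightarrow> real)" "0 \<le> mass (pot1 i :: real^'n \<Rightarrow> real)" "0 \<le> mass (pot2 i j :: real^'n \<Rightarrow> real)" for i j
    by (rule mass_nonneg kern1_cont pot1_cont pot2_cont)+
  have 1: "mass (kern1 i :: real^'n \<Rightarrow> real) \<le> (\<Sum>i\<in>UNIV. mass (kern1 i :: real^'n \<Rightarrow> real))"
    "mass (pot1 i :: real^'n \<Rightarrow> real) \<le> (\<Sum>i\<in>UNIV. mass (pot1 i :: real^'n \<Rightarrow> real))" for i
    by (rule member_le_sum; simp add: nn)+
  have "mass (pot2 i j :: real^'n \<Rightarrow> real) \<le> (\<Sum>j\<in>UNIV. mass (pot2 i j :: real^'n \<Rightarrow> real))"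
    by (rule member_le_sum; simp add: nn)
  also have "\<dots> \<le> (\<Sum>i\<in>UNIV. \<Sum>j\<in>UNIV. mass (pot2 i j :: real^'n \<Rightarrow> real))"
    by (rule member_le_sum[of i UNIV "\<lambda>i. \<Sum>j\<in>UNIV. mass (pot2 i j :: real^'n \<Rightarrow> real)"]) (auto intro!: sum_nonneg nn)
  finally have 2: "mass (pot2 i j :: real^'n \<Rightarrow> real) \<le> (\<Sum>i\<in>UNIV. \<Sum>j\<in>UNIV. mass (pot2 i j :: real^'n \<Rightarrow> real))" .
  have 3: "0 \<le> (\<Sum>i\<in>UNIV. mass (kern1 i :: real^'n \<Rightarrow> real))" "0 \<le> (\<Sum>i\<in>UNIV. mass (pot1 i :: real^'n \<Rightarrow> real))"
    "0 \<le> (\<Sum>i\<in>UNIV. \<Sum>j\<in>UNIV. mass (pot2 i j :: real^'n \<Rightarrow> real))" by (intro sum_nonneg nn)+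
  show "mass (kern1 i :: real^'n \<Rightarrow> real) \<le> kernel_bound TYPE('n)" using 1(1)[of i] 3 by (simp add: kernel_bound_def)
  show "mass (pot1 i :: real^'n \<Rightarrow> real) \<le> kernel_bound TYPE('n)" using 1(2)[of i] 3 by (simp add: kernel_bound_def)
  show "mass (pot2 i j :: real^'n \<Rightarrow> real) \<le> kernel_bound TYPE('n)" using 2 3 by (simp add: kernel_bound_def)
  show "0 \<le> kernel_bound TYPE('n)" using 3 by (simp add: kernel_bound_def)
qed

lemma open_cube: "open (cube l :: (real^'n) set)"
proof -
  have "cube l = box (\<chi> i. -l) ((\<chi> i. l) :: real^'n)" by (auto simp: cube_def mem_box_cart)
  then show ?thesis by (simp add: open_box)
qed

lemma convex_cube: "convex (cube l :: (real^'n) set)"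
proof -
  have "cube l = box (\<chi> i. -l) ((\<chi> i. l) :: real^'n)" by (auto simp: cube_def mem_box_cart)
  then show ?thesis by simp
qed

lemma cube_shift:
  assumes "\<And>i. \<bar>x $ i\<bar> \<le> l - d" "0 \<le> s" "2 * s < d" "y \<in> box2"
  shows "x - s *\<^sub>R y \<in> cube l"
  unfolding cube_def
proof (intro CollectI allI)
  fix i
  have "\<bar>s * y $ i\<bar> \<le> s * 2" using assms(2,4) by (simp add: abs_mult mem_box2 mult_left_mono)
  then show "-l < (x - s *\<^sub>R y) $ i \<and> (x - s *\<^sub>R y) $ i < l" using assms(1)[of i] assms(3) by (auto simp: abs_le_iff)
qed

lemma norm_le_CARD: "(\<And>i. \<bar>v $ i\<bar> \<le> c) \<Longrightarrow> norm v \<le> CARD('n) * c" for v :: "real^'n" and c :: real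
  using order_trans[OF norm_le_l1_cart sum_bounded_above[of UNIV "\<lambda>i. \<bar>v $ i\<bar>" c]] by simp

lemma scaleR_solve: "r \<noteq> 0 \<Longrightarrow> r *\<^sub>R a = b \<Longrightarrow> a = (1 / r) *\<^sub>R b"
  for a b :: "'a::real_vector"
  by auto

text \<open>
  The size of the Hessian of a function with bounded gradient and Laplacian, mollified at scale \<open>s\<close>, at
  distance \<open>d\<close> from the boundary of the cube: an interior estimate at scale \<open>d\<close>, plus a bounded contribution
  of each dyadic scale down to \<open>s\<close>.
\<close>
definition log_weight :: "real \<Rightarrow> real \<Rightarrow> real \<Rightarrow> real" where
  "log_weight l d s = 1 / d + ln (l / s)"

definition hess_const :: "'n::finite itself \<Rightarrow> real \<Rightarrow> real \<Rightarrow> real" where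
  "hess_const N G Lp = 4 * kernel_bound N * (G + Lp)"

definition osc_const :: "'n::finite itself \<Rightarrow> real \<Rightarrow> real \<Rightarrow> real \<Rightarrow> real" where
  "osc_const N l G Lp = 2 * kernel_bound N * Lp * l + 4 * real (CARD('n))^2 * hess_const N G Lp"

definition residual_const :: "'n::finite itself \<Rightarrow> real \<Rightarrow> real \<Rightarrow> real \<Rightarrow> real \<Rightarrow> real" where
  "residual_const N l G Lp CA =
     (real (CARD('n)))^2 * (CA * hess_const N G Lp + (2 * real (CARD('n))^2 * kernel_bound N + 1) * CA * osc_const N l G Lp)
     + (real (CARD('n)) * CA * G + CA) * (1 + 2 * real (CARD('n))) * l"

text \<open>
  Only the gradient and the Laplacian are bounded, as for a classical solution at a fixed time. For the individual
  second derivatives, the results of this locale recover bounds after mollification that grow logarithmically in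
  the scale, and with them a modulus of continuity of the gradient.
\<close>
locale bounded_laplacian =
  fixes u :: "real^'n \<Rightarrow> real^'m" and u1 u2 and l G Lp :: real
  assumes l: "0 < l"
    and jet: "jet2 (cube l) u u1 u2"
    and grad: "\<And>z i. z \<in> cube l \<Longrightarrow> norm (u1 i z) \<le> G"
    and lap: "\<And>z. z \<in> cube l \<Longrightarrow> norm (\<Sum>i\<in>UNIV. u2 i i z) \<le> Lp"
begin

abbreviation "Lap \<equiv> \<lambda>z. \<Sum>i\<in>UNIV. u2 i i z"

lemma ju: "jet1 (cube l) u u1" and ju1: "\<And>j. jet1 (cube l) (u1 j) (\<lambda>i. u2 i j)"
  using jet by (auto simp: jet2_def)

lemma cu: "continuous_on (cube l) u" "continuous_on (cube l) (u1 i)" "continuous_on (cube l) (u2 i j)"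
  "continuous_on (cube l) Lap"
proof -
  show "continuous_on (cube l) u" by (rule jet1_continuous[OF ju])
  show "continuous_on (cube l) (u1 i)" for i by (rule jet1_continuous_partial[OF ju])
  show c2: "continuous_on (cube l) (u2 i j)" for i j by (rule jet1_continuous_partial[OF ju1])
  show "continuous_on (cube l) Lap" by (intro continuous_intros c2)
qed

text \<open>
  This is the identity \<open>d/ds (kern\<^sub>s * u) = s (\<eta>\<^sub>s * \<Delta>u)\<close> differentiated once in space, with the derivative moved
  onto \<open>\<eta>\<close>. As \<open>u\<close> has no third derivatives, both sides are first rewritten in terms of \<open>u\<close> and \<open>u1\<close>.
\<close>
lemma gradient_scale_deriv:
  assumes x: "\<And>i. \<bar>x $ i\<bar> \<le> l - d" and s: "s \<in> {0<..<d/2}"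
  shows "((\<lambda>s. conv s kern (u1 i) x) has_vector_derivative conv s (pot1 i) Lap x) (at s)"
proof -
  have D: "x - r *\<^sub>R y \<in> cube l" if "r \<in> {0<..<d/2}" "y \<in> box2" for r y
    using cube_shift[OF x] that by auto
  have a1: "r *\<^sub>R conv r kern (u1 i) x = conv r (kern1 i) u x" if "r \<in> {0<..<d/2}" for r
    by (rule conv_by_parts[OF ju D[OF that] kern_jet1]) (auto simp: kernel_zero)
  define \<Psi>' where "\<Psi>' = - (\<Sum>k\<in>UNIV. conv s (\<lambda>y. y $ k * kern1 i y) (u1 k) x)"
  have dP: "((\<lambda>s. conv s (kern1 i) u x) has_vector_derivative \<Psi>') (at s)"
    unfolding \<Psi>'_def by (rule conv_deriv_scale[OF ju s D kern1_cont])
  have a2: "s *\<^sub>R conv s (pot1 i) (u2 k k) x = conv s (pot2 k i) (u1 k) x" for k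
    by (rule conv_by_parts[OF ju1 D[OF s] pot1_jet1]) (auto simp: kernel_zero)
  have yk: "continuous_on UNIV (\<lambda>y. y $ k * kern1 i y)" for k by (intro continuous_intros kern1_cont)
  have a3: "conv s (pot2 k i) (u1 k) x = - (if k = i then conv s kern (u1 k) x else 0) - conv s (\<lambda>y. y $ k * kern1 i y) (u1 k) x" for k
  proof -
    have "pot2 k i = (\<lambda>y. - (if k = i then 1 else 0) * kern y + (-1) * (y $ k * kern1 i y))"
      using kern1_swap[of _ i k] by (auto simp: pot2_def fun_eq_iff)
    moreover have "conv s (\<lambda>y. - (if k = i then 1 else 0) * kern y + (-1) * (y $ k * kern1 i y)) (u1 k) x
        = - (if k = i then 1 else 0) *\<^sub>R conv s kern (u1 k) x + (-1) *\<^sub>R conv s (\<lambda>y. y $ k * kern1 i y) (u1 k) x"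
      by (subst conv_kernel_add[OF cu(2) D[OF s]], assumption)
        (intro continuous_intros kern_cont yk, intro continuous_intros kern1_cont,
          simp only: conv_kernel_mult[OF cu(2) D[OF s] kern_cont] conv_kernel_mult[OF cu(2) D[OF s] yk])
    ultimately show ?thesis by simp
  qed
  have "s *\<^sub>R conv s (pot1 i) Lap x = (\<Sum>k\<in>UNIV. s *\<^sub>R conv s (pot1 i) (u2 k k) x)"
    by (subst conv_sum[OF finite cu(3) D[OF s] pot1_cont]) (auto simp: scaleR_sum_right)
  also have "\<dots> = \<Psi>' - conv s kern (u1 i) x"
    unfolding a2 a3 \<Psi>'_def by (simp add: sum_subtractf sum_negf)
  finally have e0: "s *\<^sub>R conv s (pot1 i) Lap x = \<Psi>' - conv s kern (u1 i) x" .
  have e: "conv s (pot1 i) Lap x = (1 / s) *\<^sub>R \<Psi>' - (1 / s) *\<^sub>R conv s kern (u1 i) x"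
    using scaleR_solve[OF _ e0] s by (simp add: scaleR_diff_right)
  have "((\<lambda>s. (1 / s) *\<^sub>R conv s (kern1 i) u x) has_vector_derivative
      ((1 / s) *\<^sub>R \<Psi>' + (- 1 / s^2) *\<^sub>R conv s (kern1 i) u x)) (at s)"
    by (rule has_vector_derivative_scaleR[OF _ dP]) (use s in \<open>auto intro!: derivative_eq_intros simp: power2_eq_square\<close>)
  moreover have "(1 / s) *\<^sub>R \<Psi>' + (- 1 / s^2) *\<^sub>R conv s (kern1 i) u x = conv s (pot1 i) Lap x"
    unfolding e a1[OF s, symmetric] using s by (simp add: power2_eq_square)
  ultimately have "((\<lambda>s. (1 / s) *\<^sub>R conv s (kern1 i) u x) has_vector_derivative conv s (pot1 i) Lap x) (at s)" by simp
  then show ?thesis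
    by (rule has_vector_derivative_transform_within_open[of _ _ _ "{0<..<d/2}"])
      (use s in \<open>auto simp flip: a1\<close>)
qed

text \<open>
  Differentiated twice in space, the identity loses one more power of \<open>s\<close>. The resulting factor \<open>1 / s\<close> is the
  origin of the logarithm in \<open>hessian_bound\<close>.
\<close>
lemma hessian_scale_deriv:
  assumes x: "\<And>i. \<bar>x $ i\<bar> \<le> l - d" and s: "s \<in> {0<..<d/2}"
  shows "((\<lambda>s. conv s kern (u2 i j) x) has_vector_derivative (1 / s) *\<^sub>R conv s (pot2 i j) Lap x) (at s)"
proof -
  have D: "x - r *\<^sub>R y \<in> cube l" if "r \<in> {0<..<d/2}" "y \<in> box2" for r y
    using cube_shift[OF x] that by auto
  have a0: "r *\<^sub>R conv r (kern1 i) (u1 j) x = conv r (kern2 j i) u x" if "r \<in> {0<..<d/2}" for r i j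
    by (rule conv_by_parts[OF ju D[OF that] kern1_jet1]) (auto simp: kernel_zero)
  have K2s: "kern2 j i = (kern2 i j :: real^'n \<Rightarrow> real)" by (rule ext) (rule kern2_sym)
  have b0: "r *\<^sub>R conv r kern (u2 i j) x = conv r (kern1 i) (u1 j) x" if "r \<in> {0<..<d/2}" for r
    by (rule conv_by_parts[OF ju1 D[OF that] kern_jet1]) (auto simp: kernel_zero)
  have a1: "conv r kern (u2 i j) x = (1 / r^2) *\<^sub>R conv r (kern2 i j) u x" if "r \<in> {0<..<d/2}" for r
  proof -
    have r: "r \<noteq> 0" using that by auto
    show ?thesis
      using scaleR_solve[OF r b0[OF that]] scaleR_solve[OF r a0[OF that, of i j]]
      by (simp add: K2s power2_eq_square)
  qed
  define \<Psi>' where "\<Psi>' = - (\<Sum>k\<in>UNIV. conv s (\<lambda>y. y $ k * kern2 i j y) (u1 k) x)"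
  have dP: "((\<lambda>s. conv s (kern2 i j) u x) has_vector_derivative \<Psi>') (at s)"
    unfolding \<Psi>'_def by (rule conv_deriv_scale[OF ju s D kern2_cont])
  have a2: "s *\<^sub>R conv s (pot2 i j) (u2 k k) x = conv s (pot3 k i j) (u1 k) x" for k
    by (rule conv_by_parts[OF ju1 D[OF s] pot2_jet1]) (auto simp: kernel_zero)
  have yk: "continuous_on UNIV (\<lambda>y. y $ k * kern2 i j y)" for k by (intro continuous_intros kern2_cont)
  \<comment> \<open>By the symmetry of \<open>pot3\<close> the term with \<open>kern2\<close> takes the form that occurs in the derivative \<open>\<Psi>'\<close>.\<close>
  have a3: "conv s (pot3 k i j) (u1 k) x = - (if k = j then conv s (kern1 i) (u1 k) x else 0)
      - (if k = i then conv s (kern1 j) (u1 k) x else 0) - conv s (\<lambda>y. y $ k * kern2 i j y) (u1 k) x" for k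
  proof -
    let ?a = "- (if k = j then 1 else 0) :: real" and ?b = "- (if k = i then 1 else 0) :: real"
    have "pot3 k i j = (\<lambda>y. ?a * kern1 i y + (?b * kern1 j y + (-1) * (y $ k * kern2 i j y)))"
    proof (rule ext)
      fix y :: "real^'n"
      show "pot3 k i j y = ?a * kern1 i y + (?b * kern1 j y + (-1) * (y $ k * kern2 i j y))"
        using kern2_swap[of y j k i] by (auto simp: pot3_def split: if_splits)
    qed
    moreover have "conv s (\<lambda>y. ?a * kern1 i y + (?b * kern1 j y + (-1) * (y $ k * kern2 i j y))) (u1 k) x
        = ?a *\<^sub>R conv s (kern1 i) (u1 k) x + (?b *\<^sub>R conv s (kern1 j) (u1 k) x + (-1) *\<^sub>R conv s (\<lambda>y. y $ k * kern2 i j y) (u1 k) x)"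
    proof -
      have c: "continuous_on UNIV (\<lambda>y. ?a * kern1 i y)" "continuous_on UNIV (\<lambda>y. ?b * kern1 j y)"
        "continuous_on UNIV (\<lambda>y. (-1) * (y $ k * kern2 i j y))"
        "continuous_on UNIV (\<lambda>y. ?b * kern1 j y + (-1) * (y $ k * kern2 i j y))"
        by (intro continuous_intros kern1_cont kern2_cont)+
      show ?thesis
        by (simp only: conv_kernel_add[OF cu(2) D[OF s] c(1) c(4)] conv_kernel_add[OF cu(2) D[OF s] c(2) c(3)]
           conv_kernel_mult[OF cu(2) D[OF s] kern1_cont] conv_kernel_mult[OF cu(2) D[OF s] yk])
    qed
    ultimately show ?thesis by simp
  qed
  have "s *\<^sub>R conv s (pot2 i j) Lap x = (\<Sum>k\<in>UNIV. s *\<^sub>R conv s (pot2 i j) (u2 k k) x)"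
    by (subst conv_sum[OF finite cu(3) D[OF s] pot2_cont]) (auto simp: scaleR_sum_right)
  also have "\<dots> = \<Psi>' - conv s (kern1 i) (u1 j) x - conv s (kern1 j) (u1 i) x"
    unfolding a2 a3 \<Psi>'_def by (simp add: sum_subtractf sum_negf)
  finally have e: "s *\<^sub>R conv s (pot2 i j) Lap x = \<Psi>' - conv s (kern1 i) (u1 j) x - conv s (kern1 j) (u1 i) x" .
  have "conv s (kern1 i) (u1 j) x = (1 / s) *\<^sub>R conv s (kern2 i j) u x" "conv s (kern1 j) (u1 i) x = (1 / s) *\<^sub>R conv s (kern2 i j) u x"
    using a0[OF s, of i j, symmetric] a0[OF s, of j i, symmetric] s by (simp_all add: K2s)
  then have e': "conv s (pot2 i j) Lap x = (1 / s) *\<^sub>R (\<Psi>' - (2 / s) *\<^sub>R conv s (kern2 i j) u x)"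
    using scaleR_solve[OF _ e] s by (simp flip: scaleR_left_distrib add: diff_diff_eq)
  have "((\<lambda>s. (1 / s^2) *\<^sub>R conv s (kern2 i j) u x) has_vector_derivative
      ((1 / s^2) *\<^sub>R \<Psi>' + (- 2 / s^3) *\<^sub>R conv s (kern2 i j) u x)) (at s)"
    by (rule has_vector_derivative_scaleR[OF _ dP])
      (use s in \<open>auto intro!: derivative_eq_intros simp: power2_eq_square power3_eq_cube field_simps\<close>)
  moreover have "(1 / s^2) *\<^sub>R \<Psi>' + (- 2 / s^3) *\<^sub>R conv s (kern2 i j) u x = (1 / s) *\<^sub>R conv s (pot2 i j) Lap x"
    unfolding e' using s by (simp add: power2_eq_square power3_eq_cube scaleR_diff_right)
  ultimately have "((\<lambda>s. (1 / s^2) *\<^sub>R conv s (kern2 i j) u x) has_vector_derivative (1 / s) *\<^sub>R conv s (pot2 i j) Lap x) (at s)" by simp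
  then show ?thesis
    by (rule has_vector_derivative_transform_within_open[of _ _ _ "{0<..<d/2}"])
      (use s in \<open>auto simp: a1\<close>)
qed

lemma GLp: "0 \<le> G" "0 \<le> Lp"
proof -
  have "0 \<in> cube l" using l by (simp add: cube_def)
  from order_trans[OF norm_ge_zero grad[OF this]] order_trans[OF norm_ge_zero lap[OF this]]
  show "0 \<le> G" "0 \<le> Lp" .
qed

lemma kernel_bound_nonneg: "0 \<le> kernel_bound TYPE('n)" by (rule kernel_bound)

lemma hess_const_nonneg: "0 \<le> hess_const TYPE('n) G Lp" unfolding hess_const_def using kernel_bound_nonneg GLp by simp

lemma inner_le: "(\<And>i. \<bar>x $ i\<bar> \<le> l - d) \<Longrightarrow> d \<le> l" for x :: "real^'n"
  using abs_ge_zero[of "x $ undefined"] by (metis diff_ge_0_iff_ge order_trans)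

lemma log_weight_nonneg: "0 < s \<Longrightarrow> 0 < d \<Longrightarrow> s \<le> l \<Longrightarrow> 0 \<le> log_weight l d s \<and> 0 \<le> ln (l / s)"
  using l by (simp add: log_weight_def)

text \<open>
  At scale \<open>d / 4\<close> one derivative is moved onto the kernel, which costs \<open>G / d\<close> up to a constant. Between this scale and \<open>s\<close>
  the mollified Hessian varies by at most a multiple of \<open>\<integral> Lp / r dr\<close>.
\<close>
lemma hessian_bound:
  assumes x: "\<And>i. \<bar>x $ i\<bar> \<le> l - d" and s: "0 < s" "4 * s \<le> d"
  shows "norm (conv s kern (u2 i j) x) \<le> hess_const TYPE('n) G Lp * log_weight l d s"
proof -
  have d: "0 < d" "d \<le> l" using s inner_le[OF x] by auto
  define s0 where "s0 = d / 4"
  have s0: "0 < s0" "s \<le> s0" "s0 < d / 2" "2 * s0 < d" using d s by (auto simp: s0_def)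
  have D: "x - r *\<^sub>R y \<in> cube l" if "0 < r" "r < d/2" "y \<in> box2" for r y
    using cube_shift[OF x] that by auto
  have A: "norm (conv s0 kern (u2 i j) x) \<le> 4 * kernel_bound TYPE('n) * G / d"
  proof -
    have e: "s0 *\<^sub>R conv s0 kern (u2 i j) x = conv s0 (kern1 i) (u1 j) x"
      by (rule conv_by_parts[OF ju1 D[OF s0(1) s0(3)] kern_jet1]) (auto simp: kernel_zero)
    have "norm (conv s0 (kern1 i) (u1 j) x) \<le> mass (kern1 i :: real^'n \<Rightarrow> real) * G"
      by (rule norm_conv_le[OF cu(2) D[OF s0(1) s0(3)] kern1_cont]) (auto intro!: grad D[OF s0(1) s0(3)])
    also have "\<dots> \<le> kernel_bound TYPE('n) * G" by (intro mult_right_mono kernel_bound GLp)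
    finally have "s0 * norm (conv s0 kern (u2 i j) x) \<le> kernel_bound TYPE('n) * G" using e s0 by (metis abs_of_pos norm_scaleR)
    then show ?thesis using d by (simp add: s0_def field_simps)
  qed
  have B: "norm (conv s0 kern (u2 i j) x - conv s kern (u2 i j) x) \<le> kernel_bound TYPE('n) * Lp * ln s0 - kernel_bound TYPE('n) * Lp * ln s"
  proof (cases "s = s0")
    case False
    then have lt: "s < s0" using s0 by simp
    show ?thesis
    proof (rule differentiable_bound_general[OF lt])
      have dv: "((\<lambda>s. conv s kern (u2 i j) x) has_vector_derivative (1 / r) *\<^sub>R conv r (pot2 i j) Lap x) (at r)" if "s \<le> r" "r \<le> s0" for r
        by (rule hessian_scale_deriv[OF x]) (use that s s0 in auto)
      show "continuous_on {s..s0} (\<lambda>s. conv s kern (u2 i j) x)"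
        by (intro continuous_at_imp_continuous_on ballI has_vector_derivative_continuous[OF dv]) auto
      show "continuous_on {s..s0} (\<lambda>s. kernel_bound TYPE('n) * Lp * ln s)"
        using s by (intro continuous_intros) auto
      fix r assume r: "s < r" "r < s0"
      show "((\<lambda>s. conv s kern (u2 i j) x) has_vector_derivative (1 / r) *\<^sub>R conv r (pot2 i j) Lap x) (at r)"
        by (rule dv) (use r in auto)
      show "((\<lambda>s. kernel_bound TYPE('n) * Lp * ln s) has_vector_derivative kernel_bound TYPE('n) * Lp * (1 / r)) (at r)"
        using r s by (auto simp: has_real_derivative_iff_has_vector_derivative[symmetric] intro!: derivative_eq_intros)
      have rr: "0 < r" "r < d/2" using r s s0 by auto
      have "norm (conv r (pot2 i j) Lap x) \<le> mass (pot2 i j :: real^'n \<Rightarrow> real) * Lp"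
        by (rule norm_conv_le[OF cu(4) D[OF rr] pot2_cont]) (auto intro!: lap D[OF rr])
      also have "\<dots> \<le> kernel_bound TYPE('n) * Lp" by (intro mult_right_mono kernel_bound GLp)
      finally show "norm ((1 / r) *\<^sub>R conv r (pot2 i j) Lap x) \<le> kernel_bound TYPE('n) * Lp * (1 / r)"
        using rr by (simp add: field_simps)
    qed
  qed simp
  have "ln s0 - ln s \<le> ln (l / s)"
  proof -
    have "ln s0 \<le> ln l" using d l by (simp add: s0_def)
    then show ?thesis using s l by (simp add: ln_div)
  qed
  then have "kernel_bound TYPE('n) * Lp * (ln s0 - ln s) \<le> kernel_bound TYPE('n) * Lp * ln (l / s)" using kernel_bound_nonneg GLp by (intro mult_left_mono) auto
  then have "norm (conv s kern (u2 i j) x) \<le> 4 * kernel_bound TYPE('n) * G / d + kernel_bound TYPE('n) * Lp * ln (l / s)"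
    using A B norm_triangle_ineq2[of "conv s kern (u2 i j) x" "conv s0 kern (u2 i j) x"] norm_minus_commute
    by (smt (verit, best) right_diff_distrib)
  also have "\<dots> \<le> 4 * kernel_bound TYPE('n) * (G + Lp) * (1 / d) + 4 * kernel_bound TYPE('n) * (G + Lp) * ln (l / s)"
  proof (rule add_mono)
    show "4 * kernel_bound TYPE('n) * G / d \<le> 4 * kernel_bound TYPE('n) * (G + Lp) * (1 / d)"
      using kernel_bound_nonneg GLp d by (simp add: divide_right_mono mult_left_mono)
    have "kernel_bound TYPE('n) * Lp \<le> 4 * kernel_bound TYPE('n) * (G + Lp)" using kernel_bound_nonneg GLp by (simp add: algebra_simps add_increasing2 add_increasing)
    then show "kernel_bound TYPE('n) * Lp * ln (l / s) \<le> 4 * kernel_bound TYPE('n) * (G + Lp) * ln (l / s)"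
      using log_weight_nonneg[of s d] s d by (intro mult_right_mono) auto
  qed
  finally show ?thesis by (simp add: hess_const_def log_weight_def algebra_simps)
qed

text \<open>
  The scale derivative of the mollified gradient is bounded, so it can be integrated down to scale zero.
\<close>
lemma gradient_bound:
  assumes x: "\<And>i. \<bar>x $ i\<bar> \<le> l - d" and s: "0 < s" "4 * s \<le> d"
  shows "norm (u1 i x - conv s kern (u1 i) x) \<le> kernel_bound TYPE('n) * Lp * s"
proof -
  have D: "x - r *\<^sub>R y \<in> cube l" if "0 \<le> r" "r \<le> s" "y \<in> box2" for r y
    using cube_shift[OF x] that s by auto
  have "norm (conv s kern (u1 i) x - conv 0 kern (u1 i) x) \<le> kernel_bound TYPE('n) * Lp * s - kernel_bound TYPE('n) * Lp * 0"
  proof (rule differentiable_bound_general[OF s(1)])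
    have "continuous_on ({0..s} \<times> box2) (\<lambda>p. u1 i (x - fst p *\<^sub>R snd p))"
      by (rule continuous_on_compose2[OF cu(2)]) (use D in \<open>auto intro!: continuous_intros\<close>)
    moreover have "continuous_on ({0..s} \<times> box2) (\<lambda>p. kern (snd p :: real^'n))"
      by (rule continuous_on_compose2[OF kern_cont]) (auto intro!: continuous_intros)
    ultimately have "continuous_on ({0..s} \<times> box2) (\<lambda>(r, y). kern y *\<^sub>R u1 i (x - r *\<^sub>R y))"
      by (auto simp: case_prod_unfold intro!: continuous_intros)
    then show "continuous_on {0..s} (\<lambda>s. conv s kern (u1 i) x)"
      unfolding conv_def box2_def by (rule integral_continuous_on_param)
    show "continuous_on {0..s} (\<lambda>s. kernel_bound TYPE('n) * Lp * s)" by (intro continuous_intros)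
    fix r assume r: "0 < r" "r < s"
    show "((\<lambda>s. conv s kern (u1 i) x) has_vector_derivative conv r (pot1 i) Lap x) (at r)"
      by (rule gradient_scale_deriv[OF x]) (use r s in auto)
    show "((\<lambda>s. kernel_bound TYPE('n) * Lp * s) has_vector_derivative kernel_bound TYPE('n) * Lp) (at r)"
      by (auto simp: has_real_derivative_iff_has_vector_derivative[symmetric] intro!: derivative_eq_intros)
    have rr: "0 \<le> r" "r \<le> s" using r by auto
    have "norm (conv r (pot1 i) Lap x) \<le> mass (pot1 i :: real^'n \<Rightarrow> real) * Lp"
      by (rule norm_conv_le[OF cu(4) D[OF rr] pot1_cont]) (auto intro!: lap D[OF rr])
    also have "\<dots> \<le> kernel_bound TYPE('n) * Lp" by (intro mult_right_mono kernel_bound GLp)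
    finally show "norm (conv r (pot1 i) Lap x) \<le> kernel_bound TYPE('n) * Lp" .
  qed
  moreover have "conv 0 kern (u1 i) x = u1 i x"
    using conv_const_kern[of 0 "u1 i x" x] by (simp add: conv_def)
  ultimately show ?thesis by (simp add: norm_minus_commute)
qed

lemma log_weight_ge: "0 < s \<Longrightarrow> 0 < d \<Longrightarrow> s \<le> l \<Longrightarrow> d \<le> l \<Longrightarrow> 1 \<le> l * log_weight l d s"
proof -
  assume a: "0 < s" "0 < d" "s \<le> l" "d \<le> l"
  have "1 \<le> l * (1 / d)" using a by simp
  also have "\<dots> \<le> l * log_weight l d s"
    using log_weight_nonneg[of s d] a l by (intro mult_left_mono) (auto simp: log_weight_def)
  finally show ?thesis .
qed

text \<open>
  Up to an error \<open>O(s)\<close> the gradient may be mollified at scale \<open>s\<close>, and the mollified gradient is Lipschitz with the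
  constant of \<open>hessian_bound\<close>: the gradient is log-Lipschitz.
\<close>
lemma gradient_osc:
  assumes x: "\<And>i. \<bar>x $ i\<bar> \<le> l - d" and s: "0 < s" "8 * s \<le> d" and z: "\<And>i. \<bar>z $ i - x $ i\<bar> \<le> 2 * s"
  shows "norm (u1 i z - u1 i x) \<le> osc_const TYPE('n) l G Lp * s * log_weight l d s"
proof -
  have d: "0 < d" "d \<le> l" using s inner_le[OF x] by auto
  define S where "S = {z :: real^'n. \<forall>i. \<bar>z $ i - x $ i\<bar> \<le> 2 * s}"
  have cS: "convex S"
  proof -
    have "S = cbox (x - (\<chi> i. 2 * s)) (x + (\<chi> i. 2 * s))"
      by (auto simp: S_def mem_box_cart abs_le_iff algebra_simps)
    then show ?thesis by simp
  qed
  have inS: "\<bar>w $ i\<bar> \<le> l - d / 2" if "w \<in> S" for w i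
  proof -
    have "\<bar>w $ i - x $ i\<bar> \<le> 2 * s" using that by (auto simp: S_def)
    then show ?thesis using x[of i] s by (auto simp: abs_le_iff)
  qed
  let ?B = "hess_const TYPE('n) G Lp * log_weight l (d / 2) s"
  define E where "E = cube (l - 2 * s) \<inter> (UNIV :: (real^'n) set)"
  have jE: "jet1 E (conv s kern (u1 i)) (\<lambda>k. conv s kern (u2 k i))"
  proof (rule conv_jet1[OF ju1 _ _ kern_cont])
    show "open E" by (simp add: E_def open_cube)
    fix w y :: "real^'n" assume "w \<in> E" "y \<in> box2"
    then have "- (l - 2 * s) < w $ k" "w $ k < l - 2 * s" "\<bar>s * y $ k\<bar> \<le> s * 2" for k
      using s by (auto simp: E_def cube_def abs_mult mem_box2)
    then show "w - s *\<^sub>R y \<in> cube l" unfolding cube_def by (auto simp: abs_le_iff) (smt (verit))+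
  qed
  have SE: "S \<subseteq> E"
  proof
    fix w assume "w \<in> S"
    then have "\<bar>w $ i\<bar> \<le> l - d / 2" for i by (rule inS)
    then have "- (l - 2 * s) < w $ k" "w $ k < l - 2 * s" for k using s by (smt (verit, best) field_sum_of_halves)+
    then show "w \<in> E" by (simp add: E_def cube_def)
  qed
  have zS: "z \<in> S" "x \<in> S" using z s by (auto simp: S_def)
  have "norm (conv s kern (u1 i) z - conv s kern (u1 i) x) \<le> CARD('n) * ?B * norm (z - x)"
    by (rule jet1_Lipschitz[OF jE cS SE _ zS]) (use hessian_bound[OF inS] s in auto)
  also have "\<dots> \<le> CARD('n) * ?B * (CARD('n) * (2 * s))"
    using hess_const_nonneg log_weight_nonneg[of s "d/2"] s d z by (intro mult_left_mono norm_le_CARD) auto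
  also have "\<dots> \<le> CARD('n) * (hess_const TYPE('n) G Lp * (2 * log_weight l d s)) * (CARD('n) * (2 * s))"
    using hess_const_nonneg log_weight_nonneg[of s d] s d by (intro mult_right_mono mult_left_mono) (auto simp: log_weight_def)
  also have "\<dots> = 4 * real (CARD('n))^2 * hess_const TYPE('n) G Lp * s * log_weight l d s" by (simp add: power2_eq_square)
  finally have 1: "norm (conv s kern (u1 i) z - conv s kern (u1 i) x) \<le> 4 * real (CARD('n))^2 * hess_const TYPE('n) G Lp * s * log_weight l d s" .
  have 2: "norm (u1 i w - conv s kern (u1 i) w) \<le> kernel_bound TYPE('n) * Lp * s" if "w \<in> S" for w
    by (rule gradient_bound[OF inS[OF that]]) (use s in auto)
  have "norm (u1 i z - u1 i x) \<le> norm (u1 i z - conv s kern (u1 i) z) + norm (conv s kern (u1 i) z - conv s kern (u1 i) x)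
     + norm (u1 i x - conv s kern (u1 i) x)"
    using norm_triangle_ineq4[of "(u1 i z - conv s kern (u1 i) z) + (conv s kern (u1 i) z - conv s kern (u1 i) x)" "u1 i x - conv s kern (u1 i) x"]
      norm_triangle_ineq[of "u1 i z - conv s kern (u1 i) z" "conv s kern (u1 i) z - conv s kern (u1 i) x"] by simp
  also have "\<dots> \<le> 2 * (kernel_bound TYPE('n) * Lp * s) * (l * log_weight l d s) + 4 * real (CARD('n))^2 * hess_const TYPE('n) G Lp * s * log_weight l d s"
  proof -
    have "2 * (kernel_bound TYPE('n) * Lp * s) * 1 \<le> 2 * (kernel_bound TYPE('n) * Lp * s) * (l * log_weight l d s)"
      using log_weight_ge[of s d] s d kernel_bound_nonneg GLp by (intro mult_left_mono) auto
    then show ?thesis using 1 2[OF zS(1)] 2[OF zS(2)] by simp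
  qed
  also have "\<dots> = osc_const TYPE('n) l G Lp * s * log_weight l d s" by (simp add: osc_const_def algebra_simps)
  finally show ?thesis .
qed

lemma osc_const_nonneg: "0 \<le> osc_const TYPE('n) l G Lp" unfolding osc_const_def using kernel_bound_nonneg GLp hess_const_nonneg l by simp

lemma box2_coord: "y \<in> box2 \<Longrightarrow> 0 \<le> s \<Longrightarrow> \<bar>(x - s *\<^sub>R y) $ i - x $ i\<bar> \<le> 2 * s" for x :: "real^'n" and s :: real
proof -
  assume "y \<in> box2" "0 \<le> s"
  then have "s * \<bar>y $ i\<bar> \<le> s * 2" by (intro mult_left_mono) (auto simp: mem_box2)
  then show ?thesis using \<open>0 \<le> s\<close> by (simp add: abs_mult)
qed

lemma box2_norm: "y \<in> box2 \<Longrightarrow> 0 \<le> s \<Longrightarrow> norm (x - (x - s *\<^sub>R y)) \<le> CARD('n) * (2 * s)" for x :: "real^'n" and s :: real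
  by (rule norm_le_CARD) (use box2_coord[of y s x] in \<open>simp add: abs_minus_commute\<close>)

text \<open>
  The factor \<open>A - A x\<close> is \<open>O(s)\<close>, but it multiplies second derivatives that are not bounded. Integration by parts
  replaces them by differences of the gradient, to which \<open>gradient_osc\<close> applies. The factor \<open>1 / s\<close> from the
  derivative of the kernel is compensated by \<open>A - A x\<close>; the derivative that falls on \<open>A\<close> is bounded by \<open>CA\<close>.
\<close>
lemma commutator_bound:
  assumes x: "\<And>i. \<bar>x $ i\<bar> \<le> l - d" and s: "0 < s" "8 * s \<le> d"
    and A: "jet1 (cube l) A A1" and A1: "\<And>z i. z \<in> cube l \<Longrightarrow> \<bar>A1 i z\<bar> \<le> CA"
  shows "norm (conv s kern (\<lambda>z. (A z - A x) *\<^sub>R u2 i j z) x)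
     \<le> (2 * real (CARD('n))^2 * kernel_bound TYPE('n) + 1) * CA * osc_const TYPE('n) l G Lp * s * log_weight l d s"
proof -
  have d: "0 < d" "d \<le> l" using s inner_le[OF x] by auto
  have D: "x - s *\<^sub>R y \<in> cube l" if "y \<in> box2" for y
    using cube_shift[OF x] that s by auto
  have xc: "x \<in> cube l" using D[of 0] by (simp add: mem_box2)
  have CA: "0 \<le> CA" using A1[OF xc, of i] by linarith
  let ?W = "osc_const TYPE('n) l G Lp * s * log_weight l d s"
  have W: "0 \<le> ?W" using osc_const_nonneg s log_weight_nonneg[of s d] d by simp
  let ?a = "\<lambda>z. A z - A x" and ?v = "\<lambda>z. u1 j z - u1 j x"
  let ?F = "\<lambda>z. ?a z *\<^sub>R ?v z"
  have ja: "jet1 (cube l) ?a A1" using jet1_diff[OF A jet1_const[of _ "A x"]] by simp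
  have jv: "jet1 (cube l) ?v (\<lambda>i. u2 i j)" using jet1_diff[OF ju1 jet1_const[of _ "u1 j x"]] by simp
  note jF = jet1_scaleR[OF ja jv]
  have osc: "norm (?v (x - s *\<^sub>R y)) \<le> ?W" if "y \<in> box2" for y
    by (rule gradient_osc[OF x s]) (use box2_coord[OF that, of s x] s in auto)
  have alip: "\<bar>?a (x - s *\<^sub>R y)\<bar> \<le> CARD('n) * CA * (CARD('n) * (2 * s))" if "y \<in> box2" for y
  proof -
    have "norm (A (x - s *\<^sub>R y) - A x) \<le> CARD('n) * CA * norm (x - s *\<^sub>R y - x)"
      using jet1_Lipschitz[OF A convex_cube subset_refl, of CA "x - s *\<^sub>R y" x] A1 D[OF that] xc by auto
    also have "\<dots> \<le> CARD('n) * CA * (CARD('n) * (2 * s))"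
      using box2_norm[OF that, of s x] s CA by (intro mult_left_mono) auto
    finally show ?thesis by simp
  qed
  have e: "s *\<^sub>R conv s kern (\<lambda>z. ?a z *\<^sub>R u2 i j z + A1 i z *\<^sub>R ?v z) x = conv s (kern1 i) ?F x"
    by (rule conv_by_parts[OF jF D kern_jet1]) (auto simp: kernel_zero)
  have ca: "continuous_on (cube l) ?a" "continuous_on (cube l) (A1 i)" "continuous_on (cube l) ?v" "continuous_on (cube l) ?F"
    by (rule jet1_continuous[OF ja] jet1_continuous_partial[OF A] jet1_continuous[OF jv] jet1_continuous[OF jF])+
  have e2: "conv s kern (\<lambda>z. ?a z *\<^sub>R u2 i j z + A1 i z *\<^sub>R ?v z) x
     = conv s kern (\<lambda>z. ?a z *\<^sub>R u2 i j z) x + conv s kern (\<lambda>z. A1 i z *\<^sub>R ?v z) x"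
    by (rule conv_add[OF _ _ D kern_cont]) (intro continuous_intros ca cu)+
  have n1: "norm (conv s (kern1 i) ?F x) \<le> kernel_bound TYPE('n) * (CARD('n) * CA * (CARD('n) * (2 * s)) * ?W)"
  proof -
    have "norm (conv s (kern1 i) ?F x) \<le> mass (kern1 i :: real^'n \<Rightarrow> real) * (CARD('n) * CA * (CARD('n) * (2 * s)) * ?W)"
      by (rule norm_conv_le[OF ca(4) D kern1_cont]) (auto intro!: mult_mono osc alip mult_nonneg_nonneg CA less_imp_le[OF s(1)])
    also have "\<dots> \<le> kernel_bound TYPE('n) * (CARD('n) * CA * (CARD('n) * (2 * s)) * ?W)"
      using CA s W by (intro mult_right_mono kernel_bound) auto
    finally show ?thesis .
  qed
  have n2: "norm (conv s kern (\<lambda>z. A1 i z *\<^sub>R ?v z) x) \<le> mass (kern :: real^'n \<Rightarrow> real) * (CA * ?W)"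
    by (rule norm_conv_le[OF _ D kern_cont])
      (use CA in \<open>auto intro!: mult_mono osc A1 D continuous_intros ca\<close>)
  have "conv s kern (\<lambda>z. ?a z *\<^sub>R u2 i j z) x = (1 / s) *\<^sub>R conv s (kern1 i) ?F x - conv s kern (\<lambda>z. A1 i z *\<^sub>R ?v z) x"
    using scaleR_solve[OF _ e] s e2 by (simp add: algebra_simps)
  then have "norm (conv s kern (\<lambda>z. ?a z *\<^sub>R u2 i j z) x) \<le> (1 / s) * norm (conv s (kern1 i) ?F x) + norm (conv s kern (\<lambda>z. A1 i z *\<^sub>R ?v z) x)"
    using norm_triangle_ineq4[of "(1 / s) *\<^sub>R conv s (kern1 i) ?F x"] s by simp
  also have "\<dots> \<le> (1 / s) * (kernel_bound TYPE('n) * (CARD('n) * CA * (CARD('n) * (2 * s)) * ?W)) + CA * ?W"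
    using n1 n2 s by (intro add_mono mult_left_mono) (auto simp: mass_kern)
  also have "\<dots> = (2 * real (CARD('n))^2 * kernel_bound TYPE('n) + 1) * CA * osc_const TYPE('n) l G Lp * s * log_weight l d s"
    using s by (simp add: field_simps power2_eq_square)
  finally show ?thesis .
qed

lemma mollification_error:
  assumes x: "\<And>i. \<bar>x $ i\<bar> \<le> l - d" and s: "0 < s" "2 * s < d"
  shows "norm (u x - conv s kern u x) \<le> 2 * real (CARD('n))^2 * G * s"
proof -
  have D: "x - s *\<^sub>R y \<in> cube l" if "y \<in> box2" for y
    using cube_shift[OF x] that s by auto
  have xc: "x \<in> cube l" using D[of 0] by (simp add: mem_box2)
  have "norm (conv s kern (\<lambda>z. u z + - u x) x) \<le> mass (kern :: real^'n \<Rightarrow> real) * (CARD('n) * G * (CARD('n) * (2 * s)))"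
  proof (rule norm_conv_le[OF _ D kern_cont])
    show "continuous_on (cube l) (\<lambda>z. u z + - u x)" by (intro continuous_intros cu)
    fix y :: "real^'n" assume y: "y \<in> box2"
    have "norm (u (x - s *\<^sub>R y) - u x) \<le> CARD('n) * G * norm (x - s *\<^sub>R y - x)"
      using jet1_Lipschitz[OF ju convex_cube subset_refl, of G "x - s *\<^sub>R y" x] grad D[OF y] xc by auto
    also have "\<dots> \<le> CARD('n) * G * (CARD('n) * (2 * s))"
      using box2_norm[OF y, of s x] s GLp by (intro mult_left_mono) auto
    finally show "norm (u (x - s *\<^sub>R y) + - u x) \<le> CARD('n) * G * (CARD('n) * (2 * s))" by simp
  qed
  moreover have "conv s kern (\<lambda>z. u z + - u x) x = conv s kern u x - u x"
    using conv_add[OF cu(1) continuous_on_const D kern_cont, of "- u x"] by (simp add: conv_const_kern)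
  ultimately have "norm (conv s kern u x - u x) \<le> CARD('n) * G * (CARD('n) * (2 * s))" by (simp add: mass_kern)
  then show ?thesis by (simp add: norm_minus_commute power2_eq_square algebra_simps)
qed

text \<open>
  The mollified solution is inserted into the equation with coefficients \<open>A'\<close>, \<open>b'\<close>, \<open>h'\<close> that are frozen at \<open>x\<close>
  and differ from the true ones there by \<open>O(\<delta>)\<close>. This freedom is needed because a comparison with an iterate
  uses the coefficients of the iterate. Freezing \<open>A\<close> costs a commutator, and replacing \<open>A\<close> by \<open>A'\<close> costs
  \<open>\<delta>\<close> times the mollified Hessian; the terms of lower order are Lipschitz.
\<close>
lemma residual_bound:
  assumes x: "\<And>i. \<bar>x $ i\<bar> \<le> l - d" and s: "0 < s" "8 * s \<le> d"
    and A: "\<And>i j. jet1 (cube l) (A i j) (A1 i j)" and A1: "\<And>z i j k. z \<in> cube l \<Longrightarrow> \<bar>A1 i j k z\<bar> \<le> CA"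
    and cont: "continuous_on (cube l) bb" "continuous_on (cube l) h" "continuous_on (cube l) v"
    and eq: "\<And>z. z \<in> cube l \<Longrightarrow> v z + (\<Sum>i\<in>UNIV. \<Sum>j\<in>UNIV. A i j z *\<^sub>R u2 i j z)
        + (\<Sum>i\<in>UNIV. bb z $ i *\<^sub>R u1 i z) + h z = 0"
    and \<delta>: "0 \<le> \<delta>" and A': "\<And>i j. \<bar>A' i j - A i j x\<bar> \<le> CA * \<delta>"
    and b': "\<And>i z. z \<in> cube l \<Longrightarrow> \<bar>b' $ i - bb z $ i\<bar> \<le> CA * (\<delta> + norm (x - z))"
    and h': "\<And>z. z \<in> cube l \<Longrightarrow> norm (h' - h z) \<le> CA * (\<delta> + norm (x - z))"
  shows "norm (conv s kern v x + (\<Sum>i\<in>UNIV. \<Sum>j\<in>UNIV. A' i j *\<^sub>R conv s kern (u2 i j) x)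
      + (\<Sum>i\<in>UNIV. b' $ i *\<^sub>R conv s kern (u1 i) x) + h') \<le> residual_const TYPE('n) l G Lp CA * log_weight l d s * (\<delta> + s)"
proof -
  let ?N = "real (CARD('n))" and ?W = "log_weight l d s"
  let ?c = "\<lambda>F. conv s (kern :: real^'n \<Rightarrow> real) F x :: real^'m"
  have d: "0 < d" "d \<le> l" using s inner_le[OF x] by auto
  have D: "x - s *\<^sub>R y \<in> cube l" if "y \<in> box2" for y
    using cube_shift[OF x] that s by auto
  have xc: "x \<in> cube l" using D[of 0] by (simp add: mem_box2)
  have CA: "0 \<le> CA" using A1[OF xc] by (meson abs_ge_zero order_trans)
  have W: "0 \<le> ?W" "1 \<le> l * ?W" using log_weight_nonneg[of s d] log_weight_ge[of s d] s d by auto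
  have cA: "continuous_on (cube l) (A i j)" for i j by (rule jet1_continuous[OF A])
  have cbb: "continuous_on (cube l) (\<lambda>z. bb z $ i)" for i using cont(1) by (intro continuous_intros)
  define T1 where "T1 = (\<lambda>i j. A' i j *\<^sub>R ?c (u2 i j) - ?c (\<lambda>z. A i j z *\<^sub>R u2 i j z))"
  define T2 where "T2 = (\<lambda>i. b' $ i *\<^sub>R ?c (u1 i) - ?c (\<lambda>z. bb z $ i *\<^sub>R u1 i z))"
  define T3 where "T3 = h' - ?c h"
  \<comment> \<open>The equation, mollified term by term; \<open>T1\<close>, \<open>T2\<close>, \<open>T3\<close> are the errors of freezing in order two, one and zero.\<close>
  have cv: "?c v = - ((\<Sum>i\<in>UNIV. \<Sum>j\<in>UNIV. ?c (\<lambda>z. A i j z *\<^sub>R u2 i j z)) + (\<Sum>i\<in>UNIV. ?c (\<lambda>z. bb z $ i *\<^sub>R u1 i z)) + ?c h)"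
  proof -
    let ?S = "\<lambda>z. (\<Sum>i\<in>UNIV. \<Sum>j\<in>UNIV. A i j z *\<^sub>R u2 i j z) + (\<Sum>i\<in>UNIV. bb z $ i *\<^sub>R u1 i z)"
    have cc: "continuous_on (cube l) (\<lambda>z. A i j z *\<^sub>R u2 i j z)" "continuous_on (cube l) (\<lambda>z. bb z $ i *\<^sub>R u1 i z)"
      "continuous_on (cube l) (\<lambda>z. \<Sum>j\<in>UNIV. A i j z *\<^sub>R u2 i j z)" for i j
      by (intro continuous_intros cA cu cbb)+
    have cS1: "continuous_on (cube l) (\<lambda>z. \<Sum>i\<in>UNIV. \<Sum>j\<in>UNIV. A i j z *\<^sub>R u2 i j z)" by (intro continuous_intros cc)
    have cS2: "continuous_on (cube l) (\<lambda>z. \<Sum>i\<in>UNIV. bb z $ i *\<^sub>R u1 i z)" by (intro continuous_intros cc)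
    have "?c v = ?c (\<lambda>z. - (?S z + h z))"
      unfolding conv_def
    proof (rule integral_cong)
      fix y :: "real^'n" assume "y \<in> box2"
      have "v (x - s *\<^sub>R y) = - (?S (x - s *\<^sub>R y) + h (x - s *\<^sub>R y))"
        using eq[OF D[OF \<open>y \<in> box2\<close>]] by (simp only: eq_neg_iff_add_eq_0 add.assoc)
      then show "kern y *\<^sub>R v (x - s *\<^sub>R y) = kern y *\<^sub>R - (?S (x - s *\<^sub>R y) + h (x - s *\<^sub>R y))" by simp
    qed
    also have "\<dots> = - ?c (\<lambda>z. ?S z + h z)"
      by (rule conv_linear[OF bounded_linear_minus[OF bounded_linear_ident] _ D kern_cont]) (intro continuous_intros cS1 cS2 cont)
    also have "?c (\<lambda>z. ?S z + h z) = ?c ?S + ?c h"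
      by (rule conv_add[OF _ cont(2) D kern_cont]) (intro continuous_intros cS1 cS2)
    also have "?c ?S = ?c (\<lambda>z. \<Sum>i\<in>UNIV. \<Sum>j\<in>UNIV. A i j z *\<^sub>R u2 i j z) + ?c (\<lambda>z. \<Sum>i\<in>UNIV. bb z $ i *\<^sub>R u1 i z)"
      by (rule conv_add[OF cS1 cS2 D kern_cont])
    also have "?c (\<lambda>z. \<Sum>i\<in>UNIV. bb z $ i *\<^sub>R u1 i z) = (\<Sum>i\<in>UNIV. ?c (\<lambda>z. bb z $ i *\<^sub>R u1 i z))"
      by (rule conv_sum[OF finite cc(2) D kern_cont])
    also have "?c (\<lambda>z. \<Sum>i\<in>UNIV. \<Sum>j\<in>UNIV. A i j z *\<^sub>R u2 i j z) = (\<Sum>i\<in>UNIV. ?c (\<lambda>z. \<Sum>j\<in>UNIV. A i j z *\<^sub>R u2 i j z))"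
      by (rule conv_sum[OF finite cc(3) D kern_cont])
    also have "\<dots> = (\<Sum>i\<in>UNIV. \<Sum>j\<in>UNIV. ?c (\<lambda>z. A i j z *\<^sub>R u2 i j z))"
      by (intro sum.cong refl conv_sum[OF finite cc(1) D kern_cont])
    finally show ?thesis .
  qed
  have main: "?c v + (\<Sum>i\<in>UNIV. \<Sum>j\<in>UNIV. A' i j *\<^sub>R ?c (u2 i j)) + (\<Sum>i\<in>UNIV. b' $ i *\<^sub>R ?c (u1 i)) + h'
      = (\<Sum>i\<in>UNIV. \<Sum>j\<in>UNIV. T1 i j) + (\<Sum>i\<in>UNIV. T2 i) + T3"
    unfolding cv T1_def T2_def T3_def by (simp add: sum_subtractf)
  have B1: "norm (T1 i j) \<le> (CA * hess_const TYPE('n) G Lp + (2 * ?N^2 * kernel_bound TYPE('n) + 1) * CA * osc_const TYPE('n) l G Lp) * ?W * (\<delta> + s)" for i j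
  proof -
    have "?c (\<lambda>z. (A i j z - A i j x) *\<^sub>R u2 i j z) = ?c (\<lambda>z. A i j z *\<^sub>R u2 i j z + (- A i j x) *\<^sub>R u2 i j z)"
      by (simp add: scaleR_diff_left)
    also have "\<dots> = ?c (\<lambda>z. A i j z *\<^sub>R u2 i j z) + ?c (\<lambda>z. (- A i j x) *\<^sub>R u2 i j z)"
      by (rule conv_add[OF _ _ D kern_cont]) (intro continuous_intros cA cu)+
    also have "?c (\<lambda>z. (- A i j x) *\<^sub>R u2 i j z) = (- A i j x) *\<^sub>R ?c (u2 i j)"
      by (rule conv_linear[OF bounded_linear_scaleR_right cu(3) D kern_cont])
    finally have "T1 i j = (A' i j - A i j x) *\<^sub>R ?c (u2 i j) - ?c (\<lambda>z. (A i j z - A i j x) *\<^sub>R u2 i j z)"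
      by (simp add: T1_def algebra_simps)
    then have "norm (T1 i j) \<le> \<bar>A' i j - A i j x\<bar> * norm (?c (u2 i j)) + norm (?c (\<lambda>z. (A i j z - A i j x) *\<^sub>R u2 i j z))"
      using norm_triangle_ineq4[of "(A' i j - A i j x) *\<^sub>R ?c (u2 i j)"] by simp
    also have "\<dots> \<le> (CA * \<delta>) * (hess_const TYPE('n) G Lp * ?W) + (2 * ?N^2 * kernel_bound TYPE('n) + 1) * CA * osc_const TYPE('n) l G Lp * s * ?W"
      using CA \<delta> s by (intro add_mono mult_mono A' hessian_bound[OF x] commutator_bound[OF x s A A1]) auto
    also have "\<dots> \<le> (CA * hess_const TYPE('n) G Lp) * ?W * (\<delta> + s) + ((2 * ?N^2 * kernel_bound TYPE('n) + 1) * CA * osc_const TYPE('n) l G Lp) * ?W * (\<delta> + s)"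
    proof (rule add_mono)
      have "(CA * hess_const TYPE('n) G Lp * ?W) * \<delta> \<le> (CA * hess_const TYPE('n) G Lp * ?W) * (\<delta> + s)"
        using CA hess_const_nonneg W s by (intro mult_left_mono) auto
      then show "(CA * \<delta>) * (hess_const TYPE('n) G Lp * ?W) \<le> (CA * hess_const TYPE('n) G Lp) * ?W * (\<delta> + s)" by (simp add: algebra_simps)
      have "((2 * ?N^2 * kernel_bound TYPE('n) + 1) * CA * osc_const TYPE('n) l G Lp * ?W) * s \<le> ((2 * ?N^2 * kernel_bound TYPE('n) + 1) * CA * osc_const TYPE('n) l G Lp * ?W) * (\<delta> + s)"
        using CA kernel_bound_nonneg osc_const_nonneg W \<delta> by (intro mult_left_mono) auto
      then show "(2 * ?N^2 * kernel_bound TYPE('n) + 1) * CA * osc_const TYPE('n) l G Lp * s * ?W \<le> ((2 * ?N^2 * kernel_bound TYPE('n) + 1) * CA * osc_const TYPE('n) l G Lp) * ?W * (\<delta> + s)"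
        by (simp add: algebra_simps)
    qed
    finally show ?thesis by (simp add: algebra_simps)
  qed
  have near: "CA * (\<delta> + norm (x - z)) \<le> CA * ((1 + 2 * ?N) * (\<delta> + s))" if "z = x - s *\<^sub>R y" "y \<in> box2" for z y
  proof -
    have "norm (x - z) \<le> ?N * (2 * s)" using box2_norm[OF that(2), of s x] s that by simp
    moreover have "0 \<le> ?N * \<delta>" using \<delta> by simp
    ultimately have "\<delta> + norm (x - z) \<le> (1 + 2 * ?N) * (\<delta> + s)" using s by (simp add: algebra_simps)
    then show ?thesis using CA by (intro mult_left_mono)
  qed
  have B2: "norm (T2 i) \<le> CA * ((1 + 2 * ?N) * (\<delta> + s)) * G" for i
  proof -
    have "?c (\<lambda>z. (b' $ i - bb z $ i) *\<^sub>R u1 i z) = ?c (\<lambda>z. b' $ i *\<^sub>R u1 i z + - (bb z $ i *\<^sub>R u1 i z))"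
      by (simp add: scaleR_diff_left)
    also have "\<dots> = ?c (\<lambda>z. b' $ i *\<^sub>R u1 i z) + ?c (\<lambda>z. - (bb z $ i *\<^sub>R u1 i z))"
      by (rule conv_add[OF _ _ D kern_cont]) (intro continuous_intros cbb cu)+
    also have "?c (\<lambda>z. - (bb z $ i *\<^sub>R u1 i z)) = - ?c (\<lambda>z. bb z $ i *\<^sub>R u1 i z)"
      by (rule conv_linear[OF bounded_linear_minus[OF bounded_linear_ident] _ D kern_cont]) (intro continuous_intros cbb cu)
    also have "?c (\<lambda>z. b' $ i *\<^sub>R u1 i z) = b' $ i *\<^sub>R ?c (u1 i)"
      by (rule conv_linear[OF bounded_linear_scaleR_right cu(2) D kern_cont])
    finally have "T2 i = ?c (\<lambda>z. (b' $ i - bb z $ i) *\<^sub>R u1 i z)" by (simp add: T2_def)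
    moreover have "norm (?c (\<lambda>z. (b' $ i - bb z $ i) *\<^sub>R u1 i z)) \<le> mass (kern :: real^'n \<Rightarrow> real) * (CA * ((1 + 2 * ?N) * (\<delta> + s)) * G)"
    proof (rule norm_conv_le[OF _ D kern_cont])
      show "continuous_on (cube l) (\<lambda>z. (b' $ i - bb z $ i) *\<^sub>R u1 i z)" by (intro continuous_intros cbb cu)
      fix y :: "real^'n" assume y: "y \<in> box2"
      let ?z = "x - s *\<^sub>R y"
      have "\<bar>b' $ i - bb ?z $ i\<bar> \<le> CA * ((1 + 2 * ?N) * (\<delta> + s))"
        using b'[OF D[OF y], of i] near[OF refl y] by linarith
      then show "norm ((b' $ i - bb ?z $ i) *\<^sub>R u1 i ?z) \<le> CA * ((1 + 2 * ?N) * (\<delta> + s)) * G"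
        using grad[OF D[OF y], of i] CA \<delta> s by (auto intro!: mult_mono)
    qed
    ultimately show ?thesis by (simp add: mass_kern)
  qed
  have B3: "norm T3 \<le> CA * ((1 + 2 * ?N) * (\<delta> + s))"
  proof -
    have "?c (\<lambda>z. h' + - h z) = ?c (\<lambda>z. h') + ?c (\<lambda>z. - h z)"
      by (rule conv_add[OF _ _ D kern_cont]) (intro continuous_intros cont)+
    also have "?c (\<lambda>z. - h z) = - ?c h"
      by (rule conv_linear[OF bounded_linear_minus[OF bounded_linear_ident] cont(2) D kern_cont])
    finally have "T3 = ?c (\<lambda>z. h' - h z)" by (simp add: T3_def conv_const_kern)
    moreover have "norm (?c (\<lambda>z. h' - h z)) \<le> mass (kern :: real^'n \<Rightarrow> real) * (CA * ((1 + 2 * ?N) * (\<delta> + s)))"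
    proof (rule norm_conv_le[OF _ D kern_cont])
      show "continuous_on (cube l) (\<lambda>z. h' - h z)" by (intro continuous_intros cont)
      fix y :: "real^'n" assume y: "y \<in> box2"
      show "norm (h' - h (x - s *\<^sub>R y)) \<le> CA * ((1 + 2 * ?N) * (\<delta> + s))"
        using h'[OF D[OF y]] near[OF refl y] by linarith
    qed
    ultimately show ?thesis by (simp add: mass_kern)
  qed
  have "norm ((\<Sum>i\<in>UNIV. \<Sum>j\<in>UNIV. T1 i j) + (\<Sum>i\<in>UNIV. T2 i) + T3)
     \<le> (\<Sum>i\<in>(UNIV::'n set). \<Sum>j\<in>(UNIV::'n set). (CA * hess_const TYPE('n) G Lp + (2 * ?N^2 * kernel_bound TYPE('n) + 1) * CA * osc_const TYPE('n) l G Lp) * ?W * (\<delta> + s))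
      + (\<Sum>i\<in>(UNIV::'n set). CA * ((1 + 2 * ?N) * (\<delta> + s)) * G) + CA * ((1 + 2 * ?N) * (\<delta> + s))"
    by (intro norm_triangle_le[OF add_mono] norm_triangle_mono sum_norm_le B1 B2 B3)
  also have "\<dots> = ?N^2 * ((CA * hess_const TYPE('n) G Lp + (2 * ?N^2 * kernel_bound TYPE('n) + 1) * CA * osc_const TYPE('n) l G Lp) * ?W * (\<delta> + s))
      + (?N * CA * G + CA) * (1 + 2 * ?N) * (\<delta> + s) * 1"
    by (simp add: power2_eq_square algebra_simps)
  also have "\<dots> \<le> ?N^2 * ((CA * hess_const TYPE('n) G Lp + (2 * ?N^2 * kernel_bound TYPE('n) + 1) * CA * osc_const TYPE('n) l G Lp) * ?W * (\<delta> + s))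
      + (?N * CA * G + CA) * (1 + 2 * ?N) * (\<delta> + s) * (l * ?W)"
    using CA GLp \<delta> s W by (intro add_left_mono mult_left_mono) auto
  also have "\<dots> = residual_const TYPE('n) l G Lp CA * ?W * (\<delta> + s)" by (simp add: residual_const_def algebra_simps)
  finally show ?thesis unfolding main .
qed

lemma residual_const_nonneg: "0 \<le> CA \<Longrightarrow> 0 \<le> residual_const TYPE('n) l G Lp CA"
  unfolding residual_const_def using kernel_bound_nonneg GLp hess_const_nonneg osc_const_nonneg l by simp

end

section \<open>Maximum principle\<close>

lemma interior_max_jet2:
  fixes F :: "real^'n \<Rightarrow> real"
  assumes D: "open D" "x \<in> D" and F: "jet2 D F F1 F2" and mx: "\<And>y. y \<in> D \<Longrightarrow> F y \<le> F x"
  shows "F1 i x = 0" and "(\<Sum>i\<in>UNIV. \<Sum>j\<in>UNIV. v $ i * v $ j * F2 i j x) \<le> 0"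
proof -
  have j1: "jet1 D F F1" and j2: "\<And>j. jet1 D (F1 j) (\<lambda>i. F2 i j)" using F by (auto simp: jet2_def)
  have eq: "(\<lambda>v. \<Sum>i\<in>UNIV. v $ i *\<^sub>R F1 i x) = (\<lambda>v. 0)"
    by (rule differential_zero_maxmin[OF D(2,1), of F]) (use j1 D mx in \<open>auto simp: jet1_def\<close>)
  have g0: "F1 i x = 0" for i
    using fun_cong[OF eq, of "axis i 1"] unfolding sum_axis_scaleR .
  then show "F1 i x = 0" .
  obtain r where r: "r > 0" "ball x r \<subseteq> D" using D by (auto simp: open_contains_ball)
  define q where "q = (\<lambda>h. \<Sum>j\<in>UNIV. v $ j * F1 j (x + h *\<^sub>R v))"
  define H where "H = (\<Sum>i\<in>UNIV. \<Sum>j\<in>UNIV. v $ i * v $ j * F2 i j x)"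
  obtain r' where r': "r' > 0" "\<And>h. \<bar>h\<bar> < r' \<Longrightarrow> x + h *\<^sub>R v \<in> D"
  proof
    show "r / (norm v + 1) > 0" using r by (simp add: add_nonneg_pos)
    fix h assume "\<bar>h\<bar> < r / (norm v + 1)"
    then have "\<bar>h\<bar> * (norm v + 1) < r" by (simp add: pos_less_divide_eq add_nonneg_pos)
    then have "norm (h *\<^sub>R v) < r" by (simp add: algebra_simps)
    then show "x + h *\<^sub>R v \<in> D" using r by (auto simp: dist_norm subset_iff)
  qed
  have dg: "((\<lambda>h. F (x + h *\<^sub>R v)) has_real_derivative q h) (at h)" if "\<bar>h\<bar> < r'" for h
    using jet1_line[OF j1 r'(2)[OF that], of UNIV]
    by (simp add: q_def has_real_derivative_iff_has_vector_derivative)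
  have dq: "(q has_real_derivative H) (at 0)"
  proof -
    have "((\<lambda>h. F1 j (x + h *\<^sub>R v)) has_real_derivative (\<Sum>i\<in>UNIV. v $ i * F2 i j x)) (at 0)" for j
      using jet1_line[OF j2, of x 0 v j UNIV] D(2) by (simp add: has_real_derivative_iff_has_vector_derivative)
    then have "(q has_real_derivative (\<Sum>j\<in>UNIV. v $ j * (\<Sum>i\<in>UNIV. v $ i * F2 i j x))) (at 0)"
      unfolding q_def by (intro DERIV_sum DERIV_cmult) auto
    moreover have "(\<Sum>j\<in>UNIV. v $ j * (\<Sum>i\<in>UNIV. v $ i * F2 i j x)) = H"
      unfolding H_def sum_distrib_left by (subst sum.swap) (simp add: mult_ac)
    ultimately show ?thesis by simp
  qed
  have q0: "q 0 = 0" by (simp add: q_def g0)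
  have "H \<le> 0"
  proof (rule ccontr)
    assume "\<not> H \<le> 0"
    then obtain d where d: "d > 0" "\<And>h. 0 < h \<Longrightarrow> h < d \<Longrightarrow> q 0 < q (0 + h)"
      using DERIV_pos_inc_right[OF dq] by auto
    define h0 where "h0 = min d r' / 2"
    have h0: "0 < h0" "h0 < d" "h0 < r'" using d r' by (auto simp: h0_def)
    have "\<exists>z>0. z < h0 \<and> F (x + h0 *\<^sub>R v) - F (x + 0 *\<^sub>R v) = (h0 - 0) * q z"
      by (rule MVT2[OF h0(1)]) (use dg h0 in auto)
    then obtain z where z: "0 < z" "z < h0" "F (x + h0 *\<^sub>R v) - F x = h0 * q z" by auto
    have "q z > 0" using d(2)[of z] z h0 q0 by simp
    then have "F (x + h0 *\<^sub>R v) > F x" using z h0 by (smt (verit) mult_pos_pos)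
    moreover have "F (x + h0 *\<^sub>R v) \<le> F x" using mx r'(2)[of h0] h0 by simp
    ultimately show False by simp
  qed
  then show "(\<Sum>i\<in>UNIV. \<Sum>j\<in>UNIV. v $ i * v $ j * F2 i j x) \<le> 0" by (simp add: H_def)
qed

lemma diffusion_component:
  "diffusion \<sigma> t x y $ i $ j = (\<Sum>k\<in>UNIV. \<sigma> t x y $ i $ k * \<sigma> t x y $ j $ k) / 2"
  by (simp add: diffusion_def matrix_matrix_mult_def transpose_def)

text \<open>
  The trace of \<open>\<sigma> \<sigma>\<^sup>T H\<close> is the sum of the values of the quadratic form \<open>H\<close> at the columns of \<open>\<sigma>\<close>.
\<close>
lemma diffusion_nonpos:
  assumes "\<And>v. (\<Sum>i\<in>UNIV. \<Sum>j\<in>UNIV. v $ i * v $ j * H i j) \<le> 0"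
  shows "(\<Sum>i\<in>UNIV. \<Sum>j\<in>UNIV. diffusion \<sigma> t x y $ i $ j * H i j) \<le> (0::real)"
proof -
  let ?s = "\<sigma> t x y"
  have "(\<Sum>i\<in>UNIV. \<Sum>j\<in>UNIV. diffusion \<sigma> t x y $ i $ j * H i j)
     = (\<Sum>i\<in>UNIV. \<Sum>j\<in>UNIV. \<Sum>k\<in>UNIV. ?s $ i $ k * ?s $ j $ k * H i j) / 2"
    by (simp add: diffusion_component sum_divide_distrib sum_distrib_right)
  also have "(\<Sum>i\<in>UNIV. \<Sum>j\<in>UNIV. \<Sum>k\<in>UNIV. ?s $ i $ k * ?s $ j $ k * H i j)
     = (\<Sum>i\<in>UNIV. \<Sum>k\<in>UNIV. \<Sum>j\<in>UNIV. ?s $ i $ k * ?s $ j $ k * H i j)"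
    by (intro sum.cong refl sum.swap)
  also have "\<dots> = (\<Sum>k\<in>UNIV. \<Sum>i\<in>UNIV. \<Sum>j\<in>UNIV. ?s $ i $ k * ?s $ j $ k * H i j)"
    by (rule sum.swap)
  also have "\<dots> = (\<Sum>k\<in>UNIV. \<Sum>i\<in>UNIV. \<Sum>j\<in>UNIV. column k ?s $ i * column k ?s $ j * H i j)"
    by (simp add: column_def)
  also have "\<dots> \<le> 0" by (intro sum_nonpos assms)
  finally show ?thesis by simp
qed

text \<open>
  The linear parabolic operator in terms of the coefficients and of the values of the derivatives at one point;
  the result type covers systems as well as scalar barriers.
\<close>
definition par_op :: "real^'n^'n \<Rightarrow> real^'n \<Rightarrow> 'b::real_vector \<Rightarrow> ('n \<Rightarrow> 'b) \<Rightarrow> ('n \<Rightarrow> 'n \<Rightarrow> 'b) \<Rightarrow> 'b" where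
  "par_op a b ft f1 f2 = ft + (\<Sum>i\<in>UNIV. \<Sum>j\<in>UNIV. a $ i $ j *\<^sub>R f2 i j) + (\<Sum>i\<in>UNIV. b $ i *\<^sub>R f1 i)"

lemma infnorm_attained: "\<exists>k. infnorm v = \<bar>v $ k\<bar>" for v :: "real^'m"
proof -
  have "infnorm v \<in> (\<lambda>i. \<bar>v \<bullet> i\<bar>) ` Basis"
    unfolding infnorm_Max by (rule Max_in) auto
  then show ?thesis by (auto simp: Basis_vec_def inner_axis)
qed

text \<open>
  Let \<open>r\<close> be the maximum of the ratio of \<open>infnorm (w t x)\<close> to \<open>\<Phi> t x\<close>, and suppose that \<open>r > 1\<close>. It is attained off
  the part of the boundary that carries data. If \<open>w\<^sub>k\<close> is a largest component there, the scalar function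
  \<open>\<plusminus>w\<^sub>k - r \<Phi>\<close>, with the sign of \<open>w\<^sub>k\<close> at this point, has an interior maximum in space and does not increase forward in time, so the operator
  applied to it is at most zero. This contradicts the hypothesis \<open>strict\<close>. That hypothesis has to be verified
  only where \<open>infnorm w = r \<Phi>\<close>, so terms of order zero in \<open>w\<close> can be absorbed by \<open>\<Phi>\<close>. The final time is
  excluded from the equation and carries data, as the problem runs backwards.
\<close>
lemma ratio_comparison:
  fixes w :: "real \<Rightarrow> real^'n \<Rightarrow> real^'m" and \<Phi> :: "real \<Rightarrow> real^'n \<Rightarrow> real"
    and \<sigma> :: "real \<Rightarrow> real^'n \<Rightarrow> real^'m \<Rightarrow> real^'d^'n" and y :: "real \<Rightarrow> real^'n \<Rightarrow> real^'m"
  assumes X: "compact X" and U: "open U" "U \<subseteq> X"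
    and cw: "continuous_on ({ta..tb} \<times> X) (\<lambda>(t, x). w t x)"
    and cP: "continuous_on ({ta..tb} \<times> X) (\<lambda>(t, x). \<Phi> t x)"
    and Ppos: "\<And>t x. t \<in> {ta..tb} \<Longrightarrow> x \<in> X \<Longrightarrow> 0 < \<Phi> t x"
    and bdry: "\<And>t x. t \<in> {ta..tb} \<Longrightarrow> x \<in> X \<Longrightarrow> t = tb \<or> x \<notin> U \<Longrightarrow> infnorm (w t x) \<le> \<Phi> t x"
    and wt: "\<And>t x. t \<in> {ta..<tb} \<Longrightarrow> x \<in> U \<Longrightarrow> ((\<lambda>s. w s x) has_vector_derivative wt t x) (at t)"
    and wj: "\<And>t. t \<in> {ta..<tb} \<Longrightarrow> jet2 U (w t) (w1 t) (w2 t)"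
    and Pt: "\<And>t x. t \<in> {ta..<tb} \<Longrightarrow> x \<in> U \<Longrightarrow> ((\<lambda>s. \<Phi> s x) has_vector_derivative \<Phi>t t x) (at t)"
    and Pj: "\<And>t. t \<in> {ta..<tb} \<Longrightarrow> jet2 U (\<Phi> t) (\<Phi>1 t) (\<Phi>2 t)"
    and strict: "\<And>t x k r. t \<in> {ta..<tb} \<Longrightarrow> x \<in> U \<Longrightarrow> 1 < r \<Longrightarrow> infnorm (w t x) = r * \<Phi> t x \<Longrightarrow>
        \<bar>w t x $ k\<bar> = r * \<Phi> t x \<Longrightarrow>
        r * par_op (diffusion \<sigma> t x (y t x)) (b t x) (\<Phi>t t x) (\<lambda>i. \<Phi>1 t i x) (\<lambda>i j. \<Phi>2 t i j x)
          < sgn (w t x $ k) * par_op (diffusion \<sigma> t x (y t x)) (b t x) (wt t x) (\<lambda>i. w1 t i x) (\<lambda>i j. w2 t i j x) $ k"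
    and tx: "t \<in> {ta..tb}" "x \<in> X"
  shows "infnorm (w t x) \<le> \<Phi> t x"
proof (rule ccontr)
  assume neg: "\<not> infnorm (w t x) \<le> \<Phi> t x"
  define R where "R = (\<lambda>(t, x). infnorm (w t x) / \<Phi> t x)"
  have cR: "continuous_on ({ta..tb} \<times> X) R"
    unfolding R_def case_prod_unfold
    using cw cP Ppos by (intro continuous_intros) (auto simp: case_prod_unfold less_imp_neq[symmetric])
  have "compact ({ta..tb} \<times> X)" "{ta..tb} \<times> X \<noteq> {}" using tx by (auto intro!: compact_Times X)
  from continuous_attains_sup[OF this cR]
  obtain p where p: "p \<in> {ta..tb} \<times> X" "\<And>q. q \<in> {ta..tb} \<times> X \<Longrightarrow> R q \<le> R p" by blast
  obtain s z where sz: "p = (s, z)" by (cases p)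
  define r where "r = R p"
  have s: "s \<in> {ta..tb}" "z \<in> X" using p(1) sz by auto
  have ge: "infnorm (w t' x') \<le> r * \<Phi> t' x'" if "t' \<in> {ta..tb}" "x' \<in> X" for t' x'
    using p(2)[of "(t', x')"] that Ppos[OF that] by (simp add: R_def r_def pos_divide_le_eq)
  have eqr: "infnorm (w s z) = r * \<Phi> s z"
    using Ppos[OF s] by (simp add: r_def R_def sz)
  have r1: "r > 1"
  proof -
    have "1 * \<Phi> t x < r * \<Phi> t x" using neg ge[OF tx] by simp
    then show ?thesis using Ppos[OF tx] by (simp only: mult_less_cancel_right_pos)
  qed
  have "\<not> (s = tb \<or> z \<notin> U)"
  proof
    assume "s = tb \<or> z \<notin> U"
    then have "infnorm (w s z) \<le> 1 * \<Phi> s z" using bdry[OF s] by simp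
    then have "r * \<Phi> s z \<le> 1 * \<Phi> s z" using eqr by simp
    then show False using r1 Ppos[OF s] by (simp only: mult_le_cancel_right_pos)
  qed
  then have st: "s \<in> {ta..<tb}" and zU: "z \<in> U" using s by auto
  obtain k where k: "infnorm (w s z) = \<bar>w s z $ k\<bar>" using infnorm_attained by blast
  define e where "e = sgn (w s z $ k)"
  have e1: "\<bar>e\<bar> \<le> 1" "e * w s z $ k = \<bar>w s z $ k\<bar>" by (auto simp: e_def sgn_if)
  let ?L = "\<lambda>v::real^'m. e * v $ k"
  have L: "bounded_linear ?L" by (intro bounded_linear_const_mult bounded_linear_vec_nth)
  define F where "F = (\<lambda>t x. e * w t x $ k - r * \<Phi> t x)"
  have F0: "F s z = 0" using k eqr e1 by (simp add: F_def)
  have Fle: "F t' x' \<le> 0" if "t' \<in> {ta..tb}" "x' \<in> X" for t' x'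
  proof -
    have "e * w t' x' $ k \<le> \<bar>e\<bar> * \<bar>w t' x' $ k\<bar>" by (metis abs_ge_self abs_mult)
    also have "\<dots> \<le> 1 * infnorm (w t' x')" using e1 by (intro mult_mono component_le_infnorm_cart) auto
    also have "\<dots> \<le> r * \<Phi> t' x'" using ge[OF that] by simp
    finally show ?thesis by (simp add: F_def)
  qed
  have jF: "jet2 U (F s) (\<lambda>i x. e * w1 s i x $ k - r * \<Phi>1 s i x) (\<lambda>i j x. e * w2 s i j x $ k - r * \<Phi>2 s i j x)"
    unfolding F_def using jet2_diff[OF jet2_linear[OF L wj[OF st]] jet2_linear[OF bounded_linear_mult_right[of r] Pj[OF st]]] .
  have max: "F s x' \<le> F s z" if "x' \<in> U" for x' using Fle[OF s(1), of x'] that U F0 by auto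
  note g = interior_max_jet2[OF U(1) zU jF max]
  have dF: "((\<lambda>t. F t z) has_real_derivative e * wt s z $ k - r * \<Phi>t s z) (at s)"
    unfolding F_def has_real_derivative_iff_has_vector_derivative
    by (intro has_vector_derivative_diff bounded_linear.has_vector_derivative[OF L wt[OF st zU]]
        bounded_linear.has_vector_derivative[OF bounded_linear_mult_right Pt[OF st zU]])
  have t0: "e * wt s z $ k - r * \<Phi>t s z \<le> 0"
  proof (rule ccontr)
    assume "\<not> ?thesis"
    then obtain d where d: "d > 0" "\<And>h. 0 < h \<Longrightarrow> h < d \<Longrightarrow> F s z < F (s + h) z"
      using DERIV_pos_inc_right[OF dF] by auto
    define h where "h = min d (tb - s) / 2"
    have "0 < h" "h < d" "s + h \<in> {ta..tb}" using d st by (auto simp: h_def min_def field_simps)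
    then show False using d(2)[of h] Fle[of "s + h" z] s F0 by simp
  qed
  let ?a = "diffusion \<sigma> s z (y s z)"
  have "(\<Sum>i\<in>UNIV. \<Sum>j\<in>UNIV. ?a $ i $ j * (e * w2 s i j z $ k - r * \<Phi>2 s i j z)) \<le> 0"
    by (rule diffusion_nonpos) (rule g(2))
  then have "e * (\<Sum>i\<in>UNIV. \<Sum>j\<in>UNIV. ?a $ i $ j * w2 s i j z $ k) \<le> r * (\<Sum>i\<in>UNIV. \<Sum>j\<in>UNIV. ?a $ i $ j * \<Phi>2 s i j z)"
    by (simp add: sum_distrib_left right_diff_distrib sum_subtractf mult_ac)
  moreover have "e * (\<Sum>i\<in>UNIV. b s z $ i * w1 s i z $ k) = r * (\<Sum>i\<in>UNIV. b s z $ i * \<Phi>1 s i z)"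
  proof -
    have "e * w1 s i z $ k = r * \<Phi>1 s i z" for i using g(1)[of i] by simp
    then have "e * (b s z $ i * w1 s i z $ k) = r * (b s z $ i * \<Phi>1 s i z)" for i by (metis mult.left_commute)
    then show ?thesis unfolding sum_distrib_left by (intro sum.cong refl)
  qed
  ultimately have "e * par_op ?a (b s z) (wt s z) (\<lambda>i. w1 s i z) (\<lambda>i j. w2 s i j z) $ k
      \<le> r * par_op ?a (b s z) (\<Phi>t s z) (\<lambda>i. \<Phi>1 s i z) (\<lambda>i j. \<Phi>2 s i j z)"
    using t0 by (simp add: par_op_def sum_component algebra_simps)
  moreover have "r * par_op ?a (b s z) (\<Phi>t s z) (\<lambda>i. \<Phi>1 s i z) (\<lambda>i j. \<Phi>2 s i j z)
     < e * par_op ?a (b s z) (wt s z) (\<lambda>i. w1 s i z) (\<lambda>i j. w2 s i j z) $ k"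
    unfolding e_def by (rule strict[OF st zU r1 eqr]) (use k eqr in simp)
  ultimately show False by simp
qed

section \<open>Barriers\<close>

text \<open>
  The exponent \<open>\<Sum>\<^sub>i \<surd>(l - x\<^sub>i) + \<surd>(l + x\<^sub>i)\<close> of \<open>sqrt_barrier\<close> has the slope \<open>dist_slope\<close> and the curvature \<open>dist_curvature\<close> in
  each coordinate. Near a face at distance \<open>d\<close> the slope is of order \<open>d\<^bsup>-1/2\<^esup>\<close> and the curvature of order
  \<open>- d\<^bsup>-3/2\<^esup>\<close>, which dominates both the square of the slope and the potential \<open>1/d\<close> summed up in \<open>inv_dist_sum\<close>.
\<close>
definition inv_sqrt :: "real \<Rightarrow> real" where "inv_sqrt r = 1 / sqrt r"

lemma inv_sqrt_deriv: "0 < r \<Longrightarrow> (inv_sqrt has_real_derivative - ((inv_sqrt r)^3) / 2) (at r)"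
proof -
  assume r: "0 < r"
  have "((\<lambda>r. 1 / sqrt r) has_real_derivative - ((1 / sqrt r)^3) / 2) (at r)"
    using r by (auto intro!: derivative_eq_intros simp: power3_eq_cube divide_simps)
  then show ?thesis by (simp add: inv_sqrt_def[abs_def])
qed

lemma inv_sqrt_pos: "0 < r \<Longrightarrow> 0 < inv_sqrt r" by (simp add: inv_sqrt_def)

lemma inv_sqrt_square: "0 < r \<Longrightarrow> (inv_sqrt r)^2 = 1 / r" by (simp add: inv_sqrt_def power_divide)

definition dist_slope :: "real \<Rightarrow> real \<Rightarrow> real" where "dist_slope l r = (inv_sqrt (l + r) - inv_sqrt (l - r)) / 2"
definition dist_curvature :: "real \<Rightarrow> real \<Rightarrow> real" where "dist_curvature l r = - ((inv_sqrt (l + r))^3 + (inv_sqrt (l - r))^3) / 4"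

definition sqrt_barrier :: "real \<Rightarrow> real^'n \<Rightarrow> real" where
  "sqrt_barrier l x = exp (\<Sum>i\<in>UNIV. sqrt (l - x $ i) + sqrt (l + x $ i))"

definition inv_dist_sum :: "real \<Rightarrow> real^'n \<Rightarrow> real" where
  "inv_dist_sum l x = (\<Sum>i\<in>UNIV. 1 / (l + x $ i) + 1 / (l - x $ i))"

text \<open>
  \<open>M\<close> is the size of the error that enters through the interfaces \<open>r = p\<close> and \<open>r = q\<close> and decays away from them;
  \<open>A\<close> is the accuracy below which nothing is gained. The final digits in the names count derivatives.
\<close>
definition edge_profile0 :: "real \<Rightarrow> real \<Rightarrow> real \<Rightarrow> real \<Rightarrow> real \<Rightarrow> real \<Rightarrow> real" where
  "edge_profile0 A M \<mu> p q r = A + M * (exp (- \<mu> * (r - p)) + exp (- \<mu> * (q - r)))"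
definition edge_profile1 :: "real \<Rightarrow> real \<Rightarrow> real \<Rightarrow> real \<Rightarrow> real \<Rightarrow> real" where
  "edge_profile1 M \<mu> p q r = M * \<mu> * (exp (- \<mu> * (q - r)) - exp (- \<mu> * (r - p)))"
definition edge_profile2 :: "real \<Rightarrow> real \<Rightarrow> real \<Rightarrow> real \<Rightarrow> real \<Rightarrow> real" where
  "edge_profile2 M \<mu> p q r = M * \<mu>^2 * (exp (- \<mu> * (q - r)) + exp (- \<mu> * (r - p)))"

definition schwarz_barrier :: "real \<Rightarrow> real \<Rightarrow> real \<Rightarrow> real \<Rightarrow> real \<Rightarrow> real \<Rightarrow> 'n \<Rightarrow> real^'n \<Rightarrow> real" where
  "schwarz_barrier l A M \<mu> p q e x = sqrt_barrier l x * edge_profile0 A M \<mu> p q (x $ e)"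
definition schwarz_barrier1 where
  "schwarz_barrier1 l A M \<mu> p q e i x = schwarz_barrier l A M \<mu> p q e x * dist_slope l (x $ i)
     + (if i = e then sqrt_barrier l x * edge_profile1 M \<mu> p q (x $ e) else 0)"
definition schwarz_barrier2 where
  "schwarz_barrier2 l A M \<mu> p q e i j x = schwarz_barrier1 l A M \<mu> p q e i x * dist_slope l (x $ j)
     + (if i = j then schwarz_barrier l A M \<mu> p q e x * dist_curvature l (x $ j) else 0)
     + (if j = e then sqrt_barrier l x * dist_slope l (x $ i) * edge_profile1 M \<mu> p q (x $ e)
          + (if i = e then sqrt_barrier l x * edge_profile2 M \<mu> p q (x $ e) else 0) else 0)"

lemma cube_pos: "x \<in> cube l \<Longrightarrow> 0 < l + x $ i \<and> 0 < l - x $ i"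
  by (simp add: cube_def) (metis add.commute less_iff_diff_less_0 minus_less_iff real_0_less_add_iff)

lemma sqrt_barrier_jet1: "jet1 (cube l) (sqrt_barrier l) (\<lambda>i x. sqrt_barrier l x * dist_slope l (x $ i))"
proof -
  have 1: "jet1 (cube l) (\<lambda>x::real^'n. sqrt (l - x $ k) + sqrt (l + x $ k)) (\<lambda>i x. dist_slope l (x $ k) * (if i = k then 1 else 0))" for k
  proof (rule jet1_coord_fun)
    fix x :: "real^'n" assume "x \<in> cube l"
    then have "0 < l + x $ k" "0 < l - x $ k" using cube_pos by auto
    then show "((\<lambda>r. sqrt (l - r) + sqrt (l + r)) has_real_derivative dist_slope l (x $ k)) (at (x $ k))"
      by (auto intro!: derivative_eq_intros simp: dist_slope_def inv_sqrt_def divide_simps)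
  next
    show "continuous_on ((\<lambda>x. x $ k) ` cube l) (dist_slope l)"
      unfolding dist_slope_def inv_sqrt_def by (intro continuous_intros) (auto dest: cube_pos[of _ _ k])
  qed
  have "jet1 (cube l) (\<lambda>x::real^'n. exp (\<Sum>k\<in>UNIV. sqrt (l - x $ k) + sqrt (l + x $ k)))
      (\<lambda>i x. exp (\<Sum>k\<in>UNIV. sqrt (l - x $ k) + sqrt (l + x $ k)) * (\<Sum>k\<in>UNIV. dist_slope l (x $ k) * (if i = k then 1 else 0)))"
    by (rule jet1_chain[OF jet1_sum[OF finite 1]]) (auto intro!: derivative_eq_intros continuous_intros)
  then show ?thesis
    by (rule jet1_cong) (auto simp: sqrt_barrier_def if_distrib[of "\<lambda>c. _ * c"] cong: if_cong)
qed

lemma edge_profile_jet1: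
  "jet1 D (\<lambda>x::real^'n. edge_profile0 A M \<mu> p q (x $ e)) (\<lambda>i x. edge_profile1 M \<mu> p q (x $ e) * (if i = e then 1 else 0))"
  "jet1 D (\<lambda>x::real^'n. edge_profile1 M \<mu> p q (x $ e)) (\<lambda>i x. edge_profile2 M \<mu> p q (x $ e) * (if i = e then 1 else 0))"
  by (rule jet1_coord_fun; auto simp: edge_profile0_def edge_profile1_def edge_profile2_def power2_eq_square algebra_simps intro!: derivative_eq_intros continuous_intros)+

lemma dist_slope_jet1: "jet1 (cube l) (\<lambda>x::real^'n. dist_slope l (x $ j)) (\<lambda>i x. dist_curvature l (x $ j) * (if i = j then 1 else 0))"
proof (rule jet1_coord_fun)
  fix x :: "real^'n" assume "x \<in> cube l"
  then have p: "0 < l + x $ j" "0 < l - x $ j" using cube_pos by auto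
  have "((\<lambda>r. inv_sqrt (l + r)) has_real_derivative - ((inv_sqrt (l + x $ j))^3) / 2 * 1) (at (x $ j))"
    by (rule DERIV_chain2[where f=inv_sqrt and g="\<lambda>r. l + r" and x="x $ j", OF inv_sqrt_deriv[OF p(1)]]) (auto intro!: derivative_eq_intros)
  moreover have "((\<lambda>r. inv_sqrt (l - r)) has_real_derivative - ((inv_sqrt (l - x $ j))^3) / 2 * (-1)) (at (x $ j))"
    by (rule DERIV_chain2[where f=inv_sqrt and g="\<lambda>r. l - r" and x="x $ j", OF inv_sqrt_deriv[OF p(2)]]) (auto intro!: derivative_eq_intros)
  ultimately show "(dist_slope l has_real_derivative dist_curvature l (x $ j)) (at (x $ j))"
    unfolding dist_slope_def[abs_def] dist_curvature_def by (auto intro!: derivative_eq_intros)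
next
  show "continuous_on ((\<lambda>x. x $ j) ` cube l) (dist_curvature l)"
    unfolding dist_curvature_def inv_sqrt_def by (intro continuous_intros) (auto dest: cube_pos[of _ _ j])
qed

lemma schwarz_barrier_jet2: "jet2 (cube l) (schwarz_barrier l A M \<mu> p q e) (schwarz_barrier1 l A M \<mu> p q e) (schwarz_barrier2 l A M \<mu> p q e)"
  unfolding jet2_def
proof (intro conjI allI)
  show j0: "jet1 (cube l) (schwarz_barrier l A M \<mu> p q e) (schwarz_barrier1 l A M \<mu> p q e)"
    by (rule jet1_cong[OF jet1_mult[OF sqrt_barrier_jet1 edge_profile_jet1(1)[of _ A M \<mu> p q e]]])
      (auto simp: schwarz_barrier_def schwarz_barrier1_def algebra_simps)
  fix j
  have "jet1 (cube l) (\<lambda>x. schwarz_barrier l A M \<mu> p q e x * dist_slope l (x $ j) + (if j = e then 1 else 0) * (sqrt_barrier l x * edge_profile1 M \<mu> p q (x $ e)))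
    (\<lambda>i x. (schwarz_barrier l A M \<mu> p q e x * (dist_curvature l (x $ j) * (if i = j then 1 else 0)) + schwarz_barrier1 l A M \<mu> p q e i x * dist_slope l (x $ j))
     + (if j = e then 1 else 0) * (sqrt_barrier l x * (edge_profile2 M \<mu> p q (x $ e) * (if i = e then 1 else 0)) + (sqrt_barrier l x * dist_slope l (x $ i)) * edge_profile1 M \<mu> p q (x $ e)))"
    by (intro jet1_add jet1_cmult jet1_mult j0 dist_slope_jet1 sqrt_barrier_jet1 edge_profile_jet1)
  then show "jet1 (cube l) (schwarz_barrier1 l A M \<mu> p q e j) (\<lambda>i. schwarz_barrier2 l A M \<mu> p q e i j)"
    by (rule jet1_cong) (auto simp: schwarz_barrier1_def[of _ _ _ _ _ _ _ j] schwarz_barrier2_def algebra_simps)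
qed

text \<open>
  This lets the cubic terms in \<open>d\<^bsup>-1/2\<^esup>\<close> absorb the quadratic ones, up to a constant.
\<close>
lemma square_le_cube:
  fixes s \<delta> :: real assumes "0 \<le> s" "0 < \<delta>"
  shows "s^2 \<le> \<delta> * s^3 + 1 / \<delta>^2"
proof (cases "s \<le> 1 / \<delta>")
  case True
  then have "s^2 \<le> (1 / \<delta>)^2" using assms by (intro power_mono) auto
  then show ?thesis using assms by (simp add: power_divide add_increasing)
next
  case False
  then have "1 \<le> \<delta> * s" using assms by (simp add: field_simps)
  then have "1 * s^2 \<le> (\<delta> * s) * s^2" by (intro mult_right_mono) auto
  then show ?thesis using assms by (simp add: power3_eq_cube power2_eq_square mult_ac add_increasing2)
qed

text \<open>
  Relative to the barrier, the curvature terms contribute \<open>- \<nu>/4\<close> times the cubes of the inverse square roots of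
  the distances to the faces. Everything else, including the potential \<open>2 Cr inv_dist_sum\<close>, is at most quadratic in these
  quantities, and \<open>square_le_cube\<close> reduces it to a constant. The constant \<open>K0\<close> may depend on \<open>\<mu>\<close>, but not on \<open>A\<close>, \<open>M\<close> and
  the interfaces, which change during the iteration.
\<close>
lemma barrier_operator:
  fixes Ca Cb \<nu> \<mu> Cr l :: real
  assumes C: "0 \<le> Ca" "0 \<le> Cb" "0 < \<nu>" "0 \<le> \<mu>" "0 \<le> Cr"
  shows "\<exists>K0\<ge>0. \<forall>(a::real^'n^'n) (b::real^'n) x (A::real) (M::real) p q e. x \<in> cube l \<longrightarrow> (\<forall>i j. \<bar>a $ i $ j\<bar> \<le> Ca) \<longrightarrow>
      (\<forall>i. \<nu> \<le> a $ i $ i) \<longrightarrow> (\<forall>i. \<bar>b $ i\<bar> \<le> Cb) \<longrightarrow> 0 \<le> A \<longrightarrow> 0 \<le> M \<longrightarrow>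
      par_op a b 0 (\<lambda>i. schwarz_barrier1 l A M \<mu> p q e i x) (\<lambda>i j. schwarz_barrier2 l A M \<mu> p q e i j x)
        \<le> (K0 - 2 * Cr * inv_dist_sum l x) * schwarz_barrier l A M \<mu> p q e x"
proof -
  let ?N = "real (CARD('n))"
  \<comment> \<open>\<open>C'\<close> bounds the terms of order at most two in the slopes, relative to \<open>1 + inv_dist_sum\<close>; the choice of \<open>\<delta>\<close>
      leaves at most the share \<open>\<nu>/4\<close> of the cubic terms for them.\<close>
  define C' where "C' = (Ca + (?N + 1) * Ca * \<mu> + Cb) * (1 + ?N) + Ca * \<mu>^2 + Cb * ?N * \<mu>"
  have C': "0 \<le> C'" unfolding C'_def using C by simp
  define \<delta> where "\<delta> = \<nu> / (4 * (C' + 2 * Cr + 1))"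
  have \<delta>: "0 < \<delta>" using C C' by (simp add: \<delta>_def)
  have \<delta>2: "(C' + 2 * Cr) * \<delta> \<le> \<nu> / 4"
  proof -
    have "(C' + 2 * Cr) * \<delta> \<le> (C' + 2 * Cr + 1) * \<delta>" using \<delta> by (intro mult_right_mono) auto
    also have "\<dots> = \<nu> / 4"
    proof -
      have "C' + 2 * Cr + 1 \<noteq> 0" using C C' by linarith
      then show ?thesis unfolding \<delta>_def by (simp add: divide_simps)
    qed
    finally show ?thesis .
  qed
  define K0 where "K0 = C' + (C' + 2 * Cr) * (2 * ?N / \<delta>^2)"
  have K0: "0 \<le> K0" unfolding K0_def using C C' \<delta> by simp
  show ?thesis
  proof (intro exI[of _ K0] conjI K0 allI impI)
    fix a :: "real^'n^'n" and b x :: "real^'n" and A M p q :: real and e :: 'n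
    assume x: "x \<in> cube l" and a: "\<forall>i j. \<bar>a $ i $ j\<bar> \<le> Ca" and nu: "\<forall>i. \<nu> \<le> a $ i $ i"
      and b: "\<forall>i. \<bar>b $ i\<bar> \<le> Cb" and A: "0 \<le> A" and M: "0 \<le> M"
    let ?\<beta> = "sqrt_barrier l x" and ?g = "\<lambda>i. dist_slope l (x $ i)" and ?\<phi> = "schwarz_barrier l A M \<mu> p q e x"
    let ?P = "\<lambda>i. inv_sqrt (l + x $ i)" and ?Q = "\<lambda>i. inv_sqrt (l - x $ i)"
    have PQ: "0 < ?P i" "0 < ?Q i" for i using inv_sqrt_pos cube_pos[OF x] by auto
    have \<beta>: "0 < ?\<beta>" by (simp add: sqrt_barrier_def)
    have e0: "0 \<le> edge_profile0 A M \<mu> p q (x $ e)" using A M by (simp add: edge_profile0_def)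
    have \<phi>: "0 \<le> ?\<phi>" using \<beta> e0 by (simp add: schwarz_barrier_def)
    have e1: "\<bar>?\<beta> * edge_profile1 M \<mu> p q (x $ e)\<bar> \<le> \<mu> * ?\<phi>"
    proof -
      let ?E = "exp (- \<mu> * (q - x $ e))" and ?F = "exp (- \<mu> * (x $ e - p))"
      have "\<bar>?E - ?F\<bar> \<le> ?E + ?F" using exp_gt_zero[of "- \<mu> * (q - x $ e)"] exp_gt_zero[of "- \<mu> * (x $ e - p)"] by linarith
      then have "M * \<mu> * \<bar>?E - ?F\<bar> \<le> M * \<mu> * (?E + ?F)" using M C by (intro mult_left_mono) auto
      also have "\<dots> \<le> \<mu> * edge_profile0 A M \<mu> p q (x $ e)" using A C by (simp add: edge_profile0_def algebra_simps)
      finally have "\<bar>edge_profile1 M \<mu> p q (x $ e)\<bar> \<le> \<mu> * edge_profile0 A M \<mu> p q (x $ e)" using M C by (simp add: edge_profile1_def abs_mult)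
      then have "?\<beta> * \<bar>edge_profile1 M \<mu> p q (x $ e)\<bar> \<le> ?\<beta> * (\<mu> * edge_profile0 A M \<mu> p q (x $ e))" using \<beta> by (intro mult_left_mono) auto
      then show ?thesis using \<beta> by (simp add: schwarz_barrier_def abs_mult mult_ac)
    qed
    have e2: "\<bar>?\<beta> * edge_profile2 M \<mu> p q (x $ e)\<bar> \<le> \<mu>^2 * ?\<phi>"
    proof -
      have "edge_profile2 M \<mu> p q (x $ e) \<le> \<mu>^2 * edge_profile0 A M \<mu> p q (x $ e)" "0 \<le> edge_profile2 M \<mu> p q (x $ e)"
        using A M C by (simp_all add: edge_profile2_def edge_profile0_def algebra_simps)
      then have "?\<beta> * edge_profile2 M \<mu> p q (x $ e) \<le> ?\<beta> * (\<mu>^2 * edge_profile0 A M \<mu> p q (x $ e))" "0 \<le> ?\<beta> * edge_profile2 M \<mu> p q (x $ e)"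
        using \<beta> by (auto intro!: mult_left_mono)
      then show ?thesis by (simp add: schwarz_barrier_def mult_ac)
    qed
    have f1: "\<bar>schwarz_barrier1 l A M \<mu> p q e i x\<bar> \<le> (\<bar>?g i\<bar> + \<mu>) * ?\<phi>" for i
    proof -
      have "\<bar>schwarz_barrier1 l A M \<mu> p q e i x\<bar> \<le> \<bar>?\<phi> * ?g i\<bar> + \<bar>?\<beta> * edge_profile1 M \<mu> p q (x $ e)\<bar>"
        unfolding schwarz_barrier1_def by auto
      also have "\<dots> \<le> ?\<phi> * \<bar>?g i\<bar> + \<mu> * ?\<phi>" using e1 \<phi> by (simp add: abs_mult)
      finally show ?thesis by (simp add: algebra_simps)
    qed
    define S1 where "S1 = (\<Sum>i\<in>UNIV. \<bar>?g i\<bar>)"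
    define S3 where "S3 = (\<Sum>i\<in>UNIV. (?P i)^3 + (?Q i)^3)"
    have S1: "0 \<le> S1" by (simp add: S1_def sum_nonneg)
    have S2eq: "inv_dist_sum l x = (\<Sum>i\<in>UNIV. (?P i)^2 + (?Q i)^2)"
      unfolding inv_dist_sum_def using cube_pos[OF x] by (simp add: inv_sqrt_square)
    have S2: "0 \<le> inv_dist_sum l x" unfolding S2eq by (simp add: sum_nonneg)
    have S1S2: "S1^2 \<le> ?N * inv_dist_sum l x"
    proof -
      have "S1^2 \<le> (\<Sum>i\<in>UNIV. \<bar>?g i\<bar>^2) * ?N" unfolding S1_def by (rule sum_squared_le_sum_of_squares)
      also have "(\<Sum>i\<in>UNIV. \<bar>?g i\<bar>^2) \<le> inv_dist_sum l x"
        unfolding S2eq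
      proof (rule sum_mono)
        fix i
        have "((?P i - ?Q i) / 2)^2 \<le> (?P i)^2 + (?Q i)^2"
        proof -
          have "(?P i - ?Q i)^2 \<le> (?P i)^2 + (?Q i)^2" using PQ[of i] by (simp add: power2_diff)
          moreover have "((?P i - ?Q i) / 2)^2 = (?P i - ?Q i)^2 / 4" by (simp add: power_divide)
          ultimately show ?thesis using zero_le_power2[of "?P i - ?Q i"] by linarith
        qed
        then show "\<bar>?g i\<bar>^2 \<le> (?P i)^2 + (?Q i)^2" by (simp only: dist_slope_def power2_abs)
      qed
      finally show ?thesis by (simp add: mult.commute mult_right_mono)
    qed
    have S23: "inv_dist_sum l x \<le> \<delta> * S3 + 2 * ?N / \<delta>^2"
    proof -
      have "inv_dist_sum l x \<le> (\<Sum>i\<in>(UNIV::'n set). \<delta> * ((?P i)^3 + (?Q i)^3) + 2 / \<delta>^2)"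
        unfolding S2eq
      proof (rule sum_mono)
        fix i
        show "(?P i)^2 + (?Q i)^2 \<le> \<delta> * ((?P i)^3 + (?Q i)^3) + 2 / \<delta>^2"
          using square_le_cube[OF less_imp_le[OF PQ(1)[of i]] \<delta>] square_le_cube[OF less_imp_le[OF PQ(2)[of i]] \<delta>]
          by (simp add: algebra_simps)
      qed
      also have "\<dots> = \<delta> * S3 + 2 * ?N / \<delta>^2"
        by (subst sum.distrib) (simp add: S3_def sum_distrib_left)
      finally show ?thesis .
    qed
    \<comment> \<open>The terms of the product rule: slope times gradient, curvature, the mixed terms of slope and edge
        profile, the second derivative of the edge profile, and the drift.\<close>
    define T1 where "T1 = (\<Sum>i\<in>UNIV. \<Sum>j\<in>UNIV. a $ i $ j * (schwarz_barrier1 l A M \<mu> p q e i x * ?g j))"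
    define T2 where "T2 = (\<Sum>i\<in>UNIV. a $ i $ i * (?\<phi> * dist_curvature l (x $ i)))"
    define T3 where "T3 = (\<Sum>i\<in>UNIV. a $ i $ e * (?g i * (?\<beta> * edge_profile1 M \<mu> p q (x $ e))))"
    define T4 where "T4 = a $ e $ e * (?\<beta> * edge_profile2 M \<mu> p q (x $ e))"
    define T5 where "T5 = (\<Sum>i\<in>UNIV. b $ i * schwarz_barrier1 l A M \<mu> p q e i x)"
    have sumeq: "par_op a b 0 (\<lambda>i. schwarz_barrier1 l A M \<mu> p q e i x) (\<lambda>i j. schwarz_barrier2 l A M \<mu> p q e i j x) = T1 + T2 + T3 + T4 + T5"
    proof -
      have "(\<Sum>j\<in>UNIV. a $ i $ j * schwarz_barrier2 l A M \<mu> p q e i j x)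
         = (\<Sum>j\<in>UNIV. a $ i $ j * (schwarz_barrier1 l A M \<mu> p q e i x * ?g j)) + a $ i $ i * (?\<phi> * dist_curvature l (x $ i))
           + a $ i $ e * (?g i * (?\<beta> * edge_profile1 M \<mu> p q (x $ e))) + (if i = e then T4 else 0)" for i
      proof -
        have "a $ i $ j * schwarz_barrier2 l A M \<mu> p q e i j x = a $ i $ j * (schwarz_barrier1 l A M \<mu> p q e i x * ?g j)
           + (if j = i then a $ i $ i * (?\<phi> * dist_curvature l (x $ i)) else 0)
           + (if j = e then a $ i $ e * (?g i * (?\<beta> * edge_profile1 M \<mu> p q (x $ e))) + (if i = e then T4 else 0) else 0)" for j
          by (auto simp: schwarz_barrier2_def T4_def algebra_simps)
        then show ?thesis by (simp add: sum.distrib)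
      qed
      then show ?thesis by (simp add: par_op_def T1_def T2_def T3_def T5_def sum.distrib)
    qed
    have b1: "T1 \<le> Ca * (S1 + ?N * \<mu>) * S1 * ?\<phi>"
    proof -
      have "T1 \<le> (\<Sum>i\<in>UNIV. \<Sum>j\<in>UNIV. Ca * ((\<bar>?g i\<bar> + \<mu>) * ?\<phi> * \<bar>?g j\<bar>))"
        unfolding T1_def
      proof (intro sum_mono)
        fix i j
        have "a $ i $ j * (schwarz_barrier1 l A M \<mu> p q e i x * ?g j) \<le> \<bar>a $ i $ j\<bar> * (\<bar>schwarz_barrier1 l A M \<mu> p q e i x\<bar> * \<bar>?g j\<bar>)"
          by (metis abs_ge_self abs_mult)
        also have "\<dots> \<le> Ca * ((\<bar>?g i\<bar> + \<mu>) * ?\<phi> * \<bar>?g j\<bar>)"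
          using a C by (intro mult_mono f1 mult_right_mono) auto
        finally show "a $ i $ j * (schwarz_barrier1 l A M \<mu> p q e i x * ?g j) \<le> Ca * ((\<bar>?g i\<bar> + \<mu>) * ?\<phi> * \<bar>?g j\<bar>)" .
      qed
      also have "\<dots> = Ca * (\<Sum>i\<in>(UNIV::'n set). \<bar>?g i\<bar> + \<mu>) * ?\<phi> * S1"
        by (simp add: S1_def sum_distrib_left sum_distrib_right mult_ac)
      also have "\<dots> = Ca * (S1 + ?N * \<mu>) * S1 * ?\<phi>" by (simp add: S1_def sum.distrib)
      finally show ?thesis .
    qed
    have b2: "T2 \<le> - (\<nu> / 4) * S3 * ?\<phi>"
    proof -
      have "T2 \<le> (\<Sum>i\<in>(UNIV::'n set). - (\<nu> / 4) * ((?P i)^3 + (?Q i)^3) * ?\<phi>)"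
        unfolding T2_def
      proof (rule sum_mono)
        fix i
        have "\<nu> * (((?P i)^3 + (?Q i)^3) / 4 * ?\<phi>) \<le> a $ i $ i * (((?P i)^3 + (?Q i)^3) / 4 * ?\<phi>)"
          using nu PQ[of i] \<phi> by (intro mult_right_mono) (auto simp: less_imp_le)
        then show "a $ i $ i * (?\<phi> * dist_curvature l (x $ i)) \<le> - (\<nu> / 4) * ((?P i)^3 + (?Q i)^3) * ?\<phi>"
        proof -
          let ?Y = "((?P i)^3 + (?Q i)^3) / 4 * ?\<phi>"
          have "dist_curvature l (x $ i) = - (((?P i)^3 + (?Q i)^3) / 4)" by (simp only: dist_curvature_def minus_divide_left)
          then have "a $ i $ i * (?\<phi> * dist_curvature l (x $ i)) = - (a $ i $ i * ?Y)"
            by (simp only: mult_minus_right mult.commute[of ?\<phi>])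
          moreover have "- (\<nu> / 4) * ((?P i)^3 + (?Q i)^3) * ?\<phi> = - (\<nu> * ?Y)" by simp
          ultimately show ?thesis using \<open>\<nu> * ?Y \<le> a $ i $ i * ?Y\<close> by linarith
        qed
      qed
      then show ?thesis by (simp only: S3_def sum_distrib_left sum_distrib_right)
    qed
    have b3: "T3 \<le> Ca * \<mu> * S1 * ?\<phi>"
    proof -
      have "T3 \<le> (\<Sum>i\<in>UNIV. Ca * (\<bar>?g i\<bar> * (\<mu> * ?\<phi>)))"
        unfolding T3_def
      proof (rule sum_mono)
        fix i
        have "a $ i $ e * (?g i * (?\<beta> * edge_profile1 M \<mu> p q (x $ e))) \<le> \<bar>a $ i $ e\<bar> * (\<bar>?g i\<bar> * \<bar>?\<beta> * edge_profile1 M \<mu> p q (x $ e)\<bar>)"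
          by (metis abs_ge_self abs_mult)
        also have "\<dots> \<le> Ca * (\<bar>?g i\<bar> * (\<mu> * ?\<phi>))" using a C by (intro mult_mono e1) auto
        finally show "a $ i $ e * (?g i * (?\<beta> * edge_profile1 M \<mu> p q (x $ e))) \<le> Ca * (\<bar>?g i\<bar> * (\<mu> * ?\<phi>))" .
      qed
      then show ?thesis by (simp add: S1_def sum_distrib_left sum_distrib_right mult_ac)
    qed
    have b4: "T4 \<le> Ca * \<mu>^2 * ?\<phi>"
    proof -
      have "T4 \<le> \<bar>a $ e $ e\<bar> * \<bar>?\<beta> * edge_profile2 M \<mu> p q (x $ e)\<bar>" unfolding T4_def by (metis abs_ge_self abs_mult)
      also have "\<dots> \<le> Ca * (\<mu>^2 * ?\<phi>)" using a C by (intro mult_mono e2) auto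
      finally show ?thesis by simp
    qed
    have b5: "T5 \<le> Cb * (S1 + ?N * \<mu>) * ?\<phi>"
    proof -
      have "T5 \<le> (\<Sum>i\<in>UNIV. Cb * ((\<bar>?g i\<bar> + \<mu>) * ?\<phi>))"
        unfolding T5_def
      proof (rule sum_mono)
        fix i
        have "b $ i * schwarz_barrier1 l A M \<mu> p q e i x \<le> \<bar>b $ i\<bar> * \<bar>schwarz_barrier1 l A M \<mu> p q e i x\<bar>" by (metis abs_ge_self abs_mult)
        also have "\<dots> \<le> Cb * ((\<bar>?g i\<bar> + \<mu>) * ?\<phi>)" using b C by (intro mult_mono f1) auto
        finally show "b $ i * schwarz_barrier1 l A M \<mu> p q e i x \<le> Cb * ((\<bar>?g i\<bar> + \<mu>) * ?\<phi>)" .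
      qed
      also have "\<dots> = Cb * (\<Sum>i\<in>(UNIV::'n set). \<bar>?g i\<bar> + \<mu>) * ?\<phi>"
        by (simp add: sum_distrib_left sum_distrib_right mult_ac)
      finally show ?thesis by (simp add: S1_def sum.distrib)
    qed
    define Z where "Z = Ca * (S1 + ?N * \<mu>) * S1 - (\<nu> / 4) * S3 + Ca * \<mu> * S1 + Ca * \<mu>^2 + Cb * (S1 + ?N * \<mu>)"
    have "T1 + T2 + T3 + T4 + T5 \<le> Z * ?\<phi>"
      using b1 b2 b3 b4 b5 by (simp add: Z_def algebra_simps)
    moreover have "Z \<le> K0 - 2 * Cr * inv_dist_sum l x"
    proof -
      let ?S = "inv_dist_sum l x" and ?q = "Ca + (?N + 1) * Ca * \<mu> + Cb"
      have l1: "S1 \<le> 1 + S1^2" using sum_squares_bound[of S1 1] S1 by simp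
      have q: "S1^2 \<le> (1 + ?N) * (1 + ?S)" "S1 \<le> (1 + ?N) * (1 + ?S)"
        using S1S2 l1 S2 by (simp_all add: algebra_simps)
      have "Z = Ca * S1^2 + ((?N + 1) * Ca * \<mu> + Cb) * S1 + Ca * \<mu>^2 + Cb * ?N * \<mu> - (\<nu> / 4) * S3"
        by (simp add: Z_def power2_eq_square algebra_simps)
      also have "\<dots> \<le> Ca * ((1 + ?N) * (1 + ?S)) + ((?N + 1) * Ca * \<mu> + Cb) * ((1 + ?N) * (1 + ?S)) + Ca * \<mu>^2 + Cb * ?N * \<mu> - (\<nu> / 4) * S3"
        using C by (intro diff_right_mono add_right_mono add_mono mult_left_mono q) auto
      also have "\<dots> = (?q * (1 + ?N)) * (1 + ?S) + (Ca * \<mu>^2 + Cb * ?N * \<mu>) * 1 - (\<nu> / 4) * S3"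
        by (simp add: algebra_simps)
      also have "\<dots> \<le> (?q * (1 + ?N)) * (1 + ?S) + (Ca * \<mu>^2 + Cb * ?N * \<mu>) * (1 + ?S) - (\<nu> / 4) * S3"
        using C S2 by (intro diff_right_mono add_left_mono mult_left_mono) auto
      also have "\<dots> = C' * (1 + ?S) - (\<nu> / 4) * S3" by (simp add: C'_def algebra_simps)
      finally have 1: "Z \<le> C' * (1 + ?S) - (\<nu> / 4) * S3" .
      have "(C' + 2 * Cr) * ?S \<le> (C' + 2 * Cr) * (\<delta> * S3 + 2 * ?N / \<delta>^2)"
        using S23 C C' by (intro mult_left_mono) auto
      also have "\<dots> = ((C' + 2 * Cr) * \<delta>) * S3 + (C' + 2 * Cr) * (2 * ?N / \<delta>^2)" by (simp add: algebra_simps)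
      also have "\<dots> \<le> (\<nu> / 4) * S3 + (C' + 2 * Cr) * (2 * ?N / \<delta>^2)"
      proof -
        have "0 \<le> S3" unfolding S3_def using PQ by (intro sum_nonneg add_nonneg_nonneg zero_le_power) (auto simp: less_imp_le)
        then show ?thesis using \<delta>2 by (intro add_right_mono mult_right_mono)
      qed
      finally have "(C' + 2 * Cr) * ?S \<le> (\<nu> / 4) * S3 + (C' + 2 * Cr) * (2 * ?N / \<delta>^2)" .
      then show ?thesis using 1 unfolding K0_def by (simp add: algebra_simps)
    qed
    ultimately show "par_op a b 0 (\<lambda>i. schwarz_barrier1 l A M \<mu> p q e i x) (\<lambda>i j. schwarz_barrier2 l A M \<mu> p q e i j x)
        \<le> (K0 - 2 * Cr * inv_dist_sum l x) * schwarz_barrier l A M \<mu> p q e x"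
      unfolding sumeq using \<phi> by (meson mult_right_mono order_trans)
  qed
qed

lemma sqrt_barrier_bounds:
  assumes "x \<in> cube l"
  shows "1 \<le> sqrt_barrier l x" "sqrt_barrier l (x :: real^'n) \<le> exp (CARD('n) * (2 * sqrt (2 * l)))"
proof -
  have p: "0 < l + x $ i" "0 < l - x $ i" for i using cube_pos[OF assms] by auto
  show "1 \<le> sqrt_barrier l x" unfolding sqrt_barrier_def
    using p by (auto intro!: sum_nonneg add_nonneg_nonneg simp: less_imp_le)
  have "(\<Sum>i\<in>UNIV. sqrt (l - x $ i) + sqrt (l + x $ i)) \<le> of_nat (card (UNIV :: 'n set)) * (2 * sqrt (2 * l))"
  proof (rule sum_bounded_above)
    fix i
    have "sqrt (l - x $ i) \<le> sqrt (2 * l)" "sqrt (l + x $ i) \<le> sqrt (2 * l)"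
      using p[of i] by (auto simp only: intro!: real_sqrt_le_mono)
    then show "sqrt (l - x $ i) + sqrt (l + x $ i) \<le> 2 * sqrt (2 * l)" by linarith
  qed
  then show "sqrt_barrier l x \<le> exp (CARD('n) * (2 * sqrt (2 * l)))" by (simp add: sqrt_barrier_def)
qed

text \<open>
  A concave function of the distance \<open>l + \<tau> x\<^sub>i\<close> to the face \<open>x\<^sub>i = - \<tau> l\<close>, where \<open>\<tau> = \<plusminus>1\<close>. For large \<open>\<gamma>\<close> its concavity dominates
  the drift, and by the last two lemmas of this section it is comparable to the distance.
\<close>
definition face_barrier :: "real \<Rightarrow> real \<Rightarrow> real \<Rightarrow> real \<Rightarrow> 'n \<Rightarrow> real \<Rightarrow> real^'n \<Rightarrow> real" where
  "face_barrier l \<gamma> \<eta> A i \<tau> x = \<eta> + A * (1 - exp (- \<gamma> * (l + \<tau> * x $ i)))"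
definition face_barrier1 :: "real \<Rightarrow> real \<Rightarrow> real \<Rightarrow> 'n \<Rightarrow> real \<Rightarrow> 'n \<Rightarrow> real^'n \<Rightarrow> real" where
  "face_barrier1 l \<gamma> A i \<tau> j x = A * \<gamma> * \<tau> * exp (- \<gamma> * (l + \<tau> * x $ i)) * (if j = i then 1 else 0)"
definition face_barrier2 :: "real \<Rightarrow> real \<Rightarrow> real \<Rightarrow> 'n \<Rightarrow> real \<Rightarrow> 'n \<Rightarrow> 'n \<Rightarrow> real^'n \<Rightarrow> real" where
  "face_barrier2 l \<gamma> A i \<tau> k j x = (if j = i then 1 else 0) * (- A * \<gamma>^2 * \<tau>^2 * exp (- \<gamma> * (l + \<tau> * x $ i)) * (if k = i then 1 else 0))"

lemma face_barrier_jet2: "jet2 D (face_barrier l \<gamma> \<eta> A i \<tau>) (face_barrier1 l \<gamma> A i \<tau>) (face_barrier2 l \<gamma> A i \<tau>)"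
  unfolding jet2_def
proof (intro conjI allI)
  show "jet1 D (face_barrier l \<gamma> \<eta> A i \<tau>) (face_barrier1 l \<gamma> A i \<tau>)"
    unfolding face_barrier_def[abs_def] face_barrier1_def[abs_def]
    by (rule jet1_coord_fun) (auto intro!: derivative_eq_intros continuous_intros simp: algebra_simps)
  fix j
  have "jet1 D (\<lambda>x::real^'a. A * \<gamma> * \<tau> * exp (- \<gamma> * (l + \<tau> * x $ i)))
    (\<lambda>k x. (- A * \<gamma>^2 * \<tau>^2 * exp (- \<gamma> * (l + \<tau> * x $ i))) * (if k = i then 1 else 0))"
    by (rule jet1_coord_fun[where \<phi>' = "\<lambda>r. - A * \<gamma>^2 * \<tau>^2 * exp (- \<gamma> * (l + \<tau> * r))"])
      (auto intro!: derivative_eq_intros continuous_intros simp: algebra_simps power2_eq_square)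
  from jet1_cmult[OF this, of "if j = i then 1 else 0"]
  show "jet1 D (face_barrier1 l \<gamma> A i \<tau> j) (\<lambda>k. face_barrier2 l \<gamma> A i \<tau> k j)"
    by (rule jet1_cong) (auto simp: face_barrier1_def face_barrier2_def)
qed

lemma face_barrier_operator:
  fixes \<nu> Cb A \<tau> \<gamma> l :: real and a :: "real^'n^'n" and b x :: "real^'n"
  assumes "0 < \<nu>" "0 \<le> Cb" "0 \<le> A" "\<tau> = 1 \<or> \<tau> = -1" "x \<in> cube l" "\<nu> \<le> a $ i $ i" "\<bar>b $ i\<bar> \<le> Cb"
    and \<gamma>: "\<gamma> = (Cb + 1) / \<nu>"
  shows "par_op a b 0 (\<lambda>j. face_barrier1 l \<gamma> A i \<tau> j x) (\<lambda>k j. face_barrier2 l \<gamma> A i \<tau> k j x) \<le> - (A * (\<gamma> * exp (- \<gamma> * (2 * l))))"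
proof -
  let ?E = "exp (- \<gamma> * (l + \<tau> * x $ i))"
  have \<gamma>0: "0 < \<gamma>" using assms by simp
  have \<tau>2: "\<tau>^2 = 1" "\<bar>\<tau>\<bar> = 1" using assms(4) by auto
  have "par_op a b 0 (\<lambda>j. face_barrier1 l \<gamma> A i \<tau> j x) (\<lambda>k j. face_barrier2 l \<gamma> A i \<tau> k j x)
     = a $ i $ i * (- A * \<gamma>^2 * ?E) + b $ i * (A * \<gamma> * \<tau> * ?E)"
  proof -
    have "(\<Sum>k\<in>UNIV. \<Sum>j\<in>UNIV. a $ k $ j * face_barrier2 l \<gamma> A i \<tau> k j x)
      = (\<Sum>k\<in>UNIV. \<Sum>j\<in>UNIV. if j = i then (if k = i then a $ i $ i * (- A * \<gamma>^2 * ?E) else 0) else 0)"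
      using \<tau>2 by (intro sum.cong refl) (auto simp: face_barrier2_def)
    moreover have "(\<Sum>j\<in>UNIV. b $ j * face_barrier1 l \<gamma> A i \<tau> j x) = (\<Sum>j\<in>UNIV. if j = i then b $ i * (A * \<gamma> * \<tau> * ?E) else 0)"
      by (intro sum.cong refl) (auto simp: face_barrier1_def)
    ultimately show ?thesis by (simp add: par_op_def)
  qed
  also have "\<dots> = A * \<gamma> * ?E * (b $ i * \<tau> - \<gamma> * a $ i $ i)" by (simp add: power2_eq_square algebra_simps)
  also have "\<dots> \<le> A * \<gamma> * ?E * (- 1)"
  proof (rule mult_left_mono)
    have "b $ i * \<tau> \<le> \<bar>b $ i\<bar> * \<bar>\<tau>\<bar>" by (metis abs_ge_self abs_mult)
    moreover have "\<gamma> * \<nu> \<le> \<gamma> * a $ i $ i" using \<gamma>0 assms by (intro mult_left_mono) auto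
    moreover have "\<gamma> * \<nu> = Cb + 1" using \<gamma> assms by simp
    ultimately show "b $ i * \<tau> - \<gamma> * a $ i $ i \<le> -1" using assms \<tau>2 by simp
  qed (use assms \<gamma>0 in auto)
  also have "\<dots> \<le> - (A * (\<gamma> * exp (- \<gamma> * (2 * l))))"
  proof -
    have "l + \<tau> * x $ i \<le> 2 * l" using assms(4) cube_pos[OF assms(5), of i] by auto
    then have "exp (- \<gamma> * (2 * l)) \<le> ?E" using \<gamma>0 by simp
    then have "(A * \<gamma>) * exp (- \<gamma> * (2 * l)) \<le> (A * \<gamma>) * ?E" using assms \<gamma>0 by (intro mult_left_mono) auto
    then show ?thesis by simp
  qed
  finally show ?thesis .
qed

lemma face_barrier_lower:
  fixes \<gamma> A r l :: real
  assumes "0 < \<gamma>" "0 \<le> A" "0 \<le> r" "r \<le> 2 * l"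
  shows "A * (\<gamma> * exp (- \<gamma> * (2 * l))) * r \<le> A * (1 - exp (- \<gamma> * r))"
proof -
  have "1 + \<gamma> * r \<le> exp (\<gamma> * r)" by (rule exp_ge_add_one_self)
  then have "exp (- \<gamma> * r) * (1 + \<gamma> * r) \<le> exp (- \<gamma> * r) * exp (\<gamma> * r)" by (intro mult_left_mono) auto
  then have "exp (- \<gamma> * r) * (\<gamma> * r) \<le> 1 - exp (- \<gamma> * r)" by (simp add: algebra_simps exp_add[symmetric])
  moreover have "exp (- \<gamma> * (2 * l)) * (\<gamma> * r) \<le> exp (- \<gamma> * r) * (\<gamma> * r)"
    using assms by (intro mult_right_mono) auto
  ultimately have "exp (- \<gamma> * (2 * l)) * (\<gamma> * r) \<le> 1 - exp (- \<gamma> * r)" by linarith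
  then have "A * (exp (- \<gamma> * (2 * l)) * (\<gamma> * r)) \<le> A * (1 - exp (- \<gamma> * r))" using assms by (intro mult_left_mono) auto
  then show ?thesis by (simp add: mult_ac)
qed

lemma face_barrier_upper: "0 \<le> A \<Longrightarrow> A * (1 - exp (- \<gamma> * r)) \<le> A * (\<gamma> * r)" for r :: real
  using exp_ge_add_one_self[of "- \<gamma> * r"] by (intro mult_left_mono) auto

section \<open>Consequences of the conditions on the coefficients\<close>

lemma linear_Basis_expansion:
  fixes f :: "'a::euclidean_space \<Rightarrow> 'b::real_vector"
  assumes "linear f"
  shows "f x = (\<Sum>v\<in>Basis. (x \<bullet> v) *\<^sub>R f v)"
proof -
  have "f x = f (\<Sum>v\<in>Basis. (x \<bullet> v) *\<^sub>R v)" by (simp only: euclidean_representation)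
  also have "\<dots> = (\<Sum>v\<in>Basis. (x \<bullet> v) *\<^sub>R f v)" by (simp add: linear_sum[OF assms] linear_cmul[OF assms])
  finally show ?thesis .
qed

lemma C1_bdd_partialsE:
  fixes f :: "'a::euclidean_space \<Rightarrow> 'b::euclidean_space"
  assumes "C1_bdd_partials S f"
  obtains f' B where "\<And>z. z \<in> S \<Longrightarrow> (f has_derivative f' z) (at z within S)"
    "\<And>v. v \<in> Basis \<Longrightarrow> continuous_on S (\<lambda>z. f' z v)"
    "0 \<le> B" "\<And>z h. z \<in> S \<Longrightarrow> norm (f' z h) \<le> B * norm h"
proof -
  obtain f' where f': "\<And>z. z \<in> S \<Longrightarrow> (f has_derivative f' z) (at z within S)"
    and c: "\<And>v. v \<in> Basis \<Longrightarrow> continuous_on S (\<lambda>z. f' z v)"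
    and b: "\<And>v. v \<in> Basis \<Longrightarrow> bounded ((\<lambda>z. f' z v) ` S)"
    using assms unfolding C1_bdd_partials_def by blast
  have "\<exists>B>0. \<forall>z\<in>S. norm (f' z v) \<le> B" if "v \<in> Basis" for v
    using b[OF that] by (simp add: bounded_pos)
  then obtain Bv where Bv: "\<And>v. v \<in> Basis \<Longrightarrow> Bv v > 0" "\<And>v z. v \<in> Basis \<Longrightarrow> z \<in> S \<Longrightarrow> norm (f' z v) \<le> Bv v"
    by metis
  show thesis
  proof (rule that[of f' "\<Sum>v\<in>Basis. Bv v", OF f' c])
    show "0 \<le> (\<Sum>v\<in>Basis. Bv v)" using Bv(1) by (intro sum_nonneg) (auto simp: less_imp_le)
    fix z h assume z: "z \<in> S"
    have "linear (f' z)" using f'[OF z] by (rule has_derivative_linear)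
    then have "f' z h = (\<Sum>v\<in>Basis. (h \<bullet> v) *\<^sub>R f' z v)" by (rule linear_Basis_expansion)
    also have "norm \<dots> \<le> (\<Sum>v\<in>Basis. norm h * Bv v)"
      by (rule sum_norm_le) (auto intro!: mult_mono Basis_le_norm Bv z)
    finally show "norm (f' z h) \<le> (\<Sum>v\<in>Basis. Bv v) * norm h" by (simp add: sum_distrib_left mult.commute)
  qed
qed

lemma C1_bdd_partials_continuous:
  assumes "C1_bdd_partials S f" shows "continuous_on S f"
proof -
  obtain f' where "\<And>z. z \<in> S \<Longrightarrow> (f has_derivative f' z) (at z within S)"
    using assms unfolding C1_bdd_partials_def by blast
  then show ?thesis by (auto simp: continuous_on_eq_continuous_within intro: has_derivative_continuous)
qed

lemma convex_strip: "convex ({0..T::real} \<times> (UNIV :: 'a::real_vector set))"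
  by (intro convex_Times convex_real_interval) auto

lemma C1_bdd_partials_Lipschitz:
  fixes f :: "real \<Rightarrow> 'a::euclidean_space \<Rightarrow> 'c::euclidean_space \<Rightarrow> 'b::euclidean_space"
  assumes "C1_bdd_partials ({0..T} \<times> UNIV) (\<lambda>(t, x, y). f t x y)"
  shows "\<exists>L\<ge>0. \<forall>t\<in>{0..T}. \<forall>x y x' y'. norm (f t x y - f t x' y') \<le> L * (norm (x - x') + norm (y - y'))"
proof -
  obtain f' B where f': "\<And>z. z \<in> {0..T} \<times> UNIV \<Longrightarrow> ((\<lambda>(t, x, y). f t x y) has_derivative f' z) (at z within {0..T} \<times> UNIV)"
    and B: "0 \<le> B" "\<And>z h. z \<in> {0..T} \<times> UNIV \<Longrightarrow> norm (f' z h) \<le> B * norm h"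
    using C1_bdd_partialsE[OF assms] by metis
  show ?thesis
  proof (intro exI[of _ B] conjI B ballI allI)
    fix t x y x' y' assume t: "t \<in> {0..T}"
    have "norm ((\<lambda>(t, x, y). f t x y) (t, x, y) - (\<lambda>(t, x, y). f t x y) (t, x', y')) \<le> B * norm ((t, x, y) - (t, x', y'))"
      by (rule differentiable_bound[OF convex_strip f']) (use t in \<open>auto intro!: onorm_le B(2)\<close>)
    also have "\<dots> \<le> B * (norm (x - x') + norm (y - y'))"
      using B(1) by (intro mult_left_mono) (auto simp: norm_Pair sqrt_sum_squares_le_sum)
    finally show "norm (f t x y - f t x' y') \<le> B * (norm (x - x') + norm (y - y'))" by simp
  qed
qed

lemma matrix_entry_le_norm: "\<bar>(A :: real^'d^'n) $ i $ k\<bar> \<le> norm A"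
  using component_le_norm_cart[of "A $ i" k] Finite_Cartesian_Product.norm_nth_le[of A i] by linarith

text \<open>
  The chain rule for \<open>z \<mapsto> \<sigma> t z (u z)\<close>. What matters is the order of quantifiers: the bound depends on \<open>u\<close> only
  through the bound \<open>G\<close> of its gradient, and is uniform in \<open>t\<close>.
\<close>
lemma diffusion_jet1:
  fixes \<sigma> :: "real \<Rightarrow> real^'n \<Rightarrow> real^'m \<Rightarrow> real^'d^'n"
  assumes C1: "C1_bdd_partials ({0..T} \<times> UNIV) (\<lambda>(t, x, y). \<sigma> t x y)"
    and C: "\<And>t x y. t \<in> {0..T} \<Longrightarrow> norm (\<sigma> t x y) \<le> C" and G: "0 \<le> G"
  shows "\<exists>CA\<ge>0. \<forall>t\<in>{0..T}. \<forall>D u u1. jet1 D u u1 \<longrightarrow> (\<forall>x\<in>D. \<forall>i. norm (u1 i x) \<le> G) \<longrightarrow>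
     (\<exists>A1. (\<forall>i j. jet1 D (\<lambda>z. diffusion \<sigma> t z (u z) $ i $ j) (A1 i j)) \<and> (\<forall>i j k. \<forall>z\<in>D. \<bar>A1 i j k z\<bar> \<le> CA))"
proof (cases "T < 0")
  case True
  then show ?thesis by auto
next
  case False
  obtain f' B where f': "\<And>z. z \<in> {0..T} \<times> UNIV \<Longrightarrow> ((\<lambda>(t, x, y). \<sigma> t x y) has_derivative f' z) (at z within {0..T} \<times> UNIV)"
    and cf': "\<And>v. v \<in> Basis \<Longrightarrow> continuous_on ({0..T} \<times> UNIV) (\<lambda>z. f' z v)"
    and B: "0 \<le> B" "\<And>z h. z \<in> {0..T} \<times> UNIV \<Longrightarrow> norm (f' z h) \<le> B * norm h"
    using C1_bdd_partialsE[OF C1] by metis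
  have C0: "0 \<le> C" using order_trans[OF norm_ge_zero C[of 0]] False by auto
  define S where "S = B * (1 + G)"
  have S: "0 \<le> S" using B G by (simp add: S_def)
  define CA where "CA = real (CARD('d)) * (C * S + S * C) / 2"
  have CA: "0 \<le> CA" using C0 S by (simp add: CA_def)
  show ?thesis
  proof (intro exI[of _ CA] conjI CA ballI allI impI)
    fix t D and u :: "real^'n \<Rightarrow> real^'m" and u1
    assume t: "t \<in> {0..T}" and u: "jet1 D u u1" and u1: "\<forall>x\<in>D. \<forall>i. norm (u1 i x) \<le> G"
    define s1 where "s1 = (\<lambda>k z. f' (t, z, u z) (0, axis k 1, u1 k z))"
    have lin: "linear (f' (t, z, u z))" for z using f'[of "(t, z, u z)"] t by (auto intro: has_derivative_linear)
    have js: "jet1 D (\<lambda>z. \<sigma> t z (u z)) s1"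
      unfolding jet1_def
    proof (intro conjI ballI allI)
      fix z assume z: "z \<in> D"
      have du: "(u has_derivative (\<lambda>v. \<Sum>i\<in>UNIV. v $ i *\<^sub>R u1 i z)) (at z)" using u z by (simp add: jet1_def)
      have 1: "((\<lambda>z. (t, z, u z)) has_derivative (\<lambda>v. (0, v, \<Sum>i\<in>UNIV. v $ i *\<^sub>R u1 i z))) (at z)"
        by (intro has_derivative_Pair has_derivative_const has_derivative_ident du)
      have "((\<lambda>z. (\<lambda>(t, x, y). \<sigma> t x y) (t, z, u z)) has_derivative
          (\<lambda>v. f' (t, z, u z) (0, v, \<Sum>i\<in>UNIV. v $ i *\<^sub>R u1 i z))) (at z within UNIV)"
        by (rule has_derivative_in_compose2[OF f' _ _ 1]) (use t in auto)
      moreover have "f' (t, z, u z) (0, v, \<Sum>i\<in>UNIV. v $ i *\<^sub>R u1 i z) = (\<Sum>i\<in>UNIV. v $ i *\<^sub>R s1 i z)" for v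
      proof -
        have "(0, v, \<Sum>i\<in>UNIV. v $ i *\<^sub>R u1 i z) = (\<Sum>i\<in>UNIV. v $ i *\<^sub>R (0 :: real, axis i (1::real), u1 i z))"
        proof -
          have "(\<Sum>i\<in>UNIV. v $ i *\<^sub>R axis i (1::real)) = v" by (simp add: basis_expansion scalar_mult_eq_scaleR[symmetric])
          then show ?thesis by (simp add: prod_eq_iff fst_sum snd_sum)
        qed
        then show ?thesis by (simp only: linear_sum[OF lin] linear_cmul[OF lin] s1_def)
      qed
      ultimately show "((\<lambda>z. \<sigma> t z (u z)) has_derivative (\<lambda>v. \<Sum>i\<in>UNIV. v $ i *\<^sub>R s1 i z)) (at z)" by simp
    next
      fix k
      have "s1 k = (\<lambda>z. \<Sum>v\<in>Basis. ((0, axis k 1, u1 k z) \<bullet> v) *\<^sub>R f' (t, z, u z) v)"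
        unfolding s1_def using linear_Basis_expansion[OF lin] by blast
      moreover have "continuous_on D (\<lambda>z. f' (t, z, u z) v)" if "v \<in> Basis" for v
        by (rule continuous_on_compose2[OF cf'[OF that]]) (use t jet1_continuous[OF u] in \<open>auto intro!: continuous_intros\<close>)
      moreover have "continuous_on D (\<lambda>z. (0, axis k 1, u1 k z) \<bullet> v)" for v :: "real \<times> (real^'n) \<times> (real^'m)"
        using jet1_continuous_partial[OF u] by (intro continuous_intros)
      ultimately show "continuous_on D (s1 k)" by (simp only:) (intro continuous_on_sum continuous_on_scaleR)
    qed
    have s1b: "norm (s1 k z) \<le> S" if "z \<in> D" for k z
    proof -
      have "norm (s1 k z) \<le> B * norm (0 :: real, axis k (1::real) :: real^'n, u1 k z)" unfolding s1_def by (rule B(2)) (use t in auto)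
      also have "\<dots> \<le> B * (1 + G)"
      proof (rule mult_left_mono[OF _ B(1)])
        have "norm (0 :: real, axis k (1::real) :: real^'n, u1 k z) \<le> norm (axis k (1::real) :: real^'n) + norm (u1 k z)"
        proof -
          have "norm (0 :: real, axis k (1::real) :: real^'n, u1 k z) = norm (axis k (1::real) :: real^'n, u1 k z)"
            by (simp add: norm_Pair[of 0])
          then show ?thesis by (simp only: norm_Pair[of "axis k 1"]) (rule sqrt_sum_squares_le_sum; simp)
        qed
        then show "norm (0 :: real, axis k (1::real) :: real^'n, u1 k z) \<le> 1 + G" using u1 that by (smt (verit) norm_axis_1)
      qed
      finally show ?thesis by (simp add: S_def)
    qed
    have je: "jet1 D (\<lambda>z. \<sigma> t z (u z) $ i $ k) (\<lambda>j z. s1 j z $ i $ k)" for i k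
      by (rule jet1_linear[OF _ js]) (intro bounded_linear_compose[OF bounded_linear_vec_nth bounded_linear_vec_nth])
    define A1 where "A1 = (\<lambda>i j k z. 1 / 2 * (\<Sum>q\<in>UNIV. \<sigma> t z (u z) $ i $ q * s1 k z $ j $ q + s1 k z $ i $ q * \<sigma> t z (u z) $ j $ q))"
    have "jet1 D (\<lambda>z. diffusion \<sigma> t z (u z) $ i $ j) (A1 i j)" for i j
    proof -
      have "jet1 D (\<lambda>z. 1 / 2 * (\<Sum>q\<in>UNIV. \<sigma> t z (u z) $ i $ q * \<sigma> t z (u z) $ j $ q)) (A1 i j)"
        unfolding A1_def by (intro jet1_cmult jet1_sum finite jet1_mult je)
      then show ?thesis by (rule jet1_cong) (auto simp: diffusion_component)
    qed
    moreover have "\<bar>A1 i j k z\<bar> \<le> CA" if z: "z \<in> D" for i j k z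
    proof -
      have e: "\<bar>\<sigma> t z (u z) $ i $ q\<bar> \<le> C" "\<bar>s1 k z $ i $ q\<bar> \<le> S" for i q
        using matrix_entry_le_norm[of "\<sigma> t z (u z)" i q] C[OF t, of z "u z"] matrix_entry_le_norm[of "s1 k z" i q] s1b[OF z, of k] by linarith+
      have "\<bar>\<Sum>q\<in>UNIV. \<sigma> t z (u z) $ i $ q * s1 k z $ j $ q + s1 k z $ i $ q * \<sigma> t z (u z) $ j $ q\<bar> \<le> (\<Sum>q\<in>(UNIV::'d set). C * S + S * C)"
      proof (rule order_trans[OF sum_abs sum_mono])
        fix q
        have "\<bar>\<sigma> t z (u z) $ i $ q * s1 k z $ j $ q\<bar> \<le> C * S" "\<bar>s1 k z $ i $ q * \<sigma> t z (u z) $ j $ q\<bar> \<le> S * C"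
          unfolding abs_mult using e C0 S by (auto intro!: mult_mono)
        then show "\<bar>\<sigma> t z (u z) $ i $ q * s1 k z $ j $ q + s1 k z $ i $ q * \<sigma> t z (u z) $ j $ q\<bar> \<le> C * S + S * C" by linarith
      qed
      then show ?thesis by (simp add: A1_def CA_def abs_mult)
    qed
    ultimately show "\<exists>A1. (\<forall>i j. jet1 D (\<lambda>z. diffusion \<sigma> t z (u z) $ i $ j) (A1 i j)) \<and> (\<forall>i j k. \<forall>z\<in>D. \<bar>A1 i j k z\<bar> \<le> CA)"
      by blast
  qed
qed

text \<open>
  Each component of the source is monotone in its own variable and vanishes where that variable does.
\<close>
lemma source_sign:
  assumes A5: "cond_A5 T bh" and t: "t \<in> {0..T}"
  shows "y $ k * bh t x y $ k \<le> 0" "y = 0 \<Longrightarrow> bh t x y = 0"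
proof -
  have r: "replace_coord k (y $ k) y = y" for k by (simp add: replace_coord_def vec_eq_iff)
  have z: "bh t x (replace_coord k 0 y) $ k = 0" and m: "antimono (\<lambda>s. bh t x (replace_coord k s y) $ k)" for k
    using A5 t unfolding cond_A5_def by blast+
  show "y $ k * bh t x y $ k \<le> 0"
  proof (cases "0 \<le> y $ k")
    case True
    then have "bh t x (replace_coord k (y $ k) y) $ k \<le> bh t x (replace_coord k 0 y) $ k" using m by (auto dest: antimonoD)
    then show ?thesis using True by (simp add: r z mult_nonneg_nonpos)
  next
    case False
    then have "bh t x (replace_coord k 0 y) $ k \<le> bh t x (replace_coord k (y $ k) y) $ k" using m[of k] by (auto dest!: antimonoD[of _ "y $ k" 0])
    then show ?thesis using False by (simp add: r z mult_nonpos_nonneg)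
  qed
  assume y: "y = 0"
  then have rp: "replace_coord k 0 y = y" for k using r[of k] by simp
  have "bh t x y $ k = 0" for k using z[of k] unfolding rp .
  then show "bh t x y = 0" by (simp add: vec_eq_iff)
qed

text \<open>
  Ellipticity and the bounds for \<open>b\<close> and \<open>bh\<close> hold where \<open>\<bar>y\<bar> \<le> M\<close>; the bound for the diffusion matrix and the Lipschitz
  bounds hold for all \<open>y\<close>.
\<close>
definition coef_bounds where
  "coef_bounds T b bh \<sigma> M Ca Cb \<nu> L \<longleftrightarrow> 0 \<le> Ca \<and> 0 \<le> Cb \<and> 0 < \<nu> \<and> 0 \<le> L \<and>
     (\<forall>t\<in>{0..T}. \<forall>x y. (\<forall>i j. \<bar>diffusion \<sigma> t x y $ i $ j\<bar> \<le> Ca) \<and>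
        (norm y \<le> M \<longrightarrow> (\<forall>i. \<nu> \<le> diffusion \<sigma> t x y $ i $ i) \<and> norm (b t x y) \<le> Cb \<and> norm (bh t x y) \<le> Cb) \<and>
        (\<forall>x' y'. norm (b t x y - b t x' y') \<le> L * (norm (x - x') + norm (y - y')) \<and>
           norm (bh t x y - bh t x' y') \<le> L * (norm (x - x') + norm (y - y'))) \<and>
        (\<forall>i j y'. \<bar>diffusion \<sigma> t x y $ i $ j - diffusion \<sigma> t x y' $ i $ j\<bar> \<le> L * norm (y - y')))"

lemma coef_bounds_exist:
  fixes b :: "real \<Rightarrow> real^'n \<Rightarrow> real^'m \<Rightarrow> real^'n" and \<sigma> :: "real \<Rightarrow> real^'n \<Rightarrow> real^'m \<Rightarrow> real^'d^'n"
  assumes T: "0 < T" and A1: "cond_A1 T b bh \<sigma> \<sigma>h g" and A2: "cond_A2 T \<sigma>" and A4: "cond_A4 T b bh" and A5: "cond_A5 T bh"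
    and M: "0 \<le> M"
  shows "\<exists>Ca Cb \<nu> L. coef_bounds T b bh \<sigma> M Ca Cb \<nu> L"
proof -
  have c1: "C1_bdd_partials ({0..T} \<times> UNIV) (\<lambda>(t, x, y). b t x y)" "C1_bdd_partials ({0..T} \<times> UNIV) (\<lambda>(t, x, y). bh t x y)"
    "C1_bdd_partials ({0..T} \<times> UNIV) (\<lambda>(t, x, y). \<sigma> t x y)" using A1 by (auto simp: cond_A1_def)
  obtain L1 where L1: "0 \<le> L1" "\<And>t x y x' y'. t \<in> {0..T} \<Longrightarrow> norm (b t x y - b t x' y') \<le> L1 * (norm (x - x') + norm (y - y'))"
    using C1_bdd_partials_Lipschitz[OF c1(1)] by metis
  obtain L2 where L2: "0 \<le> L2" "\<And>t x y x' y'. t \<in> {0..T} \<Longrightarrow> norm (bh t x y - bh t x' y') \<le> L2 * (norm (x - x') + norm (y - y'))"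
    using C1_bdd_partials_Lipschitz[OF c1(2)] by metis
  obtain L3 where L3: "0 \<le> L3" "\<And>t x y x' y'. t \<in> {0..T} \<Longrightarrow> norm (\<sigma> t x y - \<sigma> t x' y') \<le> L3 * (norm (x - x') + norm (y - y'))"
    using C1_bdd_partials_Lipschitz[OF c1(3)] by metis
  obtain \<nu> C where \<nu>: "positive_continuous \<nu>" and C: "0 < C" "\<And>t x y. t \<in> {0..T} \<Longrightarrow> norm (\<sigma> t x y) \<le> C"
    and ell: "\<And>t x y. t \<in> {0..T} \<Longrightarrow> loewner_le (\<nu> (norm y) *\<^sub>R mat 1) (\<sigma> t x y ** transpose (\<sigma> t x y))"
    using A2 unfolding cond_A2_def by blast
  obtain \<eta> where \<eta>: "\<forall>r\<ge>0. 0 < \<eta> r" "\<And>t x y. t \<in> {0..T} \<Longrightarrow> norm (b t x y) \<le> \<eta> (norm y)"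
    using A4 unfolding cond_A4_def by blast
  have "continuous_on {0..M} \<nu>" using \<nu> by (auto simp: positive_continuous_def intro: continuous_on_subset)
  then obtain r0 where r0: "r0 \<in> {0..M}" "\<And>r. r \<in> {0..M} \<Longrightarrow> \<nu> r0 \<le> \<nu> r"
    using continuous_attains_inf[of "{0..M}" \<nu>] M by auto
  define \<nu>0 where "\<nu>0 = \<nu> r0 / 2"
  have \<nu>0: "0 < \<nu>0" using \<nu> r0 by (auto simp: \<nu>0_def positive_continuous_def)
  let ?d = "real (CARD('d))"
  have ent: "\<bar>\<sigma> t x y $ i $ k\<bar> \<le> C" if "t \<in> {0..T}" for t x y i k
    using matrix_entry_le_norm[of "\<sigma> t x y" i k] C(2)[OF that, of x y] by linarith
  define Ca where "Ca = ?d * (C * C) / 2"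
  have Ca: "0 \<le> Ca" "\<bar>diffusion \<sigma> t x y $ i $ j\<bar> \<le> Ca" if "t \<in> {0..T}" for t x y i j
  proof -
    show "0 \<le> Ca" using C by (simp add: Ca_def)
    have "\<bar>\<Sum>k\<in>UNIV. \<sigma> t x y $ i $ k * \<sigma> t x y $ j $ k\<bar> \<le> (\<Sum>k\<in>(UNIV::'d set). C * C)"
      by (rule order_trans[OF sum_abs sum_mono]) (use ent[OF that] C in \<open>auto simp: abs_mult intro!: mult_mono\<close>)
    then show "\<bar>diffusion \<sigma> t x y $ i $ j\<bar> \<le> Ca" by (simp add: diffusion_component Ca_def)
  qed
  define L4 where "L4 = ?d * (2 * C * L3) / 2"
  have L4: "0 \<le> L4" using C L3 by (simp add: L4_def)
  have dif: "\<bar>diffusion \<sigma> t x y $ i $ j - diffusion \<sigma> t x y' $ i $ j\<bar> \<le> L4 * norm (y - y')" if t: "t \<in> {0..T}" for t x y y' i j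
  proof -
    have d: "\<bar>\<sigma> t x y $ i $ k - \<sigma> t x y' $ i $ k\<bar> \<le> L3 * norm (y - y')" for i k
      using matrix_entry_le_norm[of "\<sigma> t x y - \<sigma> t x y'" i k] L3(2)[OF t, of x y x y'] by simp
    have "\<bar>\<Sum>k\<in>UNIV. \<sigma> t x y $ i $ k * \<sigma> t x y $ j $ k - \<sigma> t x y' $ i $ k * \<sigma> t x y' $ j $ k\<bar>
       \<le> (\<Sum>k\<in>(UNIV::'d set). 2 * C * L3 * norm (y - y'))"
    proof (rule order_trans[OF sum_abs sum_mono])
      fix k
      let ?p = "\<sigma> t x y $ i $ k" and ?q = "\<sigma> t x y $ j $ k" and ?p' = "\<sigma> t x y' $ i $ k" and ?q' = "\<sigma> t x y' $ j $ k"
      have "?p * ?q - ?p' * ?q' = ?p * (?q - ?q') + (?p - ?p') * ?q'" by (simp add: algebra_simps)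
      also have "\<bar>\<dots>\<bar> \<le> \<bar>?p\<bar> * \<bar>?q - ?q'\<bar> + \<bar>?p - ?p'\<bar> * \<bar>?q'\<bar>" by (rule order_trans[OF abs_triangle_ineq]) (simp add: abs_mult)
      also have "\<dots> \<le> C * (L3 * norm (y - y')) + (L3 * norm (y - y')) * C"
        using ent[OF t] d C L3 by (intro add_mono mult_mono) auto
      finally show "\<bar>?p * ?q - ?p' * ?q'\<bar> \<le> 2 * C * L3 * norm (y - y')" by (simp add: algebra_simps)
    qed
    then have "\<bar>(\<Sum>k\<in>UNIV. \<sigma> t x y $ i $ k * \<sigma> t x y $ j $ k) - (\<Sum>k\<in>UNIV. \<sigma> t x y' $ i $ k * \<sigma> t x y' $ j $ k)\<bar> / 2
       \<le> ?d * (2 * C * L3 * norm (y - y')) / 2"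
      by (simp add: sum_subtractf)
    then show ?thesis by (simp add: diffusion_component L4_def abs_divide flip: diff_divide_distrib)
  qed
  have ellip: "\<nu>0 \<le> diffusion \<sigma> t x y $ i $ i" if t: "t \<in> {0..T}" and y: "norm y \<le> M" for t x y i
  proof -
    have "axis i 1 \<bullet> ((\<nu> (norm y) *\<^sub>R (mat 1 :: real^'n^'n)) *v axis i (1::real)) \<le> axis i 1 \<bullet> ((\<sigma> t x y ** transpose (\<sigma> t x y)) *v axis i (1::real))"
      using ell[OF t, of y x] unfolding loewner_le_def by (rule spec)
    moreover have e: "axis i 1 \<bullet> ((A :: real^'n^'n) *v axis i (1::real)) = A $ i $ i" for A
      by (simp add: matrix_vector_mult_basis inner_axis' column_def)
    ultimately have "(\<nu> (norm y) *\<^sub>R (mat 1 :: real^'n^'n)) $ i $ i \<le> (\<sigma> t x y ** transpose (\<sigma> t x y)) $ i $ i"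
      unfolding e by blast
    then have "\<nu> (norm y) \<le> (\<sigma> t x y ** transpose (\<sigma> t x y)) $ i $ i" by (simp add: mat_def)
    moreover have "\<nu> r0 \<le> \<nu> (norm y)" using r0(2) y by simp
    ultimately show ?thesis by (simp add: diffusion_def \<nu>0_def)
  qed
  have bb: "norm (b t x y) \<le> \<eta> 0 + L1 * M" if t: "t \<in> {0..T}" and y: "norm y \<le> M" for t x y
  proof -
    have "norm (b t x y) \<le> norm (b t x 0) + norm (b t x y - b t x 0)" by (metis add.commute diff_add_cancel norm_triangle_ineq)
    also have "\<dots> \<le> \<eta> (norm (0::real^'m)) + L1 * (norm (x - x) + norm (y - 0))" by (intro add_mono \<eta>(2) L1(2) t)
    also have "\<dots> \<le> \<eta> 0 + L1 * M" using y L1(1) by (simp add: mult_left_mono)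
    finally show ?thesis .
  qed
  have bhb: "norm (bh t x y) \<le> L2 * M" if t: "t \<in> {0..T}" and y: "norm y \<le> M" for t x y
  proof -
    have "norm (bh t x y) \<le> L2 * norm y" using L2(2)[OF t, of x y x 0] source_sign(2)[OF A5 t, of 0 x] by simp
    also have "\<dots> \<le> L2 * M" using y L2(1) by (simp add: mult_left_mono)
    finally show ?thesis .
  qed
  have up: "r \<le> (L1 + L2 + L4) * s" if "0 \<le> s" "r \<le> L1 * s \<or> r \<le> L2 * s \<or> r \<le> L4 * s" for r s
  proof -
    have "0 \<le> L1 * s" "0 \<le> L2 * s" "0 \<le> L4 * s" using that(1) L1(1) L2(1) L4 by auto
    then show ?thesis using that(2) by (auto simp: algebra_simps)
  qed
  have "coef_bounds T b bh \<sigma> M Ca (\<eta> 0 + L1 * M + L2 * M) \<nu>0 (L1 + L2 + L4)"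
    unfolding coef_bounds_def
  proof (intro conjI ballI allI impI)
    show "0 \<le> Ca" using Ca(1)[of 0] T by simp
    have e0: "0 \<le> \<eta> 0" "0 \<le> L1 * M" "0 \<le> L2 * M" using \<eta>(1) L1(1) L2(1) M by (auto simp: less_imp_le)
    then show "0 \<le> \<eta> 0 + L1 * M + L2 * M" by simp
    show "0 < \<nu>0" by (rule \<nu>0)
    show "0 \<le> L1 + L2 + L4" using L1(1) L2(1) L4 by simp
    fix t x y assume t: "t \<in> {0..T}"
    show "\<bar>diffusion \<sigma> t x y $ i $ j\<bar> \<le> Ca" for i j by (rule Ca(2)[OF t])
    show "norm (b t x y - b t x' y') \<le> (L1 + L2 + L4) * (norm (x - x') + norm (y - y'))" for x' y'
      by (rule up) (use L1(2)[OF t] in auto)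
    show "norm (bh t x y - bh t x' y') \<le> (L1 + L2 + L4) * (norm (x - x') + norm (y - y'))" for x' y'
      by (rule up) (use L2(2)[OF t] in auto)
    show "\<bar>diffusion \<sigma> t x y $ i $ j - diffusion \<sigma> t x y' $ i $ j\<bar> \<le> (L1 + L2 + L4) * norm (y - y')" for i j y'
      by (rule up) (use dif[OF t] in auto)
    assume y: "norm y \<le> M"
    show "\<nu>0 \<le> diffusion \<sigma> t x y $ i $ i" for i by (rule ellip[OF t y])
    show "norm (b t x y) \<le> \<eta> 0 + L1 * M + L2 * M" "norm (bh t x y) \<le> \<eta> 0 + L1 * M + L2 * M"
      using bb[OF t y, of x] bhb[OF t y, of x] e0 by auto
  qed
  then show ?thesis by blast
qed

section \<open>Classical solutions\<close>

lemma classical_solution_jet2: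
  assumes "classical_solution T b bh \<sigma> D u" "open D" "t \<in> {0<..<T}"
  shows "jet2 D (u t) (\<lambda>i. partial i (u t)) (\<lambda>i j. partial i (partial j (u t)))"
proof -
  have C: "C12 T D u" using assms(1) by (simp add: classical_solution_def)
  have slice: "continuous_on D (\<lambda>x. f t x)" if "continuous_on ({0<..<T} \<times> D) (\<lambda>(t, x). f t x)" for f :: "real \<Rightarrow> real^'a \<Rightarrow> real^'b"
  proof -
    have "continuous_on D (\<lambda>x. (\<lambda>(t, x). f t x) (t, x))"
      by (rule continuous_on_compose2[OF that]) (use assms(3) in \<open>auto intro!: continuous_intros\<close>)
    then show ?thesis by simp
  qed
  have c: "continuous_on D (partial i (u t))" "continuous_on D (partial i (partial j (u t)))" for i j
    using C slice[of "\<lambda>t x. partial i (u t) x"] slice[of "\<lambda>t x. partial i (partial j (u t)) x"] unfolding C12_def by auto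
  show ?thesis
    unfolding jet2_def
    by (intro conjI allI jet1_of_partials assms(2) c) (use C assms(3) in \<open>auto simp: C12_def\<close>)
qed

lemma classical_solution_time:
  assumes "classical_solution T b bh \<sigma> D u" "t \<in> {0<..<T}" "x \<in> D"
  shows "((\<lambda>s. u s x) has_vector_derivative time_deriv u t x) (at t)"
  using assms unfolding classical_solution_def C12_def time_deriv_def by (simp add: vector_derivative_works)

lemma classical_solution_equation:
  assumes "classical_solution T b bh \<sigma> D u" "t \<in> {0<..<T}" "x \<in> D"
  shows "par_op (diffusion \<sigma> t x (u t x)) (b t x (u t x)) (time_deriv u t x)
    (\<lambda>i. partial i (u t) x) (\<lambda>i j. partial i (partial j (u t)) x) = - bh t x (u t x)"
  using assms unfolding classical_solution_def par_op_def grad_inner_def by (simp add: add_eq_0_iff2)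

lemma classical_solution_continuous:
  assumes "classical_solution T b bh \<sigma> D u"
  shows "continuous_on ({0<..<T} \<times> closure D) (\<lambda>(t, x). u t x)"
    and "t \<in> {0<..<T} \<Longrightarrow> continuous_on (closure D) (u t)"
    and "x \<in> D \<Longrightarrow> continuous_on {0<..T} (\<lambda>t. u t x)"
proof -
  have c: "continuous_on ({0<..<T} \<times> closure D \<union> {T} \<times> D) (\<lambda>(t, x). u t x)"
    using assms by (simp add: classical_solution_def)
  show "continuous_on ({0<..<T} \<times> closure D) (\<lambda>(t, x). u t x)"
    using continuous_on_subset[OF c] by blast
  show "continuous_on (closure D) (u t)" if "t \<in> {0<..<T}"
  proof -
    have "continuous_on (closure D) (\<lambda>x. (\<lambda>(t, x). u t x) (t, x))"
      by (rule continuous_on_compose2[OF c]) (use that in \<open>auto intro!: continuous_intros\<close>)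
    then show ?thesis by simp
  qed
  show "continuous_on {0<..T} (\<lambda>t. u t x)" if "x \<in> D"
  proof -
    have "continuous_on {0<..T} (\<lambda>t. (\<lambda>(t, x). u t x) (t, x))"
      by (rule continuous_on_compose2[OF c]) (use that closure_subset[of D] in \<open>auto intro!: continuous_intros\<close>)
    then show ?thesis by simp
  qed
qed

text \<open>
  The time derivative is bounded up to time \<open>T\<close>. The estimate extends to the lateral boundary by continuity at fixed
  \<open>t < T\<close>. It replaces continuity at the edge \<open>{T} \<times> \<partial>D\<close>, where a classical solution need not
  be continuous.
\<close>
lemma terminal_Lipschitz:
  assumes sol: "classical_solution T b bh \<sigma> D u" and g: "continuous_on UNIV g" and fin: "\<And>x. x \<in> D \<Longrightarrow> u T x = g x"
  shows "\<exists>C\<ge>0. \<forall>t\<in>{0<..<T}. \<forall>x\<in>closure D. norm (u t x - g x) \<le> C * (T - t)"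
proof -
  have "bounded ((\<lambda>(t, x). time_deriv u t x) ` ({0<..<T} \<times> D))" using sol by (simp add: classical_solution_def)
  then obtain C where C: "C > 0" "\<And>t x. t \<in> {0<..<T} \<Longrightarrow> x \<in> D \<Longrightarrow> norm (time_deriv u t x) \<le> C"
    by (auto simp: bounded_pos)
  show ?thesis
  proof (intro exI[of _ C] conjI ballI)
    show "0 \<le> C" using C by simp
    fix t x assume t: "t \<in> {0<..<T}" and x: "x \<in> closure D"
    show "norm (u t x - g x) \<le> C * (T - t)"
    proof (rule continuous_le_on_closure[OF _ x])
      show "continuous_on (closure D) (\<lambda>x. norm (u t x - g x))"
        by (intro continuous_intros classical_solution_continuous(2)[OF sol t] continuous_on_subset[OF g]) auto
      fix x assume x: "x \<in> D"
      have "norm (u T x - u t x) \<le> C * T - C * t"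
      proof (rule differentiable_bound_general)
        show "t < T" using t by simp
        show "continuous_on {t..T} (\<lambda>s. u s x)"
          by (rule continuous_on_subset[OF classical_solution_continuous(3)[OF sol x]]) (use t in auto)
        show "continuous_on {t..T} (\<lambda>s. C * s)" by (intro continuous_intros)
        fix s assume s: "t < s" "s < T"
        show "((\<lambda>s. u s x) has_vector_derivative time_deriv u s x) (at s)"
          by (rule classical_solution_time[OF sol _ x]) (use s t in auto)
        show "((\<lambda>s. C * s) has_vector_derivative C) (at s)"
          by (auto simp: has_real_derivative_iff_has_vector_derivative[symmetric] intro!: derivative_eq_intros)
        show "norm (time_deriv u s x) \<le> C" using C(2)[of s x] s t x by auto
      qed
      then show "norm (u t x - g x) \<le> C * (T - t)" using fin[OF x] by (simp add: norm_minus_commute algebra_simps)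
    qed
  qed
qed

lemma norm_le_CARD_infnorm: "norm v \<le> CARD('m) * infnorm v" for v :: "real^'m"
  by (rule norm_le_CARD) (rule component_le_infnorm_cart)

text \<open>
  By the sign of the source a largest component cannot grow backwards in time. The comparison function
  \<open>(M + \<eta>) exp (\<eta> (T - t))\<close> makes this strict, and \<open>\<eta>\<close> tends to zero in the end.
\<close>
lemma sup_bound:
  fixes u :: "real \<Rightarrow> real^'n \<Rightarrow> real^'m" and \<sigma> :: "real \<Rightarrow> real^'n \<Rightarrow> real^'m \<Rightarrow> real^'d^'n"
  assumes sol: "classical_solution T b bh \<sigma> D u" and D: "open D" "bounded D" and g: "continuous_on UNIV g"
    and fin: "\<And>x. x \<in> D \<Longrightarrow> u T x = g x" and A5: "cond_A5 T bh"
    and M: "0 < M" "\<And>x. infnorm (g x) \<le> M"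
    and bdry: "\<And>t x. t \<in> {0<..<T} \<Longrightarrow> x \<in> frontier D \<Longrightarrow> infnorm (u t x) \<le> M"
    and tx: "t \<in> {0<..<T}" "x \<in> closure D"
  shows "infnorm (u t x) \<le> M"
proof -
  obtain C where C: "0 \<le> C" "\<And>t x. t \<in> {0<..<T} \<Longrightarrow> x \<in> closure D \<Longrightarrow> norm (u t x - g x) \<le> C * (T - t)"
    using terminal_Lipschitz[OF sol g fin] by blast
  have main: "infnorm (u t x) \<le> (M + \<eta>) * exp (\<eta> * (T - t))" if \<eta>: "0 < \<eta>" for \<eta>
  proof -
    \<comment> \<open>The comparison ends before \<open>T\<close>, at a time when the solution is \<open>\<eta>\<close>-close to \<open>g\<close> on the whole closure
        of \<open>D\<close>.\<close>
    define t2 where "t2 = max ((t + T) / 2) (T - \<eta> / (C + 1))"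
    have t2: "t < t2" "t2 < T" "C * (T - t2) \<le> \<eta>"
    proof -
      show "t < t2" "t2 < T" using tx \<eta> C by (auto simp: t2_def add_nonneg_pos less_max_iff_disj)
      have "T - t2 \<le> \<eta> / (C + 1)" by (auto simp: t2_def)
      then have "C * (T - t2) \<le> C * (\<eta> / (C + 1))" using C by (intro mult_left_mono)
      also have "\<dots> \<le> \<eta>" using C \<eta> by (simp add: field_simps)
      finally show "C * (T - t2) \<le> \<eta>" .
    qed
    define \<Phi> where "\<Phi> = (\<lambda>s (x::real^'n). (M + \<eta>) * exp (\<eta> * (T - s)))"
    have \<Phi>ge: "M + \<eta> \<le> \<Phi> s x" if "s \<le> T" for s x
    proof -
      have "(M + \<eta>) * 1 \<le> (M + \<eta>) * exp (\<eta> * (T - s))" using M \<eta> that by (intro mult_left_mono) auto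
      then show ?thesis by (simp add: \<Phi>_def)
    qed
    have T0: "s \<in> {0<..<T}" if "s \<in> {t..t2}" for s using that tx t2 by auto
    have "infnorm (u t x) \<le> \<Phi> t x"
    proof (rule ratio_comparison[where X = "closure D" and U = D and ta = t and tb = t2 and y = u and \<sigma> = \<sigma> and b = "\<lambda>t x. b t x (u t x)" and w = u and \<Phi> = \<Phi>])
      show "compact (closure D)" using D by simp
      show "open D" "D \<subseteq> closure D" using D closure_subset by auto
      show "continuous_on ({t..t2} \<times> closure D) (\<lambda>(t, x). u t x)"
        by (rule continuous_on_subset[OF classical_solution_continuous(1)[OF sol]]) (use T0 in auto)
      show "continuous_on ({t..t2} \<times> closure D) (\<lambda>(t, x). \<Phi> t x)"
        unfolding \<Phi>_def case_prod_unfold by (intro continuous_intros)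
      show "0 < \<Phi> s x" if "s \<in> {t..t2}" for s x using M \<eta> by (simp add: \<Phi>_def)
      fix s x assume s: "s \<in> {t..t2}" and x: "x \<in> closure D" and or: "s = t2 \<or> x \<notin> D"
      show "infnorm (u s x) \<le> \<Phi> s x"
      proof (cases "s = t2")
        case True
        have "infnorm (u s x) \<le> infnorm (g x) + infnorm (u s x - g x)"
          using infnorm_triangle[of "g x" "u s x - g x"] by simp
        also have "\<dots> \<le> M + C * (T - s)"
          using M(2)[of x] C(2)[OF T0[OF s] x] infnorm_le_norm[of "u s x - g x"] by linarith
        also have "\<dots> \<le> M + \<eta>" using True t2 by simp
        finally show ?thesis using \<Phi>ge[of s x] T0[OF s] by simp
      next
        case False
        then have "x \<in> frontier D" using or x D by (auto simp: frontier_def interior_open)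
        then have "infnorm (u s x) \<le> M" using bdry T0[OF s] by simp
        then show ?thesis using \<Phi>ge[of s x] T0[OF s] \<eta> by simp
      qed
    next
      fix s x assume s: "s \<in> {t..<t2}" and x: "x \<in> D"
      show "((\<lambda>s. u s x) has_vector_derivative time_deriv u s x) (at s)"
        by (rule classical_solution_time[OF sol T0 x]) (use s in auto)
      show "((\<lambda>s. \<Phi> s x) has_vector_derivative (- \<eta> * \<Phi> s x)) (at s)"
        unfolding \<Phi>_def has_real_derivative_iff_has_vector_derivative[symmetric]
        by (auto intro!: derivative_eq_intros)
    next
      fix s assume s: "s \<in> {t..<t2}"
      show "jet2 D (u s) (\<lambda>i. partial i (u s)) (\<lambda>i j. partial i (partial j (u s)))"
        by (rule classical_solution_jet2[OF sol D(1) T0]) (use s in auto)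
      show "jet2 D (\<Phi> s) (\<lambda>i x. 0) (\<lambda>i j x. 0)" unfolding \<Phi>_def jet2_def by (auto intro: jet1_const)
    next
      fix s x k r
      assume s: "s \<in> {t..<t2}" and x: "x \<in> D" and r: "1 < r" and e1: "infnorm (u s x) = r * \<Phi> s x" and e2: "\<bar>u s x $ k\<bar> = r * \<Phi> s x"
      have s': "s \<in> {0<..<T}" by (rule T0) (use s in auto)
      have P: "0 < \<Phi> s x" using M \<eta> by (simp add: \<Phi>_def)
      have "u s x $ k * bh s x (u s x) $ k \<le> 0" by (rule source_sign(1)[OF A5]) (use s' in auto)
      then have "sgn (u s x $ k) * bh s x (u s x) $ k \<le> 0"
        by (auto simp: sgn_if mult_le_0_iff split: if_splits)
      moreover have "r * (- \<eta> * \<Phi> s x) < 0" using r \<eta> P by (simp add: mult_pos_pos)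
      ultimately show "r * par_op (diffusion \<sigma> s x (u s x)) (b s x (u s x)) (- \<eta> * \<Phi> s x) (\<lambda>i. 0) (\<lambda>i j. 0)
          < sgn (u s x $ k) * par_op (diffusion \<sigma> s x (u s x)) (b s x (u s x)) (time_deriv u s x)
             (\<lambda>i. partial i (u s) x) (\<lambda>i j. partial i (partial j (u s)) x) $ k"
        unfolding classical_solution_equation[OF sol s' x] by (simp add: par_op_def)
    next
      show "t \<in> {t..t2}" "x \<in> closure D" using t2 tx by auto
    qed
    then show ?thesis by (simp add: \<Phi>_def)
  qed
  have "((\<lambda>\<eta>. (M + \<eta>) * exp (\<eta> * (T - t))) \<longlongrightarrow> (M + 0) * exp (0 * (T - t))) (at_right 0)"
    by (intro tendsto_intros)
  then have "((\<lambda>\<eta>. (M + \<eta>) * exp (\<eta> * (T - t))) \<longlongrightarrow> M) (at_right 0)" by simp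
  then show ?thesis
    by (rule tendsto_lowerbound) (auto intro!: eventually_at_rightI[of 0 1] main)
qed

text \<open>
  The difference \<open>u - g\<close> satisfies a linear parabolic system whose right-hand side is bounded by \<open>Cb\<close> and the first and second derivatives
  of \<open>g\<close>, and \<open>A\<close> is so large that the operator applied to the face barrier lies below the
  negative of this bound. The same \<open>A\<close> appears on the boundary and inside, so the estimate can be iterated without loss.
  As for \<open>sup_bound\<close>, a constant \<open>\<eta>\<close> accounts for the approach to the terminal data.
\<close>
lemma face_comparison:
  fixes u :: "real \<Rightarrow> real^'n \<Rightarrow> real^'m" and \<sigma> :: "real \<Rightarrow> real^'n \<Rightarrow> real^'m \<Rightarrow> real^'d^'n" and g :: "real^'n \<Rightarrow> real^'m"
  assumes sol: "classical_solution T b bh \<sigma> D u" and D: "open D" "D \<subseteq> cube l"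
    and g: "jet2 UNIV g g1 g2" and fin: "\<And>x. x \<in> D \<Longrightarrow> u T x = g x"
    and cb: "coef_bounds T b bh \<sigma> M Ca Cb \<nu> L"
    and uM: "\<And>t x. t \<in> {0<..<T} \<Longrightarrow> x \<in> D \<Longrightarrow> norm (u t x) \<le> M"
    and gB: "\<And>x i. norm (g1 i x) \<le> Gb" "\<And>x i j. norm (g2 i j x) \<le> Gb"
    and \<gamma>: "\<gamma> = (Cb + 1) / \<nu>" and A: "0 \<le> A" "Cb + (real (CARD('n)))^2 * Ca * Gb + real (CARD('n)) * Cb * Gb < A * (\<gamma> * exp (- \<gamma> * (2 * l)))"
    and \<tau>: "\<tau> = 1 \<or> \<tau> = -1"
    and bdry: "\<And>t x. t \<in> {0<..<T} \<Longrightarrow> x \<in> frontier D \<Longrightarrow> infnorm (u t x - g x) \<le> A * (1 - exp (- \<gamma> * (l + \<tau> * x $ i)))"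
    and tx: "t \<in> {0<..<T}" "x \<in> closure D"
  shows "infnorm (u t x - g x) \<le> A * (1 - exp (- \<gamma> * (l + \<tau> * x $ i)))"
proof -
  have cg: "continuous_on UNIV g" using g by (auto simp: jet2_def intro: jet1_continuous)
  obtain C where C: "0 \<le> C" "\<And>t x. t \<in> {0<..<T} \<Longrightarrow> x \<in> closure D \<Longrightarrow> norm (u t x - g x) \<le> C * (T - t)"
    using terminal_Lipschitz[OF sol cg fin] by blast
  have K: "0 \<le> Ca" "0 \<le> Cb" "0 < \<nu>" using cb by (auto simp: coef_bounds_def)
  have \<gamma>0: "0 < \<gamma>" using \<gamma> K by simp
  have Gb: "0 \<le> Gb" using order_trans[OF norm_ge_zero gB(1)] by blast
  have "bounded (cube l :: (real^'n) set)"
  proof -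
    have "cube l \<subseteq> cbox (\<chi> i. -l) ((\<chi> i. l) :: real^'n)" by (auto simp: cube_def mem_box_cart less_imp_le)
    then show ?thesis using bounded_cbox bounded_subset by blast
  qed
  then have bD: "bounded D" using D bounded_subset by blast
  have clD: "0 \<le> l + \<tau> * x $ i \<and> l + \<tau> * x $ i \<le> 2 * l" if "x \<in> closure D" for x
  proof -
    have "cube l \<subseteq> cbox (\<chi> i. -l) ((\<chi> i. l) :: real^'n)" by (auto simp: cube_def mem_box_cart less_imp_le)
    then have "closure D \<subseteq> cbox (\<chi> i. -l) ((\<chi> i. l) :: real^'n)" using D by (intro closure_minimal) auto
    then have "-l \<le> x $ i \<and> x $ i \<le> l" using that by (auto simp: mem_box_cart)
    then show ?thesis using \<tau> by auto
  qed
  have main: "infnorm (u t x - g x) \<le> \<eta> + A * (1 - exp (- \<gamma> * (l + \<tau> * x $ i)))" if \<eta>: "0 < \<eta>" for \<eta>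
  proof -
    define t2 where "t2 = max ((t + T) / 2) (T - \<eta> / (C + 1))"
    have t2: "t < t2" "t2 < T" "C * (T - t2) \<le> \<eta>"
    proof -
      show "t < t2" "t2 < T" using tx \<eta> C by (auto simp: t2_def add_nonneg_pos less_max_iff_disj)
      have "T - t2 \<le> \<eta> / (C + 1)" by (auto simp: t2_def)
      then have "C * (T - t2) \<le> C * (\<eta> / (C + 1))" using C by (intro mult_left_mono)
      also have "\<dots> \<le> \<eta>" using C \<eta> by (simp add: field_simps)
      finally show "C * (T - t2) \<le> \<eta>" .
    qed
    let ?\<Phi> = "\<lambda>(s::real) x. face_barrier l \<gamma> \<eta> A i \<tau> x"
    have pos: "\<eta> \<le> face_barrier l \<gamma> \<eta> A i \<tau> x" if "x \<in> closure D" for x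
    proof -
      have "exp (- \<gamma> * (l + \<tau> * x $ i)) \<le> 1" using clD[OF that] \<gamma>0 by simp
      then show ?thesis using A by (simp add: face_barrier_def)
    qed
    have T0: "s \<in> {0<..<T}" if "s \<in> {t..t2}" for s using that tx t2 by auto
    have "infnorm (u t x - g x) \<le> face_barrier l \<gamma> \<eta> A i \<tau> x"
    proof (rule ratio_comparison[where X = "closure D" and U = D and ta = t and tb = t2 and y = u and \<sigma> = \<sigma> and b = "\<lambda>t x. b t x (u t x)"
          and w = "\<lambda>t x. u t x - g x" and \<Phi> = ?\<Phi>])
      show "compact (closure D)" using bD by simp
      show "open D" "D \<subseteq> closure D" using D closure_subset by auto
      have "continuous_on ({t..t2} \<times> closure D) (\<lambda>(t, x). u t x)"
        by (rule continuous_on_subset[OF classical_solution_continuous(1)[OF sol]]) (use T0 in auto)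
      moreover have "continuous_on ({t..t2} \<times> closure D) (\<lambda>p. g (snd p))"
        by (rule continuous_on_compose2[OF cg]) (auto intro!: continuous_intros)
      ultimately show "continuous_on ({t..t2} \<times> closure D) (\<lambda>(t, x). u t x - g x)"
        unfolding case_prod_unfold by (intro continuous_intros)
      show "continuous_on ({t..t2} \<times> closure D) (\<lambda>(t, x). ?\<Phi> t x)"
        unfolding face_barrier_def case_prod_unfold by (intro continuous_intros)
      show "0 < ?\<Phi> s x" if "s \<in> {t..t2}" "x \<in> closure D" for s x using pos[OF that(2)] \<eta> by simp
      fix s x assume s: "s \<in> {t..t2}" and x: "x \<in> closure D" and or: "s = t2 \<or> x \<notin> D"
      show "infnorm (u s x - g x) \<le> ?\<Phi> s x"
      proof (cases "s = t2")
        case True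
        have "infnorm (u s x - g x) \<le> C * (T - s)"
          using C(2)[OF T0[OF s] x] infnorm_le_norm[of "u s x - g x"] by linarith
        also have "\<dots> \<le> \<eta>" using True t2 by simp
        finally show ?thesis using pos[OF x] by simp
      next
        case False
        then have "x \<in> frontier D" using or x D by (auto simp: frontier_def interior_open)
        then show ?thesis using bdry[OF T0[OF s], of x] \<eta> by (simp add: face_barrier_def)
      qed
    next
      fix s x assume s: "s \<in> {t..<t2}" and x: "x \<in> D"
      have "((\<lambda>s. u s x) has_vector_derivative time_deriv u s x) (at s)"
        by (rule classical_solution_time[OF sol T0 x]) (use s in auto)
      then show "((\<lambda>s. u s x - g x) has_vector_derivative time_deriv u s x) (at s)"
        by (auto intro!: derivative_eq_intros)
      show "((\<lambda>s. ?\<Phi> s x) has_vector_derivative 0) (at s)" by simp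
    next
      fix s assume s: "s \<in> {t..<t2}"
      have "jet2 D (u s) (\<lambda>i. partial i (u s)) (\<lambda>i j. partial i (partial j (u s)))"
        by (rule classical_solution_jet2[OF sol D(1) T0]) (use s in auto)
      from jet2_diff[OF this jet2_subset[OF g]]
      show "jet2 D (\<lambda>x. u s x - g x) (\<lambda>i x. partial i (u s) x - g1 i x) (\<lambda>i j x. partial i (partial j (u s)) x - g2 i j x)" by simp
      show "jet2 D (?\<Phi> s) (face_barrier1 l \<gamma> A i \<tau>) (face_barrier2 l \<gamma> A i \<tau>)" by (rule face_barrier_jet2)
    next
      fix s x k r
      assume s: "s \<in> {t..<t2}" and x: "x \<in> D" and r: "1 < r"
        and e2: "\<bar>(u s x - g x) $ k\<bar> = r * ?\<Phi> s x"
      have s': "s \<in> {0<..<T}" by (rule T0) (use s in auto)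
      then have s'': "s \<in> {0..T}" by auto
      let ?a = "diffusion \<sigma> s x (u s x)" and ?b = "b s x (u s x)" and ?N = "real (CARD('n))"
      have aB: "\<bar>?a $ i $ j\<bar> \<le> Ca" "\<nu> \<le> ?a $ i $ i" for i j
        using cb s'' uM[OF s' x] by (auto simp: coef_bounds_def)
      have bB: "norm ?b \<le> Cb" "norm (bh s x (u s x)) \<le> Cb" using cb s'' uM[OF s' x] by (auto simp: coef_bounds_def)
      have bi: "\<bar>?b $ i\<bar> \<le> Cb" for i using component_le_norm_cart[of ?b i] bB by linarith
      let ?G = "par_op ?a ?b 0 (\<lambda>i. g1 i x) (\<lambda>i j. g2 i j x)"
      have nG: "norm ?G \<le> ?N^2 * Ca * Gb + ?N * Cb * Gb"
      proof -
        have "norm ?G \<le> norm (\<Sum>i\<in>UNIV. \<Sum>j\<in>UNIV. ?a $ i $ j *\<^sub>R g2 i j x) + norm (\<Sum>i\<in>UNIV. ?b $ i *\<^sub>R g1 i x)"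
          unfolding par_op_def add_0 by (rule norm_triangle_ineq)
        also have "\<dots> \<le> (\<Sum>i\<in>(UNIV::'n set). \<Sum>j\<in>(UNIV::'n set). Ca * Gb) + (\<Sum>i\<in>(UNIV::'n set). Cb * Gb)"
          by (intro add_mono sum_norm_le) (auto intro!: mult_mono aB bi gB K)
        also have "\<dots> = ?N^2 * Ca * Gb + ?N * Cb * Gb" by (simp add: power2_eq_square)
        finally show ?thesis .
      qed
      have split: "par_op ?a ?b (time_deriv u s x) (\<lambda>i. partial i (u s) x - g1 i x) (\<lambda>i j. partial i (partial j (u s)) x - g2 i j x)
         = - bh s x (u s x) - ?G"
        unfolding classical_solution_equation[OF sol s' x, symmetric] par_op_def
        by (simp add: scaleR_diff_right sum_subtractf)
      have "\<bar>sgn ((u s x - g x) $ k) * (- bh s x (u s x) - ?G) $ k\<bar> \<le> 1 * norm (- bh s x (u s x) - ?G)"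
        unfolding abs_mult by (intro mult_mono component_le_norm_cart) (auto simp: sgn_if)
      also have "\<dots> \<le> Cb + (?N^2 * Ca * Gb + ?N * Cb * Gb)"
        using norm_triangle_ineq4[of "- bh s x (u s x)" ?G] bB nG by simp
      finally have 1: "- (Cb + (?N^2 * Ca * Gb + ?N * Cb * Gb)) \<le> sgn ((u s x - g x) $ k) * (- bh s x (u s x) - ?G) $ k"
        by linarith
      let ?c = "A * (\<gamma> * exp (- \<gamma> * (2 * l)))"
      have c0: "0 \<le> ?c" using A \<gamma>0 by simp
      have "par_op ?a ?b 0 (\<lambda>j. face_barrier1 l \<gamma> A i \<tau> j x) (\<lambda>k j. face_barrier2 l \<gamma> A i \<tau> k j x) \<le> - ?c"
        by (rule face_barrier_operator[OF K(3) K(2) A(1) \<tau> _ aB(2) bi \<gamma>]) (use D x in auto)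
      then have "r * par_op ?a ?b 0 (\<lambda>j. face_barrier1 l \<gamma> A i \<tau> j x) (\<lambda>k j. face_barrier2 l \<gamma> A i \<tau> k j x) \<le> r * (- ?c)"
        using r by (intro mult_left_mono) auto
      also have "\<dots> \<le> 1 * (- ?c)" using r c0 by (intro mult_right_mono_neg) auto
      also have "\<dots> < - (Cb + (?N^2 * Ca * Gb + ?N * Cb * Gb))" using A(2) by simp
      finally show "r * par_op ?a ?b 0 (\<lambda>j. face_barrier1 l \<gamma> A i \<tau> j x) (\<lambda>k j. face_barrier2 l \<gamma> A i \<tau> k j x)
        < sgn ((u s x - g x) $ k) * par_op ?a ?b (time_deriv u s x) (\<lambda>i. partial i (u s) x - g1 i x) (\<lambda>i j. partial i (partial j (u s)) x - g2 i j x) $ k"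
        unfolding split using 1 by linarith
    next
      show "t \<in> {t..t2}" "x \<in> closure D" using t2 tx by auto
    qed
    then show ?thesis by (simp add: face_barrier_def)
  qed
  show ?thesis by (rule field_le_epsilon) (use main in \<open>simp add: add.commute\<close>)
qed

section \<open>Geometry of the slabs\<close>

definition cslab :: "'n \<Rightarrow> real \<Rightarrow> real \<Rightarrow> real \<Rightarrow> (real^'n) set" where
  "cslab e l c d = {x. (\<forall>i. i \<noteq> e \<longrightarrow> -l \<le> x $ i \<and> x $ i \<le> l) \<and> c \<le> x $ e \<and> x $ e \<le> d}"

lemma slab_box: "slab e l c d = box (\<chi> i. if i = e then c else -l) ((\<chi> i. if i = e then d else l) :: real^'n)"
  by (auto simp: slab_def mem_box_cart) (smt (verit))+

lemma cslab_cbox: "cslab e l c d = cbox (\<chi> i. if i = e then c else -l) ((\<chi> i. if i = e then d else l) :: real^'n)"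
  by (auto simp: cslab_def mem_box_cart) (smt (verit))+

lemma open_slab: "open (slab e l c d)" by (simp add: slab_box open_box)

lemma convex_slab: "convex (slab e l c d)" by (simp add: slab_box)

lemma closure_slab: "0 < l \<Longrightarrow> c < d \<Longrightarrow> closure (slab e l c d) = (cslab e l c d :: (real^'n) set)"
  unfolding slab_box cslab_cbox by (intro closure_box) (auto simp: interval_ne_empty_cart)

lemma slab_subset_cube: "-l \<le> c \<Longrightarrow> d \<le> l \<Longrightarrow> slab e l c d \<subseteq> cube l"
  by (auto simp: slab_def cube_def) (smt (verit))+

lemma cube_is_slab: "cube l = (slab e l (-l) l :: (real^'n) set)"
  by (auto simp: slab_def cube_def)

text \<open>
  The gradient is controlled only inside \<open>D\<close>. By convexity the segment from \<open>x\<close> to the boundary point \<open>y\<close> stays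
  inside, except possibly at its end point \<open>y\<close>.
\<close>
lemma lateral_Lipschitz:
  fixes u :: "real \<Rightarrow> real^'n \<Rightarrow> real^'m"
  assumes sol: "classical_solution T b bh \<sigma> D u" and D: "open D" "convex D"
    and x: "x \<in> D" and y: "y \<in> closure D" "x - y = r *\<^sub>R axis i 1" and t: "t \<in> {0<..<T}"
    and G: "\<And>z. z \<in> D \<Longrightarrow> norm (partial i (u t) z) \<le> G"
  shows "norm (u t x - u t y) \<le> G * \<bar>r\<bar>"
proof -
  have pt: "y + s *\<^sub>R (x - y) \<in> D" if "0 < s" "s \<le> 1" for s
  proof -
    have "y - s *\<^sub>R (y - x) \<in> interior D"
      by (rule mem_interior_closure_convex_shrink[OF D(2)]) (use x y that D in \<open>auto simp: interior_open\<close>)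
    moreover have "y - s *\<^sub>R (y - x) = y + s *\<^sub>R (x - y)" by (simp add: algebra_simps)
    ultimately show ?thesis using D by (simp add: interior_open)
  qed
  have j: "jet1 D (u t) (\<lambda>i. partial i (u t))"
    using classical_solution_jet2[OF sol D(1) t] by (simp add: jet2_def)
  have "norm (u t (y + 1 *\<^sub>R (x - y)) - u t (y + 0 *\<^sub>R (x - y))) \<le> G * \<bar>r\<bar> * 1 - G * \<bar>r\<bar> * 0"
  proof (rule differentiable_bound_general)
    show "(0::real) < 1" by simp
    have "y + s *\<^sub>R (x - y) \<in> closure D" if "s \<in> {0..1}" for s
      using pt[of s] closure_subset[of D] y that by (cases "s = 0") auto
    then show "continuous_on {0..1} (\<lambda>s. u t (y + s *\<^sub>R (x - y)))"
      by (intro continuous_on_compose2[OF classical_solution_continuous(2)[OF sol t]]) (auto intro!: continuous_intros)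
    show "continuous_on {0..1} (\<lambda>s. G * \<bar>r\<bar> * s)" by (intro continuous_intros)
    fix s :: real assume s: "0 < s" "s < 1"
    have "(\<Sum>k\<in>UNIV. (x - y) $ k *\<^sub>R partial k (u t) (y + s *\<^sub>R (x - y))) = r *\<^sub>R partial i (u t) (y + s *\<^sub>R (x - y))"
      unfolding y(2) using sum_axis_scaleR[of i "\<lambda>k. partial k (u t) (y + s *\<^sub>R r *\<^sub>R axis i 1)"]
      by (simp add: scaleR_sum_right[symmetric] flip: scaleR_scaleR)
    then show "((\<lambda>s. u t (y + s *\<^sub>R (x - y))) has_vector_derivative r *\<^sub>R partial i (u t) (y + s *\<^sub>R (x - y))) (at s)"
      using jet1_line[OF j pt, of s UNIV] s by simp
    show "((\<lambda>s. G * \<bar>r\<bar> * s) has_vector_derivative G * \<bar>r\<bar>) (at s)"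
      by (auto simp: has_real_derivative_iff_has_vector_derivative[symmetric] intro!: derivative_eq_intros)
    show "norm (r *\<^sub>R partial i (u t) (y + s *\<^sub>R (x - y))) \<le> G * \<bar>r\<bar>"
      using mult_left_mono[OF G[OF pt[of s]] abs_ge_zero[of r]] s by (simp add: mult.commute)
  qed
  then show ?thesis by simp
qed

section \<open>The Schwarz iteration\<close>

locale schwarz =
  fixes T l :: real
    and b :: "real \<Rightarrow> real^'n \<Rightarrow> real^'m \<Rightarrow> real^'n"
    and bh :: "real \<Rightarrow> real^'n \<Rightarrow> real^'m \<Rightarrow> real^'m"
    and \<sigma> :: "real \<Rightarrow> real^'n \<Rightarrow> real^'m \<Rightarrow> real^'d^'n"
    and \<sigma>h :: "real \<Rightarrow> real^'n \<Rightarrow> real^'m \<Rightarrow> real^'d^'m \<Rightarrow> real^'d^'m"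
    and g \<theta>0 :: "real^'n \<Rightarrow> real^'m"
    and e :: 'n
    and N :: nat
    and lo hi :: "nat \<Rightarrow> real"
    and \<theta> :: "real \<Rightarrow> real^'n \<Rightarrow> real^'m"
    and \<theta>pq :: "nat \<Rightarrow> nat \<Rightarrow> real \<Rightarrow> real^'n \<Rightarrow> real^'m"
  assumes T: "0 < T" and l: "0 < l"
    and A1: "cond_A1 T b bh \<sigma> \<sigma>h g"
    and A2: "cond_A2 T \<sigma>"
    and A4: "cond_A4 T b bh"
    and A5: "cond_A5 T bh"
    and P: "solves_P T b bh \<sigma> g l \<theta>"
    and chain: "overlapping_chain l N lo hi"
    and \<theta>0_bdd: "bounded (range \<theta>0)"
    and init: "\<forall>p\<in>{1..N}. \<forall>t\<in>{0<..<T}. \<forall>x\<in>slab e l (lo p) (hi p). \<theta>pq p 0 t x = \<theta>0 x"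
    and S: "\<forall>q\<ge>1. \<forall>p\<in>{1..N}. solves_S T b bh \<sigma> g e l N lo hi \<theta>pq p q"
begin

definition \<Omega> :: "nat \<Rightarrow> (real^'n) set" where "\<Omega> p = slab e l (lo p) (hi p)"

lemma chain_step: "p \<in> {1..<N} \<Longrightarrow> lo p < lo (p + 1) \<and> lo (p + 1) < hi p \<and> hi p < hi (p + 1)"
  using chain by (auto simp: overlapping_chain_def)

lemma chain_ends: "1 \<le> N" "lo 1 = -l" "hi N = l"
  using chain by (auto simp: overlapping_chain_def)

lemma pred_in: "p \<in> {1..N} \<Longrightarrow> p \<noteq> 1 \<Longrightarrow> p - 1 \<in> {1..<N} \<and> p - 1 + 1 = p"
  by auto

lemma lo_less_hi: "p \<in> {1..N} \<Longrightarrow> lo p < hi p"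
proof (cases "p = N")
  case False
  then show "p \<in> {1..N} \<Longrightarrow> lo p < hi p" using chain_step[of p] by force
next
  case True
  assume p: "p \<in> {1..N}"
  show "lo p < hi p"
  proof (cases "p = 1")
    case True
    then show ?thesis using \<open>p = N\<close> chain_ends l by simp
  next
    case False
    then show ?thesis using chain_step[of "p - 1"] pred_in[OF p] by force
  qed
qed

lemma chain_bounds: "p \<in> {1..N} \<Longrightarrow> -l \<le> lo p" "p \<in> {1..N} \<Longrightarrow> hi p \<le> l"
  using overlapping_chain_bounds[OF chain] by auto

lemma lo_inner: "p \<in> {1..N} \<Longrightarrow> p \<noteq> 1 \<Longrightarrow> -l < lo p"
  using chain_step[of "p - 1"] pred_in[of p] chain_bounds(1)[of "p - 1"] by force

lemma hi_inner: "p \<in> {1..N} \<Longrightarrow> p \<noteq> N \<Longrightarrow> hi p < l"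
  using chain_step[of p] chain_bounds(2)[of "p + 1"] by force

lemma \<Omega>_facts:
  assumes "p \<in> {1..N}"
  shows "open (\<Omega> p)" "convex (\<Omega> p)" "\<Omega> p \<subseteq> cube l" "closure (\<Omega> p) = cslab e l (lo p) (hi p)"
    "bounded (\<Omega> p)" "\<Omega> p \<noteq> {}"
proof -
  show "open (\<Omega> p)" "convex (\<Omega> p)" by (simp_all add: \<Omega>_def open_slab convex_slab)
  show "\<Omega> p \<subseteq> cube l" unfolding \<Omega>_def by (intro slab_subset_cube chain_bounds assms)
  show "closure (\<Omega> p) = cslab e l (lo p) (hi p)" unfolding \<Omega>_def by (rule closure_slab[OF l lo_less_hi[OF assms]])
  show "bounded (\<Omega> p)" by (simp add: \<Omega>_def slab_box)
  show "\<Omega> p \<noteq> {}" unfolding \<Omega>_def slab_box using l lo_less_hi[OF assms] by (auto simp: interval_ne_empty_cart)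
qed

lemma face_lo: "p \<in> {1..N} \<Longrightarrow> p \<noteq> 1 \<Longrightarrow> p - 1 \<in> {1..N} \<and> face e l (lo p) \<subseteq> \<Omega> (p - 1)"
  using chain_step[of "p - 1"] pred_in[of p] by (auto simp: face_def \<Omega>_def slab_def)

lemma face_hi: "p \<in> {1..N} \<Longrightarrow> p \<noteq> N \<Longrightarrow> p + 1 \<in> {1..N} \<and> face e l (hi p) \<subseteq> \<Omega> (p + 1)"
  using chain_step[of p] by (auto simp: face_def \<Omega>_def slab_def)

lemma iterate:
  assumes "p \<in> {1..N}" "1 \<le> q"
  shows "classical_solution T b bh \<sigma> (\<Omega> p) (\<theta>pq p q)" "\<And>x. x \<in> \<Omega> p \<Longrightarrow> \<theta>pq p q T x = g x"
    "\<And>t x. t \<in> {0<..<T} \<Longrightarrow> x \<in> face e l (lo p) \<Longrightarrow> \<theta>pq p q t x = (if p = 1 then g x else \<theta>pq (p - 1) (q - 1) t x)"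
    "\<And>t x. t \<in> {0<..<T} \<Longrightarrow> x \<in> face e l (hi p) \<Longrightarrow> \<theta>pq p q t x = (if p = N then g x else \<theta>pq (p + 1) (q - 1) t x)"
    "\<And>t x. t \<in> {0<..<T} \<Longrightarrow> x \<in> frontier (\<Omega> p) \<Longrightarrow> x \<notin> face e l (lo p) \<Longrightarrow> x \<notin> face e l (hi p) \<Longrightarrow> \<theta>pq p q t x = g x"
  using S assms unfolding solves_S_def \<Omega>_def by blast+

lemma limit:
  shows "classical_solution T b bh \<sigma> (cube l) \<theta>" "\<And>x. x \<in> cube l \<Longrightarrow> \<theta> T x = g x"
    "\<And>t x. t \<in> {0<..<T} \<Longrightarrow> x \<in> frontier (cube l) \<Longrightarrow> \<theta> t x = g x"
  using P unfolding solves_P_def by blast+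

text \<open>
  This drives the inductions over \<open>q\<close>: on the boundary of its slab an iterate equals \<open>g\<close> or a previous iterate at an
  interior point of a neighbouring slab.
\<close>
lemma frontier_values:
  assumes "p \<in> {1..N}" "1 \<le> q" "t \<in> {0<..<T}" "x \<in> frontier (\<Omega> p)"
  obtains "\<theta>pq p q t x = g x"
  | p' where "p' \<in> {1..N}" "x \<in> \<Omega> p'" "\<theta>pq p q t x = \<theta>pq p' (q - 1) t x"
proof -
  consider "x \<in> face e l (lo p)" | "x \<in> face e l (hi p)" | "x \<notin> face e l (lo p)" "x \<notin> face e l (hi p)" by blast
  then show thesis
  proof cases
    case 1
    then show ?thesis
      using iterate(3)[OF assms(1-3) 1] face_lo[OF assms(1)] that by (cases "p = 1") auto
  next
    case 2
    then show ?thesis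
      using iterate(4)[OF assms(1-3) 2] face_hi[OF assms(1)] that by (cases "p = N") auto
  next
    case 3
    then show ?thesis using iterate(5)[OF assms] that by blast
  qed
qed

lemma g_jet2: "jet2 UNIV g (\<lambda>i. partial i g) (\<lambda>i j. partial i (partial j g))"
  and g_bounded: "bounded (range g)"
  and g_bounds: "\<exists>Gb\<ge>0. (\<forall>x i. norm (partial i g x) \<le> Gb) \<and> (\<forall>x i j. norm (partial i (partial j g) x) \<le> Gb)"
proof -
  obtain \<delta> where h: "bdd_C2_Holder \<delta> g" using A1 unfolding cond_A1_def by blast
  then have "Ck (Suc (Suc 0)) g" by (simp add: bdd_C2_Holder_def numeral_2_eq_2)
  then show "jet2 UNIV g (\<lambda>i. partial i g) (\<lambda>i j. partial i (partial j g))"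
    unfolding jet2_def by (intro conjI allI jet1_of_partials) auto
  show "bounded (range g)" using h by (simp add: bdd_C2_Holder_def)
  have 1: "\<exists>B. \<forall>x. norm (partial i g x) \<le> B" and 2: "\<exists>B. \<forall>x. norm (partial i (partial j g) x) \<le> B" for i j
    using h unfolding bdd_C2_Holder_def bounded_iff by auto
  obtain B1 where B1: "\<And>i x. norm (partial i g x) \<le> B1 i" using 1 by metis
  obtain B2 where B2: "\<And>i j x. norm (partial i (partial j g) x) \<le> B2 i j" using 2 by metis
  have nn: "0 \<le> B1 i" "0 \<le> B2 i j" for i j using B1[of i 0] B2[of i j 0] by (auto intro: order_trans[OF norm_ge_zero])
  let ?G = "(\<Sum>i\<in>UNIV. B1 i) + (\<Sum>i\<in>UNIV. \<Sum>j\<in>UNIV. B2 i j)"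
  have a: "B1 i \<le> (\<Sum>i\<in>UNIV. B1 i)" for i by (rule member_le_sum) (auto simp: nn)
  have "B2 i j \<le> (\<Sum>j\<in>UNIV. B2 i j)" for i j by (rule member_le_sum) (auto simp: nn)
  moreover have "(\<Sum>j\<in>UNIV. B2 i j) \<le> (\<Sum>i\<in>UNIV. \<Sum>j\<in>UNIV. B2 i j)" for i
    by (rule member_le_sum[of i UNIV "\<lambda>i. \<Sum>j\<in>UNIV. B2 i j"]) (auto simp: nn sum_nonneg)
  ultimately have c: "B2 i j \<le> (\<Sum>i\<in>UNIV. \<Sum>j\<in>UNIV. B2 i j)" for i j by (meson order_trans)
  have n: "0 \<le> (\<Sum>i\<in>UNIV. B1 i)" "0 \<le> (\<Sum>i\<in>UNIV. \<Sum>j\<in>UNIV. B2 i j)" by (auto simp: nn sum_nonneg)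
  show "\<exists>Gb\<ge>0. (\<forall>x i. norm (partial i g x) \<le> Gb) \<and> (\<forall>x i j. norm (partial i (partial j g) x) \<le> Gb)"
  proof (intro exI[of _ ?G] conjI allI)
    show "0 \<le> ?G" using n by simp
    show "norm (partial i g x) \<le> ?G" for x i using B1[of i x] a[of i] n by linarith
    show "norm (partial i (partial j g) x) \<le> ?G" for x i j using B2[of i j x] c[of i j] n by linarith
  qed
qed

lemma g_continuous: "continuous_on UNIV g"
  using g_jet2 by (auto simp: jet2_def intro: jet1_continuous)

text \<open>
  A common bound for \<open>g\<close> and the initial guess passes from each iterate to the next through the interfaces.
\<close>
lemma uniform_bound:
  "\<exists>M>0. (\<forall>p\<in>{1..N}. \<forall>q\<ge>1. \<forall>t\<in>{0<..<T}. \<forall>x\<in>closure (\<Omega> p). norm (\<theta>pq p q t x) \<le> M)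
    \<and> (\<forall>t\<in>{0<..<T}. \<forall>x\<in>closure (cube l). norm (\<theta> t x) \<le> M) \<and> (\<forall>x. norm (g x) \<le> M)"
proof -
  obtain M1 where M1: "M1 > 0" "\<And>x. norm (g x) \<le> M1" using g_bounded by (auto simp: bounded_pos)
  obtain M2 where M2: "M2 > 0" "\<And>x. norm (\<theta>0 x) \<le> M2" using \<theta>0_bdd by (auto simp: bounded_pos)
  define M0 where "M0 = max M1 M2"
  have M0: "0 < M0" "infnorm (g x) \<le> M0" "infnorm (\<theta>0 x) \<le> M0" for x
    using M1 M2 infnorm_le_norm[of "g x"] infnorm_le_norm[of "\<theta>0 x"] by (auto simp: M0_def le_max_iff_disj intro: order_trans)
  have it: "\<forall>p\<in>{1..N}. \<forall>t\<in>{0<..<T}. \<forall>x\<in>closure (\<Omega> p). infnorm (\<theta>pq p (Suc q) t x) \<le> M0" for q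
  proof (induction q)
    case 0
    show ?case
    proof (intro ballI)
      fix p t x assume p: "p \<in> {1..N}" and t: "t \<in> {0<..<T}" and x: "x \<in> closure (\<Omega> p)"
      show "infnorm (\<theta>pq p (Suc 0) t x) \<le> M0"
      proof (rule sup_bound[OF iterate(1)[OF p] \<Omega>_facts(1,5)[OF p] g_continuous iterate(2)[OF p] A5 M0(1,2) _ t x])
        fix t x assume t: "t \<in> {0<..<T}" and x: "x \<in> frontier (\<Omega> p)"
        show "infnorm (\<theta>pq p (Suc 0) t x) \<le> M0"
          by (rule frontier_values[OF p _ t x, of "Suc 0"]) (use M0 init t in \<open>auto simp: \<Omega>_def\<close>)
      qed auto
    qed
  next
    case (Suc q)
    show ?case
    proof (intro ballI)
      fix p t x assume p: "p \<in> {1..N}" and t: "t \<in> {0<..<T}" and x: "x \<in> closure (\<Omega> p)"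
      show "infnorm (\<theta>pq p (Suc (Suc q)) t x) \<le> M0"
      proof (rule sup_bound[OF iterate(1)[OF p] \<Omega>_facts(1,5)[OF p] g_continuous iterate(2)[OF p] A5 M0(1,2) _ t x])
        fix t x assume t: "t \<in> {0<..<T}" and x: "x \<in> frontier (\<Omega> p)"
        show "infnorm (\<theta>pq p (Suc (Suc q)) t x) \<le> M0"
        proof (rule frontier_values[OF p _ t x, of "Suc (Suc q)"])
          show "1 \<le> Suc (Suc q)" by simp
        next
          assume "\<theta>pq p (Suc (Suc q)) t x = g x"
          then show ?thesis using M0 by simp
        next
          fix p' assume "p' \<in> {1..N}" "x \<in> \<Omega> p'" "\<theta>pq p (Suc (Suc q)) t x = \<theta>pq p' (Suc (Suc q) - 1) t x"
          then show ?thesis using Suc.IH t closure_subset[of "\<Omega> p'"] by auto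
        qed
      qed auto
    qed
  qed
  have lim: "infnorm (\<theta> t x) \<le> M0" if "t \<in> {0<..<T}" "x \<in> closure (cube l)" for t x
  proof (rule sup_bound[OF limit(1) open_cube _ g_continuous limit(2) A5 M0(1,2) _ that])
    show "bounded (cube l :: (real^'n) set)" unfolding cube_is_slab[of l e] slab_box by simp
    show "infnorm (\<theta> t x) \<le> M0" if "t \<in> {0<..<T}" "x \<in> frontier (cube l)" for t x
      using limit(3)[OF that] M0 by simp
  qed
  let ?m = "real (CARD('m))"
  have conv: "norm v \<le> ?m * M0" if "infnorm v \<le> M0" for v :: "real^'m"
    by (rule order_trans[OF norm_le_CARD_infnorm]) (simp add: that mult_left_mono)
  show ?thesis
  proof (intro exI[of _ "?m * M0"] conjI ballI allI impI)
    show "0 < ?m * M0" using M0 by simp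
    show "norm (\<theta>pq p q t x) \<le> ?m * M0" if "p \<in> {1..N}" "1 \<le> q" "t \<in> {0<..<T}" "x \<in> closure (\<Omega> p)" for p q t x
      using conv it[of "q - 1"] that by auto
    show "norm (\<theta> t x) \<le> ?m * M0" if "t \<in> {0<..<T}" "x \<in> closure (cube l)" for t x
      by (rule conv[OF lim[OF that]])
    show "norm (g x) \<le> ?m * M0" for x by (rule conv[OF M0(2)])
  qed
qed

text \<open>
  From \<open>x\<close> one moves along the \<open>i\<close>-th axis to the face \<open>x\<^sub>i = - \<tau> l\<close>, where \<open>u = g\<close>; the distance is \<open>l + \<tau> x\<^sub>i\<close>. The
  hypothesis \<open>reach\<close> says that this face bounds the slab and is not cut off by an interface.
\<close>
lemma lateral_estimate:
  assumes sol: "classical_solution T b bh \<sigma> (slab e l c d) u" and cd: "-l \<le> c" "c < d" "d \<le> l"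
    and \<tau>: "\<tau> = 1 \<or> \<tau> = -1" and reach: "i \<noteq> e \<or> (\<tau> = 1 \<and> c = -l) \<or> (\<tau> = -1 \<and> d = l)"
    and face: "\<And>t y. t \<in> {0<..<T} \<Longrightarrow> y \<in> cslab e l c d \<Longrightarrow> y $ i = - \<tau> * l \<Longrightarrow> u t y = g y"
  shows "\<exists>C\<ge>0. \<forall>t\<in>{0<..<T}. \<forall>x\<in>cslab e l c d. norm (u t x - g x) \<le> C * (l + \<tau> * x $ i)"
proof -
  let ?D = "slab e l c d"
  obtain Gb where Gb: "0 \<le> Gb" "\<And>x i. norm (partial i g x) \<le> Gb" using g_bounds by blast
  have "bounded ((\<lambda>(t, x). partial i (u t) x) ` ({0<..<T} \<times> ?D))" using sol by (simp add: classical_solution_def)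
  then obtain G where G: "G > 0" "\<And>t x. t \<in> {0<..<T} \<Longrightarrow> x \<in> ?D \<Longrightarrow> norm (partial i (u t) x) \<le> G"
    by (auto simp: bounded_pos)
  have cl: "closure ?D = cslab e l c d" by (rule closure_slab[OF l cd(2)])
  have jg: "jet1 UNIV g (\<lambda>i. partial i g)" using g_jet2 by (simp add: jet2_def)
  let ?C = "G + CARD('n) * Gb"
  show ?thesis
  proof (intro exI[of _ ?C] conjI ballI)
    show "0 \<le> ?C" using G Gb by simp
    fix t x assume t: "t \<in> {0<..<T}" and x: "x \<in> cslab e l c d"
    have "norm (u t x - g x) - ?C * (l + \<tau> * x $ i) \<le> 0"
    proof (rule continuous_le_on_closure[of ?D])
      show "continuous_on (closure ?D) (\<lambda>x. norm (u t x - g x) - ?C * (l + \<tau> * x $ i))"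
        by (intro continuous_intros classical_solution_continuous(2)[OF sol t] continuous_on_subset[OF g_continuous]) auto
      show "x \<in> closure ?D" using x cl by simp
      fix x assume x: "x \<in> ?D"
      define y where "y = x - (x $ i + \<tau> * l) *\<^sub>R axis i 1"
      have yi: "y $ i = - \<tau> * l" by (simp add: y_def)
      have yk: "y $ k = x $ k" if "k \<noteq> i" for k using that by (simp add: y_def axis_def)
      have yD: "y \<in> cslab e l c d"
      proof -
        have "(k \<noteq> e \<longrightarrow> -l \<le> y $ k \<and> y $ k \<le> l)" for k
          using x yi yk[of k] \<tau> l by (cases "k = i") (auto simp: slab_def less_imp_le)
        moreover have "c \<le> y $ e \<and> y $ e \<le> d"
        proof (cases "i = e")
          case True
          then show ?thesis using reach yi cd l by auto
        next
          case False
          then show ?thesis using x yk[of e] by (auto simp: slab_def)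
        qed
        ultimately show ?thesis by (simp add: cslab_def)
      qed
      have xc: "x \<in> cube l" using x slab_subset_cube[OF cd(1,3)] by blast
      have r: "\<bar>x $ i + \<tau> * l\<bar> = l + \<tau> * x $ i"
        using \<tau> cube_pos[OF xc, of i] by auto
      have xy: "x - y = (x $ i + \<tau> * l) *\<^sub>R axis i 1" by (simp add: y_def)
      have "norm (u t x - u t y) \<le> G * \<bar>x $ i + \<tau> * l\<bar>"
        by (rule lateral_Lipschitz[OF sol open_slab convex_slab x _ xy t G(2)[OF t]]) (use yD cl in auto)
      moreover have "norm (g y - g x) \<le> CARD('n) * Gb * norm (y - x)"
        by (rule jet1_Lipschitz[OF jg convex_UNIV]) (auto simp: Gb)
      moreover have "norm (y - x) = \<bar>x $ i + \<tau> * l\<bar>" using xy by (metis norm_axis_1 norm_minus_commute norm_scaleR mult.right_neutral)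
      moreover have "u t y = g y" by (rule face[OF t yD yi])
      ultimately have "norm (u t x - g x) \<le> G * \<bar>x $ i + \<tau> * l\<bar> + CARD('n) * Gb * \<bar>x $ i + \<tau> * l\<bar>"
        by (metis norm_diff_triangle_le)
      then show "norm (u t x - g x) - ?C * (l + \<tau> * x $ i) \<le> 0" unfolding r by (simp add: algebra_simps)
    qed
    then show "norm (u t x - g x) \<le> ?C * (l + \<tau> * x $ i)" by simp
  qed
qed

lemma cslab_frontier:
  assumes "0 < l" "c < d" "y \<in> cslab e l c d" "y \<notin> slab e l c d"
  shows "y \<in> frontier (slab e l c d)"
  using assms closure_slab[OF assms(1,2), of e] by (simp add: frontier_def interior_open open_slab)

lemma limit_lateral: "\<exists>C\<ge>0. \<forall>t\<in>{0<..<T}. \<forall>x\<in>closure (cube l). \<forall>i. \<forall>\<tau>\<in>{1,-1}. norm (\<theta> t x - g x) \<le> C * (l + \<tau> * x $ i)"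
proof -
  have cl: "closure (cube l) = (cslab e l (-l) l :: (real^'n) set)" unfolding cube_is_slab[of l e] by (rule closure_slab) (use l in auto)
  have ex: "\<exists>C\<ge>0. \<forall>t\<in>{0<..<T}. \<forall>x\<in>cslab e l (-l) l. norm (\<theta> t x - g x) \<le> C * (l + \<tau> * x $ i)" if "\<tau> = 1 \<or> \<tau> = -1" for i \<tau>
  proof (rule lateral_estimate[OF limit(1)[unfolded cube_is_slab[of l e]] _ _ _ that])
    fix t y assume t: "t \<in> {0<..<T}" and y: "y \<in> cslab e l (-l) l" "y $ i = - \<tau> * l"
    have "y \<notin> slab e l (-l) l" using y that by (cases "i = e") (auto simp: slab_def)
    then show "\<theta> t y = g y" using cslab_frontier[OF l _ y(1)] l limit(3)[OF t] unfolding cube_is_slab[of l e] by simp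
  qed (use l that in auto)
  define Q where "Q = (\<lambda>i \<tau> C. 0 \<le> C \<and> (\<forall>t\<in>{0<..<T}. \<forall>x\<in>cslab e l (-l) l. norm (\<theta> t x - g x) \<le> C * (l + \<tau> * x $ i)))"
  define C where "C = (\<lambda>i \<tau>. SOME c. Q i \<tau> c)"
  have "Q i \<tau> (C i \<tau>)" if "\<tau> = 1 \<or> \<tau> = -1" for i \<tau>
    unfolding C_def by (rule someI_ex) (use ex[OF that, of i] in \<open>auto simp: Q_def\<close>)
  then have C: "\<And>i \<tau>. \<tau> = 1 \<or> \<tau> = -1 \<Longrightarrow> 0 \<le> C i \<tau>"
    "\<And>i \<tau> t x. \<tau> = 1 \<or> \<tau> = -1 \<Longrightarrow> t \<in> {0<..<T} \<Longrightarrow> x \<in> cslab e l (-l) l \<Longrightarrow> norm (\<theta> t x - g x) \<le> C i \<tau> * (l + \<tau> * x $ i)"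
    unfolding Q_def by blast+
  let ?C = "\<Sum>i\<in>UNIV. C i 1 + C i (-1)"
  have le: "C i \<tau> \<le> ?C" if "\<tau> = 1 \<or> \<tau> = -1" for i \<tau>
  proof -
    have "C i \<tau> \<le> C i 1 + C i (-1)" using that C(1)[of 1 i] C(1)[of "-1" i] by auto
    also have "\<dots> \<le> ?C" by (rule member_le_sum[of i UNIV "\<lambda>i. C i 1 + C i (-1)"]) (auto simp: C(1))
    finally show ?thesis .
  qed
  show ?thesis
  proof (intro exI[of _ ?C] conjI ballI allI)
    show "0 \<le> ?C" by (intro sum_nonneg) (auto simp: C(1))
    fix t \<tau> :: real and x :: "real^'n" and i :: 'n
    assume t: "t \<in> {0<..<T}" and x: "x \<in> closure (cube l)" and \<tau>: "\<tau> \<in> {1, -1::real}"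
    have "0 \<le> l + \<tau> * x $ i" using x \<tau> unfolding cl by (cases "i = e") (auto simp: cslab_def)
    then have "C i \<tau> * (l + \<tau> * x $ i) \<le> ?C * (l + \<tau> * x $ i)" using le[of \<tau> i] \<tau> by (intro mult_right_mono) auto
    then show "norm (\<theta> t x - g x) \<le> ?C * (l + \<tau> * x $ i)" using C(2)[of \<tau> t x i] t x \<tau> unfolding cl by auto
  qed
qed

text \<open>
  If the face bounds the slab, the gradient of the iterate gives the estimate. Otherwise the distance to the face
  is bounded below on the slab, and boundedness suffices.
\<close>
lemma first_iterate_lateral:
  assumes p: "p \<in> {1..N}" and \<tau>: "\<tau> = 1 \<or> \<tau> = -1"
  shows "\<exists>C\<ge>0. \<forall>t\<in>{0<..<T}. \<forall>x\<in>closure (\<Omega> p). norm (\<theta>pq p 1 t x - g x) \<le> C * (l + \<tau> * x $ i)"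
proof -
  note cl = \<Omega>_facts(4)[OF p]
  show ?thesis
  proof (cases "i \<noteq> e \<or> (\<tau> = 1 \<and> p = 1) \<or> (\<tau> = -1 \<and> p = N)")
    case True
    show ?thesis
      unfolding cl
    proof (rule lateral_estimate[OF iterate(1)[OF p, unfolded \<Omega>_def] chain_bounds(1)[OF p] lo_less_hi[OF p] chain_bounds(2)[OF p] \<tau>])
      show "i \<noteq> e \<or> \<tau> = 1 \<and> lo p = - l \<or> \<tau> = - 1 \<and> hi p = l" using True chain_ends by auto
      fix t y assume t: "t \<in> {0<..<T}" and y: "y \<in> cslab e l (lo p) (hi p)" "y $ i = - \<tau> * l"
      have nin: "y \<notin> slab e l (lo p) (hi p)" using y(2) True \<tau> chain_ends by (cases "i = e") (auto simp: slab_def)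
      then have fr: "y \<in> frontier (\<Omega> p)" unfolding \<Omega>_def by (rule cslab_frontier[OF l lo_less_hi[OF p] y(1)])
      consider "y \<in> face e l (lo p)" | "y \<in> face e l (hi p)" | "y \<notin> face e l (lo p)" "y \<notin> face e l (hi p)" by blast
      then show "\<theta>pq p 1 t y = g y"
      proof cases
        case 1
        then have "i = e" using y(2) \<tau> by (cases "i = e") (auto simp: face_def)
        then have "p = 1" using 1 True y(2) \<tau> chain_ends lo_inner[OF p] lo_less_hi[OF p] chain_bounds[OF p] l by (auto simp: face_def)
        then show ?thesis using iterate(3)[OF p _ t 1, of 1] by simp
      next
        case 2
        then have "i = e" using y(2) \<tau> by (cases "i = e") (auto simp: face_def)
        then have "p = N" using 2 True y(2) \<tau> chain_ends hi_inner[OF p] lo_less_hi[OF p] chain_bounds[OF p] l by (auto simp: face_def)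
        then show ?thesis using iterate(4)[OF p _ t 2, of 1] by simp
      next
        case 3
        then show ?thesis using iterate(5)[OF p _ t fr 3, of 1] by simp
      qed
    qed simp
  next
    case False
    then have ie: "i = e" and c: "\<tau> = 1 \<Longrightarrow> p \<noteq> 1" "\<tau> = -1 \<Longrightarrow> p \<noteq> N" by auto
    obtain M where M: "M > 0" "\<And>t x. t \<in> {0<..<T} \<Longrightarrow> x \<in> closure (\<Omega> p) \<Longrightarrow> norm (\<theta>pq p 1 t x) \<le> M" "\<And>x. norm (g x) \<le> M"
      using uniform_bound p by (metis order_refl)
    define \<delta> where "\<delta> = (if \<tau> = 1 then l + lo p else l - hi p)"
    have \<delta>: "0 < \<delta>" using \<tau> c lo_inner[OF p] hi_inner[OF p] by (auto simp: \<delta>_def)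
    show ?thesis
    proof (intro exI[of _ "2 * M / \<delta>"] conjI ballI)
      show "0 \<le> 2 * M / \<delta>" using M \<delta> by simp
      fix t x assume t: "t \<in> {0<..<T}" and x: "x \<in> closure (\<Omega> p)"
      have "\<delta> \<le> l + \<tau> * x $ i" using x \<tau> ie unfolding cl by (auto simp: cslab_def \<delta>_def)
      then have "2 * M / \<delta> * \<delta> \<le> 2 * M / \<delta> * (l + \<tau> * x $ i)" using M \<delta> by (intro mult_left_mono) auto
      then have "2 * M \<le> 2 * M / \<delta> * (l + \<tau> * x $ i)" using \<delta> by simp
      moreover have "norm (\<theta>pq p 1 t x - g x) \<le> 2 * M"
        using norm_triangle_ineq4[of "\<theta>pq p 1 t x" "g x"] M(2)[OF t x] M(3)[of x] by linarith
      ultimately show "norm (\<theta>pq p 1 t x - g x) \<le> 2 * M / \<delta> * (l + \<tau> * x $ i)" by linarith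
    qed
  qed
qed

text \<open>
  The gradient of an iterate is bounded, but the bound may depend on \<open>q\<close>. It is used for \<open>q = 1\<close> only; from then on \<open>face_comparison\<close>
  transports the estimate with one constant, as both kinds of boundary values in \<open>frontier_values\<close> satisfy it.
\<close>
lemma iterates_lateral:
  "\<exists>C\<ge>0. \<forall>p\<in>{1..N}. \<forall>q\<ge>1. \<forall>t\<in>{0<..<T}. \<forall>x\<in>closure (\<Omega> p). \<forall>i. \<forall>\<tau>\<in>{1,-1}.
     norm (\<theta>pq p q t x - g x) \<le> C * (l + \<tau> * x $ i)"
proof -
  obtain M where M: "M > 0" "\<And>p q t x. p \<in> {1..N} \<Longrightarrow> 1 \<le> q \<Longrightarrow> t \<in> {0<..<T} \<Longrightarrow> x \<in> closure (\<Omega> p) \<Longrightarrow> norm (\<theta>pq p q t x) \<le> M"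
    using uniform_bound by metis
  obtain Ca Cb \<nu> L where cb: "coef_bounds T b bh \<sigma> M Ca Cb \<nu> L"
    using coef_bounds_exist[OF T A1 A2 A4 A5 less_imp_le[OF M(1)]] by blast
  have K: "0 \<le> Ca" "0 \<le> Cb" "0 < \<nu>" using cb by (auto simp: coef_bounds_def)
  obtain Gb where Gb: "0 \<le> Gb" "\<And>x i. norm (partial i g x) \<le> Gb" "\<And>x i j. norm (partial i (partial j g) x) \<le> Gb"
    using g_bounds by blast
  define Q where "Q = (\<lambda>p i \<tau> C. 0 \<le> C \<and> (\<forall>t\<in>{0<..<T}. \<forall>x\<in>closure (\<Omega> p). norm (\<theta>pq p 1 t x - g x) \<le> C * (l + \<tau> * x $ i)))"
  define C where "C = (\<lambda>p i \<tau>. SOME c. Q p i \<tau> c)"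
  have "Q p i \<tau> (C p i \<tau>)" if "p \<in> {1..N}" "\<tau> = 1 \<or> \<tau> = -1" for p i \<tau>
    unfolding C_def by (rule someI_ex) (use first_iterate_lateral[OF that, of i] in \<open>auto simp: Q_def\<close>)
  then have C: "\<And>p i \<tau>. p \<in> {1..N} \<Longrightarrow> \<tau> = 1 \<or> \<tau> = -1 \<Longrightarrow> 0 \<le> C p i \<tau>"
    "\<And>p i \<tau> t x. p \<in> {1..N} \<Longrightarrow> \<tau> = 1 \<or> \<tau> = -1 \<Longrightarrow> t \<in> {0<..<T} \<Longrightarrow> x \<in> closure (\<Omega> p) \<Longrightarrow>
       norm (\<theta>pq p 1 t x - g x) \<le> C p i \<tau> * (l + \<tau> * x $ i)"
    unfolding Q_def by blast+
  define C1 where "C1 = (\<Sum>p\<in>{1..N}. \<Sum>i\<in>UNIV. C p i 1 + C p i (-1))"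
  have C1: "0 \<le> C1" unfolding C1_def by (intro sum_nonneg add_nonneg_nonneg C(1)) auto
  have le: "C p i \<tau> \<le> C1" if "p \<in> {1..N}" "\<tau> = 1 \<or> \<tau> = -1" for p i \<tau>
  proof -
    have "C p i \<tau> \<le> C p i 1 + C p i (-1)" using that C(1)[OF that(1), of 1 i] C(1)[OF that(1), of "-1" i] by auto
    also have "\<dots> \<le> (\<Sum>i\<in>UNIV. C p i 1 + C p i (-1))"
      by (rule member_le_sum[of i UNIV "\<lambda>i. C p i 1 + C p i (-1)"]) (auto simp: C(1)[OF that(1)])
    also have "\<dots> \<le> C1" unfolding C1_def
      by (rule member_le_sum[of p "{1..N}" "\<lambda>p. \<Sum>i\<in>UNIV. C p i 1 + C p i (-1)"]) (use that in \<open>auto intro!: sum_nonneg add_nonneg_nonneg C(1)\<close>)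
    finally show ?thesis .
  qed
  define \<gamma> where "\<gamma> = (Cb + 1) / \<nu>"
  have \<gamma>0: "0 < \<gamma>" using K by (simp add: \<gamma>_def)
  let ?c = "\<gamma> * exp (- \<gamma> * (2 * l))"
  have c0: "0 < ?c" using \<gamma>0 by simp
  let ?Cg = "Cb + (real (CARD('n)))^2 * Ca * Gb + real (CARD('n)) * Cb * Gb"
  have Cg: "0 \<le> ?Cg" using K Gb by simp
  \<comment> \<open>Large enough for \<open>face_comparison\<close> and for the face barrier to lie above the bound \<open>C1\<close> of the first iterates.\<close>
  define A where "A = (?Cg + C1 + 1) / ?c"
  have A: "0 \<le> A" "?Cg < A * ?c" "C1 \<le> A * ?c"
  proof -
    have Ac: "A * ?c = ?Cg + C1 + 1"
      using A_def nonzero_eq_divide_eq[OF less_imp_neq[OF c0, symmetric], of A "?Cg + C1 + 1"] by blast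
    show "0 \<le> A" using Cg C1 c0 by (simp add: A_def)
    show "?Cg < A * ?c" "C1 \<le> A * ?c" unfolding Ac using Cg C1 by linarith+
  qed
  have range: "0 \<le> l + \<tau> * x $ i \<and> l + \<tau> * x $ i \<le> 2 * l" if "p \<in> {1..N}" "x \<in> closure (\<Omega> p)" "\<tau> = 1 \<or> \<tau> = -1" for p x i \<tau>
    using that(2,3) chain_bounds[OF that(1)] unfolding \<Omega>_facts(4)[OF that(1)] by (cases "i = e") (auto simp: cslab_def)
  have main: "\<forall>p\<in>{1..N}. \<forall>t\<in>{0<..<T}. \<forall>x\<in>closure (\<Omega> p). infnorm (\<theta>pq p (Suc q) t x - g x) \<le> A * (1 - exp (- \<gamma> * (l + \<tau> * x $ i)))"
    if \<tau>: "\<tau> = 1 \<or> \<tau> = -1" for q i \<tau>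
  proof (induction q)
    case 0
    show ?case
    proof (intro ballI)
      fix p t x assume p: "p \<in> {1..N}" and t: "t \<in> {0<..<T}" and x: "x \<in> closure (\<Omega> p)"
      note r = range[OF p x \<tau>, of i]
      have "infnorm (\<theta>pq p (Suc 0) t x - g x) \<le> C p i \<tau> * (l + \<tau> * x $ i)"
        using C(2)[OF p \<tau> t x, of i] infnorm_le_norm[of "\<theta>pq p 1 t x - g x"] by simp
      also have "\<dots> \<le> A * ?c * (l + \<tau> * x $ i)" using r le[OF p \<tau>, of i] A(3) by (intro mult_right_mono) auto
      also have "\<dots> \<le> A * (1 - exp (- \<gamma> * (l + \<tau> * x $ i)))"
        using face_barrier_lower[OF \<gamma>0 A(1), of "l + \<tau> * x $ i" l] r by simp
      finally show "infnorm (\<theta>pq p (Suc 0) t x - g x) \<le> A * (1 - exp (- \<gamma> * (l + \<tau> * x $ i)))" .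
    qed
  next
    case (Suc q)
    show ?case
    proof (intro ballI)
      fix p t x assume p: "p \<in> {1..N}" and t: "t \<in> {0<..<T}" and x: "x \<in> closure (\<Omega> p)"
      show "infnorm (\<theta>pq p (Suc (Suc q)) t x - g x) \<le> A * (1 - exp (- \<gamma> * (l + \<tau> * x $ i)))"
      proof (rule face_comparison[OF iterate(1)[OF p] \<Omega>_facts(1,3)[OF p] g_jet2 iterate(2)[OF p] cb _ Gb(2,3) \<gamma>_def A(1,2) \<tau> _ t x])
        show "norm (\<theta>pq p (Suc (Suc q)) t x) \<le> M" if "t \<in> {0<..<T}" "x \<in> \<Omega> p" for t x
          using M(2)[OF p] that closure_subset[of "\<Omega> p"] by auto
        fix t x assume t: "t \<in> {0<..<T}" and x: "x \<in> frontier (\<Omega> p)"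
        have xc: "x \<in> closure (\<Omega> p)" using x by (simp add: frontier_def)
        show "infnorm (\<theta>pq p (Suc (Suc q)) t x - g x) \<le> A * (1 - exp (- \<gamma> * (l + \<tau> * x $ i)))"
        proof (rule frontier_values[OF p _ t x, of "Suc (Suc q)"])
          show "1 \<le> Suc (Suc q)" by simp
        next
          assume "\<theta>pq p (Suc (Suc q)) t x = g x"
          then show ?thesis using A(1) \<gamma>0 range[OF p xc \<tau>, of i] by (simp add: infnorm_0)
        next
          fix p' assume "p' \<in> {1..N}" "x \<in> \<Omega> p'" "\<theta>pq p (Suc (Suc q)) t x = \<theta>pq p' (Suc (Suc q) - 1) t x"
          then show ?thesis using Suc.IH t closure_subset[of "\<Omega> p'"] by auto
        qed
      qed auto
    qed
  qed
  let ?m = "real (CARD('m))"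
  show ?thesis
  proof (intro exI[of _ "?m * (A * \<gamma>)"] conjI ballI allI impI)
    show "0 \<le> ?m * (A * \<gamma>)" using A \<gamma>0 by simp
    fix p q :: nat and t \<tau> :: real and x :: "real^'n" and i :: 'n
    assume p: "p \<in> {1..N}" and q: "1 \<le> q" and t: "t \<in> {0<..<T}" and x: "x \<in> closure (\<Omega> p)" and \<tau>: "\<tau> \<in> {1, -1::real}"
    have "infnorm (\<theta>pq p (Suc (q - 1)) t x - g x) \<le> A * (1 - exp (- \<gamma> * (l + \<tau> * x $ i)))"
      using main[of \<tau> "q - 1" i] p t x \<tau> by blast
    also have "\<dots> \<le> A * (\<gamma> * (l + \<tau> * x $ i))" by (rule face_barrier_upper[OF A(1)])
    finally have a: "?m * infnorm (\<theta>pq p q t x - g x) \<le> ?m * (A * (\<gamma> * (l + \<tau> * x $ i)))"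
      using q by (intro mult_left_mono) auto
    show "norm (\<theta>pq p q t x - g x) \<le> ?m * (A * \<gamma>) * (l + \<tau> * x $ i)"
      unfolding mult.assoc by (rule order_trans[OF norm_le_CARD_infnorm a])
  qed
qed

section \<open>Mollification of the limit\<close>

definition mollified :: "real \<Rightarrow> real \<Rightarrow> real^'n \<Rightarrow> real^'m" where
  "mollified \<epsilon> t x = conv \<epsilon> kern (\<theta> t) x"

abbreviation "\<theta>1 t i \<equiv> partial i (\<theta> t)"
abbreviation "\<theta>2 t i j \<equiv> partial i (partial j (\<theta> t))"

lemma \<theta>_laplacian:
  "\<exists>G Lp. 0 \<le> G \<and> (\<forall>t\<in>{0<..<T}. bounded_laplacian (\<theta> t) (\<theta>1 t) (\<theta>2 t) l G Lp)"
proof -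
  have "\<exists>B>0. \<forall>t\<in>{0<..<T}. \<forall>x\<in>cube l. norm (\<theta>1 t i x) \<le> B" for i
  proof -
    have "bounded ((\<lambda>(t, x). \<theta>1 t i x) ` ({0<..<T} \<times> cube l))" using limit(1) by (simp add: classical_solution_def)
    then show ?thesis by (auto simp: bounded_pos)
  qed
  then obtain B where B: "\<And>i. B i > 0" "\<And>i t x. t \<in> {0<..<T} \<Longrightarrow> x \<in> cube l \<Longrightarrow> norm (\<theta>1 t i x) \<le> B i" by metis
  have "bounded ((\<lambda>(t, x). Laplacian (\<theta> t) x) ` ({0<..<T} \<times> cube l))" using limit(1) by (simp add: classical_solution_def)
  then have "\<exists>Lp. \<forall>t\<in>{0<..<T}. \<forall>x\<in>cube l. norm (\<Sum>i\<in>UNIV. \<theta>2 t i i x) \<le> Lp"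
    by (auto simp: bounded_pos Laplacian_def)
  then obtain Lp where Lp: "\<And>t x. t \<in> {0<..<T} \<Longrightarrow> x \<in> cube l \<Longrightarrow> norm (\<Sum>i\<in>UNIV. \<theta>2 t i i x) \<le> Lp"
    by blast
  have le: "B i \<le> (\<Sum>i\<in>UNIV. B i)" for i by (rule member_le_sum) (auto simp: less_imp_le B(1))
  show ?thesis
  proof (rule exI[of _ "\<Sum>i\<in>UNIV. B i"], intro exI[of _ Lp] conjI ballI)
    show "0 \<le> (\<Sum>i\<in>UNIV. B i)" by (intro sum_nonneg) (simp add: less_imp_le B(1))
    fix t assume t: "t \<in> {0<..<T}"
    show "bounded_laplacian (\<theta> t) (\<theta>1 t) (\<theta>2 t) l (\<Sum>i\<in>UNIV. B i) Lp"
    proof (rule bounded_laplacian.intro)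
      show "jet2 (cube l) (\<theta> t) (\<theta>1 t) (\<theta>2 t)" by (rule classical_solution_jet2[OF limit(1) open_cube t])
      show "norm (\<theta>1 t i z) \<le> (\<Sum>i\<in>UNIV. B i)" if "z \<in> cube l" for z i using B(2)[OF t that, of i] le[of i] by linarith
      show "norm (\<Sum>i\<in>UNIV. \<theta>2 t i i z) \<le> Lp" if "z \<in> cube l" for z by (rule Lp[OF t that])
    qed (rule l)
  qed
qed

lemma mollified_shift: "(\<And>i. \<bar>x $ i\<bar> \<le> l - 8 * \<epsilon>) \<Longrightarrow> 0 < \<epsilon> \<Longrightarrow> y \<in> box2 \<Longrightarrow> x - \<epsilon> *\<^sub>R y \<in> cube l"
  by (rule cube_shift) auto

lemma mollified_jet2:
  assumes t: "t \<in> {0<..<T}" and \<epsilon>: "0 < \<epsilon>"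
  shows "jet2 (cube (l - 8 * \<epsilon>)) (mollified \<epsilon> t) (\<lambda>i. conv \<epsilon> kern (\<theta>1 t i)) (\<lambda>i j. conv \<epsilon> kern (\<theta>2 t i j))"
proof -
  have j: "jet2 (cube l) (\<theta> t) (\<theta>1 t) (\<theta>2 t)" by (rule classical_solution_jet2[OF limit(1) open_cube t])
  have D: "x - \<epsilon> *\<^sub>R y \<in> cube l" if "x \<in> cube (l - 8 * \<epsilon>)" "y \<in> box2" for x y :: "real^'n"
    by (rule mollified_shift[OF _ \<epsilon> that(2)]) (use that(1) in \<open>auto simp: cube_def abs_le_iff less_imp_le\<close>, smt (verit))
  have "mollified \<epsilon> t = conv \<epsilon> kern (\<theta> t)" by (rule ext) (simp add: mollified_def)
  then show ?thesis
    using j conv_jet1[OF _ open_cube D kern_cont] unfolding jet2_def by auto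
qed

lemma mollified_time:
  assumes t: "t \<in> {0<..<T}" and \<epsilon>: "0 < \<epsilon>" and x: "\<And>i. \<bar>x $ i\<bar> \<le> l - 8 * \<epsilon>"
  shows "((\<lambda>t. mollified \<epsilon> t x) has_vector_derivative conv \<epsilon> kern (time_deriv \<theta> t) x) (at t)"
  unfolding mollified_def
proof (rule conv_time_deriv[OF t _ _ _ mollified_shift[OF x \<epsilon>] kern_cont])
  show "((\<lambda>t. \<theta> t z) has_vector_derivative time_deriv \<theta> t z) (at t)" if "t \<in> {0<..<T}" "z \<in> cube l" for t z
    by (rule classical_solution_time[OF limit(1) that])
  show "continuous_on (cube l) (\<theta> t)" if "t \<in> {0<..<T}" for t
    by (rule continuous_on_subset[OF classical_solution_continuous(2)[OF limit(1) that] closure_subset])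
  show "continuous_on ({0<..<T} \<times> cube l) (\<lambda>(t, z). time_deriv \<theta> t z)"
    using limit(1) by (simp add: classical_solution_def C12_def)
qed

lemma mollified_continuous:
  assumes \<epsilon>: "0 < \<epsilon>" and X: "\<And>x i. x \<in> X \<Longrightarrow> \<bar>x $ i\<bar> \<le> l - 8 * \<epsilon>"
  shows "continuous_on ({0<..<T} \<times> X) (\<lambda>(t, x). mollified \<epsilon> t x)"
proof -
  have "continuous_on (({0<..<T} \<times> X) \<times> box2) (\<lambda>p. (\<lambda>(t, x). \<theta> t x) (fst (fst p), snd (fst p) - \<epsilon> *\<^sub>R snd p))"
    by (rule continuous_on_compose2[OF classical_solution_continuous(1)[OF limit(1)]])
      (auto intro!: continuous_intros subsetD[OF closure_subset] mollified_shift[OF X \<epsilon>])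
  moreover have "continuous_on (({0<..<T} \<times> X) \<times> box2) (\<lambda>p. kern (snd p :: real^'n))"
    by (rule continuous_on_compose2[OF kern_cont]) (auto intro!: continuous_intros)
  ultimately have "continuous_on (({0<..<T} \<times> X) \<times> box2) (\<lambda>(r, y). kern y *\<^sub>R \<theta> (fst r) (snd r - \<epsilon> *\<^sub>R y))"
    by (auto simp: case_prod_unfold intro!: continuous_intros)
  then have "continuous_on ({0<..<T} \<times> X) (\<lambda>r. mollified \<epsilon> (fst r) (snd r))"
    unfolding mollified_def conv_def box2_def by (rule integral_continuous_on_param)
  then show ?thesis by (simp add: case_prod_unfold)
qed

lemma mollified_norm:
  assumes M: "\<And>x. x \<in> cube l \<Longrightarrow> norm (\<theta> t x) \<le> M" and t: "t \<in> {0<..<T}" and \<epsilon>: "0 < \<epsilon>" and x: "\<And>i. \<bar>x $ i\<bar> \<le> l - 8 * \<epsilon>"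
  shows "norm (mollified \<epsilon> t x) \<le> M"
proof -
  have "norm (conv \<epsilon> kern (\<theta> t) x) \<le> mass (kern :: real^'n \<Rightarrow> real) * M"
    by (rule norm_conv_le[OF continuous_on_subset[OF classical_solution_continuous(2)[OF limit(1) t] closure_subset] mollified_shift[OF x \<epsilon>] kern_cont])
      (auto intro!: M mollified_shift[OF x \<epsilon>])
  then show ?thesis by (simp add: mollified_def mass_kern)
qed

text \<open>
  The residual of the mollified limit in the equation whose coefficients are taken at an arbitrary value \<open>y\<close>, later
  the value of an iterate. The constants are uniform in \<open>\<epsilon>\<close>, \<open>t\<close> and \<open>y\<close>, and \<open>1/d\<close> is bounded by \<open>inv_dist_sum\<close>, which is the form of
  potential that the barrier absorbs. The distance \<open>8 \<epsilon>\<close> from the boundary is that of \<open>gradient_osc\<close>.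
\<close>
lemma residual:
  "\<exists>R\<ge>0. \<exists>Cm\<ge>0. \<forall>\<epsilon>. 0 < \<epsilon> \<longrightarrow> 8 * \<epsilon> < l \<longrightarrow>
     (\<forall>t\<in>{0<..<T}. \<forall>x. (\<forall>i. \<bar>x $ i\<bar> \<le> l - 8 * \<epsilon>) \<longrightarrow> norm (\<theta> t x - mollified \<epsilon> t x) \<le> Cm * \<epsilon>) \<and>
     (\<forall>t\<in>{0<..<T}. \<forall>x\<in>cube (l - 8 * \<epsilon>). \<forall>y.
        norm (par_op (diffusion \<sigma> t x y) (b t x y) (conv \<epsilon> kern (time_deriv \<theta> t) x)
           (\<lambda>i. conv \<epsilon> kern (\<theta>1 t i) x) (\<lambda>i j. conv \<epsilon> kern (\<theta>2 t i j) x) + bh t x y)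
        \<le> R * (inv_dist_sum l x + ln (l / \<epsilon>)) * (norm (y - mollified \<epsilon> t x) + \<epsilon>))"
proof -
  obtain G Lp where G: "0 \<le> G" and bl: "\<And>t. t \<in> {0<..<T} \<Longrightarrow> bounded_laplacian (\<theta> t) (\<theta>1 t) (\<theta>2 t) l G Lp"
    using \<theta>_laplacian by blast
  obtain Ca Cb \<nu> L where cb: "coef_bounds T b bh \<sigma> 0 Ca Cb \<nu> L" using coef_bounds_exist[OF T A1 A2 A4 A5 order_refl] by blast
  have L: "0 \<le> L" using cb by (simp add: coef_bounds_def)
  obtain C where C: "\<And>t x y. t \<in> {0..T} \<Longrightarrow> norm (\<sigma> t x y) \<le> C" using A2 unfolding cond_A2_def by blast
  have c1: "C1_bdd_partials ({0..T} \<times> UNIV) (\<lambda>(t, x, y). b t x y)" "C1_bdd_partials ({0..T} \<times> UNIV) (\<lambda>(t, x, y). bh t x y)"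
    "C1_bdd_partials ({0..T} \<times> UNIV) (\<lambda>(t, x, y). \<sigma> t x y)" using A1 by (auto simp: cond_A1_def)
  have "\<exists>CA\<ge>0. \<forall>t\<in>{0..T}. \<forall>D u u1. jet1 D u u1 \<longrightarrow> (\<forall>x\<in>D. \<forall>i. norm (u1 i x) \<le> G) \<longrightarrow>
     (\<exists>A1. (\<forall>i j. jet1 D (\<lambda>z. diffusion \<sigma> t z (u z) $ i $ j) (A1 i j)) \<and> (\<forall>i j k. \<forall>z\<in>D. \<bar>A1 i j k z\<bar> \<le> CA))"
    by (rule diffusion_jet1[OF c1(3) _ G]) (rule C)
  then obtain CA0 where CA0: "0 \<le> CA0" "\<forall>t\<in>{0..T}. \<forall>D u u1. jet1 D u u1 \<longrightarrow> (\<forall>x\<in>D. \<forall>i. norm (u1 i x) \<le> G) \<longrightarrow>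
     (\<exists>A1. (\<forall>i j. jet1 D (\<lambda>z. diffusion \<sigma> t z (u z) $ i $ j) (A1 i j)) \<and> (\<forall>i j k. \<forall>z\<in>D. \<bar>A1 i j k z\<bar> \<le> CA0))"
    by (elim exE conjE)
  let ?n = "real (CARD('n))"
  define CA where "CA = CA0 + L * (1 + ?n * G)"
  have CA: "0 \<le> CA" "CA0 \<le> CA" "L * (1 + ?n * G) \<le> CA" "L \<le> CA"
  proof -
    have "L * 1 \<le> L * (1 + ?n * G)" using L G by (intro mult_left_mono) auto
    then show "0 \<le> CA" "CA0 \<le> CA" "L * (1 + ?n * G) \<le> CA" "L \<le> CA" using CA0(1) L by (auto simp: CA_def)
  qed
  define Cm where "Cm = 2 * ?n^2 * G"
  have Cm: "0 \<le> Cm" using G by (simp add: Cm_def)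
  define R0 where "R0 = residual_const TYPE('n) l G Lp CA"
  have "T / 2 \<in> {0<..<T}" using T by simp
  from bounded_laplacian.residual_const_nonneg[OF bl[OF this] CA(1)] have R0: "0 \<le> R0" by (simp add: R0_def)
  have err: "norm (\<theta> t x - mollified \<epsilon> t x) \<le> Cm * \<epsilon>"
    if "0 < \<epsilon>" "t \<in> {0<..<T}" "\<forall>i. \<bar>x $ i\<bar> \<le> l - 8 * \<epsilon>" for \<epsilon> t x
    unfolding mollified_def Cm_def by (rule bounded_laplacian.mollification_error[OF bl[OF that(2)]]) (use that in auto)
  show ?thesis
  proof (rule exI[of _ "R0 * (1 + Cm)"], intro exI[of _ Cm] conjI Cm allI impI ballI)
    show "0 \<le> R0 * (1 + Cm)" using R0 Cm by simp
    show "norm (\<theta> t x - mollified \<epsilon> t x) \<le> Cm * \<epsilon>" if "0 < \<epsilon>" "t \<in> {0<..<T}" "\<forall>i. \<bar>x $ i\<bar> \<le> l - 8 * \<epsilon>" for \<epsilon> t x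
      by (rule err[OF that])
    fix \<epsilon> t :: real and x :: "real^'n" and y :: "real^'m"
    assume \<epsilon>: "0 < \<epsilon>" "8 * \<epsilon> < l" and t: "t \<in> {0<..<T}" and x: "x \<in> cube (l - 8 * \<epsilon>)"
    have t': "t \<in> {0..T}" using t by auto
    interpret bounded_laplacian "\<theta> t" "\<theta>1 t" "\<theta>2 t" l G Lp by (rule bl[OF t])
    have xi: "\<bar>x $ i\<bar> < l - 8 * \<epsilon>" for i using x unfolding cube_def by (simp add: abs_less_iff) (smt (verit))
    have xc: "x \<in> cube l" using xi \<epsilon> unfolding cube_def by (smt (verit) mem_Collect_eq)
    obtain k where k: "infnorm x = \<bar>x $ k\<bar>" using infnorm_attained by blast
    define d where "d = l - \<bar>x $ k\<bar>"
    have xd: "\<bar>x $ i\<bar> \<le> l - d" for i using component_le_infnorm_cart[of x i] k by (simp add: d_def)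
    have d8: "8 * \<epsilon> \<le> d" using xi[of k] by (simp add: d_def)
    have pos: "0 < l + x $ i" "0 < l - x $ i" for i using cube_pos[OF xc] by auto
    have dS: "1 / d \<le> inv_dist_sum l x"
    proof -
      have "1 / d \<le> 1 / (l + x $ k) + 1 / (l - x $ k)" using pos[of k] by (cases "0 \<le> x $ k") (auto simp: d_def)
      also have "\<dots> \<le> inv_dist_sum l x" unfolding inv_dist_sum_def
        by (rule member_le_sum[of k UNIV "\<lambda>i. 1 / (l + x $ i) + 1 / (l - x $ i)"]) (use pos in \<open>auto intro!: add_nonneg_nonneg divide_nonneg_pos simp del: zero_le_divide_1_iff\<close>)
      finally show ?thesis .
    qed
    obtain A1' where A1': "\<And>i j. jet1 (cube l) (\<lambda>z. diffusion \<sigma> t z (\<theta> t z) $ i $ j) (A1' i j)"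
      "\<And>i j k z. z \<in> cube l \<Longrightarrow> \<bar>A1' i j k z\<bar> \<le> CA0"
      using CA0(2)[rule_format, OF t' ju grad] by blast
    define \<delta> where "\<delta> = norm (y - \<theta> t x)"
    have \<delta>: "0 \<le> \<delta>" by (simp add: \<delta>_def)
    have graph: "continuous_on (cube l) (\<lambda>z. (t, z, \<theta> t z))" by (intro continuous_intros cu)
    have lip: "L * (norm (x - z) + norm (y - \<theta> t z)) \<le> CA * (\<delta> + norm (x - z))" if z: "z \<in> cube l" for z
    proof -
      have "norm (\<theta> t x - \<theta> t z) \<le> ?n * G * norm (x - z)"
        by (rule jet1_Lipschitz[OF ju convex_cube subset_refl _ xc z]) (rule grad)
      then have "norm (y - \<theta> t z) \<le> \<delta> + ?n * G * norm (x - z)"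
        using norm_triangle_ineq[of "y - \<theta> t x" "\<theta> t x - \<theta> t z"] by (simp add: \<delta>_def)
      then have "L * (norm (x - z) + norm (y - \<theta> t z)) \<le> L * (norm (x - z) + (\<delta> + ?n * G * norm (x - z)))"
        using L by (intro mult_left_mono) auto
      also have "\<dots> = L * \<delta> + L * (1 + ?n * G) * norm (x - z)" by (simp add: algebra_simps)
      also have "\<dots> \<le> CA * \<delta> + CA * norm (x - z)" using CA \<delta> by (intro add_mono mult_right_mono) auto
      finally show ?thesis by (simp add: algebra_simps)
    qed
    have "norm (conv \<epsilon> kern (time_deriv \<theta> t) x + (\<Sum>i\<in>UNIV. \<Sum>j\<in>UNIV. diffusion \<sigma> t x y $ i $ j *\<^sub>R conv \<epsilon> kern (\<theta>2 t i j) x)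
      + (\<Sum>i\<in>UNIV. b t x y $ i *\<^sub>R conv \<epsilon> kern (\<theta>1 t i) x) + bh t x y) \<le> residual_const TYPE('n) l G Lp CA * log_weight l d \<epsilon> * (\<delta> + \<epsilon>)"
    proof (rule residual_bound[OF xd \<epsilon>(1) d8 A1'(1), where bb = "\<lambda>z. b t z (\<theta> t z)" and h = "\<lambda>z. bh t z (\<theta> t z)"])
      show "\<bar>A1' i j k z\<bar> \<le> CA" if "z \<in> cube l" for z i j k using A1'(2)[OF that, of i j k] CA(2) by linarith
      have "continuous_on (cube l) (\<lambda>z. (\<lambda>(t, x, y). b t x y) (t, z, \<theta> t z))"
        by (rule continuous_on_compose2[OF C1_bdd_partials_continuous[OF c1(1)] graph]) (use t' in auto)
      then show "continuous_on (cube l) (\<lambda>z. b t z (\<theta> t z))" by simp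
      have "continuous_on (cube l) (\<lambda>z. (\<lambda>(t, x, y). bh t x y) (t, z, \<theta> t z))"
        by (rule continuous_on_compose2[OF C1_bdd_partials_continuous[OF c1(2)] graph]) (use t' in auto)
      then show "continuous_on (cube l) (\<lambda>z. bh t z (\<theta> t z))" by simp
      have "continuous_on ({0<..<T} \<times> cube l) (\<lambda>(t, z). time_deriv \<theta> t z)"
        using limit(1) by (simp add: classical_solution_def C12_def)
      then have "continuous_on (cube l) (\<lambda>z. (\<lambda>(t, z). time_deriv \<theta> t z) (t, z))"
        by (rule continuous_on_compose2) (use t in \<open>auto intro!: continuous_intros\<close>)
      then show "continuous_on (cube l) (time_deriv \<theta> t)" by simp
      show "time_deriv \<theta> t z + (\<Sum>i\<in>UNIV. \<Sum>j\<in>UNIV. diffusion \<sigma> t z (\<theta> t z) $ i $ j *\<^sub>R \<theta>2 t i j z)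
         + (\<Sum>i\<in>UNIV. b t z (\<theta> t z) $ i *\<^sub>R \<theta>1 t i z) + bh t z (\<theta> t z) = 0" if "z \<in> cube l" for z
        using classical_solution_equation[OF limit(1) t that] by (simp add: par_op_def)
      show "0 \<le> \<delta>" by (rule \<delta>)
      show "\<bar>diffusion \<sigma> t x y $ i $ j - diffusion \<sigma> t x (\<theta> t x) $ i $ j\<bar> \<le> CA * \<delta>" for i j
      proof -
        have "\<bar>diffusion \<sigma> t x y $ i $ j - diffusion \<sigma> t x (\<theta> t x) $ i $ j\<bar> \<le> L * \<delta>"
          using cb t' by (simp add: coef_bounds_def \<delta>_def)
        also have "\<dots> \<le> CA * \<delta>" using CA \<delta> by (intro mult_right_mono) auto
        finally show ?thesis .
      qed
      fix z :: "real^'n" assume z: "z \<in> cube l"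
      have bz: "norm (b t x y - b t z (\<theta> t z)) \<le> L * (norm (x - z) + norm (y - \<theta> t z))"
        "norm (bh t x y - bh t z (\<theta> t z)) \<le> L * (norm (x - z) + norm (y - \<theta> t z))"
        using cb t' by (auto simp: coef_bounds_def)
      show "norm (bh t x y - bh t z (\<theta> t z)) \<le> CA * (\<delta> + norm (x - z))" using bz(2) lip[OF z] by linarith
      fix i :: 'n
      show "\<bar>b t x y $ i - b t z (\<theta> t z) $ i\<bar> \<le> CA * (\<delta> + norm (x - z))"
        using component_le_norm_cart[of "b t x y - b t z (\<theta> t z)" i] bz(1) lip[OF z] by simp
    qed
    also have "\<dots> \<le> R0 * (inv_dist_sum l x + ln (l / \<epsilon>)) * ((1 + Cm) * (norm (y - mollified \<epsilon> t x) + \<epsilon>))"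
    proof -
      have "\<delta> \<le> norm (y - mollified \<epsilon> t x) + norm (\<theta> t x - mollified \<epsilon> t x)"
        unfolding \<delta>_def using norm_triangle_ineq4[of "y - mollified \<epsilon> t x" "\<theta> t x - mollified \<epsilon> t x"] by simp
      also have "norm (\<theta> t x - mollified \<epsilon> t x) \<le> Cm * \<epsilon>" by (rule err[OF \<epsilon>(1) t]) (use xi in \<open>auto simp: less_imp_le\<close>)
      finally have "\<delta> + \<epsilon> \<le> norm (y - mollified \<epsilon> t x) + Cm * \<epsilon> + \<epsilon>" by simp
      also have "\<dots> \<le> (1 + Cm) * (norm (y - mollified \<epsilon> t x) + \<epsilon>)" using Cm \<epsilon> by (simp add: algebra_simps)
      finally have a: "\<delta> + \<epsilon> \<le> (1 + Cm) * (norm (y - mollified \<epsilon> t x) + \<epsilon>)" .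
      have "0 < d" using d8 \<epsilon> by linarith
      then have "0 \<le> log_weight l d \<epsilon>" using log_weight_nonneg[of \<epsilon> d] \<epsilon> by simp
      moreover have "log_weight l d \<epsilon> \<le> inv_dist_sum l x + ln (l / \<epsilon>)" using dS by (simp add: log_weight_def)
      ultimately show ?thesis unfolding R0_def[symmetric] using R0 a \<delta> \<epsilon> by (intro mult_mono) auto
    qed
    finally show "norm (par_op (diffusion \<sigma> t x y) (b t x y) (conv \<epsilon> kern (time_deriv \<theta> t) x)
           (\<lambda>i. conv \<epsilon> kern (\<theta>1 t i) x) (\<lambda>i j. conv \<epsilon> kern (\<theta>2 t i j) x) + bh t x y)
        \<le> R0 * (1 + Cm) * (inv_dist_sum l x + ln (l / \<epsilon>)) * (norm (y - mollified \<epsilon> t x) + \<epsilon>)"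
      by (simp add: par_op_def mult_ac)
  qed
qed

section \<open>Contraction and time stepping\<close>

lemma chain_gap: "\<exists>\<delta>>0. \<forall>p\<in>{1..<N}. \<delta> \<le> lo (p + 1) - lo p \<and> \<delta> \<le> hi p - lo (p + 1) \<and> \<delta> \<le> hi (p + 1) - hi p"
proof -
  define f where "f = (\<lambda>p. min (lo (p + 1) - lo p) (min (hi p - lo (p + 1)) (hi (p + 1) - hi p)))"
  define \<delta> where "\<delta> = Min (insert 1 (f ` {1..<N}))"
  have "0 < \<delta>" unfolding \<delta>_def using chain_step by (auto simp: f_def)
  moreover have "\<delta> \<le> f p" if "p \<in> {1..<N}" for p unfolding \<delta>_def using that by (intro Min_le) auto
  ultimately show ?thesis by (intro exI[of _ \<delta>]) (auto simp: f_def)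
qed

text \<open>
  The time from which on the error is small may depend on \<open>p\<close> and \<open>q\<close>: the rate at which an iterate approaches the
  terminal data is given by a bound of its time derivative, which may depend on \<open>q\<close>. The comparison for a fixed
  iterate needs no more than this.
\<close>
definition error_small :: "real \<Rightarrow> nat \<Rightarrow> real \<Rightarrow> bool" where
  "error_small \<epsilon> Q T1 \<longleftrightarrow> (\<forall>q\<ge>Q. \<forall>p\<in>{1..N}. \<exists>s<T1. \<forall>t. s < t \<longrightarrow> 0 < t \<longrightarrow> t < T1 \<longrightarrow>
     (\<forall>x\<in>\<Omega> p. norm (\<theta>pq p q t x - \<theta> t x) \<le> \<epsilon>))"

lemma iterate_limit_continuous:
  assumes "p \<in> {1..N}" "1 \<le> q" "t \<in> {0<..<T}"
  shows "continuous_on (closure (\<Omega> p)) (\<lambda>x. norm (\<theta>pq p q t x - \<theta> t x))"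
  by (intro continuous_intros classical_solution_continuous(2)[OF iterate(1)[OF assms(1,2)] assms(3)]
      continuous_on_subset[OF classical_solution_continuous(2)[OF limit(1) assms(3)]] closure_mono \<Omega>_facts(3)[OF assms(1)])

text \<open>
  The difference \<open>w\<close> of an iterate and the mollified limit is compared on the points of the slab at distance
  at least \<open>8 \<epsilon>\<close> from the boundary of the cube, with \<open>\<Phi> n = exp (k (T1 - t)) \<cdot> schwarz_barrier\<close> for interface values
  \<open>2 M / 2\<^sup>n\<close>. The potential in the inequality for \<open>w\<close> is a multiple of \<open>inv_dist_sum + ln (l/\<epsilon>)\<close> by \<open>residual\<close>. The first part
  is absorbed by \<open>barrier_operator\<close>, the second by \<open>k\<close>. On the interfaces \<open>\<Phi> n\<close> lies above the bound \<open>\<Phi> (n - 1)\<close>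
  of the neighbours, and everywhere else on the boundary \<open>w\<close> is \<open>O(\<epsilon>)\<close>.
\<close>
lemma contraction:
  "\<exists>C1\<ge>0. \<exists>C2\<ge>0. \<forall>\<epsilon> T1 Q. 0 < \<epsilon> \<longrightarrow> 8 * \<epsilon> < l \<longrightarrow> 0 < T1 \<longrightarrow> T1 \<le> T \<longrightarrow> 2 \<le> Q \<longrightarrow> error_small \<epsilon> Q T1 \<longrightarrow>
     (\<forall>n. \<forall>p\<in>{1..N}. \<forall>t\<in>{0<..<T1}. \<forall>x\<in>\<Omega> p.
        norm (\<theta>pq p (Q + n) t x - \<theta> t x) \<le> C2 * exp (C1 * (ln (l / \<epsilon>) + 1) * (T1 - t)) * (\<epsilon> + 1 / 2 ^ n))"
proof -
  obtain M where M: "M > 0" "\<And>p q t x. p \<in> {1..N} \<Longrightarrow> 1 \<le> q \<Longrightarrow> t \<in> {0<..<T} \<Longrightarrow> x \<in> closure (\<Omega> p) \<Longrightarrow> norm (\<theta>pq p q t x) \<le> M"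
    "\<And>t x. t \<in> {0<..<T} \<Longrightarrow> x \<in> closure (cube l) \<Longrightarrow> norm (\<theta> t x) \<le> M"
    using uniform_bound by metis
  obtain Ca Cb \<nu> L where cb: "coef_bounds T b bh \<sigma> M Ca Cb \<nu> L"
    using coef_bounds_exist[OF T A1 A2 A4 A5 less_imp_le[OF M(1)]] by blast
  have Kc: "0 \<le> Ca" "0 \<le> Cb" "0 < \<nu>" using cb by (auto simp: coef_bounds_def)
  obtain R Cm where R: "0 \<le> R" and Cm: "0 \<le> Cm"
    and err: "\<And>\<epsilon> t x. 0 < \<epsilon> \<Longrightarrow> 8 * \<epsilon> < l \<Longrightarrow> t \<in> {0<..<T} \<Longrightarrow> (\<forall>i. \<bar>x $ i\<bar> \<le> l - 8 * \<epsilon>) \<Longrightarrow> norm (\<theta> t x - mollified \<epsilon> t x) \<le> Cm * \<epsilon>"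
    and res: "\<And>\<epsilon> t x y. 0 < \<epsilon> \<Longrightarrow> 8 * \<epsilon> < l \<Longrightarrow> t \<in> {0<..<T} \<Longrightarrow> x \<in> cube (l - 8 * \<epsilon>) \<Longrightarrow>
        norm (par_op (diffusion \<sigma> t x y) (b t x y) (conv \<epsilon> kern (time_deriv \<theta> t) x)
           (\<lambda>i. conv \<epsilon> kern (\<theta>1 t i) x) (\<lambda>i j. conv \<epsilon> kern (\<theta>2 t i j) x) + bh t x y)
        \<le> R * (inv_dist_sum l x + ln (l / \<epsilon>)) * (norm (y - mollified \<epsilon> t x) + \<epsilon>)"
    using residual by (elim exE conjE) blast
  obtain Ci where Ci: "0 \<le> Ci" "\<And>p q t x i \<tau>. p \<in> {1..N} \<Longrightarrow> 1 \<le> q \<Longrightarrow> t \<in> {0<..<T} \<Longrightarrow> x \<in> closure (\<Omega> p) \<Longrightarrow> \<tau> \<in> {1, -1} \<Longrightarrow>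
      norm (\<theta>pq p q t x - g x) \<le> Ci * (l + \<tau> * x $ i)"
    using iterates_lateral by (elim exE conjE) blast
  obtain Cl where Cl: "0 \<le> Cl" "\<And>t x i \<tau>. t \<in> {0<..<T} \<Longrightarrow> x \<in> closure (cube l) \<Longrightarrow> \<tau> \<in> {1, -1} \<Longrightarrow>
      norm (\<theta> t x - g x) \<le> Cl * (l + \<tau> * x $ i)"
    using limit_lateral by (elim exE conjE) blast
  have near: "norm (\<theta>pq p q t x - \<theta> t x) \<le> (Ci + Cl) * (8 * \<epsilon>)"
    if p: "p \<in> {1..N}" and q: "1 \<le> q" and t: "t \<in> {0<..<T}" and x: "x \<in> closure (\<Omega> p)" and xi: "l - 8 * \<epsilon> \<le> \<bar>x $ i\<bar>" for p q t x i \<epsilon>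
  proof -
    define \<tau> where "\<tau> = (if 0 \<le> x $ i then -1 else 1 :: real)"
    have \<tau>: "\<tau> \<in> {1, -1}" "l + \<tau> * x $ i \<le> 8 * \<epsilon>" using xi by (auto simp: \<tau>_def)
    have xc: "x \<in> closure (cube l)" using x closure_mono[OF \<Omega>_facts(3)[OF p]] by blast
    have "norm (\<theta>pq p q t x - \<theta> t x) \<le> norm (\<theta>pq p q t x - g x) + norm (\<theta> t x - g x)"
      using norm_triangle_ineq4[of "\<theta>pq p q t x - g x" "\<theta> t x - g x"] by simp
    also have "\<dots> \<le> Ci * (l + \<tau> * x $ i) + Cl * (l + \<tau> * x $ i)"
      by (intro add_mono Ci(2)[OF p q t x \<tau>(1)] Cl(2)[OF t xc \<tau>(1)])
    also have "\<dots> = (Ci + Cl) * (l + \<tau> * x $ i)" by (simp add: algebra_simps)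
    also have "\<dots> \<le> (Ci + Cl) * (8 * \<epsilon>)" using \<tau>(2) Ci(1) Cl(1) by (intro mult_left_mono) auto
    finally show ?thesis .
  qed
  obtain \<delta> where \<delta>: "0 < \<delta>" "\<And>p. p \<in> {1..<N} \<Longrightarrow> \<delta> \<le> lo (p + 1) - lo p \<and> \<delta> \<le> hi p - lo (p + 1) \<and> \<delta> \<le> hi (p + 1) - hi p"
    using chain_gap by blast
  \<comment> \<open>An interface that lies inside a neighbour is at distance at least \<open>\<delta>\<close> from both interfaces of that neighbour. With this
      rate each of the two exponentials is at most \<open>1/4\<close> there, which halves the transmitted error.\<close>
  define \<mu> where "\<mu> = ln 4 / \<delta>"
  have \<mu>: "0 \<le> \<mu>" using \<delta> by (simp add: \<mu>_def)
  have decay: "exp (- \<mu> * r) \<le> 1 / 4" if "\<delta> \<le> r" for r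
  proof -
    have "\<mu> * \<delta> \<le> \<mu> * r" using that \<mu> by (intro mult_left_mono)
    then have "exp (- \<mu> * r) \<le> exp (- ln 4)" using \<delta> by (simp add: \<mu>_def)
    also have "\<dots> = 1 / 4" by (simp add: exp_minus)
    finally show ?thesis .
  qed
  let ?m = "real (CARD('m))"
  \<comment> \<open>At a contact point the residual is at most \<open>R (m + 1) \<rho> \<Phi>\<close> times \<open>inv_dist_sum + ln (l/\<epsilon>)\<close>: one \<open>m\<close> for the Euclidean
      norm against the maximum norm, and 1 for the summand \<open>\<epsilon> \<le> \<rho> \<Phi>\<close>. The barrier absorbs the part with \<open>inv_dist_sum\<close>.\<close>
  define Cr where "Cr = R * (?m + 1) / 2"
  have Cr: "0 \<le> Cr" using R by (simp add: Cr_def)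
  obtain K0 where K0: "0 \<le> K0" and bar: "\<And>(a::real^'n^'n) (b::real^'n) x A M p q e. x \<in> cube l \<Longrightarrow> (\<forall>i j. \<bar>a $ i $ j\<bar> \<le> Ca) \<Longrightarrow>
      (\<forall>i. \<nu> \<le> a $ i $ i) \<Longrightarrow> (\<forall>i. \<bar>b $ i\<bar> \<le> Cb) \<Longrightarrow> 0 \<le> A \<Longrightarrow> 0 \<le> M \<Longrightarrow>
      par_op a b 0 (\<lambda>i. schwarz_barrier1 l A M \<mu> p q e i x) (\<lambda>i j. schwarz_barrier2 l A M \<mu> p q e i j x)
        \<le> (K0 - 2 * Cr * inv_dist_sum l x) * schwarz_barrier l A M \<mu> p q e x"
    using barrier_operator[OF Kc \<mu> Cr, of l, where 'n='n] by (elim exE conjE) blast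
  \<comment> \<open>\<open>A0 \<epsilon>\<close> bounds \<open>w\<close> near time \<open>T1\<close>, where the iterate is \<open>\<epsilon>\<close>-close to the limit, and at distance \<open>8 \<epsilon>\<close> from the boundary
      of the cube, where both are close to \<open>g\<close>; in each case \<open>Cm \<epsilon>\<close> is added for the mollification.\<close>
  define A0 where "A0 = 1 + Cm + (Ci + Cl) * 8"
  have A0: "1 \<le> A0" using Cm Ci(1) Cl(1) by (simp add: A0_def)
  define C1 where "C1 = K0 + R * (?m + 1) + 1"
  have C1: "0 \<le> C1" using K0 R by (simp add: C1_def)
  define B where "B = exp (CARD('n) * (2 * sqrt (2 * l)))"
  have B: "1 \<le> B" using l by (simp add: B_def)
  define C2 where "C2 = ?m * B * (A0 + 4 * M) + Cm + (Ci + Cl) * 8"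
  have C2: "0 \<le> C2" using B A0 M(1) Cm Ci(1) Cl(1) by (simp add: C2_def)
  show ?thesis
  proof (rule exI[of _ C1], rule conjI[OF C1], rule exI[of _ C2], rule conjI[OF C2], intro allI impI)
    fix \<epsilon> T1 :: real and Q :: nat
    assume \<epsilon>: "0 < \<epsilon>" "8 * \<epsilon> < l" and T1: "0 < T1" "T1 \<le> T" and Q: "2 \<le> Q" and small: "error_small \<epsilon> Q T1"
    define \<Lambda> where "\<Lambda> = ln (l / \<epsilon>)"
    have \<Lambda>: "0 \<le> \<Lambda>" using \<epsilon> by (simp add: \<Lambda>_def)
    define k where "k = K0 + R * (?m + 1) * \<Lambda> + 1"
    have k: "0 \<le> k" "k \<le> C1 * (\<Lambda> + 1)"
    proof -
      show "0 \<le> k" using K0 R \<Lambda> by (simp add: k_def)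
      have "0 \<le> (K0 + 1) * \<Lambda>" using K0 \<Lambda> by simp
      moreover have "0 \<le> R * (?m + 1)" using R by simp
      ultimately show "k \<le> C1 * (\<Lambda> + 1)" by (simp add: k_def C1_def algebra_simps)
    qed
    define X where "X = (\<lambda>p. {x \<in> closure (\<Omega> p). \<forall>i. \<bar>x $ i\<bar> \<le> l - 8 * \<epsilon>})"
    define w where "w = (\<lambda>p q t x. \<theta>pq p q t x - mollified \<epsilon> t x)"
    define A where "A = A0 * \<epsilon>"
    have A: "\<epsilon> \<le> A" "0 < A" using A0 \<epsilon> by (simp_all add: A_def)
    define \<Phi> where "\<Phi> = (\<lambda>n p t x. exp (k * (T1 - t)) * schwarz_barrier l A (2 * M / 2 ^ n) \<mu> (lo p) (hi p) e x)"
    have Xc: "x \<in> cube l" if "x \<in> X p" for x p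
    proof -
      have "\<bar>x $ i\<bar> < l" for i
      proof -
        have "\<bar>x $ i\<bar> \<le> l - 8 * \<epsilon>" using that by (simp add: X_def)
        then show ?thesis using \<epsilon> by linarith
      qed
      then show ?thesis unfolding cube_def by (auto simp: abs_less_iff) (metis minus_less_iff)
    qed
    have tT: "t \<in> {0<..<T}" if "t \<in> {0<..<T1}" for t using that T1 by auto
    have edge_ge: "A \<le> edge_profile0 A (2 * M / 2 ^ n) \<mu> a c r" for n a c r
      using M(1) by (simp add: edge_profile0_def)
    have scale: "r \<le> exp (k * (T1 - t)) * (sqrt_barrier l x * r')" if "0 \<le> r" "r \<le> r'" "x \<in> cube l" "t \<le> T1" for r r' t and x :: "real^'n"
    proof -
      have "1 * (1 * r) \<le> exp (k * (T1 - t)) * (sqrt_barrier l x * r')"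
        using that k sqrt_barrier_bounds(1)[OF that(3)] by (intro mult_mono) auto
      then show ?thesis by simp
    qed
    have \<Phi>_ge: "A \<le> \<Phi> n p t x" if "x \<in> cube l" "t \<le> T1" for n p t x
      unfolding \<Phi>_def schwarz_barrier_def by (rule scale[OF _ edge_ge that]) (use A in simp)
    have w_near: "infnorm (w p q t x) \<le> A" if "p \<in> {1..N}" "1 \<le> q" "t \<in> {0<..<T}" "x \<in> X p" "\<bar>x $ i\<bar> = l - 8 * \<epsilon>" for p q t x i
    proof -
      have "norm (w p q t x) \<le> norm (\<theta>pq p q t x - \<theta> t x) + norm (\<theta> t x - mollified \<epsilon> t x)"
        unfolding w_def using norm_triangle_ineq[of "\<theta>pq p q t x - \<theta> t x" "\<theta> t x - mollified \<epsilon> t x"] by simp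
      also have "\<dots> \<le> (Ci + Cl) * (8 * \<epsilon>) + Cm * \<epsilon>"
        by (intro add_mono near[OF that(1-3), of x \<epsilon> i] err[OF \<epsilon> that(3)]) (use that in \<open>auto simp: X_def\<close>)
      also have "\<dots> \<le> A" using \<epsilon> by (simp add: A_def A0_def algebra_simps)
      finally show ?thesis using infnorm_le_norm order_trans by blast
    qed
    have w_late: "\<exists>s<T1. \<forall>t. s < t \<longrightarrow> 0 < t \<longrightarrow> t < T1 \<longrightarrow> (\<forall>x\<in>X p. infnorm (w p q t x) \<le> A)" if p: "p \<in> {1..N}" and q: "Q \<le> q" for p q
    proof -
      obtain s where s: "s < T1" "\<And>t x. s < t \<Longrightarrow> 0 < t \<Longrightarrow> t < T1 \<Longrightarrow> x \<in> \<Omega> p \<Longrightarrow> norm (\<theta>pq p q t x - \<theta> t x) \<le> \<epsilon>"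
        using small p q unfolding error_small_def by blast
      show ?thesis
      proof (intro exI[of _ s] conjI s(1) allI impI ballI)
        fix t x assume t: "s < t" "0 < t" "t < T1" and x: "x \<in> X p"
        have t': "t \<in> {0<..<T}" using t T1 by auto
        have "norm (\<theta>pq p q t x - \<theta> t x) \<le> \<epsilon>"
          by (rule continuous_le_on_closure[OF iterate_limit_continuous[OF p _ t']]) (use x Q q s(2)[OF t] in \<open>auto simp: X_def\<close>)
        moreover have "norm (\<theta> t x - mollified \<epsilon> t x) \<le> Cm * \<epsilon>" by (rule err[OF \<epsilon> t']) (use x in \<open>auto simp: X_def\<close>)
        moreover have "norm (w p q t x) \<le> norm (\<theta>pq p q t x - \<theta> t x) + norm (\<theta> t x - mollified \<epsilon> t x)"
          unfolding w_def using norm_triangle_ineq[of "\<theta>pq p q t x - \<theta> t x" "\<theta> t x - mollified \<epsilon> t x"] by simp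
        moreover have "\<epsilon> + Cm * \<epsilon> \<le> A" using \<epsilon> Ci(1) Cl(1) by (simp add: A_def A0_def algebra_simps)
        ultimately show "infnorm (w p q t x) \<le> A" using infnorm_le_norm[of "w p q t x"] by linarith
      qed
    qed
    have w_bound: "infnorm (w p q t x) \<le> 2 * M" if "p \<in> {1..N}" "1 \<le> q" "t \<in> {0<..<T}" "x \<in> X p" for p q t x
    proof -
      have "norm (mollified \<epsilon> t x) \<le> M"
        by (rule mollified_norm[OF M(3)[OF that(3)] that(3) \<epsilon>(1)]) (use that(4) closure_subset in \<open>auto simp: X_def\<close>)
      then have "norm (w p q t x) \<le> 2 * M"
        using M(2)[OF that(1-3), of x] that(4) norm_triangle_ineq4[of "\<theta>pq p q t x" "mollified \<epsilon> t x"] by (simp add: X_def w_def)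
      then show ?thesis using infnorm_le_norm order_trans by blast
    qed

    \<comment> \<open>One iteration: a bound for the neighbours on the interfaces yields a bound on the whole slab.\<close>
    have step: "infnorm (w p q t x) \<le> \<Phi> n p t x"
      if p: "p \<in> {1..N}" and q: "Q \<le> q" and t: "t \<in> {0<..<T1}" and x: "x \<in> X p"
        and inter: "\<And>p' t x. p' \<in> {1..N} \<Longrightarrow> t \<in> {0<..<T1} \<Longrightarrow> x \<in> X p' \<Longrightarrow> x \<in> \<Omega> p' \<Longrightarrow>
          (p \<noteq> 1 \<and> p' = p - 1 \<and> x $ e = lo p) \<or> (p \<noteq> N \<and> p' = p + 1 \<and> x $ e = hi p) \<Longrightarrow>
          infnorm (w p' (q - 1) t x) \<le> exp (k * (T1 - t)) * (sqrt_barrier l x * (A + 2 * M / 2 ^ n))" for n p q t x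
    proof -
      have q1: "1 \<le> q" using q Q by linarith
      obtain s where s: "s < T1" "\<And>t x. s < t \<Longrightarrow> 0 < t \<Longrightarrow> t < T1 \<Longrightarrow> x \<in> X p \<Longrightarrow> infnorm (w p q t x) \<le> A"
        using w_late[OF p q] by blast
      \<comment> \<open>The time \<open>T1\<close> may be \<open>T\<close>, up to which solutions are not continuous on the closed slab. The comparison ends
          earlier, when \<open>w\<close> is already below \<open>A\<close>.\<close>
      define t2 where "t2 = (max s t + T1) / 2"
      have t2: "t < t2" "s < t2" "t2 < T1" using s(1) t by (auto simp: t2_def)
      have T0: "r \<in> {0<..<T}" if "r \<in> {t..t2}" for r using that t t2 T1 by auto
      have T01: "r \<in> {0<..<T1}" if "r \<in> {t..t2}" for r using that t t2 T1 by auto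
      define U where "U = \<Omega> p \<inter> cube (l - 8 * \<epsilon>)"
      have Uc: "x \<in> cube l" if "x \<in> U" for x using that \<Omega>_facts(3)[OF p] by (auto simp: U_def)
      have sol: "classical_solution T b bh \<sigma> (\<Omega> p) (\<theta>pq p q)" by (rule iterate(1)[OF p q1])
      let ?A = "A" and ?M = "2 * M / 2 ^ n"
      have MM: "0 \<le> ?M" using M(1) by simp
      let ?bar = "schwarz_barrier l ?A ?M \<mu> (lo p) (hi p) e" and ?barx = "schwarz_barrier1 l ?A ?M \<mu> (lo p) (hi p) e" and ?barxx = "schwarz_barrier2 l ?A ?M \<mu> (lo p) (hi p) e"
      let ?E = "\<lambda>t. exp (k * (T1 - t))"
      show ?thesis
      proof (rule ratio_comparison[where X = "X p" and U = U and ta = t and tb = t2 and y = "\<theta>pq p q" and \<sigma> = \<sigma>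
            and b = "\<lambda>t x. b t x (\<theta>pq p q t x)" and w = "w p q" and \<Phi> = "\<Phi> n p"])
        have Xeq: "X p = closure (\<Omega> p) \<inter> cbox (\<chi> i. - (l - 8 * \<epsilon>)) (\<chi> i. l - 8 * \<epsilon>)"
        proof -
          have ab: "(\<bar>r\<bar> \<le> c) = (- c \<le> r \<and> r \<le> c)" for r c :: real by auto
          show ?thesis by (auto simp: X_def mem_box_cart ab)
        qed
        show "compact (X p)" unfolding Xeq using \<Omega>_facts(5)[OF p] by (intro compact_Int_closed) auto
        show "open U" unfolding U_def by (intro open_Int \<Omega>_facts(1)[OF p] open_cube)
        show "U \<subseteq> X p"
          using closure_subset[of "\<Omega> p"] by (auto simp: U_def X_def cube_def abs_le_iff less_imp_le) (smt (verit))
        have cw: "continuous_on ({t..t2} \<times> X p) (\<lambda>(t, x). \<theta>pq p q t x)"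
          by (rule continuous_on_subset[OF classical_solution_continuous(1)[OF sol]]) (use T0 in \<open>auto simp: X_def\<close>)
        have cm: "continuous_on ({t..t2} \<times> X p) (\<lambda>(t, x). mollified \<epsilon> t x)"
          by (rule continuous_on_subset[OF mollified_continuous[OF \<epsilon>(1), of "X p"]]) (use T0 in \<open>auto simp: X_def\<close>)
        show "continuous_on ({t..t2} \<times> X p) (\<lambda>(t, x). w p q t x)"
          using cw cm unfolding w_def case_prod_unfold by (intro continuous_intros)
        have "continuous_on (cube l) ?bar" by (rule jet1_continuous[OF schwarz_barrier_jet2[unfolded jet2_def, THEN conjunct1]])
        then have "continuous_on ({t..t2} \<times> X p) (\<lambda>r. ?bar (snd r))"
          by (rule continuous_on_compose2) (use Xc in \<open>auto intro!: continuous_intros\<close>)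
        then show "continuous_on ({t..t2} \<times> X p) (\<lambda>(t, x). \<Phi> n p t x)"
          unfolding \<Phi>_def case_prod_unfold by (intro continuous_intros)
        show "0 < \<Phi> n p r x" if "r \<in> {t..t2}" "x \<in> X p" for r x
          using \<Phi>_ge[OF Xc[OF that(2)], of r n p] A T01[OF that(1)] by auto
      next
        fix r x assume r: "r \<in> {t..t2}" and x: "x \<in> X p" and or: "r = t2 \<or> x \<notin> U"
        note r' = T0[OF r] T01[OF r]
        have \<Phi>A: "A \<le> \<Phi> n p r x" by (rule \<Phi>_ge[OF Xc[OF x]]) (use r' in auto)
        consider "r = t2" | i where "\<bar>x $ i\<bar> = l - 8 * \<epsilon>" | "x \<in> cube (l - 8 * \<epsilon>)" "x \<notin> \<Omega> p"
        proof -
          have "x \<in> cube (l - 8 * \<epsilon>)" if "\<forall>i. \<bar>x $ i\<bar> \<noteq> l - 8 * \<epsilon>"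
          proof -
            have "\<bar>x $ i\<bar> < l - 8 * \<epsilon>" for i using that x by (auto simp: X_def less_le)
            then show ?thesis unfolding cube_def by (auto simp: abs_less_iff) (smt (verit))
          qed
          then show thesis using or that by (auto simp: U_def)
        qed
        then show "infnorm (w p q r x) \<le> \<Phi> n p r x"
        proof cases
          case 1
          have "infnorm (w p q r x) \<le> A" by (rule s(2)) (use 1 t2 r' x in auto)
          then show ?thesis using \<Phi>A by linarith
        next
          case 2
          then show ?thesis using w_near[OF p q1 r'(1) x] \<Phi>A by fastforce
        next
          case 3
          have xcs: "x \<in> cslab e l (lo p) (hi p)" using x \<Omega>_facts(4)[OF p] by (simp add: X_def)
          have xi: "-l < x $ i" "x $ i < l" for i using Xc[OF x] by (auto simp: cube_def)
          have "x $ e = lo p \<or> x $ e = hi p"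
            using 3(2) xcs xi unfolding \<Omega>_def slab_def cslab_def by (smt (verit) mem_Collect_eq)
          then show ?thesis
          proof
            assume xe: "x $ e = lo p"
            then have p1: "p \<noteq> 1" using xi[of e] chain_ends by auto
            have f: "x \<in> face e l (lo p)" using xi xe by (simp add: face_def)
            have p': "p - 1 \<in> {1..N}" "x \<in> \<Omega> (p - 1)" using face_lo[OF p p1] f by auto
            have x': "x \<in> X (p - 1)" using x p' closure_subset[of "\<Omega> (p - 1)"] by (auto simp: X_def)
            have "w p q r x = w (p - 1) (q - 1) r x" using iterate(3)[OF p q1 r'(1) f] p1 by (simp add: w_def)
            then have "infnorm (w p q r x) \<le> exp (k * (T1 - r)) * (sqrt_barrier l x * (A + ?M))"
              using inter[OF p'(1) r'(2) x' p'(2)] p1 xe by simp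
            also have "\<dots> \<le> \<Phi> n p r x"
            proof -
              have "?M * 1 \<le> ?M * (1 + exp (- \<mu> * (hi p - lo p)))" using MM by (intro mult_left_mono) auto
              then have "A + ?M \<le> edge_profile0 A ?M \<mu> (lo p) (hi p) (x $ e)" unfolding edge_profile0_def xe by simp
              then show ?thesis unfolding \<Phi>_def schwarz_barrier_def
                using sqrt_barrier_bounds(1)[OF Xc[OF x]] by (intro mult_left_mono) auto
            qed
            finally show ?thesis .
          next
            assume xe: "x $ e = hi p"
            then have p1: "p \<noteq> N" using xi[of e] chain_ends by auto
            have f: "x \<in> face e l (hi p)" using xi xe by (simp add: face_def)
            have p': "p + 1 \<in> {1..N}" "x \<in> \<Omega> (p + 1)" using face_hi[OF p p1] f by auto
            have x': "x \<in> X (p + 1)" using x p' closure_subset[of "\<Omega> (p + 1)"] by (auto simp: X_def)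
            have "w p q r x = w (p + 1) (q - 1) r x" using iterate(4)[OF p q1 r'(1) f] p1 by (simp add: w_def)
            then have "infnorm (w p q r x) \<le> exp (k * (T1 - r)) * (sqrt_barrier l x * (A + ?M))"
              using inter[OF p'(1) r'(2) x' p'(2)] p1 xe by simp
            also have "\<dots> \<le> \<Phi> n p r x"
            proof -
              have "?M * 1 \<le> ?M * (exp (- \<mu> * (hi p - lo p)) + 1)" using MM by (intro mult_left_mono) auto
              then have "A + ?M \<le> edge_profile0 A ?M \<mu> (lo p) (hi p) (x $ e)" unfolding edge_profile0_def xe by simp
              then show ?thesis unfolding \<Phi>_def schwarz_barrier_def
                using sqrt_barrier_bounds(1)[OF Xc[OF x]] by (intro mult_left_mono) auto
            qed
            finally show ?thesis .
          qed
        qed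
      next
        fix r x assume r: "r \<in> {t..<t2}" and x: "x \<in> U"
        have r': "r \<in> {0<..<T}" by (rule T0) (use r in auto)
        have "\<And>i. \<bar>x $ i\<bar> \<le> l - 8 * \<epsilon>" using x unfolding U_def cube_def by (auto simp: abs_le_iff less_imp_le) (smt (verit))
        from mollified_time[OF r' \<epsilon>(1) this]
        show "((\<lambda>s. w p q s x) has_vector_derivative (time_deriv (\<theta>pq p q) r x - conv \<epsilon> kern (time_deriv \<theta> r) x)) (at r)"
          unfolding w_def by (intro has_vector_derivative_diff classical_solution_time[OF sol r']) (use x in \<open>auto simp: U_def\<close>)
        show "((\<lambda>s. \<Phi> n p s x) has_vector_derivative (- k * \<Phi> n p r x)) (at r)"
          unfolding \<Phi>_def has_real_derivative_iff_has_vector_derivative[symmetric]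
          by (auto intro!: derivative_eq_intros)
      next
        fix r assume r: "r \<in> {t..<t2}"
        have r': "r \<in> {0<..<T}" by (rule T0) (use r in auto)
        have 1: "jet2 U (\<theta>pq p q r) (\<lambda>i. partial i (\<theta>pq p q r)) (\<lambda>i j. partial i (partial j (\<theta>pq p q r)))"
          by (rule jet2_subset[OF classical_solution_jet2[OF sol \<Omega>_facts(1)[OF p] r']]) (auto simp: U_def)
        have 2: "jet2 U (mollified \<epsilon> r) (\<lambda>i. conv \<epsilon> kern (\<theta>1 r i)) (\<lambda>i j. conv \<epsilon> kern (\<theta>2 r i j))"
          by (rule jet2_subset[OF mollified_jet2[OF r' \<epsilon>(1)]]) (auto simp: U_def)
        show "jet2 U (w p q r) (\<lambda>i x. partial i (\<theta>pq p q r) x - conv \<epsilon> kern (\<theta>1 r i) x)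
           (\<lambda>i j x. partial i (partial j (\<theta>pq p q r)) x - conv \<epsilon> kern (\<theta>2 r i j) x)"
          unfolding w_def by (rule jet2_diff[OF 1 2])
        show "jet2 U (\<Phi> n p r) (\<lambda>i x. ?E r * ?barx i x) (\<lambda>i j x. ?E r * ?barxx i j x)"
          unfolding \<Phi>_def by (rule jet2_linear[OF bounded_linear_mult_right jet2_subset[OF schwarz_barrier_jet2]]) (use Uc in auto)
      next
        fix r x i \<rho>
        assume r: "r \<in> {t..<t2}" and x: "x \<in> U" and \<rho>: "1 < \<rho>" and e1: "infnorm (w p q r x) = \<rho> * \<Phi> n p r x"
        have r': "r \<in> {0<..<T}" "r \<le> T1" using T0[of r] T01[of r] r by auto
        have r0: "r \<in> {0..T}" using r' by auto
        let ?y = "\<theta>pq p q r x"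
        let ?a = "diffusion \<sigma> r x ?y" and ?b = "b r x ?y"
        have xO: "x \<in> \<Omega> p" "x \<in> cube (l - 8 * \<epsilon>)" using x by (auto simp: U_def)
        have yM: "norm ?y \<le> M" using M(2)[OF p q1 r'(1)] xO(1) closure_subset by blast
        have aB: "\<forall>i j. \<bar>?a $ i $ j\<bar> \<le> Ca" "\<forall>i. \<nu> \<le> ?a $ i $ i" and nb: "norm ?b \<le> Cb" using cb r0 yM by (auto simp: coef_bounds_def)
        have bB: "\<forall>i. \<bar>?b $ i\<bar> \<le> Cb" using component_le_norm_cart nb order_trans by blast
        have \<Phi>pos: "A \<le> \<Phi> n p r x" by (rule \<Phi>_ge[OF Uc[OF x] r'(2)])
        have \<Phi>eq: "\<Phi> n p r x = ?E r * ?bar x" by (simp add: \<Phi>_def)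
        let ?W = "inv_dist_sum l x + \<Lambda>"
        have S0: "0 \<le> inv_dist_sum l x"
          unfolding inv_dist_sum_def using cube_pos[OF Uc[OF x]] by (intro sum_nonneg add_nonneg_nonneg) (auto simp: less_imp_le)
        have parP: "par_op ?a ?b (- k * \<Phi> n p r x) (\<lambda>i. ?E r * ?barx i x) (\<lambda>i j. ?E r * ?barxx i j x)
           = - k * \<Phi> n p r x + ?E r * par_op ?a ?b 0 (\<lambda>i. ?barx i x) (\<lambda>i j. ?barxx i j x)"
          by (simp add: par_op_def sum_distrib_left distrib_left mult.left_commute)
        have "par_op ?a ?b (- k * \<Phi> n p r x) (\<lambda>i. ?E r * ?barx i x) (\<lambda>i j. ?E r * ?barxx i j x)
           \<le> - k * \<Phi> n p r x + ?E r * ((K0 - 2 * Cr * inv_dist_sum l x) * ?bar x)"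
          unfolding parP by (intro add_left_mono mult_left_mono bar[OF Uc[OF x] aB bB _ MM]) (use A in auto)
        \<comment> \<open>The summand 1 in \<open>k\<close> makes the inequality strict.\<close>
        also have "\<dots> = (- R * (?m + 1) * ?W - 1) * \<Phi> n p r x"
          by (simp add: \<Phi>eq k_def Cr_def algebra_simps)
        finally have up: "par_op ?a ?b (- k * \<Phi> n p r x) (\<lambda>i. ?E r * ?barx i x) (\<lambda>i j. ?E r * ?barxx i j x)
           \<le> (- R * (?m + 1) * ?W - 1) * \<Phi> n p r x" .
        let ?Pm = "par_op ?a ?b (conv \<epsilon> kern (time_deriv \<theta> r) x) (\<lambda>i. conv \<epsilon> kern (\<theta>1 r i) x) (\<lambda>i j. conv \<epsilon> kern (\<theta>2 r i j) x)"
        have split: "par_op ?a ?b (time_deriv (\<theta>pq p q) r x - conv \<epsilon> kern (time_deriv \<theta> r) x)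
           (\<lambda>i. partial i (\<theta>pq p q r) x - conv \<epsilon> kern (\<theta>1 r i) x) (\<lambda>i j. partial i (partial j (\<theta>pq p q r)) x - conv \<epsilon> kern (\<theta>2 r i j) x)
           = - (?Pm + bh r x ?y)"
        proof -
          have "par_op ?a ?b (time_deriv (\<theta>pq p q) r x - conv \<epsilon> kern (time_deriv \<theta> r) x)
           (\<lambda>i. partial i (\<theta>pq p q r) x - conv \<epsilon> kern (\<theta>1 r i) x) (\<lambda>i j. partial i (partial j (\<theta>pq p q r)) x - conv \<epsilon> kern (\<theta>2 r i j) x)
            = par_op ?a ?b (time_deriv (\<theta>pq p q) r x) (\<lambda>i. partial i (\<theta>pq p q r) x) (\<lambda>i j. partial i (partial j (\<theta>pq p q r)) x) - ?Pm"
            by (simp add: par_op_def scaleR_diff_right sum_subtractf)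
          also have "\<dots> = - (?Pm + bh r x ?y)" unfolding classical_solution_equation[OF sol r'(1) xO(1)] by simp
          finally show ?thesis .
        qed
        have "norm (?Pm + bh r x ?y) \<le> R * ?W * (norm (?y - mollified \<epsilon> r x) + \<epsilon>)"
          unfolding \<Lambda>_def by (rule res[OF \<epsilon> r'(1) xO(2)])
        also have "\<dots> \<le> R * ?W * ((?m + 1) * (\<rho> * \<Phi> n p r x))"
        proof (intro mult_left_mono)
          have "norm (?y - mollified \<epsilon> r x) \<le> ?m * (\<rho> * \<Phi> n p r x)"
            using norm_le_CARD_infnorm[of "w p q r x"] e1 by (simp add: w_def)
          moreover have "\<epsilon> \<le> \<rho> * \<Phi> n p r x"
          proof -
            have "1 * \<Phi> n p r x \<le> \<rho> * \<Phi> n p r x" using \<rho> \<Phi>pos A by (intro mult_right_mono) auto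
            then show ?thesis using \<Phi>pos A(1) by linarith
          qed
          ultimately show "norm (?y - mollified \<epsilon> r x) + \<epsilon> \<le> (?m + 1) * (\<rho> * \<Phi> n p r x)" by (simp add: algebra_simps)
          show "0 \<le> R * ?W" using R S0 \<Lambda> by simp
        qed
        finally have nP: "norm (?Pm + bh r x ?y) \<le> R * ?W * ((?m + 1) * (\<rho> * \<Phi> n p r x))" .
        have "\<bar>sgn (w p q r x $ i) * (- (?Pm + bh r x ?y)) $ i\<bar> \<le> 1 * norm (- (?Pm + bh r x ?y))"
          unfolding abs_mult by (intro mult_mono component_le_norm_cart) (auto simp: sgn_if)
        then have low: "- (R * ?W * ((?m + 1) * (\<rho> * \<Phi> n p r x))) \<le> sgn (w p q r x $ i) * (- (?Pm + bh r x ?y)) $ i"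
          using nP by (simp only: norm_minus_cancel mult_1)
        have "\<rho> * par_op ?a ?b (- k * \<Phi> n p r x) (\<lambda>i. ?E r * ?barx i x) (\<lambda>i j. ?E r * ?barxx i j x)
           \<le> \<rho> * ((- R * (?m + 1) * ?W - 1) * \<Phi> n p r x)"
          using up \<rho> by (intro mult_left_mono) auto
        also have "\<dots> = - (R * ?W * ((?m + 1) * (\<rho> * \<Phi> n p r x))) - \<rho> * \<Phi> n p r x" by (simp add: algebra_simps)
        also have "\<dots> < - (R * ?W * ((?m + 1) * (\<rho> * \<Phi> n p r x)))" using \<rho> \<Phi>pos A by simp
        finally show "\<rho> * par_op ?a ?b (- k * \<Phi> n p r x) (\<lambda>i. ?E r * ?barx i x) (\<lambda>i j. ?E r * ?barxx i j x)
          < sgn (w p q r x $ i) * par_op ?a ?b (time_deriv (\<theta>pq p q) r x - conv \<epsilon> kern (time_deriv \<theta> r) x)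
           (\<lambda>i. partial i (\<theta>pq p q r) x - conv \<epsilon> kern (\<theta>1 r i) x) (\<lambda>i j. partial i (partial j (\<theta>pq p q r)) x - conv \<epsilon> kern (\<theta>2 r i j) x) $ i"
          unfolding split using low by linarith
      next
        show "t \<in> {t..t2}" "x \<in> X p" using t2 x by auto
      qed
    qed
    have all: "\<forall>p\<in>{1..N}. \<forall>t\<in>{0<..<T1}. \<forall>x\<in>X p. infnorm (w p (Q + n) t x) \<le> \<Phi> n p t x" for n
    proof (induction n)
      case 0
      show ?case
      proof (intro ballI)
        fix p t x assume p: "p \<in> {1..N}" and t: "t \<in> {0<..<T1}" and x: "x \<in> X p"
        show "infnorm (w p (Q + 0) t x) \<le> \<Phi> 0 p t x"
        proof (rule step[OF p _ t x])
          fix p' t x assume p': "p' \<in> {1..N}" and t: "t \<in> {0<..<T1}" and x: "x \<in> X p'"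
          have "infnorm (w p' (Q + 0 - 1) t x) \<le> 2 * M" by (rule w_bound[OF p' _ tT[OF t] x]) (use Q in auto)
          also have "\<dots> \<le> exp (k * (T1 - t)) * (sqrt_barrier l x * (A + 2 * M / 2 ^ 0))"
            by (rule scale[OF _ _ Xc[OF x]]) (use M(1) A t in auto)
          finally show "infnorm (w p' (Q + 0 - 1) t x) \<le> exp (k * (T1 - t)) * (sqrt_barrier l x * (A + 2 * M / 2 ^ 0))" .
        qed simp
      qed
    next
      case (Suc n)
      show ?case
      proof (intro ballI)
        fix p t x assume p: "p \<in> {1..N}" and t: "t \<in> {0<..<T1}" and x: "x \<in> X p"
        show "infnorm (w p (Q + Suc n) t x) \<le> \<Phi> (Suc n) p t x"
        proof (rule step[OF p _ t x])
          fix p' t x assume p': "p' \<in> {1..N}" and t: "t \<in> {0<..<T1}" and x: "x \<in> X p'" and xO: "x \<in> \<Omega> p'"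
            and nb: "(p \<noteq> 1 \<and> p' = p - 1 \<and> x $ e = lo p) \<or> (p \<noteq> N \<and> p' = p + 1 \<and> x $ e = hi p)"
          have gap: "\<delta> \<le> x $ e - lo p' \<and> \<delta> \<le> hi p' - x $ e"
            using nb
          proof
            assume a: "p \<noteq> 1 \<and> p' = p - 1 \<and> x $ e = lo p"
            then show ?thesis using \<delta>(2)[of "p - 1"] pred_in[OF p] by auto
          next
            assume a: "p \<noteq> N \<and> p' = p + 1 \<and> x $ e = hi p"
            then show ?thesis using \<delta>(2)[of p] p by auto
          qed
          have "edge_profile0 A (2 * M / 2 ^ n) \<mu> (lo p') (hi p') (x $ e) \<le> A + 2 * M / 2 ^ n * (1 / 4 + 1 / 4)"
            unfolding edge_profile0_def using decay gap M(1) by (intro add_left_mono mult_left_mono add_mono) auto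
          then have ed: "edge_profile0 A (2 * M / 2 ^ n) \<mu> (lo p') (hi p') (x $ e) \<le> A + 2 * M / 2 ^ Suc n" by simp
          have "infnorm (w p' (Q + Suc n - 1) t x) \<le> \<Phi> n p' t x" using Suc.IH p' t x by simp
          also have "\<dots> \<le> exp (k * (T1 - t)) * (sqrt_barrier l x * (A + 2 * M / 2 ^ Suc n))"
            unfolding \<Phi>_def schwarz_barrier_def using ed sqrt_barrier_bounds(1)[OF Xc[OF x]] by (intro mult_left_mono) auto
          finally show "infnorm (w p' (Q + Suc n - 1) t x) \<le> exp (k * (T1 - t)) * (sqrt_barrier l x * (A + 2 * M / 2 ^ Suc n))" .
        qed simp
      qed
    qed
    show "\<forall>p\<in>{1..N}. \<forall>t\<in>{0<..<T1}. \<forall>x\<in>\<Omega> p.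
        norm (\<theta>pq p (Q + n) t x - \<theta> t x) \<le> C2 * exp (C1 * (ln (l / \<epsilon>) + 1) * (T1 - t)) * (\<epsilon> + 1 / 2 ^ n)" for n
    proof (intro ballI)
      fix p t x assume p: "p \<in> {1..N}" and t: "t \<in> {0<..<T1}" and x: "x \<in> \<Omega> p"
      have q1: "1 \<le> Q + n" using Q by simp
      have xcl: "x \<in> closure (\<Omega> p)" using x closure_subset by blast
      let ?e = "exp (C1 * (ln (l / \<epsilon>) + 1) * (T1 - t))" and ?h = "\<epsilon> + 1 / 2 ^ n"
      have e1: "exp (k * (T1 - t)) \<le> ?e" using k(2) t by (simp add: \<Lambda>_def mult_right_mono)
      have e2: "1 \<le> exp (k * (T1 - t))" using k t by simp
      have h: "\<epsilon> \<le> ?h" "1 / 2 ^ n \<le> ?h" "0 \<le> ?h" using \<epsilon> by auto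
      show "norm (\<theta>pq p (Q + n) t x - \<theta> t x) \<le> C2 * ?e * ?h"
      proof (cases "x \<in> X p")
        case True
        have xc: "x \<in> cube l" by (rule Xc[OF True])
        have ed: "edge_profile0 A (2 * M / 2 ^ n) \<mu> (lo p) (hi p) (x $ e) \<le> (A0 + 4 * M) * ?h"
        proof -
          have "lo p \<le> x $ e" "x $ e \<le> hi p" using x by (auto simp: \<Omega>_def slab_def)
          then have "exp (- \<mu> * (x $ e - lo p)) \<le> 1" "exp (- \<mu> * (hi p - x $ e)) \<le> 1" using \<mu> by auto
          then have "exp (- \<mu> * (x $ e - lo p)) + exp (- \<mu> * (hi p - x $ e)) \<le> 2" by linarith
          then have "2 * M / 2 ^ n * (exp (- \<mu> * (x $ e - lo p)) + exp (- \<mu> * (hi p - x $ e))) \<le> 2 * M / 2 ^ n * 2"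
            by (rule mult_left_mono) (use M(1) in simp)
          then have "edge_profile0 A (2 * M / 2 ^ n) \<mu> (lo p) (hi p) (x $ e) \<le> A0 * \<epsilon> + 4 * M * (1 / 2 ^ n)"
            by (simp add: edge_profile0_def A_def)
          also have "\<dots> \<le> A0 * ?h + 4 * M * ?h" using A0 M(1) h by (intro add_mono mult_left_mono) auto
          finally show ?thesis by (simp add: algebra_simps)
        qed
        have "infnorm (w p (Q + n) t x) \<le> \<Phi> n p t x" using all p t True by blast
        also have "\<dots> \<le> ?e * (B * ((A0 + 4 * M) * ?h))"
          unfolding \<Phi>_def schwarz_barrier_def using e1 ed sqrt_barrier_bounds[OF xc] A edge_ge[of n "lo p" "hi p" "x $ e"]
          by (intro mult_mono) (auto simp: B_def)
        finally have "norm (w p (Q + n) t x) \<le> ?m * (?e * (B * ((A0 + 4 * M) * ?h)))"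
          using norm_le_CARD_infnorm[of "w p (Q + n) t x"] by (meson mult_left_mono of_nat_0_le_iff order_trans)
        moreover have "norm (\<theta> t x - mollified \<epsilon> t x) \<le> Cm * (?e * ?h)"
        proof -
          have "norm (\<theta> t x - mollified \<epsilon> t x) \<le> Cm * \<epsilon>" by (rule err[OF \<epsilon> tT[OF t]]) (use True in \<open>auto simp: X_def\<close>)
          also have "\<dots> \<le> Cm * (?e * ?h)"
          proof (rule mult_left_mono[OF _ Cm])
            have "1 * \<epsilon> \<le> ?e * ?h" using e1 e2 h \<epsilon> by (intro mult_mono) auto
            then show "\<epsilon> \<le> ?e * ?h" by simp
          qed
          finally show ?thesis .
        qed
        moreover have "norm (\<theta>pq p (Q + n) t x - \<theta> t x) \<le> norm (w p (Q + n) t x) + norm (\<theta> t x - mollified \<epsilon> t x)"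
          unfolding w_def using norm_triangle_ineq4[of "\<theta>pq p (Q + n) t x - mollified \<epsilon> t x" "\<theta> t x - mollified \<epsilon> t x"] by simp
        ultimately have "norm (\<theta>pq p (Q + n) t x - \<theta> t x) \<le> ?m * (?e * (B * ((A0 + 4 * M) * ?h))) + Cm * (?e * ?h)"
          by linarith
        also have "\<dots> = (?m * B * (A0 + 4 * M) + Cm) * (?e * ?h)"
        proof -
          have "a1 * (r * (a2 * (a3 * h))) + a4 * (r * h) = (a1 * a2 * a3 + a4) * (r * h)" for a1 a2 a3 a4 r h :: real
            by (simp add: algebra_simps)
          then show ?thesis .
        qed
        also have "\<dots> \<le> C2 * (?e * ?h)"
          using h Ci(1) Cl(1) by (intro mult_right_mono) (auto simp: C2_def)
        finally show ?thesis by simp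
      next
        case False
        then obtain i where i: "l - 8 * \<epsilon> \<le> \<bar>x $ i\<bar>" using xcl by (auto simp: X_def) (meson less_imp_le not_le)
        have "norm (\<theta>pq p (Q + n) t x - \<theta> t x) \<le> (Ci + Cl) * (8 * \<epsilon>)"
          by (rule near[OF p q1 tT[OF t] xcl i])
        also have "\<dots> \<le> (Ci + Cl) * 8 * (?e * ?h)"
        proof -
          have "1 * \<epsilon> \<le> ?e * ?h" using e1 e2 h \<epsilon> by (intro mult_mono) auto
          then have "((Ci + Cl) * 8) * \<epsilon> \<le> ((Ci + Cl) * 8) * (?e * ?h)" using Ci(1) Cl(1) by (intro mult_left_mono) auto
          then show ?thesis by (simp only: mult.assoc)
        qed
        also have "\<dots> \<le> C2 * (?e * ?h)"
          using h B A0 M(1) Cm by (intro mult_right_mono) (auto simp: C2_def)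
        finally show ?thesis by simp
      qed
    qed
  qed
qed

text \<open>
  With \<open>\<tau> = 1 / (2 (C1 + 1))\<close> the exponential factor in \<open>contraction\<close> is at most \<open>\<surd>(l/\<epsilon>) exp (1/2)\<close>. A small \<open>\<epsilon>\<close> makes
  \<open>\<surd>(l/\<epsilon>) \<epsilon> = \<surd>(l \<epsilon>)\<close> small, and afterwards many iterations make \<open>\<surd>(l/\<epsilon>) / 2\<^sup>n\<close> small. The length \<open>\<tau>\<close> does not depend
  on \<open>T1\<close>, so the step can be repeated.
\<close>
lemma time_step:
  "\<exists>\<tau>>0. \<forall>T1. 0 < T1 \<longrightarrow> T1 \<le> T \<longrightarrow> (\<forall>\<epsilon>>0. \<exists>Q. error_small \<epsilon> Q T1) \<longrightarrow>
     (\<forall>\<epsilon>>0. \<exists>Q. \<forall>q\<ge>Q. \<forall>p\<in>{1..N}. \<forall>t. T1 - \<tau> < t \<longrightarrow> 0 < t \<longrightarrow> t < T1 \<longrightarrow>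
        (\<forall>x\<in>\<Omega> p. norm (\<theta>pq p q t x - \<theta> t x) \<le> \<epsilon>))"
proof -
  obtain C1 C2 where C: "0 \<le> C1" "0 \<le> C2"
    and contr: "\<forall>\<epsilon> T1 Q. 0 < \<epsilon> \<longrightarrow> 8 * \<epsilon> < l \<longrightarrow> 0 < T1 \<longrightarrow> T1 \<le> T \<longrightarrow> 2 \<le> Q \<longrightarrow> error_small \<epsilon> Q T1 \<longrightarrow>
     (\<forall>n. \<forall>p\<in>{1..N}. \<forall>t\<in>{0<..<T1}. \<forall>x\<in>\<Omega> p.
        norm (\<theta>pq p (Q + n) t x - \<theta> t x) \<le> C2 * exp (C1 * (ln (l / \<epsilon>) + 1) * (T1 - t)) * (\<epsilon> + 1 / 2 ^ n))"
    using contraction by (elim exE conjE)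
  define \<tau> where "\<tau> = 1 / (2 * (C1 + 1))"
  have \<tau>: "0 < \<tau>" "C1 * \<tau> \<le> 1 / 2"
    using C by (simp_all add: \<tau>_def field_simps)
  define D where "D = C2 * exp (1 / 2) + 1"
  have D: "0 < D" using C by (simp add: D_def add_nonneg_pos)
  show ?thesis
  proof (rule exI[of _ \<tau>], intro conjI \<tau>(1) allI impI)
    fix T1 \<epsilon>' :: real assume T1: "0 < T1" "T1 \<le> T" and small: "\<forall>\<epsilon>>0. \<exists>Q. error_small \<epsilon> Q T1" and \<epsilon>': "0 < \<epsilon>'"
    define \<epsilon> where "\<epsilon> = min (l / 16) ((\<epsilon>' / (2 * D))^2 / l)"
    have \<epsilon>: "0 < \<epsilon>" "8 * \<epsilon> < l"
    proof -
      show "0 < \<epsilon>" using l \<epsilon>' D by (simp add: \<epsilon>_def)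
      have "\<epsilon> \<le> l / 16" unfolding \<epsilon>_def by (rule min.cobounded1)
      then show "8 * \<epsilon> < l" using l by linarith
    qed
    have part1: "D * (sqrt (l / \<epsilon>) * \<epsilon>) \<le> \<epsilon>' / 2"
    proof -
      have "l * \<epsilon> \<le> (\<epsilon>' / (2 * D))^2"
      proof -
        have "\<epsilon> \<le> (\<epsilon>' / (2 * D))^2 / l" by (simp add: \<epsilon>_def)
        then show ?thesis using l by (simp add: pos_le_divide_eq mult.commute)
      qed
      then have "sqrt (l * \<epsilon>) \<le> \<epsilon>' / (2 * D)" using \<epsilon>' D by (intro real_le_lsqrt) auto
      moreover have "sqrt (l / \<epsilon>) * \<epsilon> = sqrt (l * \<epsilon>)"
      proof -
        have "sqrt (l / \<epsilon>) * \<epsilon> = sqrt (l / \<epsilon>) * sqrt (\<epsilon>^2)" using \<epsilon> by simp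
        also have "\<dots> = sqrt (l / \<epsilon> * \<epsilon>^2)" by (simp only: real_sqrt_mult)
        also have "l / \<epsilon> * \<epsilon>^2 = l * \<epsilon>" using \<epsilon> by (simp add: power2_eq_square)
        finally show ?thesis .
      qed
      ultimately have "D * (sqrt (l / \<epsilon>) * \<epsilon>) \<le> D * (\<epsilon>' / (2 * D))" using D by (intro mult_left_mono) auto
      then show ?thesis using D by simp
    qed
    have s0: "0 < sqrt (l / \<epsilon>)" using l \<epsilon> by simp
    then have "0 < \<epsilon>' / (2 * (D * sqrt (l / \<epsilon>)))" using \<epsilon>' D by simp
    then obtain n0 where n0: "(1 / 2) ^ n0 < \<epsilon>' / (2 * (D * sqrt (l / \<epsilon>)))"
      using real_arch_pow_inv[of _ "1 / 2"] by auto
    have part2: "D * (sqrt (l / \<epsilon>) * (1 / 2 ^ n)) \<le> \<epsilon>' / 2" if "n0 \<le> n" for n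
    proof -
      have "(1 / 2 :: real) ^ n \<le> (1 / 2) ^ n0" using that by (intro power_decreasing) auto
      then have "(1 / 2) ^ n \<le> \<epsilon>' / (2 * (D * sqrt (l / \<epsilon>)))" using n0 by linarith
      then have "(D * sqrt (l / \<epsilon>)) * (1 / 2) ^ n \<le> (D * sqrt (l / \<epsilon>)) * (\<epsilon>' / (2 * (D * sqrt (l / \<epsilon>))))"
        using D s0 by (intro mult_left_mono) auto
      also have "\<dots> = \<epsilon>' / 2"
      proof -
        have "d * (\<epsilon>' / (2 * d)) = \<epsilon>' / 2" if "0 < d" for d using that by simp
        then show ?thesis using D s0 mult_pos_pos by blast
      qed
      finally show ?thesis by (simp add: power_divide)
    qed
    obtain Q1 where Q1: "error_small \<epsilon> Q1 T1" using small \<epsilon>(1) by blast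
    define Q where "Q = max 2 Q1"
    have Q: "2 \<le> Q" "error_small \<epsilon> Q T1" using Q1 by (auto simp: Q_def error_small_def)
    show "\<exists>Q. \<forall>q\<ge>Q. \<forall>p\<in>{1..N}. \<forall>t. T1 - \<tau> < t \<longrightarrow> 0 < t \<longrightarrow> t < T1 \<longrightarrow> (\<forall>x\<in>\<Omega> p. norm (\<theta>pq p q t x - \<theta> t x) \<le> \<epsilon>')"
    proof (rule exI[of _ "Q + n0"], intro allI impI ballI)
      fix q p t x assume q: "Q + n0 \<le> q" and p: "p \<in> {1..N}" and t: "T1 - \<tau> < t" "0 < t" "t < T1" and x: "x \<in> \<Omega> p"
      define n where "n = q - Q"
      have n: "q = Q + n" "n0 \<le> n" using q by (auto simp: n_def)
      define \<Lambda> where "\<Lambda> = ln (l / \<epsilon>)"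
      have \<Lambda>: "0 \<le> \<Lambda>" using \<epsilon> by (simp add: \<Lambda>_def)
      have "C1 * (\<Lambda> + 1) * (T1 - t) \<le> C1 * (\<Lambda> + 1) * \<tau>" using C \<Lambda> t by (intro mult_left_mono) auto
      also have "\<dots> = (C1 * \<tau>) * (\<Lambda> + 1)" by simp
      also have "\<dots> \<le> 1 / 2 * (\<Lambda> + 1)" using \<tau> \<Lambda> by (intro mult_right_mono) auto
      finally have "exp (C1 * (\<Lambda> + 1) * (T1 - t)) \<le> exp (\<Lambda> / 2 + 1 / 2)" by (simp add: add_divide_distrib)
      also have "\<dots> = sqrt (l / \<epsilon>) * exp (1 / 2)"
      proof -
        have "exp (\<Lambda> / 2) = exp (ln (sqrt (l / \<epsilon>)))" unfolding \<Lambda>_def using l \<epsilon> by (simp add: ln_sqrt)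
        then show ?thesis using s0 by (simp only: exp_add exp_ln)
      qed
      finally have e: "exp (C1 * (\<Lambda> + 1) * (T1 - t)) \<le> sqrt (l / \<epsilon>) * exp (1 / 2)" .
      have "norm (\<theta>pq p q t x - \<theta> t x) \<le> C2 * exp (C1 * (\<Lambda> + 1) * (T1 - t)) * (\<epsilon> + 1 / 2 ^ n)"
        unfolding n(1) \<Lambda>_def by (rule contr[rule_format, OF \<epsilon> T1 Q p _ x]) (use t in auto)
      also have "\<dots> \<le> C2 * (sqrt (l / \<epsilon>) * exp (1 / 2)) * (\<epsilon> + 1 / 2 ^ n)"
        using e C \<epsilon> by (intro mult_right_mono mult_left_mono) auto
      also have "\<dots> = (C2 * exp (1 / 2)) * (sqrt (l / \<epsilon>) * \<epsilon> + sqrt (l / \<epsilon>) * (1 / 2 ^ n))"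
        by (simp only: distrib_left mult.assoc mult.left_commute[of "exp (1/2)"])
      also have "\<dots> \<le> D * (sqrt (l / \<epsilon>) * \<epsilon> + sqrt (l / \<epsilon>) * (1 / 2 ^ n))"
        using s0 \<epsilon> by (intro mult_right_mono) (auto simp: D_def)
      also have "\<dots> \<le> \<epsilon>'" using part1 part2[OF n(2)] by (simp only: distrib_left)
      finally show "norm (\<theta>pq p q t x - \<theta> t x) \<le> \<epsilon>'" .
    qed
  qed
qed

lemma terminal_small: "0 < \<epsilon> \<Longrightarrow> error_small \<epsilon> 1 T"
  unfolding error_small_def
proof (intro allI impI ballI)
  fix q p :: nat assume \<epsilon>: "0 < \<epsilon>" and q: "1 \<le> q" and p: "p \<in> {1..N}"
  obtain C where C: "0 \<le> C" "\<And>t x. t \<in> {0<..<T} \<Longrightarrow> x \<in> closure (\<Omega> p) \<Longrightarrow> norm (\<theta>pq p q t x - g x) \<le> C * (T - t)"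
    using terminal_Lipschitz[OF iterate(1)[OF p q] g_continuous iterate(2)[OF p q]] by blast
  obtain C' where C': "0 \<le> C'" "\<And>t x. t \<in> {0<..<T} \<Longrightarrow> x \<in> closure (cube l) \<Longrightarrow> norm (\<theta> t x - g x) \<le> C' * (T - t)"
    using terminal_Lipschitz[OF limit(1) g_continuous limit(2)] by blast
  let ?s = "T - \<epsilon> / (C + C' + 1)"
  show "\<exists>s<T. \<forall>t. s < t \<longrightarrow> 0 < t \<longrightarrow> t < T \<longrightarrow> (\<forall>x\<in>\<Omega> p. norm (\<theta>pq p q t x - \<theta> t x) \<le> \<epsilon>)"
  proof (intro exI[of _ ?s] conjI allI impI ballI)
    show "?s < T" using \<epsilon> C(1) C'(1) by simp
    fix t x assume t: "?s < t" "0 < t" "t < T" and x: "x \<in> \<Omega> p"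
    have "norm (\<theta>pq p q t x - \<theta> t x) \<le> norm (\<theta>pq p q t x - g x) + norm (\<theta> t x - g x)"
      using norm_triangle_ineq4[of "\<theta>pq p q t x - g x" "\<theta> t x - g x"] by simp
    also have "\<dots> \<le> C * (T - t) + C' * (T - t)"
      using t x closure_subset[of "\<Omega> p"] \<Omega>_facts(3)[OF p] closure_subset[of "cube l"]
      by (intro add_mono C(2) C'(2)) auto
    also have "\<dots> = (C + C') * (T - t)" by (simp add: algebra_simps)
    also have "\<dots> \<le> (C + C' + 1) * (T - t)" using t by (intro mult_right_mono) auto
    also have "\<dots> \<le> \<epsilon>"
    proof -
      have "T - t < \<epsilon> / (C + C' + 1)" using t by simp
      then show ?thesis using C(1) C'(1) by (simp add: pos_less_divide_eq mult.commute add_nonneg_pos less_imp_le)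
    qed
    finally show "norm (\<theta>pq p q t x - \<theta> t x) \<le> \<epsilon>" .
  qed
qed

text \<open>
  Convergence is extended backwards from the times after \<open>s\<close>. The next step starts at \<open>T1\<close> slightly after \<open>s\<close>, because
  \<open>error_small\<close> refers to times before \<open>T1\<close>; starting at \<open>s + \<tau>/2\<close> gains \<open>\<tau>/2\<close> each time.
\<close>
lemma uniform_convergence:
  assumes "0 < \<epsilon>"
  shows "\<exists>Q. \<forall>q\<ge>Q. \<forall>p\<in>{1..N}. \<forall>t\<in>{0<..<T}. \<forall>x\<in>\<Omega> p. norm (\<theta>pq p q t x - \<theta> t x) \<le> \<epsilon>"
proof -
  obtain \<tau> where \<tau>: "0 < \<tau>" and step: "\<And>T1 \<epsilon>. 0 < T1 \<Longrightarrow> T1 \<le> T \<Longrightarrow> (\<forall>\<epsilon>>0. \<exists>Q. error_small \<epsilon> Q T1) \<Longrightarrow> 0 < \<epsilon> \<Longrightarrow>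
     \<exists>Q. \<forall>q\<ge>Q. \<forall>p\<in>{1..N}. \<forall>t. T1 - \<tau> < t \<longrightarrow> 0 < t \<longrightarrow> t < T1 \<longrightarrow> (\<forall>x\<in>\<Omega> p. norm (\<theta>pq p q t x - \<theta> t x) \<le> \<epsilon>)"
    using time_step by (elim exE conjE) blast
  define conv_after where "conv_after = (\<lambda>s. \<forall>\<epsilon>>0. \<exists>Q. \<forall>q\<ge>Q. \<forall>p\<in>{1..N}. \<forall>t. s < t \<longrightarrow> 0 < t \<longrightarrow> t < T \<longrightarrow>
     (\<forall>x\<in>\<Omega> p. norm (\<theta>pq p q t x - \<theta> t x) \<le> \<epsilon>))"
  have base: "conv_after (T - \<tau>)"
    unfolding conv_after_def using step[OF T order_refl] terminal_small by blast
  have ind: "conv_after (s - \<tau> / 2)" if s: "conv_after s" "s < T" for s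
  proof (cases "s \<le> 0")
    case True
    have "0 < t \<Longrightarrow> s < t" for t using True by simp
    then show ?thesis using s(1) unfolding conv_after_def by meson
  next
    case False
    define T1 where "T1 = min T (s + \<tau> / 2)"
    have T1: "0 < T1" "T1 \<le> T" "s < T1" "T1 - \<tau> \<le> s - \<tau> / 2" using False s(2) \<tau> T by (auto simp: T1_def)
    have "\<forall>\<epsilon>>0. \<exists>Q. error_small \<epsilon> Q T1"
    proof (intro allI impI)
      fix \<epsilon> :: real assume "0 < \<epsilon>"
      then obtain Q where Q: "\<And>q p t x. Q \<le> q \<Longrightarrow> p \<in> {1..N} \<Longrightarrow> s < t \<Longrightarrow> 0 < t \<Longrightarrow> t < T \<Longrightarrow> x \<in> \<Omega> p \<Longrightarrow> norm (\<theta>pq p q t x - \<theta> t x) \<le> \<epsilon>"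
        using s(1) unfolding conv_after_def by meson
      have "error_small \<epsilon> Q T1"
        unfolding error_small_def
      proof (intro allI impI ballI)
        fix q p assume "Q \<le> q" "p \<in> {1..N}"
        then show "\<exists>s<T1. \<forall>t. s < t \<longrightarrow> 0 < t \<longrightarrow> t < T1 \<longrightarrow> (\<forall>x\<in>\<Omega> p. norm (\<theta>pq p q t x - \<theta> t x) \<le> \<epsilon>)"
          using Q T1 by (intro exI[of _ s]) auto
      qed
      then show "\<exists>Q. error_small \<epsilon> Q T1" by blast
    qed
    note st = step[OF T1(1,2) this]
    show ?thesis
      unfolding conv_after_def
    proof (intro allI impI)
      fix \<epsilon> :: real assume \<epsilon>: "0 < \<epsilon>"
      obtain Q1 where Q1: "\<And>q p t x. Q1 \<le> q \<Longrightarrow> p \<in> {1..N} \<Longrightarrow> T1 - \<tau> < t \<Longrightarrow> 0 < t \<Longrightarrow> t < T1 \<Longrightarrow> x \<in> \<Omega> p \<Longrightarrow> norm (\<theta>pq p q t x - \<theta> t x) \<le> \<epsilon>"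
        using st[OF \<epsilon>] by meson
      obtain Q2 where Q2: "\<And>q p t x. Q2 \<le> q \<Longrightarrow> p \<in> {1..N} \<Longrightarrow> s < t \<Longrightarrow> 0 < t \<Longrightarrow> t < T \<Longrightarrow> x \<in> \<Omega> p \<Longrightarrow> norm (\<theta>pq p q t x - \<theta> t x) \<le> \<epsilon>"
        using s(1) \<epsilon> unfolding conv_after_def by meson
      show "\<exists>Q. \<forall>q\<ge>Q. \<forall>p\<in>{1..N}. \<forall>t. s - \<tau> / 2 < t \<longrightarrow> 0 < t \<longrightarrow> t < T \<longrightarrow> (\<forall>x\<in>\<Omega> p. norm (\<theta>pq p q t x - \<theta> t x) \<le> \<epsilon>)"
      proof (intro exI[of _ "max Q1 Q2"] allI impI ballI)
        fix q p t x assume "max Q1 Q2 \<le> q" "p \<in> {1..N}" "s - \<tau> / 2 < t" "0 < t" "t < T" "x \<in> \<Omega> p"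
        then show "norm (\<theta>pq p q t x - \<theta> t x) \<le> \<epsilon>"
          using Q1[of q p t x] Q2[of q p t x] T1 by (cases "t < T1") auto
      qed
    qed
  qed
  have "conv_after (T - \<tau> - real n * (\<tau> / 2))" for n
  proof (induction n)
    case 0 show ?case using base by simp
  next
    case (Suc n)
    have "0 \<le> real n * (\<tau> / 2)" using \<tau> by simp
    then have "T - \<tau> - real n * (\<tau> / 2) < T" using \<tau> by linarith
    note this' = this
    have eq: "T - \<tau> - real (Suc n) * (\<tau> / 2) = T - \<tau> - real n * (\<tau> / 2) - \<tau> / 2"
      by (simp add: algebra_simps add_divide_distrib)
    show ?case unfolding eq by (rule ind[OF Suc this'])
  qed
  moreover obtain n where "T / (\<tau> / 2) < real n" using reals_Archimedean2 by blast
  then have "T - \<tau> - real n * (\<tau> / 2) \<le> 0" using \<tau> by (simp add: pos_divide_less_eq)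
  ultimately show ?thesis
    using assms unfolding conv_after_def by (smt (verit) greaterThanLessThan_iff)
qed

end

section \<open>The essential supremum norm\<close>

lemma continuous_Linfty_measurable:
  fixes f :: "'a::euclidean_space \<Rightarrow> real^'m"
  assumes "continuous_on D f"
  shows "(\<lambda>z. ereal \<bar>f z $ k\<bar>) \<in> borel_measurable (restrict_space lborel D)"
proof -
  have "(\<lambda>z. \<bar>f z $ k\<bar>) \<in> borel_measurable (restrict_space borel D)"
    by (intro borel_measurable_continuous_on_restrict continuous_intros assms)
  moreover have "sets (restrict_space lborel D) = sets (restrict_space borel D)"
    by (simp add: sets_restrict_space)
  ultimately have "(\<lambda>z. \<bar>f z $ k\<bar>) \<in> borel_measurable (restrict_space lborel D)"
    by (simp cong: measurable_cong_sets)
  then show ?thesis by simp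
qed

text \<open>
  The essential supremum of a function that is not measurable is infinite by convention, so the upper bound uses continuity. The lower bound
  uses that \<open>D\<close> is not a null set.
\<close>
lemma Linfty_vec_norm_bounds:
  fixes f :: "'a::euclidean_space \<Rightarrow> real^'m"
  assumes f: "continuous_on D f" and D: "open D" "D \<noteq> {}"
  shows "0 \<le> Linfty_vec_norm D f" and "(\<And>z. z \<in> D \<Longrightarrow> norm (f z) \<le> \<epsilon>) \<Longrightarrow> Linfty_vec_norm D f \<le> ereal \<epsilon>"
proof -
  note m = continuous_Linfty_measurable[OF f]
  have Db: "D \<in> sets borel" using D by simp
  have "emeasure lborel D \<noteq> 0"
  proof
    assume "emeasure lborel D = 0"
    then have "emeasure lebesgue D = 0" using Db by simp
    then have "negligible D" using Db by (simp add: negligible_iff_emeasure0)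
    then show False using open_not_negligible[OF D] by simp
  qed
  then have ne: "emeasure (restrict_space lborel D) (space (restrict_space lborel D)) \<noteq> 0"
    using Db by (simp add: space_restrict_space emeasure_restrict_space)
  have "0 \<le> Linfty_norm D (\<lambda>z. f z $ k)" for k
  proof -
    have "0 = esssup (restrict_space lborel D) (\<lambda>z. 0 :: ereal)" by (rule esssup_const[OF ne, symmetric])
    also have "\<dots> \<le> Linfty_norm D (\<lambda>z. f z $ k)" unfolding Linfty_norm_def by (rule esssup_mono) auto
    finally show ?thesis .
  qed
  then show "0 \<le> Linfty_vec_norm D f" unfolding Linfty_vec_norm_def by (meson SUP_upper2 UNIV_I)
  assume b: "\<And>z. z \<in> D \<Longrightarrow> norm (f z) \<le> \<epsilon>"
  show "Linfty_vec_norm D f \<le> ereal \<epsilon>"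
    unfolding Linfty_vec_norm_def Linfty_norm_def
  proof (rule SUP_least, rule esssup_I[OF m])
    fix k
    have "\<bar>f z $ k\<bar> \<le> \<epsilon>" if "z \<in> D" for z using b[OF that] component_le_norm_cart[of "f z" k] by linarith
    then show "AE z in restrict_space lborel D. ereal \<bar>f z $ k\<bar> \<le> ereal \<epsilon>"
      by (intro AE_I2) (auto simp: space_restrict_space)
  qed
qed

theorem theorem3p2:
  fixes T l :: real
    and b :: "real \<Rightarrow> real^'n \<Rightarrow> real^'m \<Rightarrow> real^'n"
    and bh :: "real \<Rightarrow> real^'n \<Rightarrow> real^'m \<Rightarrow> real^'m"
    and \<sigma> :: "real \<Rightarrow> real^'n \<Rightarrow> real^'m \<Rightarrow> real^'d^'n"
    and \<sigma>h :: "real \<Rightarrow> real^'n \<Rightarrow> real^'m \<Rightarrow> real^'d^'m \<Rightarrow> real^'d^'m"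
    and g \<theta>0 :: "real^'n \<Rightarrow> real^'m"
    and e :: 'n
    and N :: nat
    and lo hi :: "nat \<Rightarrow> real"
    and \<theta> :: "real \<Rightarrow> real^'n \<Rightarrow> real^'m"
    and \<theta>pq :: "nat \<Rightarrow> nat \<Rightarrow> real \<Rightarrow> real^'n \<Rightarrow> real^'m"
  assumes "0 < T" and "0 < l"
    and "cond_A1 T b bh \<sigma> \<sigma>h g"
    and "cond_A2 T \<sigma>"
    and "cond_A3 T \<sigma>h"
    and "cond_A4 T b bh"
    and "cond_A5 T bh"
    and "solves_P T b bh \<sigma> g l \<theta>"
    and "overlapping_chain l N lo hi"
    and "C_infinity \<theta>0" and "bounded (range \<theta>0)"
    and "\<forall>p\<in>{1..N}. \<forall>t\<in>{0<..<T}. \<forall>x\<in>slab e l (lo p) (hi p). \<theta>pq p 0 t x = \<theta>0 x"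
    and "\<forall>q\<ge>1. \<forall>p\<in>{1..N}. solves_S T b bh \<sigma> g e l N lo hi \<theta>pq p q"
  shows "((\<lambda>q. SUP p\<in>{1..N}. Linfty_vec_norm ({0<..<T} \<times> slab e l (lo p) (hi p))
                    (\<lambda>(t, x). \<theta>pq p q t x - \<theta> t x)) \<longlongrightarrow> 0) sequentially"
proof -
  interpret schwarz T l b bh \<sigma> \<sigma>h g \<theta>0 e N lo hi \<theta> \<theta>pq
    by (rule schwarz.intro) (rule assms)+
  let ?D = "\<lambda>p. {0<..<T} \<times> slab e l (lo p) (hi p)"
  let ?f = "\<lambda>p q (t, x). \<theta>pq p q t x - \<theta> t x"
  let ?F = "\<lambda>q. SUP p\<in>{1..N}. Linfty_vec_norm (?D p) (?f p q)"
  have cont: "continuous_on (?D p) (?f p q)" if p: "p \<in> {1..N}" and q: "1 \<le> q" for p q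
  proof -
    have "continuous_on (?D p) (\<lambda>(t, x). \<theta>pq p q t x)"
      by (rule continuous_on_subset[OF classical_solution_continuous(1)[OF iterate(1)[OF p q]]])
        (use closure_subset in \<open>auto simp: \<Omega>_def\<close>)
    moreover have "continuous_on (?D p) (\<lambda>(t, x). \<theta> t x)"
      by (rule continuous_on_subset[OF classical_solution_continuous(1)[OF limit(1)]])
        (use \<Omega>_facts(3)[OF p] closure_subset in \<open>auto simp: \<Omega>_def\<close>)
    ultimately show ?thesis unfolding case_prod_unfold by (intro continuous_intros)
  qed
  have D: "open (?D p)" "?D p \<noteq> {}" if p: "p \<in> {1..N}" for p
    using \<Omega>_facts(1,6)[OF p] T by (auto simp: \<Omega>_def open_Times)
  have lower: "0 \<le> ?F q" if q: "1 \<le> q" for q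
  proof -
    have p: "1 \<in> {1..N}" using chain_ends by simp
    show ?thesis using Linfty_vec_norm_bounds(1)[OF cont[OF p q] D[OF p]] p by (meson SUP_upper2)
  qed
  have upper: "\<exists>Q. \<forall>q\<ge>Q. ?F q \<le> ereal \<epsilon>" if \<epsilon>: "0 < \<epsilon>" for \<epsilon>
  proof -
    obtain Q where Q: "\<And>q p t x. Q \<le> q \<Longrightarrow> p \<in> {1..N} \<Longrightarrow> t \<in> {0<..<T} \<Longrightarrow> x \<in> \<Omega> p \<Longrightarrow> norm (\<theta>pq p q t x - \<theta> t x) \<le> \<epsilon>"
      using uniform_convergence[OF \<epsilon>] by blast
    show ?thesis
    proof (intro exI[of _ "max 1 Q"] allI impI SUP_least)
      fix q p assume q: "max 1 Q \<le> q" and p: "p \<in> {1..N}"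
      show "Linfty_vec_norm (?D p) (?f p q) \<le> ereal \<epsilon>"
        by (rule Linfty_vec_norm_bounds(2)[OF cont[OF p] D[OF p]]) (use q p Q in \<open>auto simp: \<Omega>_def\<close>)
    qed
  qed
  show ?thesis
  proof (rule order_tendstoI)
    fix a :: ereal assume "a < 0"
    then show "eventually (\<lambda>q. a < ?F q) sequentially"
      using lower by (intro eventually_sequentiallyI[of 1]) (meson less_le_trans)
  next
    fix a :: ereal assume "0 < a"
    then obtain r where r: "0 < ereal r" "ereal r < a" using ereal_dense2 by blast
    then obtain Q where "\<forall>q\<ge>Q. ?F q \<le> ereal r" using upper[of r] by auto
    then show "eventually (\<lambda>q. ?F q < a) sequentially"
      using r(2) by (intro eventually_sequentiallyI[of Q]) (meson le_less_trans)
  qed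
qed

end
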